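(* Any algebraic subgroup of $\mathrm{PSL}_2(\mathbf C)$ can be realized as the Galois group of the reciprocal connection of a parallelism of $\mathbf C^3$. That is, for every algebraic subgroup $\Gamma\subseteq\mathrm{PSL}_2(\mathbf C)$ there is a rational parallelism of type $\mathfrak{sl}_2(\mathbf C)$ on $\mathbf C^3$, with associated connection $\nabla$, such that $\operatorname{Gal}(\nabla^{\rm rec})\subseteq\operatorname{Aut}(\mathfrak{sl}_2(\mathbf C))\simeq\mathrm{PSL}_2(\mathbf C)$ is, up to conjugation, equal to $\Gamma$.
   Context: A rational parallelism of type $\mathfrak g$ on a smooth variety $M$ with $\dim M=\dim\mathfrak g=r$ is a Lie algebra morphism $\rho:\mathfrak g\to\mathfrak X(M)$ into the rational vector fields such that the image of a basis of $\mathfrak g$ is a basis of $T_xM$ for generic $x$. The associated connection $\nabla$ is the unique rational linear connection on $TM$ with $\nabla\rho(A)=0$ for all $A\in\mathfrak g$; the reciprocal connection is $\nabla^{\rm rec}_XY=\nabla_YX+[X,Y]$, which is flat. Its horizontal vector fields are those commuting with all $\rho(A)$; their germs at a regular point form a Lie algebra isomorphic to $\mathfrak g$. Galois group: over a nonempty Zariski open set $M^\star$ where $\nabla^{\rm rec}$ is regular, the frame bundle $R^1(TM)\to M^\star$ is foliated by graphs of local frames of horizontal sections; with $L$ the Zariski closure of a leaf, $\operatorname{Gal}(\nabla^{\rm rec})=\{g\in\mathrm{GL}_r(\mathbf C):L\cdot g=L\}$, well defined up to conjugation. It acts on the Lie algebra of germs of horizontal vector fields at a regular point by Lie algebra automorphisms,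 hence it is viewed in $\operatorname{Aut}(\mathfrak g)$ up to conjugation. *)

theory Defs
  imports
    "HOL-Analysis.Analysis"
    "HOL-Algebra.Coset"
    "HOL-Computational_Algebra.Fraction_Field"
    "HOL-Computational_Algebra.Polynomial"
begin

section \<open>The field of rational functions on affine 3-space\<close>

text \<open>The outermost polynomial variable is the first coordinate, the innermost one the third.\<close>

type_synonym poly3 = "complex poly poly poly"
type_synonym ratfun = "poly3 fract"

definition eval3 :: "poly3 \<Rightarrow> complex^3 \<Rightarrow> complex" where
  "eval3 p x = poly (poly (poly p [:[:x $ 1:]:]) [:x $ 2:]) (x $ 3)"

definition pderiv3 :: "3 \<Rightarrow> poly3 \<Rightarrow> poly3" where
  "pderiv3 i = (if i = 1 then pderiv
                else if i = 2 then map_poly pderiv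
                else map_poly (map_poly pderiv))"

lemma map_poly_derivation:
  fixes D :: "'a::comm_ring_1 \<Rightarrow> 'a"
  assumes add: "\<And>a b. D (a + b) = D a + D b"
    and mult: "\<And>a b. D (a * b) = D a * b + a * D b"
  shows "map_poly D (p + q) = map_poly D p + map_poly D q"
    and "map_poly D (p * q) = map_poly D p * q + p * map_poly D q"
proof -
  have zero: "D 0 = 0"
    using add[of 0 0] by simp
  have sum: "D (sum f A) = (\<Sum>x\<in>A. D (f x))" for f :: "nat \<Rightarrow> 'a" and A
    by (induction A rule: infinite_finite_induct) (simp_all add: zero add)
  show "map_poly D (p + q) = map_poly D p + map_poly D q"
    by (rule poly_eqI) (simp add: coeff_map_poly zero add)
  show "map_poly D (p * q) = map_poly D p * q + p * map_poly D q"
    by (rule poly_eqI) (simp add: coeff_map_poly zero coeff_mult sum mult sum.distrib)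
qed

lemma pderiv3_mult: "pderiv3 i (p * q) = pderiv3 i p * q + p * pderiv3 i q"
proof -
  have 1: "pderiv (a * b) = pderiv a * b + a * pderiv b"
    for a b :: "'a::{comm_semiring_1,semiring_no_zero_divisors} poly"
    by (simp add: pderiv_mult algebra_simps)
  note 2 = map_poly_derivation[where D = "pderiv :: complex poly \<Rightarrow> complex poly", OF pderiv_add 1]
  note 3 = map_poly_derivation[where D = "pderiv :: complex poly poly \<Rightarrow> complex poly poly", OF pderiv_add 1]
  note 4 = map_poly_derivation[where D = "map_poly (pderiv :: complex poly \<Rightarrow> complex poly)", OF 2]
  show ?thesis
    unfolding pderiv3_def by (simp add: 1 3 4)
qed

lift_definition partial_deriv :: "3 \<Rightarrow> ratfun \<Rightarrow> ratfun" is
  "\<lambda>i (p, q). (pderiv3 i p * q - p * pderiv3 i q, q * q)"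
proof -
  fix i :: 3 and r s :: "poly3 \<times> poly3"
  assume rs: "fractrel r s"
  obtain p q p' q' where [simp]: "r = (p, q)" "s = (p', q')"
    by (cases r, cases s) auto
  have q: "q \<noteq> 0" "q' \<noteq> 0" and e: "p * q' = p' * q"
    using rs by auto
  have d: "pderiv3 i p * q' + p * pderiv3 i q' = pderiv3 i p' * q + p' * pderiv3 i q"
    using arg_cong[OF e, of "pderiv3 i"] by (simp add: pderiv3_mult)
  have "(pderiv3 i p * q - p * pderiv3 i q) * (q' * q')
      = (pderiv3 i p' * q' - p' * pderiv3 i q') * (q * q)"
    using e d by algebra
  then show "fractrel
      (case r of (p, q) \<Rightarrow> (pderiv3 i p * q - p * pderiv3 i q, q * q))
      (case s of (p, q) \<Rightarrow> (pderiv3 i p * q - p * pderiv3 i q, q * q))"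
    using q by simp
qed

definition const_ratfun :: "complex \<Rightarrow> ratfun" where
  "const_ratfun c = Fract [:[:[:c:]:]:] 1"

definition regular_at :: "ratfun \<Rightarrow> complex^3 \<Rightarrow> bool" where
  "regular_at f x \<longleftrightarrow> (\<exists>p q. f = Fract p q \<and> eval3 q x \<noteq> 0)"

definition value_at :: "ratfun \<Rightarrow> complex^3 \<Rightarrow> complex" where
  "value_at f x = (THE v. \<exists>p q. f = Fract p q \<and> eval3 q x \<noteq> 0 \<and> v = eval3 p x / eval3 q x)"

section \<open>Rational vector fields and connections\<close>

text \<open>A rational vector field is given by its components in the coordinate frame.\<close>

type_synonym ratvf = "ratfun^3"

definition vf_regular_at :: "ratvf \<Rightarrow> complex^3 \<Rightarrow> bool" where
  "vf_regular_at X x \<longleftrightarrow> (\<forall>k. regular_at (X $ k) x)"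

definition vf_at :: "ratvf \<Rightarrow> complex^3 \<Rightarrow> complex^3" where
  "vf_at X x = (\<chi> k. value_at (X $ k) x)"

definition vf_apply :: "ratvf \<Rightarrow> ratfun \<Rightarrow> ratfun" where
  "vf_apply X f = (\<Sum>i\<in>UNIV. X $ i * partial_deriv i f)"

definition vf_bracket :: "ratvf \<Rightarrow> ratvf \<Rightarrow> ratvf" where
  "vf_bracket X Y = (\<chi> k. vf_apply X (Y $ k) - vf_apply Y (X $ k))"

definition rational_connection :: "(ratvf \<Rightarrow> ratvf \<Rightarrow> ratvf) \<Rightarrow> bool" where
  "rational_connection nabla \<longleftrightarrow>
     (\<forall>X X' Y. nabla (X + X') Y = nabla X Y + nabla X' Y) \<and>
     (\<forall>f X Y. nabla (f *s X) Y = f *s nabla X Y) \<and>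
     (\<forall>X Y Y'. nabla X (Y + Y') = nabla X Y + nabla X Y') \<and>
     (\<forall>f X Y. nabla X (f *s Y) = vf_apply X f *s Y + f *s nabla X Y)"

definition reciprocal :: "(ratvf \<Rightarrow> ratvf \<Rightarrow> ratvf) \<Rightarrow> ratvf \<Rightarrow> ratvf \<Rightarrow> ratvf" where
  "reciprocal nabla X Y = nabla Y X + vf_bracket X Y"

section \<open>Zariski topology\<close>

text \<open>\<open>C\<close> is a set of coordinate functions on an affine space.\<close>

inductive_set polyfun :: "('a \<Rightarrow> complex) set \<Rightarrow> ('a \<Rightarrow> complex) set"
  for C :: "('a \<Rightarrow> complex) set" where
  const: "(\<lambda>_. c) \<in> polyfun C"
| coord: "f \<in> C \<Longrightarrow> f \<in> polyfun C"
| add: "f \<in> polyfun C \<Longrightarrow> g \<in> polyfun C \<Longrightarrow> (\<lambda>x. f x + g x) \<in> polyfun C"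
| mult: "f \<in> polyfun C \<Longrightarrow> g \<in> polyfun C \<Longrightarrow> (\<lambda>x. f x * g x) \<in> polyfun C"

definition zariski_closed :: "('a \<Rightarrow> complex) set \<Rightarrow> 'a set \<Rightarrow> bool" where
  "zariski_closed C Z \<longleftrightarrow> (\<exists>P \<subseteq> polyfun C. Z = {x. \<forall>f\<in>P. f x = 0})"

definition vec_coords :: "(complex^'n \<Rightarrow> complex) set" where
  "vec_coords = range (\<lambda>i x. x $ i)"

definition mat_coords :: "(complex^'n^'m \<Rightarrow> complex) set" where
  "mat_coords = {f. \<exists>i j. f = (\<lambda>A. A $ i $ j)}"

definition pair_coords :: "((complex^3) \<times> (complex^3^3) \<Rightarrow> complex) set" where
  "pair_coords = (\<lambda>f. f \<circ> fst) ` vec_coords \<union> (\<lambda>f. f \<circ> snd) ` mat_coords"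

section \<open>The Lie algebra of traceless matrices, its automorphisms, and the group PSL(2)\<close>

definition sl2 :: "(complex^2^2) set" where
  "sl2 = {A. trace A = 0}"

definition scale_mat :: "complex \<Rightarrow> complex^'n^'m \<Rightarrow> complex^'n^'m" where
  "scale_mat c A = (\<chi> i j. c * A $ i $ j)"

definition commutator :: "complex^'n^'n \<Rightarrow> complex^'n^'n \<Rightarrow> complex^'n^'n" where
  "commutator A B = A ** B - B ** A"

definition sl2_basis :: "3 \<Rightarrow> complex^2^2" where
  "sl2_basis i = (if i = 1 then vector [vector [1, 0], vector [0, -1]]
                  else if i = 2 then vector [vector [0, 1], vector [0, 0]]
                  else vector [vector [0, 0], vector [1, 0]])"

definition aut_sl2 :: "(complex^2^2 \<Rightarrow> complex^2^2) set" where
  "aut_sl2 = {\<alpha> \<in> extensional sl2. bij_betw \<alpha> sl2 sl2 \<and>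
     (\<forall>A\<in>sl2. \<forall>B\<in>sl2. \<alpha> (A + B) = \<alpha> A + \<alpha> B) \<and>
     (\<forall>c. \<forall>A\<in>sl2. \<alpha> (scale_mat c A) = scale_mat c (\<alpha> A)) \<and>
     (\<forall>A\<in>sl2. \<forall>B\<in>sl2. \<alpha> (commutator A B) = commutator (\<alpha> A) (\<alpha> B))}"

definition conjugate_aut ::
    "(complex^2^2 \<Rightarrow> complex^2^2) \<Rightarrow> (complex^2^2 \<Rightarrow> complex^2^2) \<Rightarrow> complex^2^2 \<Rightarrow> complex^2^2" where
  "conjugate_aut \<gamma> \<alpha> = (\<lambda>A\<in>sl2. \<gamma> (\<alpha> (inv_into sl2 \<gamma> A)))"

definition SL2 :: "(complex^2^2) monoid" where
  "SL2 = \<lparr>carrier = {A. det A = 1}, mult = (**), one = mat 1\<rparr>"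

definition PSL2 :: "(complex^2^2) set monoid" where
  "PSL2 = SL2 Mod {mat 1, - mat 1}"

text \<open>
  \<open>\<Union>\<Gamma>\<close> is the preimage of \<open>\<Gamma>\<close> in SL(2). As the variety PSL(2) is the quotient of SL(2) by a
  finite group, its Zariski topology is the quotient topology; and SL(2) is closed in the space
  of matrices.
\<close>

definition algebraic_subgroup_PSL2 :: "(complex^2^2) set set \<Rightarrow> bool" where
  "algebraic_subgroup_PSL2 \<Gamma> \<longleftrightarrow> subgroup \<Gamma> PSL2 \<and> zariski_closed mat_coords (\<Union>\<Gamma>)"

definition Ad :: "complex^2^2 \<Rightarrow> complex^2^2 \<Rightarrow> complex^2^2" where
  "Ad g = (\<lambda>A\<in>sl2. g ** A ** matrix_inv g)"

text \<open>The isomorphism of PSL(2) with the automorphism group, induced by the adjoint action.\<close>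

definition PSL2_aut :: "(complex^2^2) set \<Rightarrow> complex^2^2 \<Rightarrow> complex^2^2" where
  "PSL2_aut C = the_elem (Ad ` C)"

section \<open>Parallelisms\<close>

definition rational_parallelism :: "(complex^2^2 \<Rightarrow> ratvf) \<Rightarrow> bool" where
  "rational_parallelism \<rho> \<longleftrightarrow>
     (\<forall>A\<in>sl2. \<forall>B\<in>sl2. \<rho> (A + B) = \<rho> A + \<rho> B) \<and>
     (\<forall>c. \<forall>A\<in>sl2. \<rho> (scale_mat c A) = const_ratfun c *s \<rho> A) \<and>
     (\<forall>A\<in>sl2. \<forall>B\<in>sl2. \<rho> (commutator A B) = vf_bracket (\<rho> A) (\<rho> B)) \<and>
     (\<exists>U. zariski_closed vec_coords (- U) \<and> U \<noteq> {} \<and>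
        (\<forall>x\<in>U. (\<forall>i. vf_regular_at (\<rho> (sl2_basis i)) x) \<and>
           inj (\<lambda>i. vf_at (\<rho> (sl2_basis i)) x) \<and>
           vec.independent (range (\<lambda>i. vf_at (\<rho> (sl2_basis i)) x)) \<and>
           vec.span (range (\<lambda>i. vf_at (\<rho> (sl2_basis i)) x)) = UNIV))"

definition associated_connection ::
    "(complex^2^2 \<Rightarrow> ratvf) \<Rightarrow> (ratvf \<Rightarrow> ratvf \<Rightarrow> ratvf) \<Rightarrow> bool" where
  "associated_connection \<rho> nabla \<longleftrightarrow> rational_connection nabla \<and> (\<forall>A\<in>sl2. \<forall>X. nabla X (\<rho> A) = 0)"

section \<open>Horizontal vector fields and the Galois group\<close>

text \<open>\<open>axis i 1 :: ratvf\<close> is the \<open>i\<close>-th coordinate vector field.\<close>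

definition connection_regular_at :: "(ratvf \<Rightarrow> ratvf \<Rightarrow> ratvf) \<Rightarrow> complex^3 \<Rightarrow> bool" where
  "connection_regular_at nabla x \<longleftrightarrow> (\<forall>i j. vf_regular_at (nabla (axis i 1) (axis j 1)) x)"

definition christoffel ::
    "(ratvf \<Rightarrow> ratvf \<Rightarrow> ratvf) \<Rightarrow> complex^3 \<Rightarrow> complex^3 \<Rightarrow> complex^3 \<Rightarrow> complex^3" where
  "christoffel nabla x u v =
     (\<Sum>i\<in>UNIV. \<Sum>j\<in>UNIV. (u $ i * v $ j) *s vf_at (nabla (axis i 1) (axis j 1)) x)"

text \<open>
  The covariant derivative of \<open>Y\<close> along \<open>u\<close> is \<open>DY(x) u + christoffel nabla x u (Y x)\<close>; requiring it to
  vanish for all \<open>u\<close> determines the real differential of \<open>Y\<close>, which is then complex linear, so that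
  horizontal vector fields are automatically holomorphic.
\<close>

definition horizontal_at ::
    "(ratvf \<Rightarrow> ratvf \<Rightarrow> ratvf) \<Rightarrow> (complex^3 \<Rightarrow> complex^3) \<Rightarrow> complex^3 \<Rightarrow> bool" where
  "horizontal_at nabla Y x \<longleftrightarrow> (Y has_derivative (\<lambda>u. - christoffel nabla x u (Y x))) (at x)"

text \<open>A frame is an invertible matrix whose columns are the vectors of the frame.\<close>

definition frame_bundle :: "(complex^3) set \<Rightarrow> ((complex^3) \<times> (complex^3^3)) set" where
  "frame_bundle M = M \<times> {F. invertible F}"

definition horizontal_frame_on ::
    "(ratvf \<Rightarrow> ratvf \<Rightarrow> ratvf) \<Rightarrow> (complex^3) set \<Rightarrow> (complex^3 \<Rightarrow> complex^3^3) \<Rightarrow> bool" where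
  "horizontal_frame_on nabla U \<sigma> \<longleftrightarrow>
     (\<forall>x\<in>U. invertible (\<sigma> x) \<and> (\<forall>j. horizontal_at nabla (\<lambda>y. column j (\<sigma> y)) x))"

definition plaque ::
    "(ratvf \<Rightarrow> ratvf \<Rightarrow> ratvf) \<Rightarrow> (complex^3) set \<Rightarrow> ((complex^3) \<times> (complex^3^3)) set \<Rightarrow> bool" where
  "plaque nabla M S \<longleftrightarrow> (\<exists>U \<sigma>. open U \<and> connected U \<and> U \<subseteq> M \<and>
     horizontal_frame_on nabla U \<sigma> \<and> S = (\<lambda>x. (x, \<sigma> x)) ` U)"

definition leaf ::
    "(ratvf \<Rightarrow> ratvf \<Rightarrow> ratvf) \<Rightarrow> (complex^3) set \<Rightarrow> (complex^3) \<times> (complex^3^3)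
      \<Rightarrow> ((complex^3) \<times> (complex^3^3)) set" where
  "leaf nabla M p = {q. (\<lambda>a b. \<exists>S. plaque nabla M S \<and> a \<in> S \<and> b \<in> S)\<^sup>*\<^sup>* p q}"

definition leaf_closure ::
    "(ratvf \<Rightarrow> ratvf \<Rightarrow> ratvf) \<Rightarrow> (complex^3) set \<Rightarrow> (complex^3) \<times> (complex^3^3)
      \<Rightarrow> ((complex^3) \<times> (complex^3^3)) set" where
  "leaf_closure nabla M p = frame_bundle M \<inter> (zariski_closed pair_coords hull leaf nabla M p)"

definition galois_group ::
    "(ratvf \<Rightarrow> ratvf \<Rightarrow> ratvf) \<Rightarrow> (complex^3) set \<Rightarrow> (complex^3) \<times> (complex^3^3) \<Rightarrow> (complex^3^3) set" where
  "galois_group nabla M p = {g. invertible g \<and>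
     (\<lambda>(x, F). (x, F ** g)) ` leaf_closure nabla M p = leaf_closure nabla M p}"

definition germ_eq :: "complex^3 \<Rightarrow> (complex^3 \<Rightarrow> complex^3) \<Rightarrow> (complex^3 \<Rightarrow> complex^3) \<Rightarrow> bool" where
  "germ_eq x Y Z \<longleftrightarrow> (\<forall>\<^sub>F y in nhds x. Y y = Z y)"

definition horizontal_germ ::
    "(ratvf \<Rightarrow> ratvf \<Rightarrow> ratvf) \<Rightarrow> complex^3 \<Rightarrow> (complex^3 \<Rightarrow> complex^3) \<Rightarrow> bool" where
  "horizontal_germ nabla x Y \<longleftrightarrow> (\<forall>\<^sub>F y in nhds x. horizontal_at nabla Y y)"

definition local_bracket ::
    "(complex^3 \<Rightarrow> complex^3) \<Rightarrow> (complex^3 \<Rightarrow> complex^3) \<Rightarrow> complex^3 \<Rightarrow> complex^3" where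
  "local_bracket Y Z x = frechet_derivative Z (at x) (Y x) - frechet_derivative Y (at x) (Z x)"

text \<open>
  \<open>\<psi>\<close> is an isomorphism from \<open>sl2\<close> onto the Lie algebra of germs at \<open>x\<close> of horizontal vector fields.
\<close>

definition horizontal_germ_iso ::
    "(ratvf \<Rightarrow> ratvf \<Rightarrow> ratvf) \<Rightarrow> complex^3 \<Rightarrow> (complex^2^2 \<Rightarrow> complex^3 \<Rightarrow> complex^3) \<Rightarrow> bool" where
  "horizontal_germ_iso nabla x \<psi> \<longleftrightarrow>
     (\<forall>A\<in>sl2. horizontal_germ nabla x (\<psi> A)) \<and>
     (\<forall>Y. horizontal_germ nabla x Y \<longrightarrow> (\<exists>!A. A \<in> sl2 \<and> germ_eq x (\<psi> A) Y)) \<and>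
     (\<forall>A\<in>sl2. \<forall>B\<in>sl2. germ_eq x (\<psi> (A + B)) (\<lambda>y. \<psi> A y + \<psi> B y)) \<and>
     (\<forall>c. \<forall>A\<in>sl2. germ_eq x (\<psi> (scale_mat c A)) (\<lambda>y. c *s \<psi> A y)) \<and>
     (\<forall>A\<in>sl2. \<forall>B\<in>sl2. germ_eq x (\<psi> (commutator A B)) (local_bracket (\<psi> A) (\<psi> B)))"

text \<open>
  A matrix \<open>g\<close> in the Galois group acts on horizontal germs as the linear map with matrix \<open>g\<close> in the
  basis formed by the columns of \<open>\<sigma>\<close>, a germ at \<open>x\<close> of horizontal frame whose graph lies in the
  leaf; this action is transported to \<open>sl2\<close> through \<open>\<psi>\<close>.
\<close>

definition germ_action ::
    "complex^3 \<Rightarrow> (complex^3 \<Rightarrow> complex^3^3) \<Rightarrow> (complex^2^2 \<Rightarrow> complex^3 \<Rightarrow> complex^3)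
      \<Rightarrow> complex^3^3 \<Rightarrow> complex^2^2 \<Rightarrow> complex^2^2" where
  "germ_action x \<sigma> \<psi> g = (\<lambda>A\<in>sl2. THE B. B \<in> sl2 \<and>
     (\<exists>c. germ_eq x (\<psi> A) (\<lambda>y. \<sigma> y *v c) \<and> germ_eq x (\<psi> B) (\<lambda>y. \<sigma> y *v (g *v c))))"

text \<open>
  The Galois group seen in \<open>aut_sl2\<close>. The choices of the regular open set \<open>M\<close>, the point \<open>x\<close>, the
  leaf (through \<open>(x, \<sigma> x)\<close>) and the identification \<open>\<psi>\<close> affect it by conjugation only.
\<close>

definition galois_group_in_aut ::
    "(ratvf \<Rightarrow> ratvf \<Rightarrow> ratvf) \<Rightarrow> (complex^2^2 \<Rightarrow> complex^2^2) set \<Rightarrow> bool" where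
  "galois_group_in_aut nabla G \<longleftrightarrow> (\<exists>M x U \<sigma> \<psi>.
     zariski_closed vec_coords (- M) \<and> (\<forall>y\<in>M. connection_regular_at nabla y) \<and>
     open U \<and> connected U \<and> x \<in> U \<and> U \<subseteq> M \<and> horizontal_frame_on nabla U \<sigma> \<and>
     horizontal_germ_iso nabla x \<psi> \<and>
     G = germ_action x \<sigma> \<psi> ` galois_group nabla M (x, \<sigma> x))"

end

theory Submission
  imports Defs "HOL-Complex_Analysis.Conformal_Mappings" "HOL-Computational_Algebra.Fundamental_Theorem_Algebra"
begin

text \<open>A rational function \<open>q\<close> of one variable yields a parallelism of type \<open>sl\<^sub>2\<close> in the coordinates
  \<open>(x, y, z)\<close>. The horizontal fields of its reciprocal connection are determined by their first
  component, which is a quadratic form in two solutions of \<open>v'' = q v\<close>; hence the Galois group is the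
  image in \<open>PSL\<^sub>2\<close> of the differential Galois group of this equation, and it remains to
  find a suitable \<open>q\<close> for every algebraic subgroup \<open>G\<close> of \<open>SL\<^sub>2\<close> containing \<open>-1\<close>, up to conjugation.

  If \<open>G\<close> is infinite, it is a torus, the normalizer of a torus, a Borel subgroup, a
  subgroup of it whose diagonal characters are roots of unity, or \<open>SL\<^sub>2\<close>. In these cases \<open>q\<close> is written
  down explicitly, an algebraic relation satisfied by the solutions bounds the group from above, and
  the monodromy is Zariski dense in \<open>G\<close>. If \<open>G\<close> is finite, \<open>q\<close> is such that the inverse of the quotient map
  \<open>f\<close> of the projective line by \<open>G\<close> is a quotient of two solutions: the Schwarzian derivative of
  \<open>f\<close>, divided by \<open>2 f'\<^sup>2\<close>, is \<open>G\<close>-invariant and therefore a rational function of \<open>f\<close>.\<close>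

section \<open>Rational functions and vector fields\<close>

text \<open>The field \<open>par_E Q\<close> is \<open>y^2\<close> times the field of the linear
  system \<open>y' = - z\<close>, \<open>z' = - Q y\<close>, so its trajectories are graphs of
  solutions of \<open>y'' = Q y\<close>. A vector field commuting with the parallelism is the
  prolongation of some \<open>l(x) d/dx\<close> preserving this equation, and such \<open>l\<close>
  solve its symmetric square. This explains the quadratic forms, and why solution matrices matter
  only up to sign. The Galois group is defined through a Zariski closure in the frame bundle. The
  bound from above therefore needs a closed set \<open>Z\<close> of solution matrices that is stable
  under continuation and whose fibres are orbits of \<open>G\<close>; loops suffice for the bound
  from below, as the explicit equations have only regular singular points. Solutions are
  multivalued. They are handled through a parameter \<open>s\<close> with \<open>x = e s\<close> on
  which the quotient \<open>T\<close> of two solutions is single valued: a loop in \<open>x\<close>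
  becomes a path between two parameters over the same \<open>x\<close>, and its effect on
  \<open>T\<close> is a Moebius map that can be read off. Since \<open>v\<close> is recovered as a
  square root, signs stay undetermined throughout.\<close>

lemma eval3_simps [simp]:
  "eval3 0 x = 0" "eval3 1 x = 1" "eval3 (p + q) x = eval3 p x + eval3 q x"
  "eval3 (p - q) x = eval3 p x - eval3 q x" "eval3 (- p) x = - eval3 p x"
  "eval3 (p * q) x = eval3 p x * eval3 q x"
  by (simp_all add: eval3_def)

text \<open>Relational form of \<open>regular_at\<close> together with \<open>value_at\<close>. It
  passes through sums, products and quotients by introduction rules, without touching the definite
  description.\<close>

definition has_value :: "ratfun \<Rightarrow> complex^3 \<Rightarrow> complex \<Rightarrow> bool" where
  "has_value f x v \<longleftrightarrow> (\<exists>p q. f = Fract p q \<and> eval3 q x \<noteq> 0 \<and> v = eval3 p x / eval3 q x)"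

lemma has_value_unique: "has_value f x v \<Longrightarrow> has_value f x w \<Longrightarrow> v = w"
proof -
  assume "has_value f x v" "has_value f x w"
  then obtain p q p' q' where *: "f = Fract p q" "eval3 q x \<noteq> 0" "v = eval3 p x / eval3 q x"
    "f = Fract p' q'" "eval3 q' x \<noteq> 0" "w = eval3 p' x / eval3 q' x"
    unfolding has_value_def by metis
  then have "q \<noteq> 0" "q' \<noteq> 0" by auto
  with * have "p * q' = p' * q" by (simp add: eq_fract)
  then have "eval3 p x * eval3 q' x = eval3 p' x * eval3 q x"
    by (metis eval3_simps(6))
  with *(2,5) show ?thesis unfolding *(3,6) by (simp add: field_simps)
qed

lemma has_value_regular: "has_value f x v \<Longrightarrow> regular_at f x"
  unfolding has_value_def regular_at_def by blast

lemma has_value_value_at: "has_value f x v \<Longrightarrow> value_at f x = v"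
  unfolding value_at_def
  by (rule the_equality) (use has_value_unique has_value_def in blast)+

lemma has_value_Fract: "eval3 q x \<noteq> 0 \<Longrightarrow> has_value (Fract p q) x (eval3 p x / eval3 q x)"
  unfolding has_value_def by blast

lemma has_value_0: "has_value 0 x 0"
  using has_value_Fract[of 1 x 0] by (simp add: fract_collapse)

lemma has_value_1: "has_value 1 x 1"
  using has_value_Fract[of 1 x 1] by (simp add: fract_collapse)

lemma has_value_add:
  assumes "has_value f x v" "has_value g x w" shows "has_value (f + g) x (v + w)"
proof -
  from assms obtain p q p' q' where *: "f = Fract p q" "eval3 q x \<noteq> 0" "v = eval3 p x / eval3 q x"
    "g = Fract p' q'" "eval3 q' x \<noteq> 0" "w = eval3 p' x / eval3 q' x"
    unfolding has_value_def by metis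
  then have "q \<noteq> 0" "q' \<noteq> 0" by auto
  with * show ?thesis
    using has_value_Fract[of "q * q'" x "p * q' + p' * q"] by (simp add: add_frac_eq)
qed

lemma has_value_mult:
  assumes "has_value f x v" "has_value g x w" shows "has_value (f * g) x (v * w)"
proof -
  from assms obtain p q p' q' where *: "f = Fract p q" "eval3 q x \<noteq> 0" "v = eval3 p x / eval3 q x"
    "g = Fract p' q'" "eval3 q' x \<noteq> 0" "w = eval3 p' x / eval3 q' x"
    unfolding has_value_def by metis
  then show ?thesis
    using has_value_Fract[of "q * q'" x "p * p'"] by simp
qed

lemma has_value_minus:
  assumes "has_value f x v" shows "has_value (- f) x (- v)"
proof -
  from assms obtain p q where *: "f = Fract p q" "eval3 q x \<noteq> 0" "v = eval3 p x / eval3 q x"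
    unfolding has_value_def by metis
  then show ?thesis
    using has_value_Fract[of q x "- p"] by simp
qed

lemma has_value_diff:
  "has_value f x v \<Longrightarrow> has_value g x w \<Longrightarrow> has_value (f - g) x (v - w)"
  using has_value_add[of f x v "- g" "- w"] has_value_minus[of g x w] by simp

lemma has_value_inverse:
  assumes "has_value f x v" "v \<noteq> 0" shows "has_value (inverse f) x (inverse v)"
proof -
  from assms obtain p q where *: "f = Fract p q" "eval3 q x \<noteq> 0" "v = eval3 p x / eval3 q x"
    unfolding has_value_def by metis
  with assms have "eval3 p x \<noteq> 0" by auto
  with * show ?thesis
    using has_value_Fract[of p x q] by simp
qed

lemma has_value_divide:
  "has_value f x v \<Longrightarrow> has_value g x w \<Longrightarrow> w \<noteq> 0 \<Longrightarrow> has_value (f / g) x (v / w)"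
  using has_value_mult[of f x v "inverse g" "inverse w"] has_value_inverse[of g x w]
  by (simp add: divide_inverse)

lemma has_value_power: "has_value f x v \<Longrightarrow> has_value (f ^ n) x (v ^ n)"
  by (induction n) (auto intro: has_value_1 has_value_mult)

lemma has_value_numeral: "has_value (numeral n) x (numeral n)"
proof -
  have *: "has_value (of_nat k) x (of_nat k)" for k
    by (induction k) (auto intro: has_value_0 has_value_1 has_value_add)
  show ?thesis using *[of "numeral n"] by simp
qed

lemma has_value_const: "has_value (const_ratfun c) x c"
  using has_value_Fract[of 1 x "[:[:[:c:]:]:]"] by (simp add: const_ratfun_def eval3_def)

lemmas has_value_intros = has_value_0 has_value_1 has_value_add has_value_mult has_value_minus
  has_value_diff has_value_divide has_value_power has_value_numeral has_value_const

lemma pderiv3_add: "pderiv3 i (p + q) = pderiv3 i p + pderiv3 i q"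
proof -
  have 1: "pderiv (a * b) = pderiv a * b + a * pderiv b"
    for a b :: "'a::{comm_semiring_1,semiring_no_zero_divisors} poly"
    by (simp add: pderiv_mult algebra_simps)
  note 2 = map_poly_derivation[where D = "pderiv :: complex poly \<Rightarrow> complex poly", OF pderiv_add 1]
  note 3 = map_poly_derivation[where D = "pderiv :: complex poly poly \<Rightarrow> complex poly poly", OF pderiv_add 1]
  note 4 = map_poly_derivation[where D = "map_poly (pderiv :: complex poly \<Rightarrow> complex poly)", OF 2]
  show ?thesis
    unfolding pderiv3_def by (simp add: pderiv_add 2 3 4)
qed

lemma partial_deriv_Fract:
  "q \<noteq> 0 \<Longrightarrow> partial_deriv i (Fract p q) = Fract (pderiv3 i p * q - p * pderiv3 i q) (q * q)"
  by transfer simp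

lemma partial_deriv_add: "partial_deriv i (f + g) = partial_deriv i f + partial_deriv i g"
proof -
  obtain p q p' q' where *: "f = Fract p q" "q \<noteq> 0" "g = Fract p' q'" "q' \<noteq> 0"
    by (metis Fract_cases)
  then show ?thesis
    by (simp add: partial_deriv_Fract eq_fract pderiv3_mult pderiv3_add algebra_simps)
qed

lemma partial_deriv_mult: "partial_deriv i (f * g) = partial_deriv i f * g + f * partial_deriv i g"
proof -
  obtain p q p' q' where *: "f = Fract p q" "q \<noteq> 0" "g = Fract p' q'" "q' \<noteq> 0"
    by (metis Fract_cases)
  then show ?thesis
    by (simp add: partial_deriv_Fract eq_fract pderiv3_mult pderiv3_add algebra_simps)
qed

lemma partial_deriv_0 [simp]: "partial_deriv i 0 = 0"
  using partial_deriv_add[of i 0 0] by (simp only: add_0_left add_cancel_right_left)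

lemma partial_deriv_1 [simp]: "partial_deriv i 1 = 0"
  using partial_deriv_mult[of i 1 1] by (simp only: mult_1_left mult_1_right add_cancel_right_left)

lemma partial_deriv_minus: "partial_deriv i (- f) = - partial_deriv i f"
  using partial_deriv_add[of i f "- f"] by (simp add: eq_neg_iff_add_eq_0 add.commute)

lemma partial_deriv_diff: "partial_deriv i (f - g) = partial_deriv i f - partial_deriv i g"
  using partial_deriv_add[of i f "- g"] by (simp add: partial_deriv_minus)

lemma partial_deriv_inverse: "partial_deriv i (inverse f) = - partial_deriv i f / (f * f)"
proof (cases "f = 0")
  case False
  then have "partial_deriv i f * inverse f + f * partial_deriv i (inverse f) = 0"
    using partial_deriv_mult[of i f "inverse f"] by simp
  with False show ?thesis by (simp add: field_simps eq_neg_iff_add_eq_0 add.commute)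
qed simp

lemma partial_deriv_divide:
  "partial_deriv i (f / g) = partial_deriv i f / g - f * partial_deriv i g / (g * g)"
  by (simp add: divide_inverse partial_deriv_mult partial_deriv_inverse)

lemma pderiv3_const: "pderiv3 i [:[:[:c:]:]:] = 0"
  by (simp add: pderiv3_def map_poly_pCons)

lemma partial_deriv_const [simp]: "partial_deriv i (const_ratfun c) = 0"
proof -
  have "pderiv3 i 1 = 0" using pderiv3_const[of i 1] by (simp flip: one_pCons)
  then show ?thesis
    by (simp add: const_ratfun_def partial_deriv_Fract pderiv3_const fract_collapse)
qed

lemma const_ratfun_simps [simp]:
  "const_ratfun 0 = 0" "const_ratfun 1 = 1"
  "const_ratfun (a + b) = const_ratfun a + const_ratfun b"
  "const_ratfun (a - b) = const_ratfun a - const_ratfun b"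
  "const_ratfun (- a) = - const_ratfun a"
  "const_ratfun (a * b) = const_ratfun a * const_ratfun b"
  by (simp_all add: const_ratfun_def Zero_fract_def One_fract_def mult.commute flip: one_pCons)

definition lift_x :: "complex poly \<Rightarrow> poly3" where
  "lift_x = map_poly (\<lambda>c. [:[:c:]:])"

lemma eval3_lift_x [simp]: "eval3 (lift_x p) x = poly p (x $ 1)"
  by (induction p) (simp_all add: lift_x_def eval3_def map_poly_pCons)

lemma lift_x_eq_0_iff [simp]: "lift_x p = 0 \<longleftrightarrow> p = 0"
proof
  assume *: "lift_x p = 0"
  have "poly p c = 0" for c
    using eval3_lift_x[of p "vec c"] by (simp only: * eval3_simps vec_component)
  then show "p = 0" using poly_all_0_iff_0 by blast
qed (simp add: lift_x_def)

lemma pderiv3_lift_x: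
  "pderiv3 1 (lift_x p) = lift_x (pderiv p)" "pderiv3 2 (lift_x p) = 0" "pderiv3 3 (lift_x p) = 0"
proof -
  have add: "lift_x (a + b) = lift_x a + lift_x b" for a b
    unfolding lift_x_def by (rule poly_eqI) (simp add: coeff_map_poly)
  show "pderiv3 1 (lift_x p) = lift_x (pderiv p)"
    by (induction p)
      (simp_all add: pderiv3_def pderiv_pCons add, simp_all add: lift_x_def map_poly_pCons pderiv_pCons)
  show "pderiv3 2 (lift_x p) = 0" "pderiv3 3 (lift_x p) = 0"
    by (induction p) (simp_all add: pderiv3_def lift_x_def map_poly_pCons)
qed

definition ratX :: "complex poly \<Rightarrow> ratfun" where "ratX p = Fract (lift_x p) 1"
definition ratY :: ratfun where "ratY = Fract [:[:0, 1:]:] 1"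
definition ratZ :: ratfun where "ratZ = Fract [:[:[:0, 1:]:]:] 1"

lemma ratX_eq_0_iff [simp]: "ratX p = 0 \<longleftrightarrow> p = 0"
  by (simp add: ratX_def Zero_fract_def eq_fract)

lemma ratY_neq_0 [simp]: "ratY \<noteq> 0"
  by (simp add: ratY_def Zero_fract_def eq_fract)

lemma has_value_coords:
  "has_value (ratX p) x (poly p (x $ 1))" "has_value ratY x (x $ 2)" "has_value ratZ x (x $ 3)"
  using has_value_Fract[of 1 x "lift_x p"] has_value_Fract[of 1 x "[:[:0, 1:]:]"]
    has_value_Fract[of 1 x "[:[:[:0, 1:]:]:]"]
  by (simp_all add: ratX_def ratY_def ratZ_def, simp_all add: eval3_def)

lemma partial_deriv_coords [simp]:
  "partial_deriv 1 (ratX p) = ratX (pderiv p)" "partial_deriv 2 (ratX p) = 0" "partial_deriv 3 (ratX p) = 0"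
  "partial_deriv 1 ratY = 0" "partial_deriv 2 ratY = 1" "partial_deriv 3 ratY = 0"
  "partial_deriv 1 ratZ = 0" "partial_deriv 2 ratZ = 0" "partial_deriv 3 ratZ = 1"
proof -
  have 1: "pderiv3 i 1 = 0" for i using pderiv3_const[of i 1] by (simp flip: one_pCons)
  have y: "pderiv3 1 [:[:0, 1:]:] = 0" "pderiv3 2 [:[:0, 1:]:] = 1" "pderiv3 3 [:[:0, 1:]:] = 0"
    by (simp_all add: pderiv3_def map_poly_pCons pderiv_pCons one_pCons)
  have z: "pderiv3 1 [:[:[:0, 1:]:]:] = 0" "pderiv3 2 [:[:[:0, 1:]:]:] = 0" "pderiv3 3 [:[:[:0, 1:]:]:] = 1"
    by (simp_all add: pderiv3_def map_poly_pCons pderiv_pCons one_pCons)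
  show "partial_deriv 1 (ratX p) = ratX (pderiv p)" "partial_deriv 2 (ratX p) = 0" "partial_deriv 3 (ratX p) = 0"
    by (simp_all add: ratX_def partial_deriv_Fract 1 pderiv3_lift_x fract_collapse)
  show "partial_deriv 1 ratY = 0" "partial_deriv 2 ratY = 1" "partial_deriv 3 ratY = 0"
    by (simp_all add: ratY_def partial_deriv_Fract 1 y fract_collapse)
  show "partial_deriv 1 ratZ = 0" "partial_deriv 2 ratZ = 0" "partial_deriv 3 ratZ = 1"
    by (simp_all add: ratZ_def partial_deriv_Fract 1 z fract_collapse)
qed

section \<open>The parallelism of a second order equation\<close>

text \<open>The Euler field of the plane \<open>(y, z)\<close>. It gives \<open>par_E Q\<close>,
  which is \<open>y^2\<close> times a field of degree 0, weight 2, and \<open>par_F\<close> weight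
  -2; these are the relations of \<open>sl2\<close> that involve the diagonal generator.\<close>

definition par_H :: ratvf where "par_H = vector [0, ratY, ratZ]"
definition par_E :: "ratfun \<Rightarrow> ratvf" where
  "par_E Q = vector [ratY ^ 2, - (ratZ * ratY ^ 2), - (Q * ratY ^ 3)]"
text \<open>A constant of its own, so that the bracket and coordinate computations are polynomial
  identities modulo the single relation \<open>ratY * inv_Y = 1\<close>.\<close>

definition inv_Y :: ratfun where "inv_Y = inverse ratY"
definition par_F :: ratvf where "par_F = vector [0, 0, inv_Y]"

lemma ratY_inv_Y: "ratY * inv_Y = 1"
  by (simp add: inv_Y_def)

lemma partial_deriv_inv_Y [simp]:
  "partial_deriv 1 inv_Y = 0" "partial_deriv 2 inv_Y = - (inv_Y ^ 2)" "partial_deriv 3 inv_Y = 0"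
  by (simp_all add: inv_Y_def partial_deriv_inverse power2_eq_square divide_inverse)

lemma has_value_inv_Y: "x $ 2 \<noteq> 0 \<Longrightarrow> has_value inv_Y x (inverse (x $ 2))"
  unfolding inv_Y_def by (intro has_value_inverse has_value_coords)

definition par :: "ratfun \<Rightarrow> complex^2^2 \<Rightarrow> ratvf" where
  "par Q A = const_ratfun (A $ 1 $ 1) *s par_H + const_ratfun (A $ 1 $ 2) *s par_E Q
     + const_ratfun (A $ 2 $ 1) *s par_F"

lemmas par_defs = par_H_def par_E_def par_F_def

lemma par_nth:
  "par Q A $ 1 = const_ratfun (A $ 1 $ 2) * ratY ^ 2"
  "par Q A $ 2 = const_ratfun (A $ 1 $ 1) * ratY - const_ratfun (A $ 1 $ 2) * ratZ * ratY ^ 2"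
  "par Q A $ 3 = const_ratfun (A $ 1 $ 1) * ratZ - const_ratfun (A $ 1 $ 2) * Q * ratY ^ 3
     + const_ratfun (A $ 2 $ 1) * inv_Y"
  by (simp_all add: par_def par_defs)

lemmas partial_deriv_simps = partial_deriv_add partial_deriv_mult partial_deriv_diff
  partial_deriv_minus partial_deriv_divide power2_eq_square power3_eq_cube

lemma par_partial_deriv:
  assumes Q: "partial_deriv 2 Q = 0" "partial_deriv 3 Q = 0"
  shows "partial_deriv 1 (par Q A $ 1) = 0"
    "partial_deriv 2 (par Q A $ 1) = 2 * const_ratfun (A $ 1 $ 2) * ratY"
    "partial_deriv 3 (par Q A $ 1) = 0"
    "partial_deriv 1 (par Q A $ 2) = 0"
    "partial_deriv 2 (par Q A $ 2) = const_ratfun (A $ 1 $ 1) - 2 * const_ratfun (A $ 1 $ 2) * ratZ * ratY"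
    "partial_deriv 3 (par Q A $ 2) = - (const_ratfun (A $ 1 $ 2) * ratY ^ 2)"
    "partial_deriv 1 (par Q A $ 3) = - (const_ratfun (A $ 1 $ 2) * partial_deriv 1 Q * ratY ^ 3)"
    "partial_deriv 2 (par Q A $ 3) = - (3 * const_ratfun (A $ 1 $ 2) * Q * ratY ^ 2) - const_ratfun (A $ 2 $ 1) * inv_Y ^ 2"
    "partial_deriv 3 (par Q A $ 3) = const_ratfun (A $ 1 $ 1)"
  unfolding par_nth partial_deriv_simps by (simp_all add: Q algebra_simps power2_eq_square)

lemma par_bracket:
  assumes Q: "partial_deriv 2 Q = 0" "partial_deriv 3 Q = 0"
    and AB: "A \<in> sl2" "B \<in> sl2"
  shows "par Q (commutator A B) = vf_bracket (par Q A) (par Q B)"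
proof -
  have [simp]: "A $ 2 $ 2 = - A $ 1 $ 1" "B $ 2 $ 2 = - B $ 1 $ 1"
    using AB by (simp_all add: sl2_def trace_def sum_2 eq_neg_iff_add_eq_0 add.commute)
  have c: "commutator A B $ 1 $ 1 = A $ 1 $ 2 * B $ 2 $ 1 - B $ 1 $ 2 * A $ 2 $ 1"
    "commutator A B $ 1 $ 2 = 2 * (A $ 1 $ 1 * B $ 1 $ 2 - B $ 1 $ 1 * A $ 1 $ 2)"
    "commutator A B $ 2 $ 1 = 2 * (B $ 1 $ 1 * A $ 2 $ 1 - A $ 1 $ 1 * B $ 2 $ 1)"
    by (simp_all add: commutator_def matrix_matrix_mult_def sum_2 algebra_simps)
  have 2: "const_ratfun 2 = 2"
    using const_ratfun_simps(3)[of 1 1] by simp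
  \<comment> \<open>The three components of the bracket as ring identities in free variables:
    \<open>a, b, c\<close> and \<open>a', b', c'\<close> are the matrix entries, \<open>y\<close>
    and \<open>z\<close> the coordinates, \<open>w\<close> the inverse of \<open>y\<close>,
    \<open>u\<close> stands for \<open>Q\<close> and \<open>q\<close> for its derivative. The last
    two hold modulo \<open>y * w = 1\<close>.\<close>
  have alg1: "2 * (a * b' - a' * b) * y^2 =
      (b * y^2) * 0 + (a * y - b * z * y^2) * (2 * b' * y) + (a * z - b * u * y^3 + v * w) * 0 -
     ((b' * y^2) * 0 + (a' * y - b' * z * y^2) * (2 * b * y) + (a' * z - b' * u * y^3 + v' * w) * 0)"
    for a b a' b' y z u v v' w :: ratfun
    by (simp add: algebra_simps power2_eq_square)
  have alg2: "(b * c' - b' * c) * y - 2 * (a * b' - a' * b) * z * y^2 =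
      (b * y^2) * 0 + (a * y - b * z * y^2) * (a' - 2 * b' * z * y) + (a * z - b * u * y^3 + c * w) * (- (b' * y^2)) -
     ((b' * y^2) * 0 + (a' * y - b' * z * y^2) * (a - 2 * b * z * y) + (a' * z - b' * u * y^3 + c' * w) * (- (b * y^2)))"
    (is "?l = ?r") if "y * w = 1" for a b c a' b' c' y z u w :: ratfun
  proof -
    have "?r = (b * c' - b' * c) * y * (y * w) - 2 * (a * b' - a' * b) * z * y^2"
      by (simp add: algebra_simps power2_eq_square power3_eq_cube)
    then show ?thesis by (simp only: that mult_1_right)
  qed
  have alg3: "(b * c' - b' * c) * z - 2 * (a * b' - a' * b) * u * y^3 + 2 * (a' * c - a * c') * w =
      (b * y^2) * (- (b' * q * y^3)) + (a * y - b * z * y^2) * (- (3 * b' * u * y^2) - c' * w^2) + (a * z - b * u * y^3 + c * w) * a' -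
     ((b' * y^2) * (- (b * q * y^3)) + (a' * y - b' * z * y^2) * (- (3 * b * u * y^2) - c * w^2) + (a' * z - b' * u * y^3 + c' * w) * a)"
    (is "?l = ?r") if "y * w = 1" for a b c a' b' c' y z u w q :: ratfun
  proof -
    have "?r = (b * c' - b' * c) * z * ((y * w) * (y * w)) - 2 * (a * b' - a' * b) * u * y^3
        + (a' * c - a * c') * w * (1 + y * w)"
      by (simp add: algebra_simps power2_eq_square power3_eq_cube)
    then show ?thesis by (simp only: that mult_1_right) (simp add: algebra_simps)
  qed
  show ?thesis
    unfolding vec_eq_iff forall_3 vf_bracket_def vf_apply_def vec_lambda_beta sum_3
      par_partial_deriv[OF Q]
    unfolding par_nth c const_ratfun_simps 2
    by (intro conjI alg1 alg2[OF ratY_inv_Y] alg3[OF ratY_inv_Y])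
qed

text \<open>The three \<open>coef\<close> functions are the coordinates of a field in the frame
  \<open>par_H\<close>, \<open>par_E Q\<close>, \<open>par_F\<close>. On \<open>par Q A\<close> they
  are the constants \<open>A $ 1 $ 1\<close>, \<open>A $ 1 $ 2\<close>, \<open>A $ 2 $ 1\<close>, so
  a connection that differentiates them makes the parallelism flat.\<close>

definition coef_H :: "ratvf \<Rightarrow> ratfun" where "coef_H Y = (ratZ * Y $ 1 + Y $ 2) * inv_Y"
definition coef_E :: "ratvf \<Rightarrow> ratfun" where "coef_E Y = Y $ 1 * inv_Y ^ 2"
definition coef_F :: "ratfun \<Rightarrow> ratvf \<Rightarrow> ratfun" where
  "coef_F Q Y = (Q * ratY ^ 2 - ratZ ^ 2) * Y $ 1 - ratZ * Y $ 2 + ratY * Y $ 3"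

definition par_connection :: "ratfun \<Rightarrow> ratvf \<Rightarrow> ratvf \<Rightarrow> ratvf" where
  "par_connection Q X Y = vf_apply X (coef_H Y) *s par_H + vf_apply X (coef_E Y) *s par_E Q
     + vf_apply X (coef_F Q Y) *s par_F"

lemma par_expand: "Y = coef_H Y *s par_H + coef_E Y *s par_E Q + coef_F Q Y *s par_F"
proof -
  have 1: "ratY * (inv_Y * f) = f" "inv_Y * (ratY * f) = f" for f
    using ratY_inv_Y by (simp_all flip: mult.assoc) (simp add: mult.commute)
  show ?thesis
    unfolding vec_eq_iff forall_3
    by (simp add: par_defs coef_H_def coef_E_def coef_F_def algebra_simps power2_eq_square power3_eq_cube 1)
qed

lemma vf_apply_simps:
  "vf_apply (X + X') f = vf_apply X f + vf_apply X' f"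
  "vf_apply (g *s X) f = g * vf_apply X f"
  "vf_apply X (f + f') = vf_apply X f + vf_apply X f'"
  "vf_apply X (f * f') = vf_apply X f * f' + f * vf_apply X f'"
  by (simp_all add: vf_apply_def sum_3 partial_deriv_simps algebra_simps)

lemma coef_simps:
  "coef_H (Y + Y') = coef_H Y + coef_H Y'" "coef_H (g *s Y) = g * coef_H Y"
  "coef_E (Y + Y') = coef_E Y + coef_E Y'" "coef_E (g *s Y) = g * coef_E Y"
  "coef_F Q (Y + Y') = coef_F Q Y + coef_F Q Y'" "coef_F Q (g *s Y) = g * coef_F Q Y"
  by (simp_all add: coef_H_def coef_E_def coef_F_def algebra_simps)

lemma rational_connection_par: "rational_connection (par_connection Q)"
  unfolding rational_connection_def
proof (intro conjI allI)
  fix f X Y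
  show "par_connection Q X (f *s Y) = vf_apply X f *s Y + f *s par_connection Q X Y"
    by (subst arg_cong[OF par_expand[of Y Q], of "\<lambda>Z. vf_apply X f *s Z"])
      (simp add: par_connection_def vf_apply_simps coef_simps vec_eq_iff algebra_simps)
qed (simp_all add: par_connection_def vf_apply_simps coef_simps vec_eq_iff algebra_simps)

lemma associated_connection_par: "associated_connection (par Q) (par_connection Q)"
proof -
  have 1: "ratY * (inv_Y * f) = f" "inv_Y * (ratY * f) = f" for f
    using ratY_inv_Y by (simp_all flip: mult.assoc) (simp add: mult.commute)
  have "coef_H (par Q A) = const_ratfun (A $ 1 $ 1)" "coef_E (par Q A) = const_ratfun (A $ 1 $ 2)"
    "coef_F Q (par Q A) = const_ratfun (A $ 2 $ 1)" for A
    by (simp_all add: coef_H_def coef_E_def coef_F_def par_nth algebra_simps power2_eq_square power3_eq_cube 1 ratY_inv_Y)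
  then show ?thesis
    by (simp add: associated_connection_def rational_connection_par par_connection_def vf_apply_def)
qed

section \<open>The regular locus and the Christoffel symbols of the reciprocal connection\<close>

lemma polyfun_power: "f \<in> polyfun C \<Longrightarrow> (\<lambda>x. f x ^ n) \<in> polyfun C"
  by (induction n) (auto intro: polyfun.const[of 1] polyfun.mult)

lemma polyfun_poly: "f \<in> polyfun C \<Longrightarrow> (\<lambda>x. poly p (f x)) \<in> polyfun C"
  by (induction p) (auto intro: polyfun.const polyfun.mult polyfun.add)

lemma polyfun_minus: "f \<in> polyfun C \<Longrightarrow> (\<lambda>x. - f x) \<in> polyfun C"
  using polyfun.mult[OF polyfun.const[of "-1"], of f] by simp

lemma polyfun_diff: "f \<in> polyfun C \<Longrightarrow> g \<in> polyfun C \<Longrightarrow> (\<lambda>x. f x - g x) \<in> polyfun C"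
  using polyfun.add[OF _ polyfun_minus[of g]] by simp

lemmas polyfun_intros = polyfun.const polyfun.add polyfun.mult polyfun_power polyfun_poly
  polyfun_minus polyfun_diff

definition good_set :: "complex poly \<Rightarrow> (complex^3) set" where
  "good_set d = {p. poly d (p $ 1) \<noteq> 0 \<and> p $ 2 \<noteq> 0}"

lemma zariski_closed_good_set: "zariski_closed vec_coords (- good_set d)"
proof -
  have "(\<lambda>x::complex^3. poly d (x $ 1) * x $ 2) \<in> polyfun vec_coords"
    by (intro polyfun_intros polyfun.coord) (auto simp: vec_coords_def)
  then show ?thesis
    unfolding zariski_closed_def good_set_def
    by (intro exI[of _ "{\<lambda>x. poly d (x $ 1) * x $ 2}"]) auto
qed

lemma rational_parallelism_par:
  assumes "d \<noteq> 0"
  shows "rational_parallelism (par (ratX n / ratX d))"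
proof -
  define Q where "Q = ratX n / ratX d"
  have Q: "partial_deriv 2 Q = 0" "partial_deriv 3 Q = 0"
    by (simp_all add: Q_def partial_deriv_divide)
  have [simp]: "sl2_basis 1 $ 1 $ 1 = 1" "sl2_basis 1 $ 1 $ 2 = 0" "sl2_basis 1 $ 2 $ 1 = 0"
    "sl2_basis 2 $ 1 $ 1 = 0" "sl2_basis 2 $ 1 $ 2 = 1" "sl2_basis 2 $ 2 $ 1 = 0"
    "sl2_basis 3 $ 1 $ 1 = 0" "sl2_basis 3 $ 1 $ 2 = 0" "sl2_basis 3 $ 2 $ 1 = 1"
    by (simp_all add: sl2_basis_def)
  obtain c where c: "poly d c \<noteq> 0"
    using assms poly_all_0_iff_0 by blast
  have ne: "vector [c, 1, 0] \<in> good_set d"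
    using c by (simp add: good_set_def)
  have vals: "vf_regular_at (par Q A) x"
    "vf_at (par Q A) x = vector [A$1$2 * x$2^2, A$1$1 * x$2 - A$1$2 * x$3 * x$2^2,
       A$1$1 * x$3 - A$1$2 * (poly n (x$1) / poly d (x$1)) * x$2^3 + A$2$1 * inverse (x$2)]"
    if "x \<in> good_set d" for x A
  proof -
    have "has_value (par Q A $ 1) x (A$1$2 * x$2^2)"
      "has_value (par Q A $ 2) x (A$1$1 * x$2 - A$1$2 * x$3 * x$2^2)"
      "has_value (par Q A $ 3) x (A$1$1 * x$3 - A$1$2 * (poly n (x$1) / poly d (x$1)) * x$2^3 + A$2$1 * inverse (x$2))"
      using that unfolding par_nth Q_def good_set_def mem_Collect_eq
      by (intro has_value_intros has_value_coords has_value_inv_Y; simp)+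
    then show "vf_regular_at (par Q A) x"
      "vf_at (par Q A) x = vector [A$1$2 * x$2^2, A$1$1 * x$2 - A$1$2 * x$3 * x$2^2,
       A$1$1 * x$3 - A$1$2 * (poly n (x$1) / poly d (x$1)) * x$2^3 + A$2$1 * inverse (x$2)]"
      by (simp_all add: vf_regular_at_def vf_at_def vec_eq_iff forall_3 has_value_regular has_value_value_at)
  qed
  have "inj (\<lambda>i. vf_at (par Q (sl2_basis i)) x) \<and>
      vec.independent (range (\<lambda>i. vf_at (par Q (sl2_basis i)) x)) \<and>
      vec.span (range (\<lambda>i. vf_at (par Q (sl2_basis i)) x)) = UNIV" if x: "x \<in> good_set d" for x
  proof -
    \<comment> \<open>The three fields as rows; the determinant is \<open>- y^2\<close>, whatever
      the value of \<open>Q\<close>.\<close>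
    define R where "R = (\<chi> i. vf_at (par Q (sl2_basis i)) x)"
    have det: "det R \<noteq> 0"
      using x by (simp add: det_3 R_def vals good_set_def power2_eq_square)
    have rows: "rows R = range (\<lambda>i. vf_at (par Q (sl2_basis i)) x)"
      by (auto simp: rows_def row_def R_def vec_lambda_eta)
    have "inj (\<lambda>i. vf_at (par Q (sl2_basis i)) x)"
    proof (rule injI, rule ccontr)
      fix i j assume "vf_at (par Q (sl2_basis i)) x = vf_at (par Q (sl2_basis j)) x" "i \<noteq> j"
      then have "det R = 0"
        by (intro det_identical_rows[of i j]) (auto simp: row_def R_def vec_lambda_eta)
      with det show False by simp
    qed
    moreover have "vec.independent (rows R)"
      using det det_dependent_rows by blast
    moreover have "vec.span (rows R) = UNIV"
      using det matrix_left_invertible_span_rows_gen[of R] invertible_det_nz[of R] invertible_left_inverse[of R]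
      by (simp add: row_rank_def)
    ultimately show ?thesis by (simp add: rows)
  qed
  then show ?thesis
    unfolding rational_parallelism_def Q_def[symmetric]
    using par_bracket[OF Q] zariski_closed_good_set[of d] ne vals(1)
    by (auto simp: par_def vec_eq_iff scale_mat_def algebra_simps intro!: exI[of _ "good_set d"])
qed

text \<open>Numerical Christoffel form of the reciprocal connection at \<open>p\<close>. The
  rational function enters only through its value \<open>q\<close> and the value \<open>q'\<close>
  of its derivative at the first coordinate.\<close>

definition christ :: "complex \<Rightarrow> complex \<Rightarrow> complex^3 \<Rightarrow> complex^3 \<Rightarrow> complex^3 \<Rightarrow> complex^3" where
  "christ q q' p u v = vector [
     - 2 / p$2 * u$1 * v$2,
     u$1 * (p$3 / p$2 * v$2 + v$3) - u$2 * v$2 / p$2,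
     u$1 * (q' * p$2 * v$1 + (4 * q - (p$3 / p$2)^2) * v$2 - p$3 / p$2 * v$3)
       - u$2 * (p$3 / p$2^2 * v$2 + v$3 / p$2) + u$3 * v$2 / p$2]"

lemma reciprocal_par:
  fixes n d :: "complex poly" and p u v :: "complex^3"
  assumes "p \<in> good_set d"
  defines "q \<equiv> poly n (p$1) / poly d (p$1)"
    and "q' \<equiv> (poly (pderiv n) (p$1) * poly d (p$1) - poly n (p$1) * poly (pderiv d) (p$1)) / (poly d (p$1))^2"
  shows "connection_regular_at (reciprocal (par_connection (ratX n / ratX d))) p" (is ?reg)
    and "christoffel (reciprocal (par_connection (ratX n / ratX d))) p u v = christ q q' p u v" (is ?chr)
proof -
  define Q where "Q = ratX n / ratX d"
  have Q: "partial_deriv 2 Q = 0" "partial_deriv 3 Q = 0"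
    by (simp_all add: Q_def partial_deriv_divide)
  \<comment> \<open>On coordinate fields the bracket term vanishes, so the reciprocal connection is
    the original one with its arguments exchanged.\<close>
  have br: "vf_bracket (axis i 1) (axis j 1) = 0" for i j :: 3
  proof -
    have "partial_deriv k (axis i (1::ratfun) $ l) = 0" for i k l :: 3
      by (simp add: axis_def)
    then show ?thesis by (simp add: vf_bracket_def vf_apply_def vec_eq_iff)
  qed
  have ap: "vf_apply (axis i 1) f = partial_deriv i f" for i f
  proof -
    have "vf_apply (axis i 1) f = (\<Sum>k\<in>UNIV. if k = i then partial_deriv k f else 0)"
      unfolding vf_apply_def by (rule sum.cong) (auto simp: axis_def)
    then show ?thesis by simp
  qed
  have Y: "p$2 \<noteq> 0" "poly d (p$1) \<noteq> 0" using assms(1) by (auto simp: good_set_def)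
  have cH: "coef_H (axis 1 1) = ratZ * inv_Y" "coef_H (axis 2 1) = inv_Y" "coef_H (axis 3 1) = 0"
    and cE: "coef_E (axis 1 1) = inv_Y ^ 2" "coef_E (axis 2 1) = 0" "coef_E (axis 3 1) = 0"
    and cF: "coef_F Q (axis 1 1) = Q * ratY ^ 2 - ratZ ^ 2" "coef_F Q (axis 2 1) = - ratZ" "coef_F Q (axis 3 1) = ratY"
    by (simp_all add: coef_H_def coef_E_def coef_F_def axis_def)
  have hQ: "has_value Q p q" unfolding Q_def q_def
    by (intro has_value_intros has_value_coords Y)
  have hQ': "has_value (partial_deriv 1 Q) p q'"
  proof -
    have "has_value (partial_deriv 1 Q) p (poly (pderiv n) (p$1) / poly d (p$1)
        - poly n (p$1) * poly (pderiv d) (p$1) / (poly d (p$1) * poly d (p$1)))"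
      unfolding Q_def partial_deriv_divide partial_deriv_coords
      by (intro has_value_intros has_value_coords) (use Y in auto)
    then show ?thesis using Y by (simp add: q'_def field_simps power2_eq_square)
  qed
  have ext: "has_value f p v \<Longrightarrow> v = w \<Longrightarrow> has_value f p w" for f v w by simp
  note hv = has_value_intros hQ hQ' has_value_coords has_value_inv_Y[OF Y(1)]
  have "\<forall>i j k. has_value (reciprocal (par_connection Q) (axis i 1) (axis j 1) $ k) p (christ q q' p (axis i 1) (axis j 1) $ k)"
    unfolding forall_3 reciprocal_def br par_connection_def ap cH cE cF par_defs
      partial_deriv_simps partial_deriv_coords partial_deriv_inv_Y Q partial_deriv_0 partial_deriv_1
    using Y
    by (intro conjI; simp only: vector_add_component vector_smult_component zero_index vector_3 add_0_right)
       (rule ext, (rule hv)+, simp add: christ_def axis_def field_simps power2_eq_square power3_eq_cube)+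
  then have hv: "has_value (reciprocal (par_connection Q) (axis i 1) (axis j 1) $ k) p
      (christ q q' p (axis i 1) (axis j 1) $ k)" for i j k
    by blast
  then show ?reg
    unfolding connection_regular_at_def vf_regular_at_def Q_def[symmetric]
    using has_value_regular by blast
  have va: "vf_at (reciprocal (par_connection Q) (axis i 1) (axis j 1)) p = christ q q' p (axis i 1) (axis j 1)" for i j
    using hv by (simp add: vf_at_def vec_eq_iff has_value_value_at)
  show ?chr
    unfolding vec_eq_iff forall_3 christoffel_def Q_def[symmetric] va sum_3
    by (simp add: christ_def axis_def algebra_simps add_divide_distrib diff_divide_distrib)
qed

section \<open>Algebraic subgroups of the special linear group\<close>

definition mat2 :: "complex \<Rightarrow> complex \<Rightarrow> complex \<Rightarrow> complex \<Rightarrow> complex^2^2" where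
  "mat2 a b c d = vector [vector [a, b], vector [c, d]]"

lemma mat2_nth [simp]:
  "mat2 a b c d $ 1 $ 1 = a" "mat2 a b c d $ 1 $ 2 = b" "mat2 a b c d $ 2 $ 1 = c" "mat2 a b c d $ 2 $ 2 = d"
  by (simp_all add: mat2_def)

lemma mat2_eq_iff [simp]: "mat2 a b c d = mat2 a' b' c' d' \<longleftrightarrow> a = a' \<and> b = b' \<and> c = c' \<and> d = d'"
  by (auto simp: vec_eq_iff forall_2)

lemma mat2_eqI:
  "A $ 1 $ 1 = B $ 1 $ 1 \<Longrightarrow> A $ 1 $ 2 = B $ 1 $ 2 \<Longrightarrow> A $ 2 $ 1 = B $ 2 $ 1 \<Longrightarrow> A $ 2 $ 2 = B $ 2 $ 2 \<Longrightarrow> A = B"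
  for A B :: "complex^2^2"
  by (simp add: vec_eq_iff forall_2)

lemma mat2_collapse: "mat2 (A $ 1 $ 1) (A $ 1 $ 2) (A $ 2 $ 1) (A $ 2 $ 2) = A"
  by (rule mat2_eqI) simp_all

lemma mat2_cases: obtains a b c d where "A = mat2 a b c d"
  using mat2_collapse[of A] by metis

lemma mat2_mult [simp]:
  "mat2 a b c d ** mat2 a' b' c' d' = mat2 (a*a' + b*c') (a*b' + b*d') (c*a' + d*c') (c*b' + d*d')"
  by (rule mat2_eqI) (simp_all add: matrix_matrix_mult_def sum_2)

lemma det_mat2 [simp]: "det (mat2 a b c d) = a * d - b * c"
  by (simp add: det_2)

lemma mat_1_mat2: "mat 1 = mat2 1 0 0 1"
  by (rule mat2_eqI) (simp_all add: mat_def)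

lemma minus_mat2 [simp]: "- mat2 a b c d = mat2 (-a) (-b) (-c) (-d)"
  by (rule mat2_eqI) simp_all

text \<open>The adjugate serves as inverse on determinant 1. Being linear in the entries, it keeps
  inversion and conjugation inside polynomial maps.\<close>

definition adj2 :: "complex^2^2 \<Rightarrow> complex^2^2" where
  "adj2 A = mat2 (A $ 2 $ 2) (- A $ 1 $ 2) (- A $ 2 $ 1) (A $ 1 $ 1)"

lemma adj2_mat2 [simp]: "adj2 (mat2 a b c d) = mat2 d (-b) (-c) a"
  by (simp add: adj2_def)

lemma det_adj2 [simp]: "det (adj2 A) = det A"
  by (cases A rule: mat2_cases) simp

lemma adj2_adj2 [simp]: "adj2 (adj2 A) = A"
  by (cases A rule: mat2_cases) simp

lemma adj2_mult: "adj2 (A ** B) = adj2 B ** adj2 A"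
  by (cases A rule: mat2_cases; cases B rule: mat2_cases) (simp add: algebra_simps)

lemma mult_adj2: "det A = 1 \<Longrightarrow> A ** adj2 A = mat 1" "det A = 1 \<Longrightarrow> adj2 A ** A = mat 1"
  by (cases A rule: mat2_cases; simp add: mat_1_mat2 algebra_simps)+

lemma mult_adj2_cancel:
  assumes "det A = 1"
  shows "A ** (adj2 A ** B) = B" "adj2 A ** (A ** B) = B" "B ** A ** adj2 A = B" "B ** adj2 A ** A = B"
  by (simp_all add: matrix_mul_assoc mult_adj2[OF assms]) (simp_all add: mult_adj2[OF assms] flip: matrix_mul_assoc)

definition conj2 :: "complex^2^2 \<Rightarrow> complex^2^2 \<Rightarrow> complex^2^2" where
  "conj2 h A = h ** A ** adj2 h"

lemma conj2_mult: "det h = 1 \<Longrightarrow> conj2 h (A ** B) = conj2 h A ** conj2 h B"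
  by (simp add: conj2_def matrix_mul_assoc mult_adj2_cancel)

lemma conj2_adj2: "conj2 h (adj2 A) = adj2 (conj2 h A)"
  by (simp add: conj2_def adj2_mult matrix_mul_assoc)

lemma conj2_conj2: "conj2 g (conj2 h A) = conj2 (g ** h) A"
  by (simp add: conj2_def adj2_mult matrix_mul_assoc)

lemma conj2_inverse: "det h = 1 \<Longrightarrow> conj2 (adj2 h) (conj2 h A) = A" "det h = 1 \<Longrightarrow> conj2 h (conj2 (adj2 h) A) = A"
  by (simp_all add: conj2_def matrix_mul_assoc mult_adj2 mult_adj2_cancel)

lemma det_conj2: "det h = 1 \<Longrightarrow> det (conj2 h A) = det A"
  by (simp add: conj2_def det_mul)

lemma conj2_1: "det h = 1 \<Longrightarrow> conj2 h (mat 1) = mat 1" "det h = 1 \<Longrightarrow> conj2 h (- mat 1) = - mat 1"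
  by (cases h rule: mat2_cases; simp add: conj2_def mat_1_mat2 algebra_simps)+

lemma trace_conj2: "det h = 1 \<Longrightarrow> trace (conj2 h A) = trace A"
proof -
  assume h: "det h = 1"
  have "trace (conj2 h A) = trace (adj2 h ** (h ** A))"
    unfolding conj2_def by (rule trace_mul_sym)
  with h show ?thesis by (simp add: mult_adj2_cancel)
qed

lemma trace_mat2 [simp]: "trace (mat2 a b c d) = a + d"
  by (simp add: trace_def sum_2)

text \<open>Containing \<open>- mat 1\<close> singles out the preimages of the closed subgroups of
  \<open>PSL2\<close>; sign changes are then always available.\<close>

definition alg_group :: "(complex^2^2) set \<Rightarrow> bool" where
  "alg_group G \<longleftrightarrow> G \<subseteq> {A. det A = 1} \<and> mat 1 \<in> G \<and> - mat 1 \<in> G \<and>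
     (\<forall>A\<in>G. \<forall>B\<in>G. A ** B \<in> G) \<and> (\<forall>A\<in>G. adj2 A \<in> G) \<and> zariski_closed mat_coords G"

lemma alg_groupD:
  assumes "alg_group G"
  shows "A \<in> G \<Longrightarrow> det A = 1" "mat 1 \<in> G" "- mat 1 \<in> G" "A \<in> G \<Longrightarrow> B \<in> G \<Longrightarrow> A ** B \<in> G"
    "A \<in> G \<Longrightarrow> adj2 A \<in> G" "zariski_closed mat_coords G"
  using assms by (auto simp: alg_group_def)

lemma polyfun_comp:
  assumes "f \<in> polyfun C" "\<And>c. c \<in> C \<Longrightarrow> (\<lambda>x. c (\<phi> x)) \<in> polyfun C'"
  shows "(\<lambda>x. f (\<phi> x)) \<in> polyfun C'"
  using assms(1) by induction (auto intro: polyfun.intros assms(2))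

lemma zariski_closed_vimage:
  assumes "zariski_closed C Z" "\<And>c. c \<in> C \<Longrightarrow> (\<lambda>x. c (\<phi> x)) \<in> polyfun C'"
  shows "zariski_closed C' {x. \<phi> x \<in> Z}"
proof -
  obtain P where P: "P \<subseteq> polyfun C" "Z = {x. \<forall>f\<in>P. f x = 0}"
    using assms(1) by (auto simp: zariski_closed_def)
  define P' where "P' = (\<lambda>f x. f (\<phi> x)) ` P"
  have "P' \<subseteq> polyfun C'"
    unfolding P'_def
  proof (rule image_subsetI)
    fix f assume "f \<in> P"
    then have "f \<in> polyfun C" using P by blast
    from polyfun_comp[OF this assms(2)] show "(\<lambda>x. f (\<phi> x)) \<in> polyfun C'" .
  qed
  moreover have "{x. \<phi> x \<in> Z} = {x. \<forall>f\<in>P'. f x = 0}"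
    by (simp add: P'_def P)
  ultimately show ?thesis
    unfolding zariski_closed_def by blast
qed

lemma polyfun_mat_coords: "(\<lambda>A. A $ i $ j) \<in> polyfun mat_coords"
  by (rule polyfun.coord) (auto simp: mat_coords_def)

lemma polyfun_mat_mult:
  fixes M N :: "'a \<Rightarrow> complex^2^2"
  assumes "\<And>i j. (\<lambda>x. M x $ i $ j) \<in> polyfun C" "\<And>i j. (\<lambda>x. N x $ i $ j) \<in> polyfun C"
  shows "(\<lambda>x. (M x ** N x) $ i $ j) \<in> polyfun C"
  unfolding matrix_matrix_mult_def vec_lambda_beta sum_2
  by (intro polyfun_intros assms)

lemma alg_group_conj:
  assumes "alg_group G" "det h = 1"
  shows "alg_group (conj2 h ` G)"
proof -
  have eq: "conj2 h ` G = {A. conj2 (adj2 h) A \<in> G}"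
    using assms(2) by (force simp: conj2_inverse)
  have "(\<lambda>x. c (conj2 (adj2 h) x)) \<in> polyfun mat_coords" if cm: "c \<in> mat_coords" for c
  proof -
    obtain i j where "c = (\<lambda>A. A $ i $ j)" using cm unfolding mat_coords_def by blast
    then show ?thesis
      unfolding conj2_def by (simp only:) (intro polyfun_mat_mult polyfun_mat_coords polyfun.const)
  qed
  then have "zariski_closed mat_coords (conj2 h ` G)"
    unfolding eq using alg_groupD(6)[OF assms(1)] by (rule zariski_closed_vimage[rotated])
  moreover have "mat 1 \<in> conj2 h ` G" "- mat 1 \<in> conj2 h ` G"
    using imageI[OF alg_groupD(2)[OF assms(1)], of "conj2 h"] imageI[OF alg_groupD(3)[OF assms(1)], of "conj2 h"]
    by (simp_all add: conj2_1 assms(2))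
  moreover have "A ** B \<in> conj2 h ` G" if AB: "A \<in> conj2 h ` G" "B \<in> conj2 h ` G" for A B
  proof -
    obtain A' B' where "A = conj2 h A'" "B = conj2 h B'" "A' \<in> G" "B' \<in> G" using AB by blast
    then show ?thesis
      using alg_groupD(4)[OF assms(1)] by (simp flip: conj2_mult[OF assms(2)])
  qed
  moreover have "adj2 A \<in> conj2 h ` G" if AB: "A \<in> conj2 h ` G" for A
  proof -
    obtain A' where "A = conj2 h A'" "A' \<in> G" using AB by blast
    then show ?thesis
      using alg_groupD(5)[OF assms(1)] by (simp flip: conj2_adj2)
  qed
  ultimately show ?thesis
    using det_conj2[OF assms(2)] alg_groupD(1)[OF assms(1)] by (auto simp: alg_group_def)
qed

text \<open>Regular functions on the punctured line. Nothing is required at \<open>t = 0\<close>,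
  where \<open>1 / t\<close> has its default value 0.\<close>

definition laurent :: "(complex \<Rightarrow> complex) \<Rightarrow> bool" where
  "laurent h \<longleftrightarrow> (\<exists>p k. \<forall>t. t \<noteq> 0 \<longrightarrow> h t * t ^ k = poly p t)"

lemma laurent_const: "laurent (\<lambda>t. c)"
  unfolding laurent_def by (rule exI[of _ "[:c:]"], rule exI[of _ 0]) simp

lemma laurent_id: "laurent (\<lambda>t. t)"
  unfolding laurent_def by (rule exI[of _ "[:0, 1:]"], rule exI[of _ 0]) simp

lemma laurent_inverse: "laurent (\<lambda>t. 1 / t)"
  unfolding laurent_def by (rule exI[of _ "[:1:]"], rule exI[of _ 1]) simp

lemma laurent_add:
  assumes "laurent f" "laurent g" shows "laurent (\<lambda>t. f t + g t)"
proof -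
  obtain p k p' k' where *: "\<And>t. t \<noteq> 0 \<Longrightarrow> f t * t ^ k = poly p t" "\<And>t. t \<noteq> 0 \<Longrightarrow> g t * t ^ k' = poly p' t"
    using assms unfolding laurent_def by metis
  have "(f t + g t) * t ^ (k + k') = poly (p * monom 1 k' + p' * monom 1 k) t" if "t \<noteq> 0" for t
    by (simp add: poly_monom power_add algebra_simps *[OF that, symmetric])
  then show ?thesis unfolding laurent_def by blast
qed

lemma laurent_mult:
  assumes "laurent f" "laurent g" shows "laurent (\<lambda>t. f t * g t)"
proof -
  obtain p k p' k' where *: "\<And>t. t \<noteq> 0 \<Longrightarrow> f t * t ^ k = poly p t" "\<And>t. t \<noteq> 0 \<Longrightarrow> g t * t ^ k' = poly p' t"
    using assms unfolding laurent_def by metis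
  have "(f t * g t) * t ^ (k + k') = poly (p * p') t" if "t \<noteq> 0" for t
    by (simp add: power_add algebra_simps *[OF that, symmetric])
  then show ?thesis unfolding laurent_def by blast
qed

lemmas laurent_intros = laurent_const laurent_id laurent_inverse laurent_add laurent_mult

lemma laurent_mat_mult:
  fixes M N :: "complex \<Rightarrow> complex^2^2"
  assumes "\<And>i j. laurent (\<lambda>x. M x $ i $ j)" "\<And>i j. laurent (\<lambda>x. N x $ i $ j)"
  shows "laurent (\<lambda>x. (M x ** N x) $ i $ j)"
  unfolding matrix_matrix_mult_def vec_lambda_beta sum_2
  by (intro laurent_intros assms)

lemma laurent_mat2:
  assumes "laurent a" "laurent b" "laurent c" "laurent d"
  shows "laurent (\<lambda>t. mat2 (a t) (b t) (c t) (d t) $ i $ j)"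
  using assms exhaust_2[of i] exhaust_2[of j] by auto

text \<open>An equation of \<open>Z\<close> pulled back to the curve is, up to a power of
  \<open>t\<close>, a polynomial in \<open>t\<close>; infinitely many zeros kill it. This turns the
  powers of one matrix into a whole one-parameter group.\<close>

lemma zariski_curve:
  assumes "zariski_closed mat_coords Z" "\<And>i j. laurent (\<lambda>t. M t $ i $ j)"
    "infinite {t. t \<noteq> 0 \<and> M t \<in> Z}" "t \<noteq> 0"
  shows "M t \<in> Z"
proof -
  obtain P where P: "P \<subseteq> polyfun mat_coords" "Z = {x. \<forall>f\<in>P. f x = 0}"
    using assms(1) by (auto simp: zariski_closed_def)
  have "f (M t) = 0" if "f \<in> P" for f
  proof -
    have "f \<in> polyfun mat_coords" using that P by blast
    then have "laurent (\<lambda>t. f (M t))"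
      by induction (auto simp: mat_coords_def intro: laurent_intros assms(2))
    then obtain p k where p: "\<And>t. t \<noteq> 0 \<Longrightarrow> f (M t) * t ^ k = poly p t"
      unfolding laurent_def by blast
    have "{t. t \<noteq> 0 \<and> M t \<in> Z} \<subseteq> {t. poly p t = 0}"
      using p P(2) that by force
    then have "p = 0" using assms(3) poly_roots_finite finite_subset by blast
    then show ?thesis using p[OF assms(4)] assms(4) by simp
  qed
  then show ?thesis using P(2) by blast
qed

primrec matpow :: "complex^2^2 \<Rightarrow> nat \<Rightarrow> complex^2^2" where
  "matpow A 0 = mat 1"
| "matpow A (Suc n) = A ** matpow A n"

lemma matpow_in: "alg_group G \<Longrightarrow> A \<in> G \<Longrightarrow> matpow A n \<in> G"
  by (induction n) (auto simp: alg_groupD)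

lemma matpow_diag: "matpow (mat2 a 0 0 d) n = mat2 (a ^ n) 0 0 (d ^ n)"
  by (induction n) (simp_all add: mat_1_mat2)

lemma matpow_unipotent: "matpow (mat2 1 u 0 1) n = mat2 1 (of_nat n * u) 0 1"
  by (induction n) (simp_all add: mat_1_mat2 algebra_simps)

lemma matpow_conj2: "det h = 1 \<Longrightarrow> conj2 h (matpow A n) = matpow (conj2 h A) n"
  by (induction n) (simp_all add: conj2_1 conj2_mult)

definition contains_T :: "(complex^2^2) set \<Rightarrow> bool" where
  "contains_T G \<longleftrightarrow> (\<forall>t. t \<noteq> 0 \<longrightarrow> mat2 t 0 0 (1 / t) \<in> G)"

definition contains_U :: "(complex^2^2) set \<Rightarrow> bool" where
  "contains_U G \<longleftrightarrow> (\<forall>u. mat2 1 u 0 1 \<in> G)"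

lemma infinite_powers:
  fixes l :: complex
  assumes "l \<noteq> 0" "\<And>k. k \<ge> 1 \<Longrightarrow> l ^ k \<noteq> 1"
  shows "infinite (range (\<lambda>k::nat. l ^ k))"
proof -
  have "inj (\<lambda>k::nat. l ^ k)"
  proof (rule linorder_injI)
    fix j k :: nat assume "j < k"
    then have "l ^ k = l ^ j * l ^ (k - j)" by (simp flip: power_add)
    then show "l ^ j \<noteq> l ^ k" using assms(2)[of "k - j"] \<open>j < k\<close> assms(1) by auto
  qed
  then show ?thesis using range_inj_infinite by blast
qed

lemma infinite_torus:
  assumes "zariski_closed mat_coords G" "infinite {t. t \<noteq> 0 \<and> mat2 t 0 0 (1 / t) \<in> G}"
  shows "contains_T G"
  unfolding contains_T_def
  using zariski_curve[OF assms(1) laurent_mat2[OF laurent_id laurent_const laurent_const laurent_inverse] assms(2)]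
  by blast

lemma contains_T_powers:
  assumes "alg_group G" "mat2 l 0 0 (1 / l) \<in> G" "l \<noteq> 0" "\<And>k. k \<ge> 1 \<Longrightarrow> l ^ k \<noteq> 1"
  shows "contains_T G"
proof (rule infinite_torus[OF alg_groupD(6)[OF assms(1)]])
  have "range (\<lambda>k::nat. l ^ k) \<subseteq> {t. t \<noteq> 0 \<and> mat2 t 0 0 (1 / t) \<in> G}"
    using matpow_in[OF assms(1,2)] assms(3) by (auto simp: matpow_diag power_divide)
  then show "infinite {t. t \<noteq> 0 \<and> mat2 t 0 0 (1 / t) \<in> G}"
    using infinite_powers[OF assms(3,4)] finite_subset by blast
qed

lemma contains_U_unipotent:
  assumes "alg_group G" "mat2 1 u 0 1 \<in> G" "u \<noteq> 0"
  shows "contains_U G"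
proof -
  \<comment> \<open>Multiples are counted from 1, since \<open>zariski_curve\<close> disregards the
    parameter 0.\<close>
  have "range (\<lambda>k::nat. of_nat (Suc k) * u) \<subseteq> {t. t \<noteq> 0 \<and> mat2 1 t 0 1 \<in> G}"
  proof (rule image_subsetI)
    fix k
    have "mat2 1 (of_nat (Suc k) * u) 0 1 \<in> G"
      using matpow_in[OF assms(1,2), of "Suc k"] unfolding matpow_unipotent .
    moreover have "of_nat (Suc k) * u \<noteq> 0"
      using assms(3) of_nat_neq_0 by (metis mult_eq_0_iff)
    ultimately show "of_nat (Suc k) * u \<in> {t. t \<noteq> 0 \<and> mat2 1 t 0 1 \<in> G}" by blast
  qed
  moreover have "infinite (range (\<lambda>k::nat. of_nat (Suc k) * u))"
    using assms(3) by (intro range_inj_infinite injI) simp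
  ultimately have "infinite {t. t \<noteq> 0 \<and> mat2 1 t 0 1 \<in> G}"
    using finite_subset by blast
  then have "mat2 1 t 0 1 \<in> G" if "t \<noteq> 0" for t
    using zariski_curve[OF alg_groupD(6)[OF assms(1)] laurent_mat2[OF laurent_const laurent_id laurent_const laurent_const]]
      that by blast
  then show ?thesis
    unfolding contains_U_def using alg_groupD(2)[OF assms(1)] unfolding mat_1_mat2 by metis
qed

lemma conj2_triangular:
  assumes "det A = 1" shows "\<exists>h. det h = 1 \<and> conj2 h A $ 2 $ 1 = 0"
proof -
  obtain a b c d where A: "A = mat2 a b c d" by (rule mat2_cases)
  show ?thesis
  proof (cases "c = 0")
    case True
    then show ?thesis
      by (intro exI[of _ "mat 1"]) (simp add: A mat_1_mat2 conj2_def)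
  next
    case False
    \<comment> \<open>A root of the characteristic polynomial
      \<open>l^2 - (a + d) l + 1\<close>.\<close>
    define l where "l = ((a + d) + csqrt ((a + d)^2 - 4)) / 2"
    have "2 * l - (a + d) = csqrt ((a + d)^2 - 4)" by (simp add: l_def field_simps)
    then have "(2 * l - (a + d))^2 = (a + d)^2 - 4" by simp
    then have "4 * (l^2 - (a + d) * l + 1) = 0" by (simp add: power2_eq_square algebra_simps)
    then have l: "l^2 - (a + d) * l + 1 = 0" by (simp only: mult_eq_0_iff) simp
    have ad: "a * d - b * c = 1" using assms by (simp add: A)
    have 0: "c * (l * a - l * l + d * l + b * c - a * d) = 0" using l ad by algebra
    \<comment> \<open>The second row \<open>(- c, l - d)\<close> of the witness is a left
      eigenvector of \<open>A\<close> for the eigenvalue \<open>a + d - l\<close>, which clears the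
      lower left entry of the conjugate.\<close>
    show ?thesis
      using False 0 by (intro exI[of _ "mat2 0 (1 / c) (- c) (l - d)"])
        (simp add: A conj2_def field_simps)
  qed
qed

lemma conj2_normal_form:
  assumes "det A = 1"
  shows "(\<exists>h l. det h = 1 \<and> l \<noteq> 0 \<and> l^2 \<noteq> 1 \<and> conj2 h A = mat2 l 0 0 (1 / l)) \<or>
    (\<exists>h e u. det h = 1 \<and> e^2 = 1 \<and> conj2 h A = mat2 e u 0 e)"
proof -
  obtain h where h: "det h = 1" "conj2 h A $ 2 $ 1 = 0" using conj2_triangular[OF assms] by blast
  obtain a b c d where B: "conj2 h A = mat2 a b c d" by (rule mat2_cases)
  have c: "c = 0" using h B by simp
  have ad: "a * d = 1" using assms det_conj2[OF h(1), of A] by (simp add: B c)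
  then have "a \<noteq> 0" by auto
  with ad have d: "d = 1 / a" "a \<noteq> 0" by (simp_all add: eq_divide_eq mult.commute)
  show ?thesis
  proof (cases "a = d")
    case True
    then have "conj2 h A = mat2 a b 0 a" "a^2 = 1" using B c ad by (simp_all add: power2_eq_square)
    then show ?thesis using h by blast
  next
    case False
    define g where "g = mat2 1 (b / (a - d)) 0 1"
    have "conj2 (g ** h) A = conj2 g (mat2 a b 0 d)" by (simp only: conj2_conj2[symmetric] B c)
    also have "\<dots> = mat2 a 0 0 d"
      using False by (simp add: g_def conj2_def field_simps)
    finally have "conj2 (g ** h) A = mat2 a 0 0 d" .
    moreover have "det (g ** h) = 1" using h by (simp add: det_mul g_def)
    moreover have "a^2 \<noteq> 1" using False d by (auto simp: power2_eq_square field_simps)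
    ultimately show ?thesis using d by blast
  qed
qed

section \<open>Algebraic groups without tori and unipotent subgroups are finite\<close>

lemma polyfun_mat_continuous: "f \<in> polyfun mat_coords \<Longrightarrow> continuous_on UNIV f"
  by (induction rule: polyfun.induct) (auto simp: mat_coords_def intro!: continuous_intros)

lemma zariski_closed_imp_closed:
  fixes Z :: "(complex^'n^'m) set"
  assumes "zariski_closed mat_coords Z" shows "closed Z"
proof -
  obtain P where P: "P \<subseteq> polyfun mat_coords" "Z = {x. \<forall>f\<in>P. f x = 0}"
    using assms by (auto simp: zariski_closed_def)
  have "Z = (\<Inter>f\<in>P. {x. f x = 0})" using P(2) by auto
  moreover have "closed {x. f x = 0}" if "f \<in> P" for f
    using polyfun_mat_continuous[of f] that P(1) by (intro closed_Collect_eq) auto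
  ultimately show ?thesis by auto
qed

text \<open>Despite the name, tori are excluded as well. All conjugates are considered because
  \<open>contains_T\<close> and \<open>contains_U\<close> speak of one fixed torus and one fixed
  unipotent group.\<close>

definition unipotent_free :: "(complex^2^2) set \<Rightarrow> bool" where
  "unipotent_free G \<longleftrightarrow> (\<forall>h. det h = 1 \<longrightarrow> \<not> contains_T (conj2 h ` G) \<and> \<not> contains_U (conj2 h ` G))"

lemma unipotent_free_conj:
  assumes "unipotent_free G" "det h = 1" shows "unipotent_free (conj2 h ` G)"
proof -
  have "conj2 g ` conj2 h ` G = conj2 (g ** h) ` G" for g
    by (simp add: image_image conj2_conj2)
  then show ?thesis using assms by (simp add: unipotent_free_def det_mul)
qed

lemma unipotent_freeD:
  assumes "unipotent_free G"
  shows "\<not> contains_T G" "\<not> contains_U G"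
proof -
  have "conj2 (mat 1) A = A" for A
    by (cases A rule: mat2_cases) (simp add: conj2_def mat_1_mat2)
  then have "conj2 (mat 1) ` G = G" by simp
  then show "\<not> contains_T G" "\<not> contains_U G"
    using assms[unfolded unipotent_free_def, rule_format, of "mat 1"] by simp_all
qed

text \<open>An eigenvalue must be a root of unity, otherwise its powers fill a torus by
  \<open>contains_T_powers\<close>; a nontrivial Jordan block has a nontrivial unipotent square,
  which would generate a unipotent subgroup.\<close>

lemma unipotent_free_cases:
  assumes G: "alg_group G" "unipotent_free G" and A: "A \<in> G"
  shows "A = mat 1 \<or> A = - mat 1 \<or>
    (\<exists>h l. det h = 1 \<and> norm l = 1 \<and> l^2 \<noteq> 1 \<and> conj2 h A = mat2 l 0 0 (1 / l))"
  using conj2_normal_form[OF alg_groupD(1)[OF G(1) A]]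
proof (elim disjE exE conjE)
  fix h l assume *: "det h = 1" "l \<noteq> 0" "l^2 \<noteq> 1" "conj2 h A = mat2 l 0 0 (1 / l)"
  note G' = alg_group_conj[OF G(1) *(1)]
  have "mat2 l 0 0 (1 / l) \<in> conj2 h ` G" using A *(4) by (metis imageI)
  then obtain k where k: "k \<ge> 1" "l ^ k = 1"
    using contains_T_powers[OF G' _ *(2)] G(2) *(1) unfolding unipotent_free_def by blast
  then have "norm l ^ k = 1" by (metis norm_one norm_power)
  then have "norm l = 1"
    using k(1) power_eq_imp_eq_base[of "norm l" k 1] by simp
  then show ?thesis using * by blast
next
  fix h e u assume *: "det h = 1" "e^2 = 1" "conj2 h A = mat2 e u 0 e"
  note G' = alg_group_conj[OF G(1) *(1)]
  have m: "mat2 e u 0 e \<in> conj2 h ` G" using A *(3) by (metis imageI)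
  have "mat2 1 (2 * e * u) 0 1 \<in> conj2 h ` G"
    using alg_groupD(4)[OF G' m m] *(2) by (simp add: power2_eq_square algebra_simps)
  then have "2 * e * u = 0"
    using contains_U_unipotent[OF G'] G(2) *(1) unfolding unipotent_free_def by blast
  then have "u = 0" using *(2) by auto
  have e: "e = 1 \<or> e = -1" using *(2) by (simp add: power2_eq_1_iff)
  have "A = conj2 (adj2 h) (mat2 e 0 0 e)"
    using conj2_inverse(1)[OF *(1), of A] *(3) \<open>u = 0\<close> by simp
  moreover have "mat2 1 0 0 1 = mat 1" "mat2 (-1) 0 0 (-1) = - mat 1"
    by (simp_all add: mat_1_mat2)
  ultimately have "A = mat 1 \<or> A = - mat 1"
    using e conj2_1[of "adj2 h"] *(1) by auto
  then show ?thesis by blast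
qed

text \<open>Up to the central elements the trace is \<open>l + 1 / l\<close> with
  \<open>norm l = 1\<close>. This bound is the source of compactness, and violating it ends the
  argument below.\<close>

lemma unipotent_free_trace:
  assumes G: "alg_group G" "unipotent_free G" and A: "A \<in> G"
  shows "norm (A $ 1 $ 1 + A $ 2 $ 2) \<le> 2"
  using unipotent_free_cases[OF assms]
proof (elim disjE exE conjE)
  fix h l assume *: "det h = 1" "norm l = 1" "conj2 h A = mat2 l 0 0 (1 / l)"
  have "A $ 1 $ 1 + A $ 2 $ 2 = trace A" by (simp add: trace_def sum_2)
  also have "\<dots> = l + 1 / l" using trace_conj2[OF *(1), of A] *(3) by simp
  finally show ?thesis
    using norm_triangle_ineq[of l "1 / l"] *(2) by (simp add: norm_divide)
qed (simp_all add: mat_1_mat2)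

text \<open>If \<open>A\<close> has eigenvalues \<open>cis \<theta>\<close> and \<open>cis (-\<theta>)\<close>, its powers trace out a circle in the plane
  spanned by the identity and a traceless matrix \<open>J\<close>.\<close>

definition rot :: "complex \<Rightarrow> complex \<Rightarrow> complex^2^2 \<Rightarrow> complex^2^2" where
  "rot c s J = (\<chi> i j. c * mat 1 $ i $ j + s * J $ i $ j)"

lemma rot_mat2: "rot x y (mat2 p q r s) = mat2 (x + y * p) (y * q) (y * r) (x + y * s)"
  by (rule mat2_eqI) (simp_all add: rot_def mat_def)

lemma conj2_rot:
  assumes "det h = 1" shows "conj2 h (rot x y J) = rot x y (conj2 h J)"
proof -
  obtain a b c d where h: "h = mat2 a b c d" by (rule mat2_cases)
  obtain p q r s where J: "J = mat2 p q r s" by (rule mat2_cases)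
  have ad: "a * d - b * c = 1" using assms by (simp add: h)
  have x: "a * (d * x) = x + b * (c * x)" using ad by algebra
  show ?thesis
    unfolding h J conj2_def rot_mat2 adj2_mat2 mat2_mult mat2_eq_iff
    by (simp add: algebra_simps) (simp add: x algebra_simps)
qed

text \<open>\<open>J\<close> is a conjugate of the diagonal matrix with entries \<open>\<i>\<close>
  and \<open>- \<i>\<close>. Replacing \<open>J\<close> by \<open>- J\<close> if necessary puts the
  angle into the open interval from 0 to \<open>pi\<close>, so that \<open>arccos\<close> recovers
  it from the trace.\<close>

lemma unipotent_free_rot:
  assumes G: "alg_group G" "unipotent_free G" and A: "A \<in> G" "A \<noteq> mat 1" "A \<noteq> - mat 1"
  shows "\<exists>\<theta> J. 0 < \<theta> \<and> \<theta> < pi \<and> trace J = 0 \<and>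
    (\<forall>k. matpow A k = rot (of_real (cos (real k * \<theta>))) (of_real (sin (real k * \<theta>))) J)"
proof -
  obtain h l where *: "det h = 1" "norm l = 1" "l^2 \<noteq> 1" "conj2 h A = mat2 l 0 0 (1 / l)"
    using unipotent_free_cases[OF G A(1)] A(2,3) by blast
  define \<phi> where "\<phi> = Arg l"
  have l: "l = cis \<phi>" "\<phi> \<le> pi" "- pi < \<phi>"
  proof -
    have "l \<noteq> 0" using *(2) by auto
    then show "l = cis \<phi>" "\<phi> \<le> pi" "- pi < \<phi>"
      using *(2) cis_Arg[of l] Arg_bounded[of l] by (simp_all add: \<phi>_def sgn_eq)
  qed
  have ne: "\<phi> \<noteq> 0" "\<phi> \<noteq> pi" using *(3) by (auto simp: l(1))
  define J0 where "J0 = conj2 (adj2 h) (mat2 \<i> 0 0 (- \<i>))"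
  have tr: "trace J0 = 0" unfolding J0_def using trace_conj2[of "adj2 h"] *(1) by simp
  have pw: "matpow A k = rot (of_real (cos (real k * \<phi>))) (of_real (sin (real k * \<phi>))) J0" for k
  proof -
    have il: "1 / l = cis (- \<phi>)" by (simp add: l(1) cis_divide flip: cis_zero)
    have "conj2 h (matpow A k) = mat2 (cis (k * \<phi>)) 0 0 (cis (- (k * \<phi>)))"
      unfolding matpow_conj2[OF *(1)] *(4) matpow_diag il by (simp add: l(1) Complex.DeMoivre)
    then have "matpow A k = conj2 (adj2 h) (mat2 (cis (k * \<phi>)) 0 0 (cis (- (k * \<phi>))))"
      using conj2_inverse(1)[OF *(1)] by metis
    also have "mat2 (cis (k * \<phi>)) 0 0 (cis (- (k * \<phi>)))
        = rot (of_real (cos (real k * \<phi>))) (of_real (sin (real k * \<phi>))) (mat2 \<i> 0 0 (- \<i>))"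
      by (rule mat2_eqI) (simp_all add: rot_def mat_def complex_eq_iff)
    also have "conj2 (adj2 h) \<dots> = rot (of_real (cos (real k * \<phi>))) (of_real (sin (real k * \<phi>))) J0"
      unfolding J0_def using *(1) by (intro conj2_rot) simp
    finally show ?thesis .
  qed
  show ?thesis
  proof (cases "\<phi> > 0")
    case True
    then show ?thesis using l ne tr pw by (intro exI[of _ \<phi>] exI[of _ J0]) auto
  next
    case False
    have "trace (- J0) = 0" using tr by (simp add: trace_def sum_negf)
    moreover have "rot c s J0 = rot c (- s) (- J0)" for c s by (simp add: rot_def)
    ultimately show ?thesis
      using False l ne pw by (intro exI[of _ "- \<phi>"] exI[of _ "- J0"]) auto
  qed
qed

text \<open>Burnside's idea: traces are bounded by 2, and the traces of \<open>A\<close> and of the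
  diagonal element times \<open>A\<close> determine the diagonal of \<open>A\<close> linearly. The
  diagonals of \<open>A ** k1\<close> and \<open>A ** k2\<close> then control the two remaining
  entries.\<close>

lemma unipotent_free_bounded:
  assumes G: "alg_group G" "unipotent_free G"
    and g: "mat2 l 0 0 (1 / l) \<in> G" "l \<noteq> 0" "l^2 \<noteq> 1"
    and k: "k1 \<in> G" "k1 $ 1 $ 2 \<noteq> 0" "k2 \<in> G" "k2 $ 2 $ 1 \<noteq> 0"
  shows "\<exists>B\<ge>0. \<forall>A\<in>G. \<forall>i j. norm (A $ i $ j) \<le> B"
proof -
  have ll: "l - 1 / l \<noteq> 0" using g(2,3) by (simp add: field_simps power2_eq_square)
  define D where "D = (2 + 2 * norm l + 2 * norm (1 / l)) / norm (l - 1 / l)"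
  have diag: "norm (A $ 1 $ 1) \<le> D \<and> norm (A $ 2 $ 2) \<le> D" if A: "A \<in> G" for A
  proof -
    obtain a b c d where AA: "A = mat2 a b c d" by (rule mat2_cases)
    have t: "norm (a + d) \<le> 2" "norm (l * a + 1 / l * d) \<le> 2"
      using unipotent_free_trace[OF G A] unipotent_free_trace[OF G alg_groupD(4)[OF G(1) g(1) A]]
      by (simp_all add: AA)
    have "(l - 1 / l) * a = (l * a + 1 / l * d) - 1 / l * (a + d)"
      by (simp add: algebra_simps add_divide_distrib)
    then have "norm (l - 1 / l) * norm a \<le> norm (l * a + 1 / l * d) + norm (1 / l) * norm (a + d)"
      by (metis norm_mult norm_triangle_ineq4)
    also have "\<dots> \<le> 2 + norm (1 / l) * 2" by (intro add_mono t mult_left_mono) simp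
    also have "\<dots> \<le> 2 + 2 * norm l + 2 * norm (1 / l)" by simp
    finally have a: "norm a \<le> D" unfolding D_def using ll by (simp add: field_simps)
    have "(l - 1 / l) * d = l * (a + d) - (l * a + 1 / l * d)" by (simp add: algebra_simps)
    then have "norm (l - 1 / l) * norm d \<le> norm l * norm (a + d) + norm (l * a + 1 / l * d)"
      by (metis norm_mult norm_triangle_ineq4)
    also have "\<dots> \<le> norm l * 2 + 2" by (intro add_mono t mult_left_mono) simp
    also have "\<dots> \<le> 2 + 2 * norm l + 2 * norm (1 / l)" by simp
    finally have "norm d \<le> D" unfolding D_def using ll by (simp add: field_simps)
    with a show ?thesis by (simp add: AA)
  qed
  have D0: "D \<ge> 0" by (simp add: D_def)
  define E where "E = D + (D + D * norm (k1 $ 2 $ 2)) / norm (k1 $ 1 $ 2) + (D + D * norm (k2 $ 1 $ 1)) / norm (k2 $ 2 $ 1)"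
  have "norm (A $ i $ j) \<le> E" if A: "A \<in> G" for A i j
  proof -
    obtain a b c d where AA: "A = mat2 a b c d" by (rule mat2_cases)
    obtain p q r s where k1: "k1 = mat2 p q r s" by (rule mat2_cases)
    obtain p' q' r' s' where k2: "k2 = mat2 p' q' r' s'" by (rule mat2_cases)
    have ad: "norm a \<le> D" "norm d \<le> D" using diag[OF A] by (simp_all add: AA)
    have "norm (c * q + d * s) \<le> D"
      using diag[OF alg_groupD(4)[OF G(1) A k(1)]] by (simp add: AA k1)
    then have "norm (c * q) \<le> D + D * norm s"
      using norm_triangle_ineq4[of "c * q + d * s" "d * s"] mult_right_mono[OF ad(2), of "norm s"]
      by (simp add: norm_mult)
    then have c: "norm c \<le> (D + D * norm s) / norm q" using k(2) by (simp add: k1 norm_mult field_simps)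
    have "norm (a * p' + b * r') \<le> D"
      using diag[OF alg_groupD(4)[OF G(1) A k(3)]] by (simp add: AA k2)
    then have "norm (b * r') \<le> D + D * norm p'"
      using norm_triangle_ineq4[of "a * p' + b * r'" "a * p'"] mult_right_mono[OF ad(1), of "norm p'"]
      by (simp add: norm_mult)
    then have b: "norm b \<le> (D + D * norm p') / norm r'" using k(4) by (simp add: k2 norm_mult field_simps)
    have "0 \<le> (D + D * norm s) / norm q" "0 \<le> (D + D * norm p') / norm r'"
      using D0 by simp_all
    then have "norm a \<le> E" "norm b \<le> E" "norm c \<le> E" "norm d \<le> E"
      using ad b c D0 unfolding E_def k1 k2 mat2_nth by linarith+
    then show ?thesis using exhaust_2[of i] exhaust_2[of j] by (auto simp: AA)
  qed
  moreover have "E \<ge> 0" using D0 by (simp add: E_def)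
  ultimately show ?thesis by blast
qed

lemma norm_vec_le_sum: "norm x \<le> (\<Sum>i\<in>UNIV. norm (x $ i))"
  for x :: "('a::real_normed_vector) ^ 'n"
  unfolding norm_vec_def by (rule L2_set_le_sum) simp

lemma tendsto_mat_entries:
  fixes f :: "nat \<Rightarrow> complex^2^2"
  shows "f \<longlonglongrightarrow> l \<longleftrightarrow> (\<forall>i j. (\<lambda>n. f n $ i $ j) \<longlonglongrightarrow> l $ i $ j)"
proof
  assume "f \<longlonglongrightarrow> l"
  then show "\<forall>i j. (\<lambda>n. f n $ i $ j) \<longlonglongrightarrow> l $ i $ j"
    by (intro allI tendsto_vec_nth)
next
  assume "\<forall>i j. (\<lambda>n. f n $ i $ j) \<longlonglongrightarrow> l $ i $ j"
  then show "f \<longlonglongrightarrow> l"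
    by (intro vec_tendstoI) blast
qed

lemma tendsto_mat_mult:
  fixes f g :: "nat \<Rightarrow> complex^2^2"
  assumes "f \<longlonglongrightarrow> l" "g \<longlonglongrightarrow> m" shows "(\<lambda>n. f n ** g n) \<longlonglongrightarrow> l ** m"
  unfolding tendsto_mat_entries matrix_matrix_mult_def vec_lambda_beta
  by (intro allI tendsto_intros) (use assms in \<open>simp_all add: tendsto_mat_entries\<close>)

text \<open>An infinite compact group accumulates at the identity. Elements near it have small
  angles, so their powers become dense in a limit circle contained in the group. Zariski closedness
  adds the complexified circle, and there the trace exceeds 2.\<close>

lemma unipotent_free_compact_finite:
  assumes G: "alg_group G" "unipotent_free G" and B: "B \<ge> 0" "\<And>A i j. A \<in> G \<Longrightarrow> norm (A $ i $ j) \<le> B"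
  shows "finite G"
proof (rule ccontr)
  assume inf: "infinite G"
  have bdd: "bounded G"
    unfolding bounded_iff
  proof (intro exI ballI)
    fix A assume A: "A \<in> G"
    have "norm A \<le> (\<Sum>i\<in>UNIV. norm (A $ i))" by (rule norm_vec_le_sum)
    also have "\<dots> \<le> (\<Sum>i::2\<in>UNIV. \<Sum>j::2\<in>UNIV. B)"
      by (intro sum_mono order_trans[OF norm_vec_le_sum] B(2) A)
    finally show "norm A \<le> (\<Sum>i::2\<in>UNIV. \<Sum>j::2\<in>UNIV. B)" .
  qed
  have clo: "closed G" by (rule zariski_closed_imp_closed[OF alg_groupD(6)[OF G(1)]])
  have "compact G" using bdd clo compact_eq_bounded_closed by blast
  then obtain l where l: "l \<in> G" "l islimpt G"
    using inf compact_eq_Bolzano_Weierstrass[of G] by blast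
  then obtain f where f: "\<And>n. f n \<in> G - {l}" "f \<longlonglongrightarrow> l"
    using islimpt_sequential[of l G] by blast
  define h where "h n = adj2 l ** f n" for n
  have dl: "det l = 1" by (rule alg_groupD(1)[OF G(1) l(1)])
  have hG: "h n \<in> G" for n unfolding h_def by (intro alg_groupD[OF G(1)] l(1)) (use f in blast)
  have h1: "h n \<noteq> mat 1" for n
  proof
    assume "h n = mat 1"
    then have "l ** (adj2 l ** f n) = l" by (simp add: h_def)
    then show False using f(1)[of n] by (simp add: mult_adj2_cancel[OF dl])
  qed
  have "h \<longlonglongrightarrow> adj2 l ** l"
    unfolding h_def by (intro tendsto_mat_mult tendsto_const f)
  then have hlim: "h \<longlonglongrightarrow> mat 1" by (simp add: mult_adj2 dl)
  then have tr: "(\<lambda>n. Re (h n $ 1 $ 1 + h n $ 2 $ 2)) \<longlonglongrightarrow> 2"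
  proof -
    have "(\<lambda>n. h n $ 1 $ 1) \<longlonglongrightarrow> 1" "(\<lambda>n. h n $ 2 $ 2) \<longlonglongrightarrow> 1"
      using hlim[unfolded tendsto_mat_entries, rule_format, of 1 1]
        hlim[unfolded tendsto_mat_entries, rule_format, of 2 2]
      by (simp_all add: mat_def)
    from tendsto_Re[OF tendsto_add[OF this]] show ?thesis by simp
  qed
  then have "eventually (\<lambda>n. Re (h n $ 1 $ 1 + h n $ 2 $ 2) > 0) sequentially"
    by (rule order_tendstoD) simp
  then obtain N where N: "\<And>n. n \<ge> N \<Longrightarrow> Re (h n $ 1 $ 1 + h n $ 2 $ 2) > 0"
    unfolding eventually_sequentially by blast
  \<comment> \<open>The shift passes to indices where the trace has positive real part; this
    excludes \<open>- mat 1\<close>, for which no angle is available.\<close>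
  define h' where "h' n = h (n + N)" for n
  have h'm: "h' n \<noteq> - mat 1" for n
    using N[of "n + N"] by (auto simp: h'_def mat_1_mat2)
  have "\<forall>n. \<exists>\<theta> J. 0 < \<theta> \<and> \<theta> < pi \<and> trace J = 0 \<and>
      (\<forall>k. matpow (h' n) k = rot (of_real (cos (real k * \<theta>))) (of_real (sin (real k * \<theta>))) J)"
    using unipotent_free_rot[OF G] hG h1 h'm unfolding h'_def by blast
  then obtain \<theta> J where \<theta>: "\<And>n. 0 < \<theta> n" "\<And>n. \<theta> n < pi" "\<And>n. trace (J n) = 0"
    and pw: "\<And>n k. matpow (h' n) k = rot (of_real (cos (real k * \<theta> n))) (of_real (sin (real k * \<theta> n))) (J n)"
    by metis
  have rG: "rot (of_real (cos (real k * \<theta> n))) (of_real (sin (real k * \<theta> n))) (J n) \<in> G" for k n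
    using matpow_in[OF G(1) hG, of "n + N" k] pw[of n k] by (simp add: h'_def)
  have "Re (h (n + N) $ 1 $ 1 + h (n + N) $ 2 $ 2) / 2 = cos (\<theta> n)" for n
  proof -
    have "J n $ 1 $ 1 + J n $ 2 $ 2 = 0" using \<theta>(3)[of n] by (simp add: trace_def sum_2)
    then have s: "sin (\<theta> n) * Re (J n $ 1 $ 1) + sin (\<theta> n) * Re (J n $ 2 $ 2) = 0"
      by (metis Re_complex_of_real distrib_left mult_zero_right of_real_0 plus_complex.sel(1))
    have "h (n + N) = rot (of_real (cos (\<theta> n))) (of_real (sin (\<theta> n))) (J n)"
      using pw[of n 1] by (simp add: h'_def)
    then show ?thesis using s by (simp add: rot_def mat_def)
  qed
  then have "(\<lambda>n. cos (\<theta> n)) \<longlonglongrightarrow> 2 / 2"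
    using tendsto_divide[OF LIMSEQ_ignore_initial_segment[OF tr, of N] tendsto_const[of 2]] by simp
  then have "(\<lambda>n. arccos (cos (\<theta> n))) \<longlonglongrightarrow> arccos 1"
    by (intro continuous_on_tendsto_compose[OF continuous_on_arccos']) auto
  then have \<theta>0: "\<theta> \<longlonglongrightarrow> 0"
  proof -
    have "arccos (cos (\<theta> n)) = \<theta> n" for n
      using \<theta>(1,2)[of n] by (intro arccos_cos) simp_all
    with \<open>(\<lambda>n. arccos (cos (\<theta> n))) \<longlonglongrightarrow> arccos 1\<close> show ?thesis by simp
  qed
  have Jb: "norm (J n $ i $ j) \<le> 2 * (B + 1)" if "\<theta> n < pi / 2" for n i j
  proof -
    \<comment> \<open>A power whose total angle lies between \<open>pi / 4\<close> and
      \<open>3 * pi / 4\<close>. There the sine is at least 1/2, so the bound on the entries of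
      \<open>G\<close> becomes a bound on \<open>J n\<close>.\<close>
    define k where "k = nat \<lceil>pi / (4 * \<theta> n)\<rceil>"
    have k: "pi / (4 * \<theta> n) \<le> real k" "real k < pi / (4 * \<theta> n) + 1"
    proof -
      have "0 \<le> pi / (4 * \<theta> n)" using \<theta>(1)[of n] by simp
      then have "real k = of_int \<lceil>pi / (4 * \<theta> n)\<rceil>" unfolding k_def by simp
      then show "pi / (4 * \<theta> n) \<le> real k" "real k < pi / (4 * \<theta> n) + 1" by linarith+
    qed
    have t: "pi / 4 \<le> k * \<theta> n" "k * \<theta> n \<le> 3 * pi / 4"
      using k \<theta>(1)[of n] that by (simp_all add: field_simps)
    have "sin (k * \<theta> n) \<ge> 1 / 2"
    proof (cases "k * \<theta> n \<le> pi / 2")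
      case True
      then have "sin (pi / 6) \<le> sin (k * \<theta> n)"
        using t by (intro sin_monotone_2pi_le) (auto simp: field_simps)
      then show ?thesis by (simp add: sin_30)
    next
      case False
      then have "sin (pi / 6) \<le> sin (pi - k * \<theta> n)"
        using t by (intro sin_monotone_2pi_le) (auto simp: field_simps)
      then show ?thesis by (simp add: sin_30)
    qed
    moreover have "norm (of_real (sin (k * \<theta> n)) * J n $ i $ j) \<le> B + 1"
    proof -
      let ?r = "rot (of_real (cos (real k * \<theta> n))) (of_real (sin (real k * \<theta> n))) (J n)"
      have "of_real (sin (k * \<theta> n)) * J n $ i $ j = ?r $ i $ j - of_real (cos (real k * \<theta> n)) * mat 1 $ i $ j"
        by (simp add: rot_def)
      then have "norm (of_real (sin (k * \<theta> n)) * J n $ i $ j) \<le>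
          norm (?r $ i $ j) + norm (of_real (cos (real k * \<theta> n)) * (mat 1 $ i $ j :: complex))"
        by (metis norm_triangle_ineq4)
      also have "\<dots> \<le> B + 1"
        using abs_cos_le_one[of "k * \<theta> n"] by (intro add_mono B(2) rG) (simp add: norm_mult mat_def)
      finally show ?thesis .
    qed
    ultimately have "norm (J n $ i $ j) * (1 / 2) \<le> B + 1"
      by (smt (verit) mult_left_mono mult.commute norm_ge_zero norm_mult norm_of_real)
    then show ?thesis by simp
  qed
  obtain N2 where N2: "\<And>n. n \<ge> N2 \<Longrightarrow> \<theta> n < pi / 2"
    using order_tendstoD(2)[OF \<theta>0, of "pi / 2"] pi_gt_zero unfolding eventually_sequentially by auto
  have "bounded (range (\<lambda>n. J (n + N2)))"
    unfolding bounded_iff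
  proof (intro exI ballI)
    fix A assume "A \<in> range (\<lambda>n. J (n + N2))"
    then obtain n where A: "A = J (n + N2)" by blast
    have "norm A \<le> (\<Sum>i\<in>UNIV. norm (A $ i))" by (rule norm_vec_le_sum)
    also have "\<dots> \<le> (\<Sum>i::2\<in>UNIV. \<Sum>j::2\<in>UNIV. 2 * (B + 1))"
      unfolding A by (intro sum_mono order_trans[OF norm_vec_le_sum] Jb N2) simp
    finally show "norm A \<le> (\<Sum>i::2\<in>UNIV. \<Sum>j::2\<in>UNIV. 2 * (B + 1))" .
  qed
  then obtain J' r where r: "strict_mono r" "(\<lambda>n. J (r n + N2)) \<longlonglongrightarrow> J'"
    using bounded_imp_convergent_subsequence[of "\<lambda>n. J (n + N2)"] by (auto simp: o_def)
  define s where "s n = r n + N2" for n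
  have s: "filterlim s at_top sequentially"
    by (rule filterlim_subseq) (use r(1) in \<open>simp add: s_def strict_mono_def\<close>)
  have \<theta>s: "(\<lambda>n. \<theta> (s n)) \<longlonglongrightarrow> 0" using \<theta>0 s by (rule filterlim_compose)
  have circle: "rot (of_real (cos \<phi>)) (of_real (sin \<phi>)) J' \<in> G" if "\<phi> \<ge> 0" for \<phi>
  proof -
    \<comment> \<open>The total angle approaches \<open>\<phi>\<close> from below with an error of
      at most \<open>\<theta> (s n)\<close>, which tends to 0.\<close>
    define k where "k n = nat \<lfloor>\<phi> / \<theta> (s n)\<rfloor>" for n
    have k: "real (k n) * \<theta> (s n) \<le> \<phi>" "\<phi> - \<theta> (s n) \<le> real (k n) * \<theta> (s n)" for n
    proof -
      have "real (k n) = of_int \<lfloor>\<phi> / \<theta> (s n)\<rfloor>"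
        using that \<theta>(1)[of "s n"] by (simp add: k_def)
      then have "real (k n) \<le> \<phi> / \<theta> (s n)" "\<phi> / \<theta> (s n) - 1 \<le> real (k n)"
        by linarith+
      then show "real (k n) * \<theta> (s n) \<le> \<phi>" "\<phi> - \<theta> (s n) \<le> real (k n) * \<theta> (s n)"
        using \<theta>(1)[of "s n"] by (simp_all add: field_simps)
    qed
    have kl: "(\<lambda>n. real (k n) * \<theta> (s n)) \<longlonglongrightarrow> \<phi>"
      by (rule tendsto_sandwich[OF _ _ _ tendsto_const])
        (use k tendsto_diff[OF tendsto_const \<theta>s, of \<phi>] in auto)
    have "(\<lambda>n. rot (of_real (cos (real (k n) * \<theta> (s n)))) (of_real (sin (real (k n) * \<theta> (s n)))) (J (s n)))
        \<longlonglongrightarrow> rot (of_real (cos \<phi>)) (of_real (sin \<phi>)) J'"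
      unfolding tendsto_mat_entries rot_def vec_lambda_beta
      by (intro allI tendsto_intros kl r(2)[folded s_def])
    from closed_sequentially[OF clo rG this] show ?thesis .
  qed
  \<comment> \<open>Complexification of the circle: at \<open>t = cis \<phi>\<close> the two
    coefficients, \<open>(t + 1/t) / 2\<close> and \<open>(t - 1/t) / (2 i)\<close>, are the cosine
    and the sine.\<close>
  define M where "M t = rot (1 / 2 * t + 1 / 2 * (1 / t)) (1 / (2 * \<i>) * t + - 1 / (2 * \<i>) * (1 / t)) J'" for t
  have Mc: "M (cis \<phi>) = rot (of_real (cos \<phi>)) (of_real (sin \<phi>)) J'" for \<phi>
  proof -
    have ci: "1 / cis \<phi> = cis (- \<phi>)" by (simp add: cis_divide flip: cis_zero)
    have "1 / 2 * cis \<phi> + 1 / 2 * (1 / cis \<phi>) = of_real (cos \<phi>)"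
      "1 / (2 * \<i>) * cis \<phi> + - 1 / (2 * \<i>) * (1 / cis \<phi>) = of_real (sin \<phi>)"
      unfolding ci by (simp_all add: complex_eq_iff Re_divide Im_divide)
    then show ?thesis by (simp only: M_def)
  qed
  have "infinite (cis ` {0..1})"
  proof -
    have "inj_on cis {0..1}"
    proof (rule inj_onI)
      fix x y :: real assume xy: "x \<in> {0..1}" "y \<in> {0..1}" "cis x = cis y"
      then have "cos x = cos y" by (simp add: cis.code)
      moreover have "0 \<le> x" "x \<le> pi" "0 \<le> y" "y \<le> pi"
        using xy(1,2) pi_ge_two unfolding atLeastAtMost_iff by linarith+
      ultimately show "x = y" using cos_inj_pi by blast
    qed
    then show ?thesis using finite_imageD by (metis infinite_Icc zero_less_one)
  qed
  moreover have "cis ` {0..1} \<subseteq> {t. t \<noteq> 0 \<and> M t \<in> G}"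
    using circle by (auto simp: Mc)
  ultimately have "infinite {t. t \<noteq> 0 \<and> M t \<in> G}" using finite_subset by blast
  moreover have "laurent (\<lambda>t. M t $ i $ j)" for i j
    unfolding M_def rot_def vec_lambda_beta by (intro laurent_intros)
  \<comment> \<open>At \<open>t = 2\<close> the trace is \<open>2 + 1/2\<close>, because
    \<open>J'\<close> is traceless; any real \<open>t > 1\<close> would do.\<close>
  ultimately have "M 2 \<in> G"
    using zariski_curve[OF alg_groupD(6)[OF G(1)], where M = M and t = 2] by simp
  then have "norm (M 2 $ 1 $ 1 + M 2 $ 2 $ 2) \<le> 2"
    by (rule unipotent_free_trace[OF G])
  moreover have "trace J' = 0"
  proof -
    have "(\<lambda>n. trace (J (s n))) \<longlonglongrightarrow> trace J'"
      unfolding trace_def by (intro tendsto_intros r(2)[folded s_def])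
    then have "(\<lambda>n::nat. 0) \<longlonglongrightarrow> trace J'" by (simp only: \<theta>(3))
    from LIMSEQ_unique[OF this tendsto_const] show ?thesis .
  qed
  ultimately show False
  proof -
    assume *: "norm (M 2 $ 1 $ 1 + M 2 $ 2 $ 2) \<le> 2" "trace J' = 0"
    have j: "J' $ 2 $ 2 = - J' $ 1 $ 1" using *(2) by (simp add: trace_def sum_2 eq_neg_iff_add_eq_0 add.commute)
    have m: "M 2 $ 1 $ 1 + M 2 $ 2 $ 2 = 5 / 2" by (simp add: M_def rot_def mat_def j)
    show False using *(1) unfolding m by (simp add: norm_divide)
  qed
qed

text \<open>After a conjugation the group contains a nonscalar diagonal matrix. If its elements are
  all upper or all lower triangular, the group is diagonal, and an infinite closed diagonal group is
  the torus. Otherwise the entries are bounded and compactness applies.\<close>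

lemma unipotent_free_finite:
  assumes G: "alg_group G" "unipotent_free G" shows "finite G"
proof (rule ccontr)
  assume inf: "infinite G"
  have "\<not> G \<subseteq> {mat 1, - mat 1}" using inf by (meson finite.emptyI finite.insertI finite_subset)
  then obtain g where g: "g \<in> G" "g \<noteq> mat 1" "g \<noteq> - mat 1" by blast
  then obtain h l where h: "det h = 1" "norm l = 1" "l^2 \<noteq> 1" "conj2 h g = mat2 l 0 0 (1 / l)"
    using unipotent_free_cases[OF G g(1)] by blast
  define H where "H = conj2 h ` G"
  have H: "alg_group H" "unipotent_free H"
    unfolding H_def using alg_group_conj[OF G(1) h(1)] unipotent_free_conj[OF G(2) h(1)] by auto
  have infH: "infinite H"
  proof -
    have "inj_on (conj2 h) G" by (intro inj_on_inverseI) (rule conj2_inverse(1)[OF h(1)])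
    then show ?thesis unfolding H_def using inf finite_imageD by blast
  qed
  have l0: "l \<noteq> 0" using h(2) by auto
  have d: "mat2 l 0 0 (1 / l) \<in> H" unfolding H_def using g(1) h(4) by (metis imageI)
  \<comment> \<open>The commutator of the diagonal element with an upper triangular one is
    unipotent, so it has to be trivial, which forces the latter to be diagonal.\<close>
  have no_upper: "A $ 1 $ 2 = 0" if K: "alg_group K" "unipotent_free K" "mat2 m 0 0 (1 / m) \<in> K" "m \<noteq> 0" "m^2 \<noteq> 1"
    and A: "A \<in> K" "A $ 2 $ 1 = 0" for A K m
  proof -
    obtain a b c e where AA: "A = mat2 a b c e" by (rule mat2_cases)
    have e: "c = 0" "a * e = 1" using A alg_groupD(1)[OF K(1) A(1)] by (auto simp: AA)
    have "mat2 m 0 0 (1 / m) ** A ** adj2 (mat2 m 0 0 (1 / m)) ** adj2 A \<in> K"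
      by (intro alg_groupD[OF K(1)] K A)
    also have "mat2 m 0 0 (1 / m) ** A ** adj2 (mat2 m 0 0 (1 / m)) ** adj2 A = mat2 1 ((m^2 - 1) * (a * b)) 0 1"
      using K(4) e by (simp add: AA field_simps power2_eq_square)
    finally have "(m^2 - 1) * (a * b) = 0"
      using contains_U_unipotent[OF K(1)] unipotent_freeD(2)[OF K(2)] by blast
    then show ?thesis using K(5) e by (auto simp: AA)
  qed
  have not_diag: False if K: "alg_group K" "unipotent_free K" "infinite K" "\<And>A. A \<in> K \<Longrightarrow> A $ 1 $ 2 = 0 \<and> A $ 2 $ 1 = 0" for K
  proof -
    have A: "A = mat2 (A $ 1 $ 1) 0 0 (1 / A $ 1 $ 1)" "A $ 1 $ 1 \<noteq> 0" if "A \<in> K" for A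
    proof -
      obtain a b c e where AA: "A = mat2 a b c e" by (rule mat2_cases)
      have e: "b = 0" "c = 0" "a * e = 1" using K(4)[OF that] alg_groupD(1)[OF K(1) that] by (auto simp: AA)
      then have "a \<noteq> 0" by auto
      with e show "A = mat2 (A $ 1 $ 1) 0 0 (1 / A $ 1 $ 1)" "A $ 1 $ 1 \<noteq> 0"
        by (simp_all add: AA eq_divide_eq mult.commute)
    qed
    have "K \<subseteq> (\<lambda>t. mat2 t 0 0 (1 / t)) ` {t. t \<noteq> 0 \<and> mat2 t 0 0 (1 / t) \<in> K}"
    proof
      fix A assume "A \<in> K"
      then show "A \<in> (\<lambda>t. mat2 t 0 0 (1 / t)) ` {t. t \<noteq> 0 \<and> mat2 t 0 0 (1 / t) \<in> K}"
        using A[of A] by (intro image_eqI[of _ _ "A $ 1 $ 1"]) auto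
    qed
    then have "infinite {t. t \<noteq> 0 \<and> mat2 t 0 0 (1 / t) \<in> K}"
      using K(3) finite_surj by blast
    then show False
      using infinite_torus[OF alg_groupD(6)[OF K(1)]] unipotent_freeD(1)[OF K(2)] by blast
  qed
  \<comment> \<open>Conjugation by the Weyl element exchanges upper and lower triangular
    matrices.\<close>
  define w where "w = mat2 0 1 (-1) 0"
  have w: "det w = 1" by (simp add: w_def)
  consider "\<forall>A\<in>H. A $ 2 $ 1 = 0" | "\<forall>A\<in>H. A $ 1 $ 2 = 0"
    | k1 k2 where "k1 \<in> H" "k1 $ 1 $ 2 \<noteq> 0" "k2 \<in> H" "k2 $ 2 $ 1 \<noteq> 0"
    by blast
  then show False
  proof cases
    case 1
    then show False
      using not_diag[OF H infH] no_upper[OF H d l0 h(3)] by blast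
  next
    case 2
    have lower: "A $ 2 $ 1 = 0" if "A \<in> H" for A
    proof -
      have m: "mat2 (1 / l) 0 0 (1 / (1 / l)) = conj2 w (mat2 l 0 0 (1 / l))"
        by (simp add: w_def conj2_def)
      have A: "conj2 w A $ 2 $ 1 = 0" "conj2 w A $ 1 $ 2 = - A $ 2 $ 1"
        using 2 that by (cases A rule: mat2_cases; force simp: w_def conj2_def)+
      have "conj2 w A $ 1 $ 2 = 0"
        by (rule no_upper[OF alg_group_conj[OF H(1) w] unipotent_free_conj[OF H(2) w]
              imageI[OF d, of "conj2 w", folded m]])
          (use l0 h(3) A that in \<open>auto simp: power_divide\<close>)
      then show ?thesis using A by simp
    qed
    show False using not_diag[OF H infH] 2 lower by blast
  next
    case 3
    obtain B where "B \<ge> 0" "\<forall>A\<in>H. \<forall>i j. norm (A $ i $ j) \<le> B"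
      using unipotent_free_bounded[OF H d l0 h(3) 3] by blast
    then show False using unipotent_free_compact_finite[OF H] infH by blast
  qed
qed

section \<open>Classification of the infinite algebraic subgroups\<close>

definition borel2 :: "(complex^2^2) set" where "borel2 = {A. det A = 1 \<and> A $ 2 $ 1 = 0}"
text \<open>The exponent is even because \<open>- mat 1\<close> has to belong to the group. For
  \<open>n = 0\<close> the last condition is empty and the group is \<open>borel2\<close>, so one
  construction covers both families.\<close>

definition borel2_root :: "nat \<Rightarrow> (complex^2^2) set" where
  "borel2_root n = {A. det A = 1 \<and> A $ 2 $ 1 = 0 \<and> A $ 2 $ 2 ^ (2 * n) = 1}"
definition torus2 :: "(complex^2^2) set" where "torus2 = {A. det A = 1 \<and> A $ 1 $ 2 = 0 \<and> A $ 2 $ 1 = 0}"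
definition monomial2 :: "(complex^2^2) set" where
  "monomial2 = torus2 \<union> {A. det A = 1 \<and> A $ 1 $ 1 = 0 \<and> A $ 2 $ 2 = 0}"

text \<open>Multiplication by \<open>x\<close> permutes \<open>S\<close>; comparing the product over
  \<open>S\<close> with its image gives \<open>x ^ card S = 1\<close>, and this equation has exactly
  \<open>card S\<close> complex roots.\<close>

lemma finite_mult_group:
  fixes S :: "complex set"
  assumes "finite S" "0 \<notin> S" "1 \<in> S" "\<And>x y. x \<in> S \<Longrightarrow> y \<in> S \<Longrightarrow> x * y \<in> S"
  shows "S = {z. z ^ card S = 1}"
proof -
  have c: "card S > 0" using assms(1,3) card_gt_0_iff by blast
  have "x ^ card S = 1" if x: "x \<in> S" for x
  proof -
    have inj: "inj_on (\<lambda>y. x * y) S" using x assms(2) by (intro inj_onI) auto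
    then have "(\<lambda>y. x * y) ` S = S"
      using assms(1,4) x by (intro endo_inj_surj) auto
    then have "(\<Prod>y\<in>S. y) = (\<Prod>y\<in>S. x * y)"
      using prod.reindex[OF inj, of "\<lambda>y. y"] by simp
    also have "\<dots> = x ^ card S * (\<Prod>y\<in>S. y)" by (simp add: prod.distrib)
    finally show ?thesis using assms(1,2) by (auto simp: prod_zero_iff)
  qed
  then have "S \<subseteq> {z. z ^ card S = 1}" by blast
  moreover have "card {z::complex. z ^ card S = 1} = card S" by (rule card_roots_unity_eq[OF c])
  ultimately show ?thesis using c by (intro card_subset_eq) (auto intro: card_ge_0_finite)
qed

text \<open>Inside the Borel group the unipotent part is free, so only the set \<open>S\<close> of
  diagonal entries matters; it is finite, hence consists of roots of unity, or it is all of the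
  punctured line. Outside, the Bruhat decomposition generates the whole of
  \<open>SL2\<close>.\<close>

lemma contains_U_cases:
  assumes G: "alg_group G" "contains_U G"
  shows "G = {A. det A = 1} \<or> G = borel2 \<or> (\<exists>n\<ge>1. G = borel2_root n)"
proof (cases "G \<subseteq> borel2")
  case True
  define S where "S = {t. t \<noteq> 0 \<and> mat2 t 0 0 (1 / t) \<in> G}"
  have U: "mat2 1 u 0 1 \<in> G" for u using G(2) by (simp add: contains_U_def)
  have mem: "mat2 a b 0 d \<in> G \<longleftrightarrow> a * d = 1 \<and> d \<in> S" for a b d
  proof
    assume A: "mat2 a b 0 d \<in> G"
    then have ad: "a * d = 1" using alg_groupD(1)[OF G(1)] by force
    then have ad': "d \<noteq> 0" "a = 1 / d" by (auto simp: eq_divide_eq)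
    have "adj2 (mat2 a b 0 d) ** mat2 1 (a * b) 0 1 \<in> G"
      by (intro alg_groupD[OF G(1)] A U)
    also have "adj2 (mat2 a b 0 d) ** mat2 1 (a * b) 0 1 = mat2 d 0 0 (1 / d)"
      using ad' by (simp add: field_simps)
    finally show "a * d = 1 \<and> d \<in> S" using ad ad' by (simp add: S_def)
  next
    assume *: "a * d = 1 \<and> d \<in> S"
    then have d: "d \<noteq> 0" "a = 1 / d" "mat2 d 0 0 (1 / d) \<in> G" by (auto simp: eq_divide_eq S_def)
    have "adj2 (mat2 d 0 0 (1 / d)) ** mat2 1 (d * b) 0 1 \<in> G"
      by (intro alg_groupD[OF G(1)] d U)
    also have "adj2 (mat2 d 0 0 (1 / d)) ** mat2 1 (d * b) 0 1 = mat2 a b 0 d"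
      using d by simp
    finally show "mat2 a b 0 d \<in> G" .
  qed
  have memG: "A \<in> G \<longleftrightarrow> det A = 1 \<and> A $ 2 $ 1 = 0 \<and> A $ 2 $ 2 \<in> S" for A
  proof -
    obtain a b c d where A: "A = mat2 a b c d" by (rule mat2_cases)
    show ?thesis
    proof (cases "c = 0")
      case True
      then show ?thesis using mem[of a b d] by (simp add: A)
    next
      case False
      then have "A \<notin> borel2" by (simp add: A borel2_def)
      then show ?thesis using False \<open>G \<subseteq> borel2\<close> by (auto simp: A)
    qed
  qed
  show ?thesis
  proof (cases "finite S")
    case True
    have 1: "1 \<in> S" "-1 \<in> S" "0 \<notin> S"
      using alg_groupD(2,3)[OF G(1)] by (auto simp: S_def mat_1_mat2)
    have m: "x * y \<in> S" if "x \<in> S" "y \<in> S" for x y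
    proof -
      have "mat2 x 0 0 (1 / x) ** mat2 y 0 0 (1 / y) \<in> G" using that by (intro alg_groupD[OF G(1)]) (auto simp: S_def)
      then show ?thesis using that by (simp add: S_def)
    qed
    have S: "S = {z. z ^ card S = 1}" by (rule finite_mult_group[OF True 1(3,1) m])
    then have "(-1::complex) ^ card S = 1" using 1 by blast
    then have "even (card S)" by (metis neg_one_odd_power one_neq_neg_one)
    then obtain n where n: "card S = 2 * n" by (elim evenE)
    have "n \<ge> 1" using n True 1(1) card_gt_0_iff[of S] by auto
    moreover have "G = borel2_root n"
      using memG S unfolding borel2_root_def n by blast
    ultimately show ?thesis by blast
  next
    case False
    then have "contains_T G" unfolding S_def by (rule infinite_torus[OF alg_groupD(6)[OF G(1)]])
    then have "S = - {0}" unfolding S_def contains_T_def by blast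
    have "A $ 2 $ 2 \<noteq> 0" if "det A = 1" "A $ 2 $ 1 = 0" for A :: "complex^2^2"
      using that by (auto simp: det_2)
    then have "G = borel2"
      using memG \<open>S = - {0}\<close> unfolding borel2_def by blast
    then show ?thesis by blast
  qed
next
  case False
  have U: "mat2 1 u 0 1 \<in> G" for u using G(2) by (simp add: contains_U_def)
  obtain g where "g \<in> G" "g \<notin> borel2" using False by blast
  moreover obtain a b c d where "g = mat2 a b c d" by (rule mat2_cases)
  ultimately have g: "mat2 a b c d \<in> G" "a * d - b * c = 1" "c \<noteq> 0"
    using alg_groupD(1)[OF G(1), of g] by (auto simp: borel2_def)
  \<comment> \<open>The antidiagonal factor in the Bruhat decomposition of \<open>g\<close>;
    conjugating by it moves the upper unipotent group to the lower one.\<close>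
  define w where "w = mat2 0 (- 1 / c) c 0"
  have "mat2 1 (- a / c) 0 1 ** mat2 a b c d ** mat2 1 (- d / c) 0 1 \<in> G"
    by (intro alg_groupD[OF G(1)] U g)
  also have "mat2 1 (- a / c) 0 1 ** mat2 a b c d ** mat2 1 (- d / c) 0 1 = w"
    using g(2,3) by (simp add: w_def field_simps)
  finally have w: "w \<in> G" .
  have L: "mat2 1 0 u 1 \<in> G" for u
  proof -
    have "w ** mat2 1 (- u / c^2) 0 1 ** adj2 w \<in> G" by (intro alg_groupD[OF G(1)] U w)
    also have "w ** mat2 1 (- u / c^2) 0 1 ** adj2 w = mat2 1 0 u 1"
      using g(3) by (simp add: w_def field_simps power2_eq_square)
    finally show ?thesis .
  qed
  have nz: "mat2 p q r s \<in> G" if "p * s - q * r = 1" "r \<noteq> 0" for p q r s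
  proof -
    have "mat2 1 ((p - 1) / r) 0 1 ** mat2 1 0 r 1 ** mat2 1 ((s - 1) / r) 0 1 \<in> G"
      by (intro alg_groupD[OF G(1)] U L)
    also have "mat2 1 ((p - 1) / r) 0 1 ** mat2 1 0 r 1 ** mat2 1 ((s - 1) / r) 0 1 = mat2 p q r s"
      using that by (simp add: field_simps)
    finally show ?thesis .
  qed
  have "A \<in> G" if A: "det A = 1" for A
  proof -
    obtain p q r s where AA: "A = mat2 p q r s" by (rule mat2_cases)
    show ?thesis
    proof (cases "r = 0")
      case False
      then show ?thesis using nz A by (simp add: AA)
    next
      case True
      have "w ** A \<in> G"
        using A True g(3) unfolding AA w_def mat2_mult by (intro nz) (auto simp: field_simps)
      then have "adj2 w ** (w ** A) \<in> G" by (intro alg_groupD(4)[OF G(1) alg_groupD(5)[OF G(1) w]])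
      also have "adj2 w ** (w ** A) = A"
        by (rule mult_adj2_cancel) (use g(3) in \<open>simp add: w_def\<close>)
      finally show ?thesis .
    qed
  qed
  then have "G = {A. det A = 1}" using alg_groupD(1)[OF G(1)] by blast
  then show ?thesis by blast
qed

text \<open>The normalizer of the torus has two components, which gives the first two cases. An
  element outside it can be multiplied by a torus element, possibly after a further product, so as
  to have trace 2 without being the identity; it is then unipotent.\<close>

lemma contains_T_cases:
  assumes G: "alg_group G" "contains_T G"
  shows "G = torus2 \<or> G = monomial2 \<or> (\<exists>h. det h = 1 \<and> contains_U (conj2 h ` G))"
proof -
  have T: "mat2 t 0 0 (1 / t) \<in> G" if "t \<noteq> 0" for t using G(2) that by (simp add: contains_T_def)
  have torus_eq: "A = mat2 (A $ 1 $ 1) 0 0 (1 / A $ 1 $ 1) \<and> A $ 1 $ 1 \<noteq> 0" if "A \<in> torus2" for A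
  proof -
    obtain a b c d where A: "A = mat2 a b c d" by (rule mat2_cases)
    have "a * d = 1" "b = 0" "c = 0" using that by (auto simp: torus2_def A)
    moreover from this have "a \<noteq> 0" by auto
    ultimately show ?thesis by (simp add: A eq_divide_eq mult.commute)
  qed
  have sub: "torus2 \<subseteq> G"
  proof
    fix A assume "A \<in> torus2"
    note A = torus_eq[OF this]
    then have "mat2 (A $ 1 $ 1) 0 0 (1 / A $ 1 $ 1) \<in> G" by (intro T) simp
    then show "A \<in> G" using A by simp
  qed
  show ?thesis
  proof (cases "G \<subseteq> monomial2")
    case True
    show ?thesis
    proof (cases "G \<subseteq> torus2")
      case False
      then obtain g where g0: "g \<in> G" "g \<notin> torus2" by blast
      then have "g \<in> monomial2" using True by blast
      then obtain b c where g: "g = mat2 0 b c 0" "- b * c = 1"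
        using g0(2) by (cases g rule: mat2_cases) (auto simp: monomial2_def)
      have "A \<in> G" if A: "det A = 1" "A $ 1 $ 1 = 0" "A $ 2 $ 2 = 0" for A
      proof -
        obtain p q r s where AA: "A = mat2 p q r s" by (rule mat2_cases)
        have A': "p = 0" "s = 0" "- q * r = 1" using A by (auto simp: AA)
        have "mat2 (q / b) 0 0 (1 / (q / b)) ** g \<in> G"
          using A' g(2) by (intro alg_groupD[OF G(1)] T g0) auto
        also have "mat2 (q / b) 0 0 (1 / (q / b)) ** g = A"
        proof -
          have "b \<noteq> 0" "q \<noteq> 0" using A' g(2) by auto
          moreover have "b * c = q * r" using A' g(2) by (simp add: minus_equation_iff)
          ultimately show ?thesis using A' by (simp add: AA g field_simps)
        qed
        finally show ?thesis .
      qed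
      then have "G = monomial2" using True sub by (auto simp: monomial2_def)
      then show ?thesis by blast
    qed (use sub in blast)
  next
    case False
    then obtain g where g0: "g \<in> G" "g \<notin> monomial2" by blast
    have fin: "\<exists>h. det h = 1 \<and> contains_U (conj2 h ` G)"
      if k: "mat2 a b c d \<in> G" "a \<noteq> 0" "d \<noteq> 0" "b \<noteq> 0 \<or> c \<noteq> 0" for a b c d
    proof -
      \<comment> \<open>Chosen so that the trace \<open>l * a + d / l\<close> of the product with
        the torus element equals 2.\<close>
      define l where "l = (1 + csqrt (1 - a * d)) / a"
      have la: "l * a = 1 + csqrt (1 - a * d)" using k(2) by (simp add: l_def)
      then have "(l * a - 1)^2 = 1 - a * d" by simp
      then have "a * (l^2 * a - 2 * l + d) = 0" by (simp add: power2_eq_square algebra_simps)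
      then have l: "l^2 * a - 2 * l + d = 0" using k(2) by simp
      then have l0: "l \<noteq> 0" using k(3) by auto
      define B where "B = mat2 l 0 0 (1 / l) ** mat2 a b c d"
      have BG: "B \<in> G" unfolding B_def by (intro alg_groupD[OF G(1)] T k l0)
      have "l * (l * a + d / l) = l * 2" using l l0 by (simp add: algebra_simps power2_eq_square)
      then have tr: "trace B = 2" using l0 by (simp add: B_def)
      have B1: "B \<noteq> mat 1" using k(4) l0 by (auto simp: B_def mat_1_mat2)
      show ?thesis
        using conj2_normal_form[OF alg_groupD(1)[OF G(1) BG]]
      proof (elim disjE exE conjE)
        fix h m assume *: "det h = 1" "m \<noteq> 0" "m^2 \<noteq> 1" "conj2 h B = mat2 m 0 0 (1 / m)"
        have "m + 1 / m = 2" using trace_conj2[OF *(1), of B] *(4) tr by simp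
        then have "(m - 1)^2 = 0" using *(2) by (simp add: field_simps power2_eq_square)
        then show ?thesis using *(3) by simp
      next
        fix h e u assume *: "det h = 1" "e^2 = 1" "conj2 h B = mat2 e u 0 e"
        have e: "e = 1" using trace_conj2[OF *(1), of B] *(3) tr by simp
        have "u \<noteq> 0"
        proof
          assume "u = 0"
          then have "B = conj2 (adj2 h) (mat 1)"
            using conj2_inverse(1)[OF *(1), of B] *(3) e by (simp add: mat_1_mat2)
          then show False using B1 conj2_1(1)[of "adj2 h"] *(1) by simp
        qed
        moreover have "mat2 1 u 0 1 \<in> conj2 h ` G" using BG *(3) e by (metis imageI)
        ultimately show ?thesis
          using contains_U_unipotent[OF alg_group_conj[OF G(1) *(1)]] *(1) by blast
      qed
    qed
    obtain a b c d where g: "g = mat2 a b c d" by (rule mat2_cases)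
    have dg: "a * d - b * c = 1" using alg_groupD(1)[OF G(1) g0(1)] by (simp add: g)
    have mm: "\<not> (a = 0 \<and> d = 0)" "b \<noteq> 0 \<or> c \<noteq> 0"
      using g0(2) dg by (auto simp: monomial2_def torus2_def g)
    show ?thesis
    proof (cases "a = 0 \<or> d = 0")
      case False
      then show ?thesis using fin g0(1) mm(2) unfolding g by blast
    next
      case True
      then have bc: "b * c = -1" using dg by (auto simp: minus_equation_iff)
      \<comment> \<open>The finitely many \<open>l\<close> for which a diagonal entry of the product
        of \<open>g\<close>, the torus element and \<open>g\<close> vanishes.\<close>
      define S where "S = {l. poly [:-1, 0, a^2:] l = 0} \<union> {l. poly [:- (d^2), 0, 1:] l = 0} \<union> {0}"
      have "finite S" unfolding S_def
        by (intro finite_UnI poly_roots_finite) auto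
      from ex_new_if_finite[OF infinite_UNIV_char_0 this] obtain l where "l \<notin> S" ..
      then have l: "l \<noteq> 0" "l * l * a^2 \<noteq> 1" "l * l \<noteq> d^2"
        by (simp_all add: S_def algebra_simps)
      have "mat2 a b c d ** mat2 l 0 0 (1 / l) ** mat2 a b c d \<in> G"
        using g0(1) unfolding g by (intro alg_groupD[OF G(1)] T l)
      also have "mat2 a b c d ** mat2 l 0 0 (1 / l) ** mat2 a b c d =
          mat2 (l * a^2 - 1 / l) (b * (l * a + d / l)) (c * (l * a + d / l)) (d^2 / l - l)"
      proof -
        have bc': "b * (c * x) = - x" for x using bc by (simp flip: mult.assoc)
        show ?thesis using l(1) by (simp add: power2_eq_square field_simps bc' bc)
      qed
      finally show ?thesis
        using fin[of "l * a^2 - 1 / l" "b * (l * a + d / l)" "c * (l * a + d / l)" "d^2 / l - l"] l bc True mm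
        by (auto simp: field_simps power2_eq_square)
    qed
  qed
qed

theorem alg_group_classification:
  assumes G: "alg_group G" "infinite G"
  shows "\<exists>h. det h = 1 \<and> (conj2 h ` G \<in> {{A. det A = 1}, borel2, torus2, monomial2} \<or>
    (\<exists>n\<ge>1. conj2 h ` G = borel2_root n))"
proof -
  have U: ?thesis if "det h = 1" "contains_U (conj2 h ` G)" for h
    using contains_U_cases[OF alg_group_conj[OF G(1) that(1)] that(2)] that(1) by blast
  obtain h where h: "det h = 1" "contains_T (conj2 h ` G) \<or> contains_U (conj2 h ` G)"
    using unipotent_free_finite[OF G(1)] G(2) unfolding unipotent_free_def by blast
  show ?thesis
  proof (cases "contains_U (conj2 h ` G)")
    case True
    then show ?thesis using U h(1) by blast
  next
    case False
    then have "contains_T (conj2 h ` G)" using h(2) by blast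
    then consider "conj2 h ` G = torus2" | "conj2 h ` G = monomial2"
      | g where "det g = 1" "contains_U (conj2 g ` conj2 h ` G)"
      using contains_T_cases[OF alg_group_conj[OF G(1) h(1)]] by blast
    then show ?thesis
    proof cases
      case 3
      then show ?thesis
        using U[of "g ** h"] h(1) by (simp add: det_mul image_image conj2_conj2)
    qed (use h(1) in blast)+
  qed
qed

section \<open>Horizontal vector fields\<close>

lemma has_derivative_vec:
  fixes f :: "'a::real_normed_vector \<Rightarrow> complex^'n"
  assumes "\<And>i. ((\<lambda>x. f x $ i) has_derivative (\<lambda>u. f' u $ i)) (at x)"
  shows "(f has_derivative f') (at x)"
proof -
  have "((\<lambda>x. f x \<bullet> b) has_derivative (\<lambda>u. f' u \<bullet> b)) (at x)" if b: "b \<in> Basis" for b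
  proof -
    obtain i u where "b = axis i u" using b unfolding Basis_vec_def by blast
    then show ?thesis using has_derivative_inner_left[OF assms[of i], of u] by (simp add: inner_axis)
  qed
  then show ?thesis using has_derivative_componentwise_within[of f f' x UNIV] by blast
qed

lemma has_derivative_vec_nth: "(f has_derivative f') F \<Longrightarrow> ((\<lambda>x. f x $ i) has_derivative (\<lambda>u. f' u $ i)) F"
  by (rule bounded_linear.has_derivative[OF bounded_linear_vec_nth])

lemma has_derivative_coord: "((\<lambda>p. p $ i) has_derivative (\<lambda>u. u $ i)) (at p)"
  by (rule has_derivative_vec_nth[OF has_derivative_ident])

lemma has_derivative_of_coord:
  fixes f :: "complex \<Rightarrow> complex"
  assumes "(f has_field_derivative D) (at (p $ i))"
  shows "((\<lambda>p. f (p $ i)) has_derivative (\<lambda>u. D * u $ i)) (at p)"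
  using has_derivative_compose[OF has_derivative_coord[of i p], of f "\<lambda>h. D * h"] assms
  by (simp add: has_field_derivative_def)

definition rat_eval :: "complex poly \<Rightarrow> complex poly \<Rightarrow> complex \<Rightarrow> complex" where
  "rat_eval n d x = poly n x / poly d x"

definition rat_eval' :: "complex poly \<Rightarrow> complex poly \<Rightarrow> complex \<Rightarrow> complex" where
  "rat_eval' n d x = (poly (pderiv n) x * poly d x - poly n x * poly (pderiv d) x) / (poly d x)^2"

lemma rat_eval_deriv: "poly d x \<noteq> 0 \<Longrightarrow> (rat_eval n d has_field_derivative rat_eval' n d x) (at x)"
  unfolding rat_eval_def[abs_def] rat_eval'_def
  by (auto intro!: derivative_eq_intros simp: power2_eq_square)

definition rec_conn :: "complex poly \<Rightarrow> complex poly \<Rightarrow> ratvf \<Rightarrow> ratvf \<Rightarrow> ratvf" where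
  "rec_conn n d = reciprocal (par_connection (ratX n / ratX d))"

lemma christoffel_rec_conn:
  "p \<in> good_set d \<Longrightarrow> christoffel (rec_conn n d) p u v = christ (rat_eval n d (p$1)) (rat_eval' n d (p$1)) p u v"
  unfolding rec_conn_def rat_eval_def rat_eval'_def by (rule reciprocal_par(2))

text \<open>The second column holds two solutions \<open>u\<close>, \<open>v\<close> of
  \<open>v'' = q v\<close>, the first their derivatives. The determinant \<open>u' v - u v'\<close>
  is the Wronskian, normalized so that the derivative of \<open>u / v\<close> is
  \<open>1 / v^2\<close>. A change of basis multiplies from the left.\<close>

definition is_solution :: "(complex \<Rightarrow> complex) \<Rightarrow> complex set \<Rightarrow> (complex \<Rightarrow> complex^2^2) \<Rightarrow> bool" where
  "is_solution q U P \<longleftrightarrow> (\<forall>x\<in>U. det (P x) = 1 \<and>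
     (\<forall>i. ((\<lambda>x. P x $ i $ 2) has_field_derivative P x $ i $ 1) (at x) \<and>
          ((\<lambda>x. P x $ i $ 1) has_field_derivative q x * P x $ i $ 2) (at x)))"

lemma is_solutionD:
  assumes "is_solution q U P" "x \<in> U"
  shows "det (P x) = 1" "((\<lambda>x. P x $ i $ 2) has_field_derivative P x $ i $ 1) (at x)"
    "((\<lambda>x. P x $ i $ 1) has_field_derivative q x * P x $ i $ 2) (at x)"
  using assms by (auto simp: is_solution_def)

lemma is_solution_mult:
  assumes "is_solution q U P" "det g = 1"
  shows "is_solution q U (\<lambda>x. g ** P x)"
  unfolding is_solution_def
proof (intro ballI conjI allI)
  fix x i assume x: "x \<in> U"
  show "det (g ** P x) = 1" using assms is_solutionD(1)[OF assms(1) x] by (simp add: det_mul)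
  note D = is_solutionD(2,3)[OF assms(1) x]
  show "((\<lambda>x. (g ** P x) $ i $ 2) has_field_derivative (g ** P x) $ i $ 1) (at x)"
    "((\<lambda>x. (g ** P x) $ i $ 1) has_field_derivative q x * (g ** P x) $ i $ 2) (at x)"
    unfolding matrix_matrix_mult_def vec_lambda_beta sum_2
    by (auto intro!: derivative_eq_intros D simp: algebra_simps)
qed

text \<open>Prolongation of the field \<open>l d/dx\<close>, with \<open>m = l' / 2\<close> and
  \<open>k = m'\<close>: the coordinate \<open>y\<close> transforms as a density of weight -1/2,
  like a solution, and \<open>z\<close> as minus its derivative.\<close>

definition jet :: "complex^3 \<Rightarrow> complex \<Rightarrow> complex \<Rightarrow> complex \<Rightarrow> complex^3" where
  "jet p l m k = vector [l, p $ 2 * m, - (p $ 2 * k) - p $ 3 * m]"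

text \<open>The columns are the jets of \<open>u^2\<close>, \<open>u v\<close>, \<open>v^2\<close>,
  where \<open>(u, v)\<close> is the second column of \<open>P\<close>. Only products of two entries
  occur, hence the sign of \<open>P\<close> is lost.\<close>

definition frame :: "complex \<Rightarrow> complex^3 \<Rightarrow> complex^2^2 \<Rightarrow> complex^3^3" where
  "frame q p P = vector [
     vector [P$1$2 * P$1$2, P$1$2 * P$2$2, P$2$2 * P$2$2],
     p$2 *s vector [P$1$1 * P$1$2, (P$1$1 * P$2$2 + P$1$2 * P$2$1) / 2, P$2$1 * P$2$2],
     (- (p$2)) *s vector [P$1$1 * P$1$1 + q * (P$1$2 * P$1$2), P$1$1 * P$2$1 + q * (P$1$2 * P$2$2), P$2$1 * P$2$1 + q * (P$2$2 * P$2$2)]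
       - p$3 *s vector [P$1$1 * P$1$2, (P$1$1 * P$2$2 + P$1$2 * P$2$1) / 2, P$2$1 * P$2$2]]"

text \<open>For a solution matrix, \<open>quad0\<close> is a quadratic form \<open>l\<close> in the
  two solutions, \<open>quad1\<close> is \<open>l' / 2\<close>, and \<open>quad2\<close> is
  \<open>l'' / 2 - q * l\<close>.\<close>

definition quad0 :: "complex^3 \<Rightarrow> complex^2^2 \<Rightarrow> complex" where
  "quad0 k P = k$1 * (P$1$2 * P$1$2) + k$2 * (P$1$2 * P$2$2) + k$3 * (P$2$2 * P$2$2)"
definition quad1 :: "complex^3 \<Rightarrow> complex^2^2 \<Rightarrow> complex" where
  "quad1 k P = k$1 * (P$1$1 * P$1$2) + k$2 * ((P$1$1 * P$2$2 + P$1$2 * P$2$1) / 2) + k$3 * (P$2$1 * P$2$2)"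
definition quad2 :: "complex^3 \<Rightarrow> complex^2^2 \<Rightarrow> complex" where
  "quad2 k P = k$1 * (P$1$1 * P$1$1) + k$2 * (P$1$1 * P$2$1) + k$3 * (P$2$1 * P$2$1)"

lemmas quad_defs = quad0_def quad1_def quad2_def

lemma frame_mult_vec: "frame q p P *v k = jet p (quad0 k P) (quad1 k P) (quad2 k P + q * quad0 k P)"
  unfolding vec_eq_iff forall_3
  by (simp add: matrix_vector_mult_def sum_3 frame_def jet_def quad_defs algebra_simps)

definition sym_sq :: "complex^2^2 \<Rightarrow> complex^3^3" where
  "sym_sq g = vector [
     vector [g$1$1 * g$1$1, g$1$1 * g$2$1, g$2$1 * g$2$1],
     vector [2 * g$1$1 * g$1$2, g$1$1 * g$2$2 + g$1$2 * g$2$1, 2 * g$2$1 * g$2$2],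
     vector [g$1$2 * g$1$2, g$1$2 * g$2$2, g$2$2 * g$2$2]]"

lemma frame_mult: "frame q p (g ** P) = frame q p P ** sym_sq g"
  unfolding vec_eq_iff forall_3
  by (simp add: matrix_matrix_mult_def sum_3 sum_2 frame_def sym_sq_def field_simps)

lemma frame_minus: "frame q p (- P) = frame q p P"
  by (simp add: frame_def)

lemma det_frame: "det P = 1 \<Longrightarrow> det (frame q p P) = (p$2)^2 / 2"
proof -
  obtain a b c d where P: "P = mat2 a b c d" by (rule mat2_cases)
  assume "det P = 1"
  then have "a * d - b * c = 1" by (simp add: P)
  moreover have "det (frame q p P) = (p$2)^2 / 2 * (a * d - b * c)^3"
    by (simp add: P det_3 frame_def field_simps power2_eq_square power3_eq_cube)
  ultimately show ?thesis by simp
qed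

lemma invertible_frame: "det P = 1 \<Longrightarrow> p \<in> good_set d \<Longrightarrow> invertible (frame q p P)"
  by (simp add: invertible_det_nz det_frame good_set_def)

text \<open>Horizontality amounts to the symmetric square \<open>l''' = 4 q l' + 2 q' l\<close> of
  \<open>v'' = q v\<close>, written as a first order system in \<open>l\<close>,
  \<open>m = l' / 2\<close> and \<open>k = m'\<close>.\<close>

lemma has_derivative_jet:
  assumes p: "p \<in> good_set d"
    and l: "(l has_field_derivative 2 * m (p$1)) (at (p$1))"
    and m: "(m has_field_derivative k (p$1)) (at (p$1))"
    and k: "(k has_field_derivative 4 * q * m (p$1) + q' * l (p$1)) (at (p$1))"
  shows "((\<lambda>p. jet p (l (p$1)) (m (p$1)) (k (p$1))) has_derivative
     (\<lambda>u. - christ q q' p u (jet p (l (p$1)) (m (p$1)) (k (p$1))))) (at p)"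
proof (rule has_derivative_vec)
  fix i :: 3
  have y: "p $ 2 \<noteq> 0" using p by (simp add: good_set_def)
  note D = has_derivative_of_coord[OF l] has_derivative_of_coord[OF m] has_derivative_of_coord[OF k] has_derivative_coord
  consider "i = 1" | "i = 2" | "i = 3" using exhaust_3 by blast
  then show "((\<lambda>p. jet p (l (p$1)) (m (p$1)) (k (p$1)) $ i) has_derivative
     (\<lambda>u. (- christ q q' p u (jet p (l (p$1)) (m (p$1)) (k (p$1)))) $ i)) (at p)"
  proof cases
    case 1
    then show ?thesis using y has_derivative_of_coord[OF l]
      by (simp add: jet_def christ_def mult_ac)
  next
    case 2
    then show ?thesis using y
      by (auto simp: jet_def christ_def fun_eq_iff field_simps intro!: derivative_eq_intros D)
  next
    case 3
    then show ?thesis using y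
      by (auto simp: jet_def christ_def fun_eq_iff field_simps power2_eq_square intro!: derivative_eq_intros D)
  qed
qed

lemma has_derivative_frame:
  assumes p: "p \<in> good_set d" and P: "is_solution (rat_eval n d) U P" "p $ 1 \<in> U"
  shows "((\<lambda>p. frame (rat_eval n d (p$1)) p (P (p$1)) *v k) has_derivative
     (\<lambda>u. - christ (rat_eval n d (p$1)) (rat_eval' n d (p$1)) p u (frame (rat_eval n d (p$1)) p (P (p$1)) *v k))) (at p)"
proof -
  have d: "poly d (p $ 1) \<noteq> 0" using p by (simp add: good_set_def)
  note D = is_solutionD(2,3)[OF P] rat_eval_deriv[OF d]
  show ?thesis
    unfolding frame_mult_vec
    by (rule has_derivative_jet[OF p])
      (auto simp: quad_defs algebra_simps intro!: derivative_eq_intros D)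
qed

lemma horizontal_frame:
  assumes "p \<in> good_set d" "is_solution (rat_eval n d) U P" "p $ 1 \<in> U"
  shows "horizontal_at (rec_conn n d) (\<lambda>p. frame (rat_eval n d (p$1)) p (P (p$1)) *v k) p"
  unfolding horizontal_at_def christoffel_rec_conn[OF assms(1)] by (rule has_derivative_frame[OF assms])

text \<open>Coefficients of the quadratic form with prescribed \<open>quad0\<close>,
  \<open>quad1\<close>, \<open>quad2\<close>; the entries come from the symmetric square of the
  inverse of \<open>P\<close>.\<close>

definition frame_coord :: "complex^2^2 \<Rightarrow> complex \<Rightarrow> complex \<Rightarrow> complex \<Rightarrow> complex^3" where
  "frame_coord P l m k = vector [
     P$2$2 * P$2$2 * k - 2 * (P$2$1 * P$2$2) * m + P$2$1 * P$2$1 * l,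
     - 2 * (P$1$2 * P$2$2) * k + 2 * (P$1$1 * P$2$2 + P$1$2 * P$2$1) * m - 2 * (P$1$1 * P$2$1) * l,
     P$1$2 * P$1$2 * k - 2 * (P$1$1 * P$1$2) * m + P$1$1 * P$1$1 * l]"

lemma frame_coord:
  assumes "det P = 1"
  shows "quad0 (frame_coord P l m k) P = l" "quad1 (frame_coord P l m k) P = m" "quad2 (frame_coord P l m k) P = k"
proof -
  obtain a b c d where P: "P = mat2 a b c d" by (rule mat2_cases)
  have e: "(a * d - b * c) ^ 2 = 1" using assms by (simp add: P)
  have "quad0 (frame_coord P l m k) P = (a * d - b * c)^2 * l"
    "quad1 (frame_coord P l m k) P = (a * d - b * c)^2 * m"
    "quad2 (frame_coord P l m k) P = (a * d - b * c)^2 * k"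
    by (simp_all add: P quad_defs frame_coord_def field_simps power2_eq_square)
  then show "quad0 (frame_coord P l m k) P = l" "quad1 (frame_coord P l m k) P = m" "quad2 (frame_coord P l m k) P = k"
    by (simp_all add: e)
qed

text \<open>Variation of constants. The functions \<open>l\<close>, \<open>m\<close>,
  \<open>k\<close> read off from \<open>Y\<close> what \<open>quad0\<close>, \<open>quad1\<close>,
  \<open>quad2\<close> would be, \<open>C\<close> are the resulting coordinates in the horizontal
  frame, and their derivative vanishes.\<close>

lemma horizontal_unique:
  assumes W: "open W" "connected W" "W \<subseteq> good_set d"
    and P: "is_solution (rat_eval n d) U P" "\<And>p. p \<in> W \<Longrightarrow> p $ 1 \<in> U"
    and Y: "\<And>p. p \<in> W \<Longrightarrow> horizontal_at (rec_conn n d) Y p"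
  shows "\<exists>k. \<forall>p\<in>W. Y p = frame (rat_eval n d (p$1)) p (P (p$1)) *v k"
proof -
  define l m k where "l p = Y p $ 1" and "m p = Y p $ 2 / p $ 2"
    and "k p = - (Y p $ 3 + p $ 3 * (Y p $ 2 / p $ 2)) / p $ 2 - rat_eval n d (p $ 1) * Y p $ 1" for p
  define C where "C p = frame_coord (P (p $ 1)) (l p) (m p) (k p)" for p
  have y: "p $ 2 \<noteq> 0" "poly d (p $ 1) \<noteq> 0" if "p \<in> W" for p using W(3) that by (auto simp: good_set_def)
  have YC: "Y p = frame (rat_eval n d (p$1)) p (P (p$1)) *v C p" if "p \<in> W" for p
    using y[OF that] is_solutionD(1)[OF P(1) P(2)[OF that]]
    unfolding C_def frame_mult_vec vec_eq_iff forall_3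
    by (simp add: frame_coord jet_def l_def m_def k_def field_simps)
  have "(C has_derivative (\<lambda>u. 0)) (at p)" if p: "p \<in> W" for p
  proof -
    let ?q = "rat_eval n d (p$1)" and ?q' = "rat_eval' n d (p$1)"
    have pg: "p \<in> good_set d" using p W(3) by blast
    have "(Y has_derivative (\<lambda>u. - christ ?q ?q' p u (Y p))) (at p)"
      using Y[OF p] unfolding horizontal_at_def christoffel_rec_conn[OF pg] .
    note D = has_derivative_vec_nth[OF this] has_derivative_coord
      has_derivative_of_coord[OF rat_eval_deriv[OF y(2)[OF p], of n]]
    have dl: "(l has_derivative (\<lambda>u. 2 * m p * u $ 1)) (at p)"
      unfolding l_def[abs_def] m_def
      by (rule has_derivative_eq_rhs[OF D(1)]) (simp add: christ_def fun_eq_iff)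
    have dm: "(m has_derivative (\<lambda>u. (k p + ?q * l p) * u $ 1)) (at p)"
      unfolding m_def[abs_def] k_def l_def using y[OF p]
      by (auto intro!: derivative_eq_intros D simp: christ_def fun_eq_iff field_simps)
    have dk: "(k has_derivative (\<lambda>u. 2 * ?q * m p * u $ 1)) (at p)"
      unfolding k_def[abs_def] m_def using y[OF p]
      by (auto intro!: derivative_eq_intros D simp: christ_def fun_eq_iff field_simps power2_eq_square)
    have dP: "((\<lambda>p. P (p$1) $ i $ 2) has_derivative (\<lambda>u. P (p$1) $ i $ 1 * u $ 1)) (at p)"
      "((\<lambda>p. P (p$1) $ i $ 1) has_derivative (\<lambda>u. ?q * P (p$1) $ i $ 2 * u $ 1)) (at p)" for i
      by (intro has_derivative_of_coord is_solutionD[OF P(1) P(2)[OF p]])+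
    show ?thesis
      unfolding C_def[abs_def]
    proof (rule has_derivative_vec)
      fix i :: 3
      consider "i = 1" | "i = 2" | "i = 3" using exhaust_3 by blast
      then show "((\<lambda>p. frame_coord (P (p $ 1)) (l p) (m p) (k p) $ i) has_derivative (\<lambda>u. 0 $ i)) (at p)"
        by cases (auto intro!: derivative_eq_intros dP dl dm dk simp: frame_coord_def fun_eq_iff algebra_simps)
    qed
  qed
  then have "C p = C p'" if "p \<in> W" "p' \<in> W" for p p'
    using has_derivative_zero_unique_connected[OF W(1,2)] that by blast
  then show ?thesis using YC by metis
qed

section \<open>Reductions and monodromy\<close>

text \<open>Analytic continuation inside one connected open set. Both signs are left free: frames do
  not see them, and square roots do not determine them.\<close>

definition step :: "complex poly \<Rightarrow> complex poly \<Rightarrow> complex \<times> (complex^2^2) \<Rightarrow> complex \<times> (complex^2^2) \<Rightarrow> bool" where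
  "step n d a b \<longleftrightarrow> (\<exists>U P. open U \<and> connected U \<and> U \<subseteq> {x. poly d x \<noteq> 0} \<and> is_solution (rat_eval n d) U P \<and>
     fst a \<in> U \<and> fst b \<in> U \<and> (snd a = P (fst a) \<or> snd a = - P (fst a)) \<and> (snd b = P (fst b) \<or> snd b = - P (fst b)))"

abbreviation reach :: "complex poly \<Rightarrow> complex poly \<Rightarrow> complex \<times> (complex^2^2) \<Rightarrow> complex \<times> (complex^2^2) \<Rightarrow> bool" where
  "reach n d \<equiv> (step n d)\<^sup>*\<^sup>*"

lemma step_sym: "step n d a b \<Longrightarrow> step n d b a"
  unfolding step_def by blast

lemma reach_sym: "reach n d a b \<Longrightarrow> reach n d b a"
  using step_sym sympD[OF symp_rtranclp] by (metis sympI)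

lemma mult_minus_mat2: "g ** (- A) = - (g ** A)" for g A :: "complex^2^2"
  by (simp add: vec_eq_iff matrix_matrix_mult_def sum_negf)

lemma step_mult: "step n d a b \<Longrightarrow> det g = 1 \<Longrightarrow> step n d (fst a, g ** snd a) (fst b, g ** snd b)"
  unfolding step_def
proof (elim exE conjE)
  fix U P assume *: "open U" "connected U" "U \<subseteq> {x. poly d x \<noteq> 0}" "is_solution (rat_eval n d) U P"
     "fst a \<in> U" "fst b \<in> U" "(snd a = P (fst a) \<or> snd a = - P (fst a))" "(snd b = P (fst b) \<or> snd b = - P (fst b))"
    "det g = 1"
  then show "\<exists>U P. open U \<and> connected U \<and> U \<subseteq> {x. poly d x \<noteq> 0} \<and> is_solution (rat_eval n d) U P \<and>
     fst (fst a, g ** snd a) \<in> U \<and> fst (fst b, g ** snd b) \<in> U \<and> (snd (fst a, g ** snd a) = P (fst (fst a, g ** snd a)) \<or> snd (fst a, g ** snd a) = - P (fst (fst a, g ** snd a))) \<and> (snd (fst b, g ** snd b) = P (fst (fst b, g ** snd b)) \<or> snd (fst b, g ** snd b) = - P (fst (fst b, g ** snd b)))"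
    by (intro exI[of _ U] exI[of _ "\<lambda>x. g ** P x"]) (auto intro: is_solution_mult simp: mult_minus_mat2)
qed

lemma reach_mult:
  assumes "reach n d a b" "det g = 1"
  shows "reach n d (fst a, g ** snd a) (fst b, g ** snd b)"
  using assms(1)
proof induction
  case (step b c)
  then show ?case using step_mult[OF step.hyps(2) assms(2)] by (meson rtranclp.rtrancl_into_rtrancl)
qed simp

text \<open>Products of two entries are invariant under the sign change of the matrix and can be
  recovered from a frame, see \<open>frame_prod\<close>; equations in them descend to the frame
  bundle.\<close>

definition even_coords :: "(complex \<times> (complex^2^2) \<Rightarrow> complex) set" where
  "even_coords = insert (\<lambda>a. fst a) {f. \<exists>i j k l. f = (\<lambda>a. snd a $ i $ j * snd a $ k $ l)}"

text \<open>\<open>Z\<close> is an algebraic reduction to \<open>G\<close> of the bundle of solution matrices: its fibres are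
  orbits of \<open>G\<close>, and it contains the local solutions through its points.\<close>

definition reduction :: "complex poly \<Rightarrow> complex poly \<Rightarrow> (complex^2^2) set \<Rightarrow> (complex \<times> (complex^2^2)) set \<Rightarrow> bool" where
  "reduction n d G Z \<longleftrightarrow> d \<noteq> 0 \<and> alg_group G \<and>
     (\<forall>x P. (x, P) \<in> Z \<longrightarrow> poly d x \<noteq> 0 \<and> det P = 1) \<and>
     (\<forall>x P P'. (x, P) \<in> Z \<longrightarrow> det P' = 1 \<longrightarrow> ((x, P') \<in> Z \<longleftrightarrow> P' ** adj2 P \<in> G)) \<and>
     (\<forall>x. poly d x \<noteq> 0 \<longrightarrow> (\<exists>r>0. \<exists>P. ball x r \<subseteq> {x. poly d x \<noteq> 0} \<and> is_solution (rat_eval n d) (ball x r) P \<and>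
        (\<forall>y\<in>ball x r. (y, P y) \<in> Z))) \<and>
     (\<exists>E\<subseteq>polyfun even_coords. \<forall>x P. poly d x \<noteq> 0 \<longrightarrow> det P = 1 \<longrightarrow> ((x, P) \<in> Z \<longleftrightarrow> (\<forall>f\<in>E. f (x, P) = 0)))"

lemma reductionD:
  assumes "reduction n d G Z"
  shows "d \<noteq> 0" "alg_group G" "(x, P) \<in> Z \<Longrightarrow> poly d x \<noteq> 0" "(x, P) \<in> Z \<Longrightarrow> det P = 1"
    "(x, P) \<in> Z \<Longrightarrow> det P' = 1 \<Longrightarrow> (x, P') \<in> Z \<longleftrightarrow> P' ** adj2 P \<in> G"
    "poly d x \<noteq> 0 \<Longrightarrow> \<exists>r>0. \<exists>P. ball x r \<subseteq> {x. poly d x \<noteq> 0} \<and> is_solution (rat_eval n d) (ball x r) P \<and>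
        (\<forall>y\<in>ball x r. (y, P y) \<in> Z)"
    "\<exists>E\<subseteq>polyfun even_coords. \<forall>x P. poly d x \<noteq> 0 \<longrightarrow> det P = 1 \<longrightarrow> ((x, P) \<in> Z \<longleftrightarrow> (\<forall>f\<in>E. f (x, P) = 0))"
  using assms unfolding reduction_def by blast+

lemma reduction_mult:
  assumes R: "reduction n d G Z" and P: "(x, P) \<in> Z" and g: "g \<in> G"
  shows "(x, g ** P) \<in> Z"
proof -
  note dP = reductionD(4)[OF R P]
  have "det (g ** P) = 1" using dP alg_groupD(1)[OF reductionD(2)[OF R] g] by (simp add: det_mul)
  then show ?thesis
    using reductionD(5)[OF R P, of "g ** P"] g by (simp add: mult_adj2_cancel[OF dP])
qed

lemma reduction_factor:
  assumes R: "reduction n d G Z" and P: "(x, P) \<in> Z" "(x, P') \<in> Z"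
  shows "\<exists>g\<in>G. P' = g ** P"
proof
  note dP = reductionD(4)[OF R P(1)]
  show "P' ** adj2 P \<in> G" using reductionD(5)[OF R P(1)] P(2) reductionD(4)[OF R P(2)] by blast
  show "P' = P' ** adj2 P ** P" by (simp add: mult_adj2_cancel[OF dP])
qed

lemma connected_nonroots: "d \<noteq> 0 \<Longrightarrow> connected {x::complex. poly d x \<noteq> 0}"
proof -
  assume "d \<noteq> 0"
  then have "connected (UNIV - {x. poly d x = 0})"
    by (intro connected_open_delete_finite poly_roots_finite) auto
  moreover have "UNIV - {x. poly d x = 0} = {x. poly d x \<noteq> 0}" by blast
  ultimately show ?thesis by simp
qed

lemma reduction_step_refl:
  assumes R: "reduction n d G Z" and P: "(x, P) \<in> Z"
  shows "step n d (x, P) (x, P)"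
proof -
  obtain r P1 where r: "r > 0" "ball x r \<subseteq> {x. poly d x \<noteq> 0}" "is_solution (rat_eval n d) (ball x r) P1"
    "\<And>y. y \<in> ball x r \<Longrightarrow> (y, P1 y) \<in> Z"
    using reductionD(6)[OF R reductionD(3)[OF R P]] by blast
  have "(x, P1 x) \<in> Z" using r by simp
  then obtain g where g: "g \<in> G" "P = g ** P1 x" using reduction_factor[OF R _ P] by blast
  have "is_solution (rat_eval n d) (ball x r) (\<lambda>y. g ** P1 y)"
    using is_solution_mult[OF r(3)] alg_groupD(1)[OF reductionD(2)[OF R] g(1)] by blast
  then show ?thesis
    unfolding step_def using r g(2) by (intro exI[of _ "ball x r"] exI[of _ "\<lambda>y. g ** P1 y"]) auto
qed

text \<open>Continuation over the connected complement of the roots of \<open>d\<close>, one disc at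
  a time: in a disc every element of \<open>Z\<close> is a translate by \<open>G\<close> of the
  local solution, which is again a solution inside \<open>Z\<close>.\<close>

lemma reduction_reach_all:
  assumes R: "reduction n d G Z" and P0: "(x0, P0) \<in> Z" and x: "poly d x \<noteq> 0"
  shows "\<exists>P. (x, P) \<in> Z \<and> reach n d (x0, P0) (x, P)"
proof (rule connected_induction_simple[OF connected_nonroots[OF reductionD(1)[OF R]],
      where P = "\<lambda>x. \<exists>P. (x, P) \<in> Z \<and> reach n d (x0, P0) (x, P)" and a = x0 and b = x])
  show "x0 \<in> {x. poly d x \<noteq> 0}" "x \<in> {x. poly d x \<noteq> 0}" using x reductionD(3)[OF R P0] by simp_all
  show "\<exists>P. (x0, P) \<in> Z \<and> reach n d (x0, P0) (x0, P)" using P0 by blast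
  fix a assume a: "a \<in> {x. poly d x \<noteq> 0}"
  then obtain r P1 where r: "r > 0" "ball a r \<subseteq> {x. poly d x \<noteq> 0}" "is_solution (rat_eval n d) (ball a r) P1"
    "\<And>y. y \<in> ball a r \<Longrightarrow> (y, P1 y) \<in> Z"
    using reductionD(6)[OF R, of a] by blast
  have "\<exists>P. (z, P) \<in> Z \<and> reach n d (x0, P0) (z, P)"
    if yz: "y \<in> ball a r" "z \<in> ball a r" and P: "(y, P) \<in> Z" "reach n d (x0, P0) (y, P)" for y z P
  proof -
    obtain g where g: "g \<in> G" "P = g ** P1 y" using reduction_factor[OF R r(4)[OF yz(1)] P(1)] by blast
    have "is_solution (rat_eval n d) (ball a r) (\<lambda>y. g ** P1 y)"
      using is_solution_mult[OF r(3)] alg_groupD(1)[OF reductionD(2)[OF R] g(1)] by blast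
    then have "step n d (y, P) (z, g ** P1 z)"
      unfolding step_def using r g(2) yz by (intro exI[of _ "ball a r"] exI[of _ "\<lambda>y. g ** P1 y"]) auto
    then show ?thesis
      using P(2) reduction_mult[OF R r(4)[OF yz(2)] g(1)] by (meson rtranclp.rtrancl_into_rtrancl)
  qed
  then show "\<exists>T. openin (top_of_set {x. poly d x \<noteq> 0}) T \<and> a \<in> T \<and>
      (\<forall>y\<in>T. \<forall>z\<in>T. (\<exists>P. (y, P) \<in> Z \<and> reach n d (x0, P0) (y, P)) \<longrightarrow> (\<exists>P. (z, P) \<in> Z \<and> reach n d (x0, P0) (z, P)))"
    using r(1,2) by (intro exI[of _ "ball a r"]) (auto intro: open_subset)
qed

section \<open>The frame bundle: leaves, and the equations of a reduction\<close>

definition reduction_frames ::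
    "complex poly \<Rightarrow> complex poly \<Rightarrow> (complex \<times> (complex^2^2)) set \<Rightarrow> ((complex^3) \<times> (complex^3^3)) set" where
  "reduction_frames n d Z = {(p, frame (rat_eval n d (p$1)) p P) | p P. p \<in> good_set d \<and> (p$1, P) \<in> Z}"

lemma column_matrix_mult: "column j (A ** B) = A *v column j B"
  by (simp add: vec_eq_iff column_def matrix_matrix_mult_def matrix_vector_mult_def)

lemma column_eq_mult_axis: "column j A = A *v axis j 1" for A :: "complex^3^3"
  by (simp add: vec_eq_iff column_def matrix_vector_mult_def axis_def if_distrib sum.delta cong: if_cong)

lemma invertible_cancel_left: "invertible A \<Longrightarrow> A ** B = A ** C \<Longrightarrow> B = C"
  for A :: "complex^3^3" and B C :: "complex^3^3"
  by (metis invertible_def matrix_mul_assoc matrix_mul_lid)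

text \<open>On a small ball a horizontal frame is the standard one times a constant matrix
  \<open>C\<close>. A single point in the set forces \<open>C = sym_sq g\<close> with
  \<open>g\<close> in \<open>G\<close>, and then the whole piece lies in it; connectedness of the
  plaque does the rest.\<close>

lemma plaque_reduction_frames:
  assumes R: "reduction n d G Z" and S: "plaque (rec_conn n d) (good_set d) S" "a \<in> S" "b \<in> S"
    and a: "a \<in> reduction_frames n d Z"
  shows "b \<in> reduction_frames n d Z"
proof -
  obtain U \<sigma> where U: "open U" "connected U" "U \<subseteq> good_set d" "horizontal_frame_on (rec_conn n d) U \<sigma>"
    "S = (\<lambda>x. (x, \<sigma> x)) ` U"
    using S(1) unfolding plaque_def by blast
  obtain pa pb where pab: "pa \<in> U" "pb \<in> U" "a = (pa, \<sigma> pa)" "b = (pb, \<sigma> pb)" using S(2,3) U(5) by blast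
  have "(pb, \<sigma> pb) \<in> reduction_frames n d Z"
  proof (rule connected_induction_simple[OF U(2) pab(1,2), where P = "\<lambda>p. (p, \<sigma> p) \<in> reduction_frames n d Z"])
    show "(pa, \<sigma> pa) \<in> reduction_frames n d Z" using a pab by simp
    fix p assume p: "p \<in> U"
    then have "poly d (p $ 1) \<noteq> 0" using U(3) by (auto simp: good_set_def)
    then obtain r P1 where r: "r > 0" "ball (p$1) r \<subseteq> {x. poly d x \<noteq> 0}" "is_solution (rat_eval n d) (ball (p$1) r) P1"
      "\<And>y. y \<in> ball (p$1) r \<Longrightarrow> (y, P1 y) \<in> Z"
      using reductionD(6)[OF R, of "p $ 1"] by blast
    obtain e where e: "e > 0" "ball p e \<subseteq> U" using U(1) p open_contains_ball by blast
    define W where "W = ball p (min e r)"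
    have W: "open W" "connected W" "W \<subseteq> good_set d" "p \<in> W" "W \<subseteq> U"
      using e r(1) U(3) by (auto simp: W_def)
    have W1: "p' $ 1 \<in> ball (p$1) r" if "p' \<in> W" for p'
      using that dist_vec_nth_le[of p 1 p'] by (simp add: W_def)
    have "\<exists>k. \<forall>p\<in>W. column j (\<sigma> p) = frame (rat_eval n d (p$1)) p (P1 (p$1)) *v k" for j
      using horizontal_unique[OF W(1-3) r(3) W1, of "\<lambda>p. column j (\<sigma> p)"] U(4) W(5)
      unfolding horizontal_frame_on_def by blast
    then obtain k where k: "\<And>j p. p \<in> W \<Longrightarrow> column j (\<sigma> p) = frame (rat_eval n d (p$1)) p (P1 (p$1)) *v k j" by metis
    define C where "C = (\<chi> i j. k j $ i)"
    have C: "\<sigma> p' = frame (rat_eval n d (p'$1)) p' (P1 (p'$1)) ** C" if "p' \<in> W" for p'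
    proof -
      have "column j (\<sigma> p') = column j (frame (rat_eval n d (p'$1)) p' (P1 (p'$1)) ** C)" for j
        using k[OF that, of j] by (simp add: column_matrix_mult) (simp add: C_def column_def vec_lambda_eta)
      then show ?thesis by (simp add: vec_eq_iff column_def)
    qed
    have "(p2, \<sigma> p2) \<in> reduction_frames n d Z" if p12: "p1 \<in> W" "p2 \<in> W" and i: "(p1, \<sigma> p1) \<in> reduction_frames n d Z" for p1 p2
    proof -
      obtain P where P: "\<sigma> p1 = frame (rat_eval n d (p1$1)) p1 P" "(p1$1, P) \<in> Z" "p1 \<in> good_set d"
        using i unfolding reduction_frames_def by blast
      obtain g where g: "g \<in> G" "P = g ** P1 (p1$1)" using reduction_factor[OF R r(4)[OF W1[OF p12(1)]] P(2)] by blast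
      have "frame (rat_eval n d (p1$1)) p1 (P1 (p1$1)) ** C = frame (rat_eval n d (p1$1)) p1 (P1 (p1$1)) ** sym_sq g"
        using P(1) C[OF p12(1)] by (simp add: g(2) frame_mult)
      then have "C = sym_sq g"
        using invertible_cancel_left[OF invertible_frame[OF reductionD(4)[OF R r(4)[OF W1[OF p12(1)]]] P(3)]] by blast
      then have "\<sigma> p2 = frame (rat_eval n d (p2$1)) p2 (g ** P1 (p2$1))"
        using C[OF p12(2)] by (simp add: frame_mult)
      moreover have "(p2$1, g ** P1 (p2$1)) \<in> Z" by (intro reduction_mult[OF R r(4)[OF W1[OF p12(2)]] g(1)])
      ultimately show ?thesis using W(3) p12(2) unfolding reduction_frames_def by blast
    qed
    moreover have "openin (top_of_set U) W" by (rule open_subset[OF W(5,1)])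
    ultimately show "\<exists>T. openin (top_of_set U) T \<and> p \<in> T \<and> (\<forall>x\<in>T. \<forall>y\<in>T. (x, \<sigma> x) \<in> reduction_frames n d Z \<longrightarrow> (y, \<sigma> y) \<in> reduction_frames n d Z)"
      using W(4) by blast
  qed
  then show ?thesis using pab by simp
qed

lemma leaf_subset_reduction_frames:
  assumes R: "reduction n d G Z" and a: "a \<in> reduction_frames n d Z"
  shows "leaf (rec_conn n d) (good_set d) a \<subseteq> reduction_frames n d Z"
proof
  fix b assume "b \<in> leaf (rec_conn n d) (good_set d) a"
  then have "(\<lambda>a b. \<exists>S. plaque (rec_conn n d) (good_set d) S \<and> a \<in> S \<and> b \<in> S)\<^sup>*\<^sup>* a b" by (simp add: leaf_def)
  then show "b \<in> reduction_frames n d Z"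
    by induction (use a plaque_reduction_frames[OF R] in blast)+
qed

lemma connected_coordinate_box:
  assumes "connected U" shows "connected {p::complex^3. p $ 1 \<in> U \<and> p $ 2 \<noteq> 0}"
proof -
  define f :: "complex \<times> complex \<times> complex \<Rightarrow> complex^3" where
    "f t = (\<chi> i. if i = 1 then fst t else if i = 2 then fst (snd t) else snd (snd t))" for t
  have "continuous_on A f" for A
    unfolding f_def
  proof (rule continuous_on_vec_lambda)
    fix i :: 3
    show "continuous_on A (\<lambda>t. if i = 1 then fst t else if i = 2 then fst (snd t) else snd (snd t))"
      by (cases "i = 1"; cases "i = 2") (auto intro!: continuous_intros)
  qed
  moreover have "connected (U \<times> (- {0::complex}) \<times> (UNIV :: complex set))"
    using assms by (intro connected_Times connected_UNIV connected_punctured_universe) auto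
  ultimately have "connected (f ` (U \<times> (- {0}) \<times> UNIV))"
    by (intro connected_continuous_image) auto
  also have "f ` (U \<times> (- {0}) \<times> UNIV) = {p. p $ 1 \<in> U \<and> p $ 2 \<noteq> 0}"
  proof safe
    fix p :: "complex^3" assume "p $ 1 \<in> U" "p $ 2 \<noteq> 0"
    then show "p \<in> f ` (U \<times> (- {0}) \<times> UNIV)"
      by (intro image_eqI[of _ _ "(p$1, p$2, p$3)"]) (auto simp: f_def vec_eq_iff forall_3)
  qed (auto simp: f_def)
  finally show ?thesis .
qed

lemma horizontal_frame_on_frame:
  assumes "W \<subseteq> good_set d" "is_solution (rat_eval n d) U P" "\<And>p. p \<in> W \<Longrightarrow> p $ 1 \<in> U"
  shows "horizontal_frame_on (rec_conn n d) W (\<lambda>p. frame (rat_eval n d (p$1)) p (P (p$1)))"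
  unfolding horizontal_frame_on_def column_eq_mult_axis
  using assms by (auto intro!: invertible_frame horizontal_frame is_solutionD)

text \<open>The plaque lies over the whole tube of points with first coordinate in \<open>U\<close>
  and second coordinate nonzero, so the other coordinates of the two end points are
  arbitrary.\<close>

lemma step_plaque:
  assumes "step n d a b" and p: "p \<in> good_set d" "p $ 1 = fst a" and p': "p' \<in> good_set d" "p' $ 1 = fst b"
  shows "\<exists>S. plaque (rec_conn n d) (good_set d) S \<and> (p, frame (rat_eval n d (p$1)) p (snd a)) \<in> S \<and>
    (p', frame (rat_eval n d (p'$1)) p' (snd b)) \<in> S"
proof -
  obtain U P where U: "open U" "connected U" "U \<subseteq> {x. poly d x \<noteq> 0}" "is_solution (rat_eval n d) U P"
     "fst a \<in> U" "fst b \<in> U" "(snd a = P (fst a) \<or> snd a = - P (fst a))" "(snd b = P (fst b) \<or> snd b = - P (fst b))"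
    using assms(1) unfolding step_def by blast
  define W where "W = {p::complex^3. p $ 1 \<in> U \<and> p $ 2 \<noteq> 0}"
  define \<sigma> where "\<sigma> p = frame (rat_eval n d (p$1)) p (P (p$1))" for p
  have "open W"
  proof -
    have "open ((\<lambda>p::complex^3. p $ 1) -` U \<inter> (\<lambda>p::complex^3. p $ 2) -` (- {0}))"
      using U(1) by (intro open_Int open_vimage_vec_nth) auto
    moreover have "(\<lambda>p::complex^3. p $ 1) -` U \<inter> (\<lambda>p::complex^3. p $ 2) -` (- {0}) = W" by (auto simp: W_def)
    ultimately show ?thesis by simp
  qed
  moreover have W: "W \<subseteq> good_set d" using U(3) by (auto simp: W_def good_set_def)
  moreover have "horizontal_frame_on (rec_conn n d) W \<sigma>"
    unfolding \<sigma>_def by (rule horizontal_frame_on_frame[OF W U(4)]) (simp add: W_def)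
  ultimately have "plaque (rec_conn n d) (good_set d) ((\<lambda>p. (p, \<sigma> p)) ` W)"
    using connected_coordinate_box[OF U(2)] unfolding plaque_def W_def by blast
  moreover have "p \<in> W" "p' \<in> W" using p p' U(5,6) by (auto simp: W_def good_set_def)
  moreover have "frame (rat_eval n d (p$1)) p (snd a) = \<sigma> p" "frame (rat_eval n d (p'$1)) p' (snd b) = \<sigma> p'"
    using U(7,8) p p' by (auto simp: \<sigma>_def frame_minus)
  ultimately show ?thesis by force
qed

lemma reach_leaf:
  assumes R: "reduction n d G Z" and a: "a \<in> Z" and reach: "reach n d a b"
    and p: "p \<in> good_set d" "p $ 1 = fst a" and p': "p' \<in> good_set d" "p' $ 1 = fst b"
  shows "(p', frame (rat_eval n d (p'$1)) p' (snd b)) \<in> leaf (rec_conn n d) (good_set d) (p, frame (rat_eval n d (p$1)) p (snd a))"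
proof -
  \<comment> \<open>At least one step is required: even for \<open>a = b\<close> the points
    \<open>p\<close> and \<open>p'\<close> may differ in their last two coordinates.\<close>
  have "(step n d)\<^sup>+\<^sup>+ a b"
    using reach reduction_step_refl[OF R, of "fst a" "snd a"] a
    by (metis prod.collapse rtranclpD tranclp.r_into_trancl)
  then show ?thesis
    using p'
  proof (induction arbitrary: p')
    case (base b)
    then show ?case using step_plaque[OF base(1) p base(2,3)] by (auto simp: leaf_def intro: r_into_rtranclp)
  next
    case (step b c)
    \<comment> \<open>Any good point over the intermediate value serves; \<open>y = 1\<close>,
      \<open>z = 0\<close> is a choice.\<close>
    define p1 :: "complex^3" where "p1 = vector [fst b, 1, 0]"
    have "poly d (fst b) \<noteq> 0" using step(2) unfolding step_def by blast
    then have p1: "p1 \<in> good_set d" "p1 $ 1 = fst b" by (simp_all add: p1_def good_set_def)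
    show ?case
      using step(3)[OF p1] step_plaque[OF step(2) p1 step(4,5)] unfolding leaf_def mem_Collect_eq
      by (auto elim: rtranclp.rtrancl_into_rtrancl)
  qed
qed

text \<open>Recovers \<open>P $ i $ j * P $ k $ l\<close> from the frame. The column
  \<open>c\<close> encodes the two row indices. Products inside the second column are in the first
  row of \<open>F\<close>, products inside the first column in the third, and the second row holds
  half of a mixed sum, which determinant 1 splits by adding or subtracting 1/2.\<close>

definition frame_prod :: "complex \<Rightarrow> complex^3 \<Rightarrow> complex^3^3 \<Rightarrow> 2 \<Rightarrow> 2 \<Rightarrow> 2 \<Rightarrow> 2 \<Rightarrow> complex" where
  "frame_prod q p F i j k l =
    (let c = (if i = k then (if i = 1 then 1 else 3) else 2) :: 3; M = F$2$c * (1 / p$2) in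
     if j = l then
       (if j = 2 then F$1$c else - (F$3$c + p$3 * M) * (1 / p$2) - q * F$1$c)
     else if i = k then M
     else if i = j then M + 1 / 2 else M - 1 / 2)"

lemma frame_prod_frame:
  assumes "det P = 1" "p $ 2 \<noteq> 0"
  shows "frame_prod q p (frame q p P) i j k l = P$i$j * P$k$l"
proof -
  obtain a b c d where P: "P = mat2 a b c d" by (rule mat2_cases)
  have ad: "a * d = 1 + b * c" using assms(1) by (simp add: P algebra_simps)
  show ?thesis
    using exhaust_2[of i] exhaust_2[of j] exhaust_2[of k] exhaust_2[of l] assms(2)
    by (elim disjE; simp add: P frame_prod_def Let_def frame_def field_simps ad)
qed

lemma frame_prod_det: "frame_prod q p F 1 1 2 2 - frame_prod q p F 1 2 2 1 = 1"
  by (simp add: frame_prod_def Let_def)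

text \<open>The relations say that the tensor \<open>s\<close> of would-be products has rank one.
  Some diagonal entry is nonzero, since otherwise \<open>s\<close> would vanish, against
  \<open>frame_prod_det\<close>; its row divided by its square root is the matrix
  \<open>P\<close>.\<close>

lemma frame_prod_rank_one:
  assumes rel: "\<And>i j k l i' j' k' l'. frame_prod q p F i j k l * frame_prod q p F i' j' k' l' = frame_prod q p F i j i' j' * frame_prod q p F k l k' l'"
    and y: "p $ 2 \<noteq> 0"
  shows "\<exists>P. det P = 1 \<and> F = frame q p P"
proof -
  define s where "s = frame_prod q p F"
  have rel': "s i j k l * s i' j' k' l' = s i j i' j' * s k l k' l'" for i j k l i' j' k' l'
    unfolding s_def by (rule rel)
  have "\<exists>a b. s a b a b \<noteq> 0"
  proof (rule ccontr)
    assume *: "\<not> ?thesis"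
    have "s i j k l * s i j k l = 0" for i j k l
      using rel'[of i j i j k l k l] rel'[of i j k l i j k l] * by simp
    then have "s i j k l = 0" for i j k l by simp
    then show False using frame_prod_det[of q p F] by (simp flip: s_def)
  qed
  then obtain a b where ab: "s a b a b \<noteq> 0" by blast
  define r where "r = csqrt (s a b a b)"
  have r: "r * r = s a b a b" "r \<noteq> 0" using ab by (auto simp: r_def simp flip: power2_eq_square)
  define P :: "complex^2^2" where "P = (\<chi> i j. s a b i j / r)"
  have PP: "P$i$j * P$k$l = s i j k l" for i j k l
    using rel'[of a b i j a b k l] ab by (simp add: P_def r)
  have "det P = 1"
    using frame_prod_det[of q p F] by (simp add: det_2 PP s_def)
  moreover have "F = frame q p P"
  proof -
    have "frame q p P $ i $ j = F $ i $ j" for i j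
      using exhaust_3[of i] exhaust_3[of j] y
      by (elim disjE; simp add: frame_def PP; simp add: s_def frame_prod_def Let_def field_simps)
    then show ?thesis by (simp add: vec_eq_iff)
  qed
  ultimately show ?thesis by blast
qed

text \<open>Functions on the frame bundle which become polynomial after multiplication by a power of the
  equation of the complement of \<open>good_set d\<close>.\<close>

definition clearable :: "complex poly \<Rightarrow> ((complex^3) \<times> (complex^3^3) \<Rightarrow> complex) \<Rightarrow> bool" where
  "clearable d h \<longleftrightarrow> (\<exists>k. \<exists>g\<in>polyfun pair_coords. \<forall>a. fst a \<in> good_set d \<longrightarrow> g a = (poly d (fst a $ 1) * fst a $ 2) ^ k * h a)"

lemma polyfun_pair_coords: "(\<lambda>a. fst a $ i) \<in> polyfun pair_coords" "(\<lambda>a. snd a $ i $ j) \<in> polyfun pair_coords"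
  by (rule polyfun.coord; force simp: pair_coords_def vec_coords_def mat_coords_def o_def)+

lemma polyfun_disc: "(\<lambda>a. (poly d (fst a $ 1) * fst a $ 2) ^ k) \<in> polyfun pair_coords"
  by (intro polyfun_intros polyfun_pair_coords)

lemma clearable_polyfun: "f \<in> polyfun pair_coords \<Longrightarrow> clearable d f"
  unfolding clearable_def by (intro exI[of _ 0] bexI[of _ f]) auto

lemma clearable_add:
  assumes "clearable d f" "clearable d g" shows "clearable d (\<lambda>a. f a + g a)"
proof -
  let ?D = "\<lambda>a :: (complex^3) \<times> (complex^3^3). poly d (fst a $ 1) * fst a $ 2"
  obtain k u k' u' where *: "u \<in> polyfun pair_coords" "\<And>a. fst a \<in> good_set d \<Longrightarrow> u a = ?D a ^ k * f a"
    "u' \<in> polyfun pair_coords" "\<And>a. fst a \<in> good_set d \<Longrightarrow> u' a = ?D a ^ k' * g a"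
    using assms unfolding clearable_def by metis
  have "(\<lambda>a. ?D a ^ k' * u a + ?D a ^ k * u' a) \<in> polyfun pair_coords"
    by (intro polyfun.add polyfun.mult polyfun_disc *)
  then show ?thesis
    unfolding clearable_def using *(2,4)
    by (intro exI[of _ "k + k'"] bexI[of _ "\<lambda>a. ?D a ^ k' * u a + ?D a ^ k * u' a"]) (auto simp: power_add algebra_simps)
qed

lemma clearable_mult:
  assumes "clearable d f" "clearable d g" shows "clearable d (\<lambda>a. f a * g a)"
proof -
  let ?D = "\<lambda>a :: (complex^3) \<times> (complex^3^3). poly d (fst a $ 1) * fst a $ 2"
  obtain k u k' u' where *: "u \<in> polyfun pair_coords" "\<And>a. fst a \<in> good_set d \<Longrightarrow> u a = ?D a ^ k * f a"
    "u' \<in> polyfun pair_coords" "\<And>a. fst a \<in> good_set d \<Longrightarrow> u' a = ?D a ^ k' * g a"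
    using assms unfolding clearable_def by metis
  then show ?thesis
    unfolding clearable_def
    by (intro exI[of _ "k + k'"] bexI[of _ "\<lambda>a. u a * u' a"]) (auto simp: power_add algebra_simps intro: polyfun.mult)
qed

lemma clearable_const: "clearable d (\<lambda>a. c)"
  by (intro clearable_polyfun polyfun.const)

lemma clearable_minus: "clearable d f \<Longrightarrow> clearable d (\<lambda>a. - f a)"
  using clearable_mult[OF clearable_const[of d "-1"]] by simp

lemma clearable_diff: "clearable d f \<Longrightarrow> clearable d g \<Longrightarrow> clearable d (\<lambda>a. f a - g a)"
  using clearable_add[OF _ clearable_minus[of d g]] by simp

lemma clearable_rational:
  "clearable d (\<lambda>a. 1 / fst a $ 2)" "clearable d (\<lambda>a. rat_eval n d (fst a $ 1))"
  unfolding clearable_def rat_eval_def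
  by (intro exI[of _ 1] bexI[of _ "\<lambda>a. poly d (fst a $ 1)"] bexI[of _ "\<lambda>a. poly n (fst a $ 1) * fst a $ 2"];
      (intro polyfun_intros polyfun_pair_coords)?; simp add: good_set_def)+

lemma clearable_if: "clearable d f \<Longrightarrow> clearable d g \<Longrightarrow> clearable d (\<lambda>a. if b then f a else g a)"
  by (cases b) simp_all

lemmas clearable_intros = clearable_const clearable_add clearable_mult clearable_minus clearable_diff
  clearable_rational clearable_polyfun[OF polyfun_pair_coords(1)] clearable_polyfun[OF polyfun_pair_coords(2)]

lemma clearable_frame_prod: "clearable d (\<lambda>a. frame_prod (rat_eval n d (fst a $ 1)) (fst a) (snd a) i j k l)"
  unfolding frame_prod_def Let_def by (intro clearable_if clearable_intros)

text \<open>\<open>V\<close> is cut out by all polynomials vanishing on the set, and it has to be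
  seen that no further frames over the good set appear. The rank one relations and the equations of
  \<open>Z\<close> become such polynomials once denominators are cleared; the former provide
  \<open>P\<close>, the latter put it into \<open>Z\<close>.\<close>

lemma reduction_frames_closed:
  assumes R: "reduction n d G Z"
  shows "\<exists>V. zariski_closed pair_coords V \<and> reduction_frames n d Z = frame_bundle (good_set d) \<inter> V"
proof -
  define A where "A = {g\<in>polyfun pair_coords. \<forall>a\<in>reduction_frames n d Z. g a = 0}"
  define V where "V = {a. \<forall>g\<in>A. g a = 0}"
  have V: "zariski_closed pair_coords V" unfolding zariski_closed_def V_def by (intro exI[of _ A]) (auto simp: A_def)
  have vanish: "h a = 0" if h: "clearable d h" "\<And>b. b \<in> reduction_frames n d Z \<Longrightarrow> h b = 0"
    and a: "a \<in> V" "fst a \<in> good_set d" for h a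
  proof -
    obtain k g where g: "g \<in> polyfun pair_coords"
      "\<And>a. fst a \<in> good_set d \<Longrightarrow> g a = (poly d (fst a $ 1) * fst a $ 2) ^ k * h a"
      using h(1) unfolding clearable_def by blast
    have "g b = 0" if "b \<in> reduction_frames n d Z" for b
      using h(2)[OF that] g(2)[of b] that by (auto simp: reduction_frames_def)
    then have "g a = 0" using g(1) a(1) by (auto simp: V_def A_def)
    then show ?thesis using g(2)[OF a(2)] a(2) by (auto simp: good_set_def)
  qed
  have good: "p $ 2 \<noteq> 0" "poly d (p $ 1) \<noteq> 0" if "p \<in> good_set d" for p using that by (auto simp: good_set_def)
  have "a \<in> reduction_frames n d Z" if a: "a \<in> frame_bundle (good_set d)" "a \<in> V" for a
  proof -
    obtain p F where pF: "a = (p, F)" by (cases a)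
    have p: "p \<in> good_set d" using a(1) by (simp add: pF frame_bundle_def)
    let ?s = "\<lambda>a. frame_prod (rat_eval n d (fst a $ 1)) (fst a) (snd a)"
    have "?s a i j k l * ?s a i' j' k' l' - ?s a i j i' j' * ?s a k l k' l' = 0" for i j k l i' j' k' l'
      by (rule vanish[where h = "\<lambda>a. ?s a i j k l * ?s a i' j' k' l' - ?s a i j i' j' * ?s a k l k' l'"])
        (use a(2) p good in \<open>auto simp: pF reduction_frames_def frame_prod_frame reductionD(4)[OF R]
           intro!: clearable_intros clearable_frame_prod\<close>)
    then obtain P where P: "det P = 1" "F = frame (rat_eval n d (p $ 1)) p P"
      using frame_prod_rank_one[of "rat_eval n d (p $ 1)" p F] good(1)[OF p] by (auto simp: pF)
    obtain E where E: "E \<subseteq> polyfun even_coords"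
      "\<And>x P. poly d x \<noteq> 0 \<Longrightarrow> det P = 1 \<Longrightarrow> ((x, P) \<in> Z \<longleftrightarrow> (\<forall>f\<in>E. f (x, P) = 0))"
      using reductionD(7)[OF R] by blast
    have "f (p $ 1, P) = 0" if f: "f \<in> E" for f
    proof -
      have "f \<in> polyfun even_coords" using f E(1) by blast
      then have "\<exists>h. clearable d h \<and> (\<forall>p\<in>good_set d. \<forall>P. det P = 1 \<longrightarrow> h (p, frame (rat_eval n d (p $ 1)) p P) = f (p $ 1, P))"
      proof induction
        case (const c)
        then show ?case by (intro exI[of _ "\<lambda>_. c"]) (auto intro: clearable_intros)
      next
        case (coord f)
        then consider "f = (\<lambda>a. fst a)" | i j k l where "f = (\<lambda>a. snd a $ i $ j * snd a $ k $ l)"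
          unfolding even_coords_def by blast
        then show ?case
        proof cases
          case 1
          then show ?thesis by (intro exI[of _ "\<lambda>a. fst a $ 1"]) (auto intro: clearable_intros)
        next
          case 2
          then show ?thesis
            by (intro exI[of _ "\<lambda>a. ?s a i j k l"]) (auto simp: frame_prod_frame good intro: clearable_frame_prod)
        qed
      next
        case (add f g)
        then obtain h h' where "clearable d h" "clearable d h'"
          "\<forall>p\<in>good_set d. \<forall>P. det P = 1 \<longrightarrow> h (p, frame (rat_eval n d (p $ 1)) p P) = f (p $ 1, P)"
          "\<forall>p\<in>good_set d. \<forall>P. det P = 1 \<longrightarrow> h' (p, frame (rat_eval n d (p $ 1)) p P) = g (p $ 1, P)" by blast
        then show ?case by (intro exI[of _ "\<lambda>a. h a + h' a"]) (auto intro: clearable_intros)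
      next
        case (mult f g)
        then obtain h h' where "clearable d h" "clearable d h'"
          "\<forall>p\<in>good_set d. \<forall>P. det P = 1 \<longrightarrow> h (p, frame (rat_eval n d (p $ 1)) p P) = f (p $ 1, P)"
          "\<forall>p\<in>good_set d. \<forall>P. det P = 1 \<longrightarrow> h' (p, frame (rat_eval n d (p $ 1)) p P) = g (p $ 1, P)" by blast
        then show ?case by (intro exI[of _ "\<lambda>a. h a * h' a"]) (auto intro: clearable_intros)
      qed
      then obtain h where h: "clearable d h"
        "\<And>p P. p\<in>good_set d \<Longrightarrow> det P = 1 \<Longrightarrow> h (p, frame (rat_eval n d (p $ 1)) p P) = f (p $ 1, P)" by blast
      have "h b = 0" if b: "b \<in> reduction_frames n d Z" for b
      proof -
        obtain p' P' where b': "b = (p', frame (rat_eval n d (p'$1)) p' P')" "p' \<in> good_set d" "(p'$1, P') \<in> Z"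
          using b unfolding reduction_frames_def by blast
        then show ?thesis
          using h(2) E(2)[OF reductionD(3,4)[OF R b'(3)]] reductionD(4)[OF R b'(3)] f by simp
      qed
      then have "h a = 0" using vanish[OF h(1)] a(2) p by (simp add: pF)
      then show ?thesis using h(2)[OF p P(1)] P(2) by (simp add: pF)
    qed
    then have "(p $ 1, P) \<in> Z" using E(2) good(2)[OF p] P(1) by blast
    then show ?thesis using P(2) p unfolding pF reduction_frames_def by blast
  qed
  moreover have "reduction_frames n d Z \<subseteq> frame_bundle (good_set d)"
    by (auto simp: reduction_frames_def frame_bundle_def intro: invertible_frame reductionD(4)[OF R])
  moreover have "reduction_frames n d Z \<subseteq> V" by (auto simp: V_def A_def)
  ultimately show ?thesis using V by blast
qed

lemma zariski_closed_hull: "zariski_closed C (zariski_closed C hull S)"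
proof -
  define A where "A = {g\<in>polyfun C. \<forall>a\<in>S. g a = 0}"
  have A: "A \<subseteq> polyfun C" unfolding A_def by blast
  then have cl: "zariski_closed C {x. \<forall>f\<in>A. f x = 0}" unfolding zariski_closed_def by blast
  have "zariski_closed C hull S = {x. \<forall>f\<in>A. f x = 0}"
  proof
    show "zariski_closed C hull S \<subseteq> {x. \<forall>f\<in>A. f x = 0}"
      by (rule hull_minimal[where S = "zariski_closed C", OF _ cl]) (unfold A_def, blast)
    show "{x. \<forall>f\<in>A. f x = 0} \<subseteq> zariski_closed C hull S"
      unfolding hull_def
    proof (intro subsetI InterI)
      fix x T assume x: "x \<in> {x. \<forall>f\<in>A. f x = 0}" and "T \<in> {T. zariski_closed C T \<and> S \<subseteq> T}"
      then obtain B where B: "B \<subseteq> polyfun C" "T = {x. \<forall>f\<in>B. f x = 0}" "S \<subseteq> T"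
        unfolding zariski_closed_def by blast
      then have "B \<subseteq> A" unfolding A_def by blast
      then show "x \<in> T" using x B(2) by blast
    qed
  qed
  with cl show ?thesis by simp
qed

lemma polyfun_divide: "f \<in> polyfun C \<Longrightarrow> (\<lambda>x. f x / c) \<in> polyfun C"
  using polyfun.mult[OF polyfun.const[of "1 / c"], of f] by simp

lemma polyfun_frame_mult:
  fixes P :: "complex^2^2"
  shows "(\<lambda>m. frame q p (m ** P) $ i $ j) \<in> polyfun mat_coords"
proof -
  have m: "(\<lambda>m::complex^2^2. (m ** P) $ i $ j) \<in> polyfun mat_coords" for i j
    by (intro polyfun_mat_mult polyfun_mat_coords polyfun.const)
  show ?thesis
    using exhaust_3[of i] exhaust_3[of j]
    by (elim disjE; simp add: frame_def; intro polyfun_intros polyfun_divide m)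
qed

definition monodromy :: "complex poly \<Rightarrow> complex poly \<Rightarrow> complex \<times> (complex^2^2) \<Rightarrow> (complex^2^2) set" where
  "monodromy n d a = {m. det m = 1 \<and> reach n d a (fst a, m ** snd a)}"

text \<open>One inclusion holds as the right side is relatively closed and contains the leaf. For
  the other, the matrices \<open>m\<close> whose translate of a continued frame lies in the closure
  form a closed set, since the frame is polynomial in \<open>m\<close>; it contains the monodromy,
  hence \<open>G\<close>.\<close>

lemma leaf_closure_reduction:
  assumes R: "reduction n d G Z" and a0: "(p0 $ 1, P0) \<in> Z" "p0 \<in> good_set d"
    and mon: "G \<subseteq> zariski_closed mat_coords hull monodromy n d (p0 $ 1, P0)"
  shows "leaf_closure (rec_conn n d) (good_set d) (p0, frame (rat_eval n d (p0$1)) p0 P0) = reduction_frames n d Z"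
    (is "leaf_closure _ _ ?a = _")
proof
  have a: "?a \<in> reduction_frames n d Z" using a0 unfolding reduction_frames_def by blast
  obtain V where V: "zariski_closed pair_coords V" "reduction_frames n d Z = frame_bundle (good_set d) \<inter> V"
    using reduction_frames_closed[OF R] by blast
  have "zariski_closed pair_coords hull leaf (rec_conn n d) (good_set d) ?a \<subseteq> V"
    by (rule hull_minimal) (use leaf_subset_reduction_frames[OF R a] V in auto)
  then show "leaf_closure (rec_conn n d) (good_set d) ?a \<subseteq> reduction_frames n d Z"
    unfolding leaf_closure_def V(2) by blast
  show "reduction_frames n d Z \<subseteq> leaf_closure (rec_conn n d) (good_set d) ?a"
  proof
    fix b assume b: "b \<in> reduction_frames n d Z"
    then obtain p P where pP: "b = (p, frame (rat_eval n d (p$1)) p P)" "p \<in> good_set d" "(p$1, P) \<in> Z"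
      unfolding reduction_frames_def by blast
    let ?H = "zariski_closed pair_coords hull leaf (rec_conn n d) (good_set d) ?a"
    obtain P1 where P1: "(p$1, P1) \<in> Z" "reach n d (p0$1, P0) (p$1, P1)"
      using reduction_reach_all[OF R a0(1) reductionD(3)[OF R pP(3)]] by blast
    obtain g where g: "g \<in> G" "P = g ** P1" using reduction_factor[OF R P1(1) pP(3)] by blast
    let ?\<phi> = "\<lambda>m. (p, frame (rat_eval n d (p$1)) p (m ** P1))"
    have "(\<lambda>m. c (?\<phi> m)) \<in> polyfun mat_coords" if c: "c \<in> pair_coords" for c
    proof -
      have "(\<exists>i. c = (\<lambda>a. fst a $ i)) \<or> (\<exists>i j. c = (\<lambda>a. snd a $ i $ j))"
        using c by (auto simp: pair_coords_def vec_coords_def mat_coords_def o_def)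
      then show ?thesis by (elim disjE exE) (simp_all add: polyfun_frame_mult polyfun.const)
    qed
    then have "zariski_closed mat_coords {m. ?\<phi> m \<in> ?H}"
      by (rule zariski_closed_vimage[OF zariski_closed_hull])
    moreover have "monodromy n d (p0 $ 1, P0) \<subseteq> {m. ?\<phi> m \<in> ?H}"
    proof
      fix m assume "m \<in> monodromy n d (p0 $ 1, P0)"
      then have m: "det m = 1" "reach n d (p0$1, P0) (p0$1, m ** P0)" by (auto simp: monodromy_def)
      have "reach n d (p0$1, P0) (p$1, m ** P1)"
        using m(2) reach_mult[OF P1(2) m(1)] by simp
      then have "?\<phi> m \<in> leaf (rec_conn n d) (good_set d) ?a"
        using reach_leaf[OF R a0(1) _ a0(2) _ pP(2), of "(p$1, m ** P1)"] by simp
      then have "?\<phi> m \<in> ?H" by (rule hull_inc)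
      then show "m \<in> {m. ?\<phi> m \<in> ?H}" by blast
    qed
    ultimately have "zariski_closed mat_coords hull monodromy n d (p0 $ 1, P0) \<subseteq> {m. ?\<phi> m \<in> ?H}"
      by (intro hull_minimal[where S = "zariski_closed mat_coords"])
    then have "b \<in> ?H" using mon g pP(1) by blast
    moreover have "b \<in> frame_bundle (good_set d)" using b V(2) by blast
    ultimately show "b \<in> leaf_closure (rec_conn n d) (good_set d) ?a" by (simp add: leaf_closure_def)
  qed
qed

lemma det_sym_sq: "det g = 1 \<Longrightarrow> invertible (sym_sq g)"
proof -
  assume g: "det g = 1"
  obtain a b c d where G: "g = mat2 a b c d" by (rule mat2_cases)
  have "det (sym_sq g) = (a * d - b * c)^3"
    by (simp add: G sym_sq_def det_3 power3_eq_cube algebra_simps)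
  then show ?thesis using g by (simp add: G invertible_det_nz)
qed

text \<open>The closure is a principal bundle under the image of \<open>G\<close>, so its stabilizer
  is that image: moving one point inside its fibre already determines the matrix.\<close>

lemma galois_group_reduction:
  assumes R: "reduction n d G Z" and a0: "(p0 $ 1, P0) \<in> Z" "p0 \<in> good_set d"
    and mon: "G \<subseteq> zariski_closed mat_coords hull monodromy n d (p0 $ 1, P0)"
  shows "galois_group (rec_conn n d) (good_set d) (p0, frame (rat_eval n d (p0$1)) p0 P0) = sym_sq ` G"
proof -
  note G = reductionD(2)[OF R]
  have sub: "(\<lambda>(x, F). (x, F ** sym_sq g)) ` reduction_frames n d Z \<subseteq> reduction_frames n d Z" if g: "g \<in> G" for g
    using reduction_mult[OF R _ g] by (auto simp: reduction_frames_def simp flip: frame_mult) blast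
  have "(\<lambda>(x, F). (x, F ** sym_sq g)) ` reduction_frames n d Z = reduction_frames n d Z" if g: "g \<in> G" for g
  proof
    show "reduction_frames n d Z \<subseteq> (\<lambda>(x, F). (x, F ** sym_sq g)) ` reduction_frames n d Z"
    proof
      fix b assume "b \<in> reduction_frames n d Z"
      then obtain p P where pP: "b = (p, frame (rat_eval n d (p$1)) p P)" "p \<in> good_set d" "(p$1, P) \<in> Z"
        unfolding reduction_frames_def by blast
      have "(p, frame (rat_eval n d (p$1)) p (adj2 g ** P)) \<in> reduction_frames n d Z"
        using reduction_mult[OF R pP(3) alg_groupD(5)[OF G g]] pP(2) unfolding reduction_frames_def by blast
      moreover have "b = (\<lambda>(x, F). (x, F ** sym_sq g)) (p, frame (rat_eval n d (p$1)) p (adj2 g ** P))"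
        using alg_groupD(1)[OF G g] by (simp add: pP(1) mult_adj2_cancel flip: frame_mult)
      ultimately show "b \<in> (\<lambda>(x, F). (x, F ** sym_sq g)) ` reduction_frames n d Z" by blast
    qed
  qed (rule sub[OF g])
  moreover have "g \<in> sym_sq ` G"
    if g: "(\<lambda>(x, F). (x, F ** g)) ` reduction_frames n d Z = reduction_frames n d Z" for g
  proof -
    have "(p0, frame (rat_eval n d (p0$1)) p0 P0) \<in> reduction_frames n d Z"
      using a0 unfolding reduction_frames_def by blast
    from imageI[OF this, of "\<lambda>(x, F). (x, F ** g)", unfolded g]
    obtain P where P: "frame (rat_eval n d (p0$1)) p0 P0 ** g = frame (rat_eval n d (p0$1)) p0 P" "(p0$1, P) \<in> Z"
      unfolding reduction_frames_def by auto
    obtain h where h: "h \<in> G" "P = h ** P0" using reduction_factor[OF R a0(1) P(2)] by blast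
    have "g = sym_sq h"
      using P(1) invertible_cancel_left[OF invertible_frame[OF reductionD(4)[OF R a0(1)] a0(2)]]
      unfolding h(2) frame_mult by blast
    then show ?thesis using h(1) by blast
  qed
  ultimately show ?thesis
    unfolding galois_group_def leaf_closure_reduction[OF assms]
    using det_sym_sq alg_groupD(1)[OF G] by blast
qed

text \<open>In the coordinate \<open>T = u / v\<close> the field \<open>l d/dx\<close> with these
  coefficients is \<open>(A21 T^2 - 2 A11 T - A12) d/dT\<close>, minus the infinitesimal Moebius
  action of \<open>A\<close>. The sign makes commutators correspond to brackets of fields.\<close>

definition coef_vec :: "complex^2^2 \<Rightarrow> complex^3" where
  "coef_vec A = vector [A$2$1, - 2 * A$1$1, - A$1$2]"

lemma coef_vec_add: "coef_vec (A + B) = coef_vec A + coef_vec B"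
  by (simp add: coef_vec_def vec_eq_iff forall_3)

lemma coef_vec_scale: "coef_vec (scale_mat c A) = c *s coef_vec A"
  by (simp add: coef_vec_def vec_eq_iff forall_3 scale_mat_def)

lemma sl2_mat2: "A \<in> sl2 \<Longrightarrow> \<exists>x y z. A = mat2 x y z (- x)"
  by (cases A rule: mat2_cases) (simp add: sl2_def add_eq_0_iff)

lemma coef_vec_inject: "A \<in> sl2 \<Longrightarrow> B \<in> sl2 \<Longrightarrow> coef_vec A = coef_vec B \<Longrightarrow> A = B"
  by (auto dest!: sl2_mat2 simp: coef_vec_def vec_eq_iff forall_3)

lemma coef_vec_surj: "\<exists>A\<in>sl2. coef_vec A = k"
  by (intro bexI[of _ "mat2 (- (k$2) / 2) (- (k$3)) (k$1) (k$2 / 2)"])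
    (simp_all add: coef_vec_def sl2_def vec_eq_iff forall_3)

lemma sl2_conj2: "det h = 1 \<Longrightarrow> A \<in> sl2 \<Longrightarrow> conj2 h A \<in> sl2"
  by (simp add: sl2_def trace_conj2)

lemma sl2_commutator: "commutator A B \<in> sl2"
  by (cases A rule: mat2_cases; cases B rule: mat2_cases) (simp add: sl2_def commutator_def trace_def sum_2)

lemma coef_vec_conj2:
  assumes "det g = 1" "A \<in> sl2"
  shows "coef_vec (conj2 (adj2 g) A) = sym_sq g *v coef_vec A"
proof -
  obtain x y z where A: "A = mat2 x y z (- x)" using sl2_mat2[OF assms(2)] by blast
  obtain a b c d where g: "g = mat2 a b c d" by (rule mat2_cases)
  show ?thesis
    by (simp add: A g conj2_def coef_vec_def sym_sq_def vec_eq_iff forall_3 matrix_vector_mult_def sum_3 algebra_simps)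
qed

text \<open>Primes denote the second field here, not derivatives. The bracket of
  \<open>l d/dx\<close> and \<open>l' d/dx\<close> has the coefficient
  \<open>2 * (l * m' - l' * m)\<close>; the two other formulas continue its jet. Both sides become
  homogeneous in \<open>P\<close> after multiplication by the determinant.\<close>

lemma quad_bracket:
  assumes "det P = 1" "A \<in> sl2" "B \<in> sl2"
  defines "l \<equiv> quad0 (coef_vec A) P" and "m \<equiv> quad1 (coef_vec A) P" and "k \<equiv> quad2 (coef_vec A) P"
    and "l' \<equiv> quad0 (coef_vec B) P" and "m' \<equiv> quad1 (coef_vec B) P" and "k' \<equiv> quad2 (coef_vec B) P"
  shows "quad0 (coef_vec (commutator A B)) P = 2 * (l * m' - l' * m)"
    "quad1 (coef_vec (commutator A B)) P = l * k' - l' * k"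
    "quad2 (coef_vec (commutator A B)) P = 2 * (m * k' - m' * k)"
proof -
  obtain x y z where A: "A = mat2 x y z (- x)" using sl2_mat2[OF assms(2)] by blast
  obtain x' y' z' where B: "B = mat2 x' y' z' (- x')" using sl2_mat2[OF assms(3)] by blast
  obtain a b c d where P: "P = mat2 a b c d" by (rule mat2_cases)
  have e: "a * d - b * c = 1" using assms(1) by (simp add: P)
  have "(a * d - b * c) * quad0 (coef_vec (commutator A B)) P = 2 * (l * m' - l' * m)"
    "(a * d - b * c) * quad1 (coef_vec (commutator A B)) P = l * k' - l' * k"
    "(a * d - b * c) * quad2 (coef_vec (commutator A B)) P = 2 * (m * k' - m' * k)"
    by (simp_all add: A B P l_def m_def k_def l'_def m'_def k'_def quad_defs coef_vec_def commutator_def field_simps)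
  then show "quad0 (coef_vec (commutator A B)) P = 2 * (l * m' - l' * m)"
    "quad1 (coef_vec (commutator A B)) P = l * k' - l' * k"
    "quad2 (coef_vec (commutator A B)) P = 2 * (m * k' - m' * k)"
    by (simp_all add: e)
qed

lemma christ_bracket:
  assumes "p$2 \<noteq> 0"
  shows "- christ q q' p (jet p l m k) (jet p l' m' k') + christ q q' p (jet p l' m' k') (jet p l m k) =
    jet p (2 * (l * m' - l' * m)) (l * k' - l' * k) (2 * (m * k' - m' * k) + 4 * q * (l * m' - l' * m))"
  using assms by (simp add: vec_eq_iff forall_3 christ_def jet_def field_simps power2_eq_square)

lemma open_good_set: "open (good_set d)"
proof -
  have "open {x::complex. poly d x \<noteq> 0}"
    by (intro open_Collect_neq continuous_intros)
  then have "open ((\<lambda>p::complex^3. p $ 1) -` {x. poly d x \<noteq> 0} \<inter> (\<lambda>p::complex^3. p $ 2) -` (- {0}))"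
    by (intro open_Int open_vimage_vec_nth) auto
  moreover have "(\<lambda>p::complex^3. p $ 1) -` {x. poly d x \<noteq> 0} \<inter> (\<lambda>p::complex^3. p $ 2) -` (- {0}) = good_set d"
    by (auto simp: good_set_def)
  ultimately show ?thesis by simp
qed

definition germ_field :: "complex poly \<Rightarrow> complex poly \<Rightarrow> (complex \<Rightarrow> complex^2^2) \<Rightarrow> complex^2^2 \<Rightarrow> complex^3 \<Rightarrow> complex^3" where
  "germ_field n d P A = (\<lambda>p. frame (rat_eval n d (p$1)) p (P (p$1)) *v coef_vec A)"

lemma germ_eqI: "open W \<Longrightarrow> p \<in> W \<Longrightarrow> (\<And>y. y \<in> W \<Longrightarrow> Y y = Z y) \<Longrightarrow> germ_eq p Y Z"
  unfolding germ_eq_def eventually_nhds by blast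

lemma germ_eqD: "germ_eq p Y Z \<Longrightarrow> Y p = Z p"
  unfolding germ_eq_def by (rule eventually_nhds_x_imp_x)

lemma frame_vec_inject:
  assumes "det P = 1" "p \<in> good_set d" "frame q p P *v k = frame q p P *v k'"
  shows "k = k'"
  using invertible_frame[OF assms(1,2), of q] assms(3)
  by (metis invertible_def matrix_vector_mul_assoc matrix_vector_mul_lid)

text \<open>Every germ is reached by \<open>horizontal_unique\<close> on a small ball, uniqueness is
  the invertibility of the frame, and compatibility with brackets is \<open>quad_bracket\<close>
  combined with \<open>christ_bracket\<close>.\<close>

lemma horizontal_germ_iso_field:
  assumes W: "open W" "p0 \<in> W" "W \<subseteq> good_set d" and P: "is_solution (rat_eval n d) U P" "\<And>p. p \<in> W \<Longrightarrow> p $ 1 \<in> U"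
  shows "horizontal_germ_iso (rec_conn n d) p0 (germ_field n d P)"
  unfolding horizontal_germ_iso_def
proof (intro conjI ballI allI impI)
  have dP: "det (P (p $ 1)) = 1" if "p \<in> W" for p using is_solutionD(1)[OF P(1) P(2)[OF that]] .
  fix A
  show "horizontal_germ (rec_conn n d) p0 (germ_field n d P A)"
    unfolding horizontal_germ_def eventually_nhds germ_field_def
    using W horizontal_frame[OF _ P(1) P(2)] by blast
next
  have dP: "det (P (p $ 1)) = 1" if "p \<in> W" for p using is_solutionD(1)[OF P(1) P(2)[OF that]] .
  fix Y assume "horizontal_germ (rec_conn n d) p0 Y"
  then obtain V where V: "open V" "p0 \<in> V" "\<And>y. y \<in> V \<Longrightarrow> horizontal_at (rec_conn n d) Y y"
    unfolding horizontal_germ_def eventually_nhds by blast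
  obtain e where e: "e > 0" "ball p0 e \<subseteq> V \<inter> W"
    using V W open_contains_ball[of "V \<inter> W"] by blast
  have "\<exists>k. \<forall>p\<in>ball p0 e. Y p = frame (rat_eval n d (p$1)) p (P (p$1)) *v k"
    by (rule horizontal_unique[where d = d and U = U]) (use e V W P in auto)
  then obtain k where k: "\<And>p. p \<in> ball p0 e \<Longrightarrow> Y p = frame (rat_eval n d (p$1)) p (P (p$1)) *v k" by blast
  obtain A where A: "A \<in> sl2" "coef_vec A = k" using coef_vec_surj by blast
  show "\<exists>!A. A \<in> sl2 \<and> germ_eq p0 (germ_field n d P A) Y"
  proof (rule ex1I[of _ A])
    show "A \<in> sl2 \<and> germ_eq p0 (germ_field n d P A) Y"
      using A k e(1) by (auto intro!: germ_eqI[of "ball p0 e"] simp: germ_field_def)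
    fix B assume B: "B \<in> sl2 \<and> germ_eq p0 (germ_field n d P B) Y"
    then have "frame (rat_eval n d (p0$1)) p0 (P (p0$1)) *v coef_vec B = frame (rat_eval n d (p0$1)) p0 (P (p0$1)) *v coef_vec A"
      using germ_eqD[of p0 "germ_field n d P B" Y] k[of p0] e(1) A(2) by (simp add: germ_field_def)
    then have "coef_vec B = coef_vec A"
      using frame_vec_inject[OF dP[OF W(2)]] W(2,3) by blast
    then show "B = A" using coef_vec_inject A(1) B by blast
  qed
next
  fix A B
  show "germ_eq p0 (germ_field n d P (A + B)) (\<lambda>y. germ_field n d P A y + germ_field n d P B y)"
    by (simp add: germ_eq_def germ_field_def coef_vec_add matrix_vector_right_distrib)
next
  fix c A
  show "germ_eq p0 (germ_field n d P (scale_mat c A)) (\<lambda>y. c *s germ_field n d P A y)"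
    by (simp add: germ_eq_def germ_field_def coef_vec_scale vector_scalar_commute)
next
  have dP: "det (P (p $ 1)) = 1" if "p \<in> W" for p using is_solutionD(1)[OF P(1) P(2)[OF that]] .
  fix A B assume AB: "A \<in> sl2" "B \<in> sl2"
  show "germ_eq p0 (germ_field n d P (commutator A B)) (local_bracket (germ_field n d P A) (germ_field n d P B))"
  proof (rule germ_eqI[OF W(1,2)])
    fix p assume p: "p \<in> W"
    let ?q = "rat_eval n d (p$1)" and ?q' = "rat_eval' n d (p$1)" and ?P = "P (p$1)"
    have pg: "p \<in> good_set d" "p $ 2 \<noteq> 0" using p W(3) by (auto simp: good_set_def)
    have "frechet_derivative (germ_field n d P C) (at p) = (\<lambda>u. - christ ?q ?q' p u (germ_field n d P C p))" for C
      unfolding germ_field_def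
      by (rule frechet_derivative_at[symmetric]) (rule has_derivative_frame[OF pg(1) P(1) P(2)[OF p]])
    then have "local_bracket (germ_field n d P A) (germ_field n d P B) p =
        - christ ?q ?q' p (germ_field n d P A p) (germ_field n d P B p) + christ ?q ?q' p (germ_field n d P B p) (germ_field n d P A p)"
      by (simp add: local_bracket_def)
    also have "\<dots> = germ_field n d P (commutator A B) p"
      unfolding germ_field_def frame_mult_vec christ_bracket[OF pg(2)] quad_bracket[OF dP[OF p] AB]
      by (simp add: jet_def algebra_simps)
    finally show "germ_field n d P (commutator A B) p = local_bracket (germ_field n d P A) (germ_field n d P B) p" ..
  qed
qed

lemma matrix_inv_adj2: "det g = 1 \<Longrightarrow> matrix_inv g = adj2 g"
proof -
  assume g: "det g = 1"
  have "g ** matrix_inv g = mat 1"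
    unfolding matrix_inv_def by (rule someI2[of _ "adj2 g"]) (simp_all add: mult_adj2 g)
  then have "adj2 g ** (g ** matrix_inv g) = adj2 g" by simp
  then show ?thesis by (simp add: mult_adj2_cancel[OF g])
qed

lemma Ad_eq: "det g = 1 \<Longrightarrow> Ad g = (\<lambda>A\<in>sl2. conj2 g A)"
  by (simp add: Ad_def conj2_def matrix_inv_adj2)

text \<open>The matrix \<open>sym_sq g\<close> acts on coefficients of quadratic forms through the
  inverse of \<open>g\<close>. The image of a group is unaffected by this inversion.\<close>

lemma germ_action_sym_sq:
  assumes p0: "p0 \<in> good_set d" and dP: "det (P (p0$1)) = 1" and g: "det g = 1"
  shows "germ_action p0 (\<lambda>p. frame (rat_eval n d (p$1)) p (P (p$1))) (germ_field n d P) (sym_sq g) = Ad (adj2 g)"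
proof -
  let ?\<sigma> = "\<lambda>p. frame (rat_eval n d (p$1)) p (P (p$1))"
  have "(THE B. B \<in> sl2 \<and> (\<exists>c. germ_eq p0 (germ_field n d P A) (\<lambda>y. ?\<sigma> y *v c) \<and>
      germ_eq p0 (germ_field n d P B) (\<lambda>y. ?\<sigma> y *v (sym_sq g *v c)))) = conj2 (adj2 g) A" if A: "A \<in> sl2" for A
  proof (rule the_equality)
    show "conj2 (adj2 g) A \<in> sl2 \<and> (\<exists>c. germ_eq p0 (germ_field n d P A) (\<lambda>y. ?\<sigma> y *v c) \<and>
      germ_eq p0 (germ_field n d P (conj2 (adj2 g) A)) (\<lambda>y. ?\<sigma> y *v (sym_sq g *v c)))"
      using A g by (auto intro!: sl2_conj2 exI[of _ "coef_vec A"] simp: germ_eq_def germ_field_def coef_vec_conj2)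
    fix B assume "B \<in> sl2 \<and> (\<exists>c. germ_eq p0 (germ_field n d P A) (\<lambda>y. ?\<sigma> y *v c) \<and>
      germ_eq p0 (germ_field n d P B) (\<lambda>y. ?\<sigma> y *v (sym_sq g *v c)))"
    then obtain c where B: "B \<in> sl2" "germ_eq p0 (germ_field n d P A) (\<lambda>y. ?\<sigma> y *v c)"
      "germ_eq p0 (germ_field n d P B) (\<lambda>y. ?\<sigma> y *v (sym_sq g *v c))" by blast
    have "coef_vec A = c" "coef_vec B = sym_sq g *v c"
      using germ_eqD[OF B(2)] germ_eqD[OF B(3)] frame_vec_inject[OF dP p0] unfolding germ_field_def by blast+
    then have "coef_vec B = coef_vec (conj2 (adj2 g) A)" using coef_vec_conj2[OF g A] by simp
    then show "B = conj2 (adj2 g) A" using coef_vec_inject[OF B(1)] sl2_conj2[of "adj2 g"] A g by simp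
  qed
  then show ?thesis
    unfolding germ_action_def using g by (simp add: Ad_eq restrict_def fun_eq_iff)
qed

theorem galois_group_in_aut_reduction:
  assumes R: "reduction n d G Z" and a0: "(x0, P0) \<in> Z"
    and mon: "G \<subseteq> zariski_closed mat_coords hull monodromy n d (x0, P0)"
  shows "galois_group_in_aut (rec_conn n d) (Ad ` G)"
proof -
  define p0 :: "complex^3" where "p0 = vector [x0, 1, 0]"
  have p01: "p0 $ 1 = x0" by (simp add: p0_def)
  have p0: "p0 \<in> good_set d" using reductionD(3)[OF R a0] by (simp add: p0_def good_set_def)
  obtain r P1 where r: "r > 0" "ball x0 r \<subseteq> {x. poly d x \<noteq> 0}" "is_solution (rat_eval n d) (ball x0 r) P1"
    "\<And>y. y \<in> ball x0 r \<Longrightarrow> (y, P1 y) \<in> Z"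
    using reductionD(6)[OF R reductionD(3)[OF R a0]] by blast
  have "(x0, P1 x0) \<in> Z" using r by simp
  then obtain g where g: "g \<in> G" "P0 = g ** P1 x0" using reduction_factor[OF R _ a0] by blast
  define P where "P y = g ** P1 y" for y
  have P: "is_solution (rat_eval n d) (ball x0 r) P"
    unfolding P_def using is_solution_mult[OF r(3)] alg_groupD(1)[OF reductionD(2)[OF R] g(1)] by blast
  have P0: "P x0 = P0" by (simp add: P_def g)
  obtain e where e: "e > 0" "ball p0 e \<subseteq> good_set d" using open_good_set p0 open_contains_ball by blast
  define W where "W = ball p0 (min e r)"
  have W: "open W" "connected W" "p0 \<in> W" "W \<subseteq> good_set d" using e r(1) by (auto simp: W_def)
  have W1: "p $ 1 \<in> ball x0 r" if "p \<in> W" for p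
    using that dist_vec_nth_le[of p0 1 p] by (simp add: W_def p01)
  define \<sigma> where "\<sigma> = (\<lambda>p. frame (rat_eval n d (p$1)) p (P (p$1)))"
  have \<sigma>0: "\<sigma> p0 = frame (rat_eval n d (p0$1)) p0 P0" by (simp add: \<sigma>_def p01 P0)
  have "germ_action p0 \<sigma> (germ_field n d P) ` galois_group (rec_conn n d) (good_set d) (p0, \<sigma> p0) = Ad ` G"
  proof -
    have *: "germ_action p0 \<sigma> (germ_field n d P) (sym_sq h) = Ad (adj2 h)" if "h \<in> G" for h
      unfolding \<sigma>_def
      by (rule germ_action_sym_sq[OF p0])
        (use reductionD(4)[OF R a0] alg_groupD(1)[OF reductionD(2)[OF R] that] in \<open>simp_all add: p01 P0\<close>)
    have "germ_action p0 \<sigma> (germ_field n d P) ` sym_sq ` G = Ad ` adj2 ` G"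
      unfolding image_image by (rule image_cong[OF refl *])
    moreover have "adj2 ` G = G"
    proof (intro equalityI subsetI)
      note adjG = alg_groupD(5)[OF reductionD(2)[OF R]]
      show "x \<in> G" if "x \<in> adj2 ` G" for x using that adjG by blast
      show "x \<in> adj2 ` G" if "x \<in> G" for x
        by (rule image_eqI[of _ _ "adj2 x"]) (use adjG[OF that] in simp_all)
    qed
    ultimately show ?thesis
      unfolding \<sigma>0 using galois_group_reduction[OF R, of p0 P0] a0 p0 mon by (simp add: p01)
  qed
  moreover have "\<forall>y\<in>good_set d. connection_regular_at (rec_conn n d) y"
    unfolding rec_conn_def using reciprocal_par(1) by blast
  moreover have "horizontal_frame_on (rec_conn n d) W \<sigma>"
    unfolding \<sigma>_def by (rule horizontal_frame_on_frame[OF W(4) P W1])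
  moreover have "horizontal_germ_iso (rec_conn n d) p0 (germ_field n d P)"
    by (rule horizontal_germ_iso_field[OF W(1,3,4) P W1])
  ultimately show ?thesis
    unfolding galois_group_in_aut_def using W zariski_closed_good_set
    by (intro exI[of _ "good_set d"] exI[of _ p0] exI[of _ W] exI[of _ \<sigma>] exI[of _ "germ_field n d P"]) simp
qed

section \<open>Subgroups of \<open>PSL2\<close> and their preimages in \<open>SL2\<close>\<close>

lemma group_SL2: "group SL2"
proof (rule groupI)
  show "\<exists>y\<in>carrier SL2. y \<otimes>\<^bsub>SL2\<^esub> x = \<one>\<^bsub>SL2\<^esub>" if "x \<in> carrier SL2" for x
    using that by (intro bexI[of _ "adj2 x"]) (auto simp: SL2_def mult_adj2)
qed (auto simp: SL2_def det_mul matrix_mul_assoc)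

lemma normal_pm1: "{mat 1, - mat 1} \<lhd> SL2"
proof -
  interpret group SL2 by (rule group_SL2)
  have inv: "inv\<^bsub>SL2\<^esub> x = adj2 x" if "det x = 1" for x
    by (rule inv_equality) (use that in \<open>auto simp: SL2_def mult_adj2\<close>)
  have m: "det (- mat 1 :: complex^2^2) = 1" "adj2 (- mat 1) = - mat 1" "adj2 (mat 1) = mat 1"
    "- mat 1 ** - mat 1 = (mat 1 :: complex^2^2)"
    by (simp_all add: mat_1_mat2)
  have sub: "subgroup {mat 1, - mat 1 :: complex^2^2} SL2"
  proof (rule subgroupI)
    show "inv\<^bsub>SL2\<^esub> a \<in> {mat 1, - mat 1}" if "a \<in> {mat 1, - mat 1}" for a
      using that m by (auto simp: inv)
  qed (use m in \<open>auto simp: SL2_def\<close>)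
  show ?thesis
    unfolding normal_inv_iff
  proof (intro conjI sub ballI)
    fix x h :: "complex^2^2" assume "x \<in> carrier SL2" "h \<in> {mat 1, - mat 1}"
    then have "x \<otimes>\<^bsub>SL2\<^esub> h \<otimes>\<^bsub>SL2\<^esub> inv\<^bsub>SL2\<^esub> x = h"
      using inv[of x] by (cases x rule: mat2_cases) (auto simp: SL2_def mat_1_mat2 algebra_simps)
    then show "x \<otimes>\<^bsub>SL2\<^esub> h \<otimes>\<^bsub>SL2\<^esub> inv\<^bsub>SL2\<^esub> x \<in> {mat 1, - mat 1}"
      using \<open>h \<in> _\<close> by simp
  qed
qed

definition pm :: "complex^2^2 \<Rightarrow> (complex^2^2) set" where "pm A = {A, - A}"

lemma pm_mult: "pm A <#>\<^bsub>SL2\<^esub> pm B = pm (A ** B)"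
proof -
  have "(- A) ** B = - (A ** B)" "A ** (- B) = - (A ** B)" "(- A) ** (- B) = A ** B" for A B :: "complex^2^2"
    by (cases A rule: mat2_cases; cases B rule: mat2_cases; simp)+
  then show ?thesis by (auto simp: pm_def set_mult_def SL2_def)
qed

lemma carrier_PSL2: "carrier PSL2 = pm ` {A. det A = 1}"
proof -
  have "(- mat 1) ** A = - A" for A :: "complex^2^2"
    by (cases A rule: mat2_cases) (simp add: mat_1_mat2)
  then have "{mat 1, - mat 1} #>\<^bsub>SL2\<^esub> A = pm A" for A
    by (auto simp: r_coset_def SL2_def pm_def)
  then show ?thesis by (auto simp: PSL2_def FactGroup_def RCOSETS_def SL2_def)
qed

lemma alg_groupI:
  "G \<subseteq> {A. det A = 1} \<Longrightarrow> mat 1 \<in> G \<Longrightarrow> - mat 1 \<in> G \<Longrightarrow> (\<And>A B. A \<in> G \<Longrightarrow> B \<in> G \<Longrightarrow> A ** B \<in> G) \<Longrightarrow>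
    (\<And>A. A \<in> G \<Longrightarrow> adj2 A \<in> G) \<Longrightarrow> zariski_closed mat_coords G \<Longrightarrow> alg_group G"
  unfolding alg_group_def by blast

lemma alg_group_Union:
  assumes "algebraic_subgroup_PSL2 \<Gamma>"
  shows "alg_group (\<Union>\<Gamma>)" "\<And>A. A \<in> \<Union>\<Gamma> \<Longrightarrow> pm A \<in> \<Gamma>" "\<And>C. C \<in> \<Gamma> \<Longrightarrow> \<exists>A. det A = 1 \<and> C = pm A"
proof -
  have S: "subgroup \<Gamma> PSL2" and cl: "zariski_closed mat_coords (\<Union>\<Gamma>)"
    using assms by (auto simp: algebraic_subgroup_PSL2_def)
  interpret N: normal "{mat 1, - mat 1}" SL2 by (rule normal_pm1)
  interpret G: group PSL2 unfolding PSL2_def by (rule N.factorgroup_is_group)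
  interpret S: subgroup \<Gamma> PSL2 by (rule S)
  have one: "\<one>\<^bsub>PSL2\<^esub> = pm (mat 1)" by (simp add: PSL2_def FactGroup_def pm_def)
  have mult: "pm A \<otimes>\<^bsub>PSL2\<^esub> pm B = pm (A ** B)" for A B
    by (simp add: PSL2_def FactGroup_def pm_mult)
  show ex: "\<exists>A. det A = 1 \<and> C = pm A" if "C \<in> \<Gamma>" for C
    using S.subset that unfolding carrier_PSL2 by blast
  have pm_minus: "pm (- A) = pm A" for A by (auto simp: pm_def)
  show pm: "pm A \<in> \<Gamma>" if tt: "A \<in> \<Union>\<Gamma>" for A
  proof -
    obtain C where C: "A \<in> C" "C \<in> \<Gamma>" using tt by blast
    then obtain B where "C = pm B" using ex by blast
    then have "pm A = C" using C(1) by (auto simp: pm_def)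
    then show ?thesis using C(2) by simp
  qed
  have self: "A \<in> pm A" for A by (simp add: pm_def)
  have det: "det A = 1" if tt: "A \<in> \<Union>\<Gamma>" for A
  proof -
    obtain B where B: "det B = 1" "pm A = pm B" using ex[OF pm[OF tt]] by blast
    then have "A = B \<or> A = - B" using self[of A] by (auto simp: pm_def)
    then show ?thesis using B(1) by (cases B rule: mat2_cases) auto
  qed
  have adj: "adj2 A \<in> \<Union>\<Gamma>" if tt: "A \<in> \<Union>\<Gamma>" for A
  proof -
    have dA: "det A = 1" by (rule det[OF tt])
    have "pm (adj2 A) \<otimes>\<^bsub>PSL2\<^esub> pm A = \<one>\<^bsub>PSL2\<^esub>" by (simp add: mult one mult_adj2 dA)
    then have "inv\<^bsub>PSL2\<^esub> (pm A) = pm (adj2 A)"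
      by (intro G.inv_equality) (use dA in \<open>auto simp: carrier_PSL2\<close>)
    then have "pm (adj2 A) \<in> \<Gamma>" using S.m_inv_closed[OF pm[OF tt]] by simp
    then show ?thesis using self by blast
  qed
  have "\<Union>\<Gamma> \<subseteq> {A. det A = 1}" using det by blast
  moreover have "A ** B \<in> \<Union>\<Gamma>" if "A \<in> \<Union>\<Gamma>" "B \<in> \<Union>\<Gamma>" for A B
    using S.m_closed[OF pm[OF that(1)] pm[OF that(2)]] self unfolding mult by blast
  moreover have "mat 1 \<in> \<Union>\<Gamma>" "- mat 1 \<in> \<Union>\<Gamma>"
    using S.one_closed unfolding one pm_def by blast+
  ultimately show "alg_group (\<Union>\<Gamma>)"
    using adj cl by (intro alg_groupI)
qed

text \<open>\<open>the_elem\<close> is meaningful because \<open>Ad A = Ad (- A)\<close>, so a class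
  \<open>pm A\<close> has a singleton image.\<close>

lemma PSL2_aut_Union:
  assumes "algebraic_subgroup_PSL2 \<Gamma>"
  shows "PSL2_aut ` \<Gamma> = Ad ` \<Union>\<Gamma>"
proof -
  have Am: "Ad (- A) = Ad A" if "det A = 1" for A
  proof -
    have "det (- A) = 1" using that by (cases A rule: mat2_cases) simp
    moreover have "conj2 (- A) B = conj2 A B" for B
      by (cases A rule: mat2_cases; cases B rule: mat2_cases) (simp add: conj2_def algebra_simps)
    ultimately show ?thesis using that by (simp add: Ad_eq)
  qed
  have aut: "PSL2_aut (pm A) = Ad A" if "det A = 1" for A
    by (simp add: PSL2_aut_def pm_def Am[OF that])
  note U = alg_group_Union[OF assms]
  show ?thesis
  proof
    show "PSL2_aut ` \<Gamma> \<subseteq> Ad ` \<Union>\<Gamma>"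
    proof
      fix \<alpha> assume "\<alpha> \<in> PSL2_aut ` \<Gamma>"
      then obtain C where C: "C \<in> \<Gamma>" "\<alpha> = PSL2_aut C" by blast
      obtain A where A: "det A = 1" "C = pm A" using U(3)[OF C(1)] by blast
      have "A \<in> \<Union>\<Gamma>" using C(1) A(2) by (auto simp: pm_def)
      then show "\<alpha> \<in> Ad ` \<Union>\<Gamma>" using C(2) A aut by blast
    qed
    show "Ad ` \<Union>\<Gamma> \<subseteq> PSL2_aut ` \<Gamma>"
    proof
      fix \<alpha> assume "\<alpha> \<in> Ad ` \<Union>\<Gamma>"
      then obtain A where A: "A \<in> \<Union>\<Gamma>" "\<alpha> = Ad A" by blast
      have "\<alpha> = PSL2_aut (pm A)" using A aut[OF alg_groupD(1)[OF U(1) A(1)]] by simp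
      then show "\<alpha> \<in> PSL2_aut ` \<Gamma>" using U(2)[OF A(1)] by blast
    qed
  qed
qed

lemma Ad_aut:
  assumes "det h = 1" shows "Ad h \<in> aut_sl2"
proof -
  have pm: "mat2 a b c d + mat2 a' b' c' d' = mat2 (a + a') (b + b') (c + c') (d + d')"
    "mat2 a b c d - mat2 a' b' c' d' = mat2 (a - a') (b - b') (c - c') (d - d')" for a b c d a' b' c' d'
    by (rule mat2_eqI; simp)+
  have 1: "conj2 h (A + B) = conj2 h A + conj2 h B" for A B
    by (cases h rule: mat2_cases; cases A rule: mat2_cases; cases B rule: mat2_cases)
      (simp add: conj2_def pm algebra_simps)
  have 2: "conj2 h (scale_mat c A) = scale_mat c (conj2 h A)" for c A
    by (cases h rule: mat2_cases; cases A rule: mat2_cases)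
      (simp add: conj2_def scale_mat_def vec_eq_iff forall_2 matrix_matrix_mult_def sum_2 algebra_simps)
  have 3: "conj2 h (commutator A B) = commutator (conj2 h A) (conj2 h B)" for A B
  proof -
    have "conj2 h (A ** B - B ** A) = conj2 h (A ** B) - conj2 h (B ** A)"
      by (cases h rule: mat2_cases; cases A rule: mat2_cases; cases B rule: mat2_cases)
        (simp add: conj2_def pm algebra_simps)
    then show ?thesis by (simp add: commutator_def conj2_mult[OF assms])
  qed
  have bij: "bij_betw (conj2 h) sl2 sl2"
    by (rule bij_betw_byWitness[where f' = "conj2 (adj2 h)"])
      (use assms in \<open>auto simp: conj2_inverse sl2_conj2\<close>)
  have n: "A $ 2 $ 2 = - A $ 1 $ 1" if "A \<in> sl2" for A
    using sl2_mat2[OF that] by auto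
  have sl2: "A + B \<in> sl2" "scale_mat c A \<in> sl2" if "A \<in> sl2" "B \<in> sl2" for A B c
    using n[OF that(1)] n[OF that(2)] by (simp_all add: sl2_def trace_def sum_2 scale_mat_def)
  have "bij_betw (\<lambda>A\<in>sl2. conj2 h A) sl2 sl2"
    using bij by (rule bij_betw_cong[THEN iffD1, rotated]) simp
  then show ?thesis
    using sl2 by (simp add: aut_sl2_def Ad_eq[OF assms] 1 2 3 sl2_commutator)
qed

lemma conjugate_aut_Ad:
  assumes "det h = 1" "det g = 1"
  shows "conjugate_aut (Ad h) (Ad g) = Ad (conj2 h g)"
proof -
  have "bij_betw (Ad h) sl2 sl2" using Ad_aut[OF assms(1)] by (simp add: aut_sl2_def)
  then have inv: "inv_into sl2 (Ad h) A = conj2 (adj2 h) A" if "A \<in> sl2" for A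
    by (intro inv_into_f_eq) (use that assms in \<open>auto simp: bij_betw_def Ad_eq sl2_conj2 conj2_inverse\<close>)
  have d: "det (conj2 h g) = 1" using assms by (simp add: det_conj2)
  show ?thesis
  proof
    fix A
    show "conjugate_aut (Ad h) (Ad g) A = Ad (conj2 h g) A"
    proof (cases "A \<in> sl2")
      case True
      then have "conj2 (adj2 h) A \<in> sl2" "conj2 g (conj2 (adj2 h) A) \<in> sl2"
        using assms by (simp_all add: sl2_conj2)
      then have "conjugate_aut (Ad h) (Ad g) A = conj2 h (conj2 g (conj2 (adj2 h) A))"
        using True by (simp add: conjugate_aut_def inv) (simp add: Ad_eq assms)
      also have "\<dots> = conj2 (conj2 h g) A"
        by (simp add: conj2_conj2) (simp add: conj2_def matrix_mul_assoc)
      finally show ?thesis using True d by (simp add: Ad_eq)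
    qed (simp add: conjugate_aut_def Ad_eq d)
  qed
qed

lemma realization:
  assumes \<Gamma>: "algebraic_subgroup_PSL2 \<Gamma>" and h: "det h = 1"
    and R: "reduction n d (conj2 h ` \<Union>\<Gamma>) Z" "(x0, P0) \<in> Z"
    and mon: "conj2 h ` \<Union>\<Gamma> \<subseteq> zariski_closed mat_coords hull monodromy n d (x0, P0)"
  shows "\<exists>\<rho> nabla G. rational_parallelism \<rho> \<and> associated_connection \<rho> nabla \<and>
           galois_group_in_aut (reciprocal nabla) G \<and>
           (\<exists>\<gamma>\<in>aut_sl2. G = conjugate_aut \<gamma> ` (PSL2_aut ` \<Gamma>))"
proof (intro exI conjI bexI)
  let ?Q = "ratX n / ratX d"
  show "rational_parallelism (par ?Q)" by (rule rational_parallelism_par[OF reductionD(1)[OF R(1)]])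
  show "associated_connection (par ?Q) (par_connection ?Q)" by (rule associated_connection_par)
  show "galois_group_in_aut (reciprocal (par_connection ?Q)) (Ad ` conj2 h ` \<Union>\<Gamma>)"
    using galois_group_in_aut_reduction[OF R mon] by (simp add: rec_conn_def)
  show "Ad h \<in> aut_sl2" by (rule Ad_aut[OF h])
  show "Ad ` conj2 h ` \<Union>\<Gamma> = conjugate_aut (Ad h) ` (PSL2_aut ` \<Gamma>)"
    unfolding PSL2_aut_Union[OF \<Gamma>] image_image
    by (rule image_cong[OF refl])
      (use conjugate_aut_Ad[OF h] alg_groupD(1)[OF alg_group_Union(1)[OF \<Gamma>]] in simp)
qed

section \<open>Parametrized solutions\<close>

text \<open>The solution matrix with developing map \<open>T\<close>: its second column is \<open>(T v, v)\<close> with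
  \<open>v\<^sup>2 = \<rho>\<close>, and \<open>b\<close> is the derivative of \<open>\<rho>\<close> with respect to \<open>x\<close>.\<close>

definition param_mat :: "complex \<Rightarrow> complex \<Rightarrow> complex \<Rightarrow> complex^2^2" where
  "param_mat T \<rho> b = (let v = csqrt \<rho> in mat2 (1 / v + T * b / (2 * v)) (T * v) (b / (2 * v)) v)"

lemma param_mat_sqrt:
  assumes "v^2 = \<rho>" "\<rho> \<noteq> 0"
  shows "mat2 (1 / v + T * b / (2 * v)) (T * v) (b / (2 * v)) v = param_mat T \<rho> b \<or>
    mat2 (1 / v + T * b / (2 * v)) (T * v) (b / (2 * v)) v = - param_mat T \<rho> b"
proof -
  have "v = csqrt \<rho> \<or> v = - csqrt \<rho>"
    using assms(1) by (metis power2_csqrt power2_eq_iff)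
  then show ?thesis by (auto simp: param_mat_def Let_def)
qed

lemma det_param_mat: "\<rho> \<noteq> 0 \<Longrightarrow> det (param_mat T \<rho> b) = 1"
  by (simp add: param_mat_def Let_def field_simps)

lemma param_mat_prods:
  fixes T \<rho> b :: complex
  assumes "\<rho> \<noteq> 0"
  defines "P \<equiv> param_mat T \<rho> b"
  shows "P$1$2 * P$2$2 = T * \<rho>" "P$1$1 * P$2$2 + P$1$2 * P$2$1 = 1 + T * b"
    "P$2$2 * P$2$2 = \<rho>" "P$2$1 * P$2$2 = b / 2" "P$2$2 \<noteq> 0"
proof -
  have v: "csqrt \<rho> * csqrt \<rho> = \<rho>" by (simp flip: power2_eq_square)
  then show "P$1$2 * P$2$2 = T * \<rho>" "P$1$1 * P$2$2 + P$1$2 * P$2$1 = 1 + T * b"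
    "P$2$2 * P$2$2 = \<rho>" "P$2$1 * P$2$2 = b / 2" "P$2$2 \<noteq> 0"
    using assms(1) by (auto simp: P_def param_mat_def Let_def field_simps)
qed

text \<open>With \<open>v^2 = \<rho>\<close> the column \<open>(T v, v)\<close> is multiplied by the
  matrix, so the new \<open>v\<close> is \<open>(\<gamma> T + \<delta>) v\<close> up to sign. The
  rule for \<open>b\<close> is the derivative of the rule for \<open>\<rho>\<close>, as
  \<open>dT/dx = 1 / \<rho>\<close>.\<close>

lemma param_mat_moebius:
  assumes g: "\<alpha> * \<delta> - \<beta> * \<gamma> = 1" and nz: "\<gamma> * T + \<delta> \<noteq> 0" "\<rho> \<noteq> 0"
    and T': "T' = (\<alpha> * T + \<beta>) / (\<gamma> * T + \<delta>)" and \<rho>': "\<rho>' = (\<gamma> * T + \<delta>)^2 * \<rho>"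
    and b': "b' = (\<gamma> * T + \<delta>)^2 * b + 2 * \<gamma> * (\<gamma> * T + \<delta>)"
  shows "param_mat T' \<rho>' b' = mat2 \<alpha> \<beta> \<gamma> \<delta> ** param_mat T \<rho> b \<or>
    param_mat T' \<rho>' b' = - (mat2 \<alpha> \<beta> \<gamma> \<delta> ** param_mat T \<rho> b)"
proof -
  define v where "v = csqrt \<rho>"
  define j where "j = \<gamma> * T + \<delta>"
  have v: "v \<noteq> 0" "v^2 = \<rho>" using nz by (auto simp: v_def)
  have j: "j \<noteq> 0" "\<delta> = j - \<gamma> * T" using nz unfolding j_def by simp_all
  have g': "\<alpha> * j = 1 + \<gamma> * (\<alpha> * T + \<beta>)" using g unfolding j_def by algebra
  have J: "\<alpha> = (1 + \<gamma> * (\<alpha> * T + \<beta>)) / j" using g' j(1) by (simp add: eq_divide_eq)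
  let ?u = "j * v"
  have "?u^2 = \<rho>'" unfolding \<rho>' j_def[symmetric] by (simp add: power_mult_distrib v(2))
  moreover have "\<rho>' \<noteq> 0" unfolding \<rho>' using nz by simp
  ultimately have *: "mat2 (1 / ?u + T' * b' / (2 * ?u)) (T' * ?u) (b' / (2 * ?u)) ?u = param_mat T' \<rho>' b' \<or>
    mat2 (1 / ?u + T' * b' / (2 * ?u)) (T' * ?u) (b' / (2 * ?u)) ?u = - param_mat T' \<rho>' b'"
    by (rule param_mat_sqrt)
  have "mat2 (1 / ?u + T' * b' / (2 * ?u)) (T' * ?u) (b' / (2 * ?u)) ?u = mat2 \<alpha> \<beta> \<gamma> \<delta> ** param_mat T \<rho> b"
  proof -
    define k where "k = \<alpha> * T + \<beta>"
    have b: "b' = j^2 * b + 2 * \<gamma> * j" "T' = k / j" "\<beta> = k - \<alpha> * T"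
      by (simp_all add: b' T' j_def k_def)
    have a: "\<alpha> = (1 + \<gamma> * k) / j" using J by (simp add: k_def)
    show ?thesis
      unfolding param_mat_def Let_def v_def[symmetric] mat2_mult mat2_eq_iff
      using v(1) j(1) by (intro conjI) (simp_all add: b(1,2) b(3) a j(2) field_simps power2_eq_square)
  qed
  then show ?thesis using * by (metis minus_equation_iff)
qed

text \<open>In terms of \<open>x = e s\<close> the conditions read
  \<open>dT/dx = 1 / \<rho>\<close>, \<open>d\<rho>/dx = b\<close> and
  \<open>db/dx = 2 \<rho> q + b^2 / (2 \<rho>)\<close>. The last one is \<open>v'' = q v\<close>
  expressed through \<open>\<rho> = v^2\<close>.\<close>

definition parametrization ::
    "(complex \<Rightarrow> complex) \<Rightarrow> complex set \<Rightarrow> (complex \<Rightarrow> complex) \<Rightarrow> (complex \<Rightarrow> complex) \<Rightarrow> (complex \<Rightarrow> complex) \<Rightarrow> (complex \<Rightarrow> complex) \<Rightarrow> (complex \<Rightarrow> complex) \<Rightarrow> bool" where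
  "parametrization q S e e' T \<rho> b \<longleftrightarrow> open S \<and> connected S \<and> (\<forall>s\<in>S. e' s \<noteq> 0 \<and> \<rho> s \<noteq> 0 \<and>
     (e has_field_derivative e' s) (at s) \<and> (T has_field_derivative e' s / \<rho> s) (at s) \<and>
     (\<rho> has_field_derivative b s * e' s) (at s) \<and>
     (b has_field_derivative e' s * (2 * \<rho> s * q (e s) + (b s)^2 / (2 * \<rho> s))) (at s))"

lemma parametrization_local:
  assumes p: "parametrization q S e e' T \<rho> b" and s0: "s0 \<in> S"
  shows "\<exists>r>0. \<exists>P V. is_solution q (ball (e s0) r) P \<and> open V \<and> s0 \<in> V \<and> V \<subseteq> S \<and> e ` V = ball (e s0) r \<and>
    (\<forall>s\<in>V. P (e s) = param_mat (T s) (\<rho> s) (b s) \<or> P (e s) = - param_mat (T s) (\<rho> s) (b s))"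
proof -
  have S: "open S" and D: "\<And>s. s \<in> S \<Longrightarrow> e' s \<noteq> 0" "\<And>s. s \<in> S \<Longrightarrow> \<rho> s \<noteq> 0"
    "\<And>s. s \<in> S \<Longrightarrow> (e has_field_derivative e' s) (at s)" "\<And>s. s \<in> S \<Longrightarrow> (T has_field_derivative e' s / \<rho> s) (at s)"
    "\<And>s. s \<in> S \<Longrightarrow> (\<rho> has_field_derivative b s * e' s) (at s)"
    "\<And>s. s \<in> S \<Longrightarrow> (b has_field_derivative e' s * (2 * \<rho> s * q (e s) + (b s)^2 / (2 * \<rho> s))) (at s)"
    using p unfolding parametrization_def by blast+
  have ehol: "e holomorphic_on S" using D(3) S holomorphic_on_open by blast
  have de: "deriv e s = e' s" if "s \<in> S" for s using D(3)[OF that] by (rule DERIV_imp_deriv)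
  obtain r1 where r1: "r1 > 0" "ball s0 r1 \<subseteq> S" "inj_on e (ball s0 r1)"
    using has_complex_derivative_locally_injective[OF ehol s0 S] de[OF s0] D(1)[OF s0] by metis
  have "(\<lambda>s. Re (\<rho> s / \<rho> s0)) \<midarrow>s0\<rightarrow> Re (\<rho> s0 / \<rho> s0)"
    by (intro tendsto_intros isContD[OF DERIV_isCont[OF D(5)[OF s0]]] D(2)[OF s0])
  then have "\<forall>\<^sub>F s in at s0. Re (\<rho> s / \<rho> s0) > 0"
    using D(2)[OF s0] by (intro order_tendstoD(1)) auto
  then obtain r2 where r2: "r2 > 0" "\<And>s. s \<noteq> s0 \<Longrightarrow> dist s s0 < r2 \<Longrightarrow> Re (\<rho> s / \<rho> s0) > 0"
    unfolding eventually_at by blast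
  define B where "B = ball s0 (min r1 r2)"
  have B: "open B" "s0 \<in> B" "B \<subseteq> S" using r1 r2 by (auto simp: B_def)
  have inj: "inj_on e B" using r1(3) by (rule inj_on_subset) (auto simp: B_def)
  have Re: "Re (\<rho> s / \<rho> s0) > 0" if "s \<in> B" for s
    using that r2(2)[of s] D(2)[OF s0] by (cases "s = s0") (auto simp: B_def dist_commute)
  have eholB: "e holomorphic_on B" using ehol B(3) holomorphic_on_subset by blast
  have oeB: "open (e ` B)" using open_mapping_thm3[OF eholB B(1) inj] .
  obtain f where f: "f holomorphic_on (e ` B)" "\<And>z. z \<in> B \<Longrightarrow> deriv e z * deriv f (e z) = 1" "\<And>z. z \<in> B \<Longrightarrow> f (e z) = z"
    using holomorphic_has_inverse[OF eholB B(1) inj] by blast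
  have Df: "(f has_field_derivative 1 / e' s) (at (e s))" if "s \<in> B" for s
  proof -
    have "(f has_field_derivative deriv f (e s)) (at (e s))"
      using f(1) oeB that by (intro holomorphic_derivI[of _ "e ` B"]) auto
    moreover have "deriv f (e s) = 1 / e' s"
      using f(2)[OF that] de[of s] B(3) that D(1) by (auto simp: field_simps)
    ultimately show ?thesis by simp
  qed
  \<comment> \<open>A holomorphic square root of \<open>\<rho>\<close> near \<open>s0\<close>: the
    quotient \<open>\<rho> s / \<rho> s0\<close> has positive real part there and stays off the cut
    of \<open>csqrt\<close>.\<close>
  define v where "v s = csqrt (\<rho> s0) * csqrt (\<rho> s / \<rho> s0)" for s
  have v: "(v s)^2 = \<rho> s" for s using D(2)[OF s0] by (simp add: v_def power_mult_distrib)
  have v0: "v s \<noteq> 0" if "s \<in> B" for s using v[of s] D(2)[of s] that B(3) by auto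
  have Dv: "(v has_field_derivative b s * e' s / (2 * v s)) (at s)" if "s \<in> B" for s
  proof -
    have nz: "csqrt (\<rho> s / \<rho> s0) \<noteq> 0" using v0[OF that] by (auto simp: v_def)
    have "\<rho> s / \<rho> s0 \<notin> \<real>\<^sub>\<le>\<^sub>0" using Re[OF that] by (auto simp: complex_nonpos_Reals_iff)
    then have "(v has_field_derivative csqrt (\<rho> s0) * ((b s * e' s) / \<rho> s0 / (2 * csqrt (\<rho> s / \<rho> s0)))) (at s)"
      unfolding v_def[abs_def] using D(2)[OF s0] D(5)[of s] B(3) that
      by (auto intro!: derivative_eq_intros)
    moreover have "csqrt (\<rho> s0) * ((b s * e' s) / \<rho> s0 / (2 * csqrt (\<rho> s / \<rho> s0))) = b s * e' s / (2 * v s)"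
    proof -
      have "\<rho> s0 = csqrt (\<rho> s0) * csqrt (\<rho> s0)" by (simp flip: power2_eq_square)
      then show ?thesis using D(2)[OF s0] nz unfolding v_def
        by (simp add: divide_simps)
    qed
    ultimately show ?thesis by simp
  qed
  define R where "R s = mat2 (1 / v s + T s * b s / (2 * v s)) (T s * v s) (b s / (2 * v s)) (v s)" for s
  define P where "P x = R (f x)" for x
  have R: "R s = param_mat (T s) (\<rho> s) (b s) \<or> R s = - param_mat (T s) (\<rho> s) (b s)" if "s \<in> B" for s
    unfolding R_def using param_mat_sqrt[OF v, of s] D(2)[of s] that B(3) by blast
  have chain: "((\<lambda>x. F (f x)) has_field_derivative F' / e' s) (at (e s))"
    if "(F has_field_derivative F') (at s)" "s \<in> B" for F F' s
    using DERIV_chain2[OF _ Df[OF that(2)], of F F'] that f(3) by simp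
  obtain r where r: "r > 0" "ball (e s0) r \<subseteq> e ` B"
    using oeB B(2) open_contains_ball by blast
  have sol: "is_solution q (ball (e s0) r) P"
    unfolding is_solution_def
  proof (intro ballI conjI allI)
    fix x and i :: 2 assume "x \<in> ball (e s0) r"
    then obtain s where s: "s \<in> B" "x = e s" using r(2) by blast
    have sS: "s \<in> S" using s(1) B(3) by blast
    have Px: "P x = R s" by (simp add: P_def s f(3))
    have vs: "v s \<noteq> 0" "\<rho> s = v s * v s" using v0[OF s(1)] v[of s] by (simp_all add: power2_eq_square)
    show "det (P x) = 1" using vs by (simp add: Px R_def field_simps)
    note DD = D(4)[OF sS] D(6)[OF sS] Dv[OF s(1)]
    have e': "e' s \<noteq> 0" by (rule D(1)[OF sS])
    have "((\<lambda>s. R s $ i $ 2) has_field_derivative R s $ i $ 1 * e' s) (at s)"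
      using exhaust_2[of i]
    proof
      assume "i = 1"
      have "((\<lambda>s. T s * v s) has_field_derivative (1 / v s + T s * b s / (2 * v s)) * e' s) (at s)"
        by (rule derivative_eq_intros DD refl)+ (use vs in \<open>simp add: field_simps\<close>)
      then show ?thesis by (simp add: \<open>i = 1\<close> R_def)
    next
      assume "i = 2"
      then show ?thesis using Dv[OF s(1)] by (simp add: R_def field_simps)
    qed
    from chain[OF this s(1)] show "((\<lambda>x. P x $ i $ 2) has_field_derivative P x $ i $ 1) (at x)"
      using e' unfolding Px by (simp add: P_def s(2))
    have b2: "((\<lambda>s. b s / (2 * v s)) has_field_derivative q x * v s * e' s) (at s)"
      by (rule derivative_eq_intros DD refl)+ (use vs s(2) in \<open>simp_all add: field_simps power2_eq_square\<close>)
    have "((\<lambda>s. R s $ i $ 1) has_field_derivative q x * R s $ i $ 2 * e' s) (at s)"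
      using exhaust_2[of i]
    proof
      assume "i = 1"
      have "((\<lambda>s. 1 / v s + T s * (b s / (2 * v s))) has_field_derivative q x * (T s * v s) * e' s) (at s)"
      proof -
        have "((\<lambda>s. 1 / v s) has_field_derivative - (b s * e' s / (2 * v s)) / (v s * v s)) (at s)"
          using DERIV_inverse'[OF Dv[OF s(1)] vs(1)] vs(1) by (simp add: field_simps)
        from DERIV_add[OF this DERIV_mult[OF D(4)[OF sS] b2]] show ?thesis
          by (rule DERIV_cong) (use vs in \<open>simp add: field_simps\<close>)
      qed
      then show ?thesis by (simp add: \<open>i = 1\<close> R_def)
    next
      assume "i = 2"
      then show ?thesis using b2 by (simp add: R_def)
    qed
    from chain[OF this s(1)] show "((\<lambda>x. P x $ i $ 1) has_field_derivative q x * P x $ i $ 2) (at x)"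
      using e' unfolding Px by (simp add: P_def s(2))
  qed
  define V where "V = B \<inter> e -` ball (e s0) r"
  have "open V"
    unfolding V_def using B(1) holomorphic_on_imp_continuous_on[OF eholB]
    by (simp add: continuous_on_open_vimage Int_commute)
  moreover have "s0 \<in> V" "V \<subseteq> S" "e ` V = ball (e s0) r" using B r by (auto simp: V_def)
  moreover have "\<forall>s\<in>V. P (e s) = param_mat (T s) (\<rho> s) (b s) \<or> P (e s) = - param_mat (T s) (\<rho> s) (b s)"
    using R f(3) by (auto simp: V_def P_def)
  ultimately show ?thesis using r(1) sol by blast
qed

text \<open>Local solutions are glued along the connected set \<open>S\<close>. Parameters with
  \<open>e s = e t\<close> are allowed, and this is how loops are obtained.\<close>

lemma parametrization_reach:
  assumes p: "parametrization (rat_eval n d) S e e' T \<rho> b" and d: "\<And>s. s \<in> S \<Longrightarrow> poly d (e s) \<noteq> 0"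
    and s: "s \<in> S" "t \<in> S"
  shows "reach n d (e s, param_mat (T s) (\<rho> s) (b s)) (e t, param_mat (T t) (\<rho> t) (b t))"
proof (rule connected_equivalence_relation[where S = S and
      R = "\<lambda>s t. reach n d (e s, param_mat (T s) (\<rho> s) (b s)) (e t, param_mat (T t) (\<rho> t) (b t))"])
  show "connected S" using p by (simp add: parametrization_def)
  show "s \<in> S" "t \<in> S" by fact+
  fix a assume a: "a \<in> S"
  obtain r P V where V: "r > 0" "is_solution (rat_eval n d) (ball (e a) r) P" "open V" "a \<in> V" "V \<subseteq> S" "e ` V = ball (e a) r"
    "\<And>s. s \<in> V \<Longrightarrow> P (e s) = param_mat (T s) (\<rho> s) (b s) \<or> P (e s) = - param_mat (T s) (\<rho> s) (b s)"
    using parametrization_local[OF p a] by blast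
  have sub: "ball (e a) r \<subseteq> {x. poly d x \<noteq> 0}"
    unfolding V(6)[symmetric]
  proof (rule image_subsetI)
    fix s assume "s \<in> V"
    then show "e s \<in> {x. poly d x \<noteq> 0}" using d[of s] V(5) by blast
  qed
  have "step n d (e a, param_mat (T a) (\<rho> a) (b a)) (e x, param_mat (T x) (\<rho> x) (b x))" if x: "x \<in> V" for x
    unfolding step_def
  proof (intro exI[of _ "ball (e a) r"] exI[of _ P] conjI)
    show "fst (e x, param_mat (T x) (\<rho> x) (b x)) \<in> ball (e a) r" using x V(6) by auto
    show "snd (e a, param_mat (T a) (\<rho> a) (b a)) = P (fst (e a, param_mat (T a) (\<rho> a) (b a))) \<or>
      snd (e a, param_mat (T a) (\<rho> a) (b a)) = - P (fst (e a, param_mat (T a) (\<rho> a) (b a)))"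
      using V(7)[OF V(4)] by auto
    show "snd (e x, param_mat (T x) (\<rho> x) (b x)) = P (fst (e x, param_mat (T x) (\<rho> x) (b x))) \<or>
      snd (e x, param_mat (T x) (\<rho> x) (b x)) = - P (fst (e x, param_mat (T x) (\<rho> x) (b x)))"
      using V(7)[OF x] by auto
  qed (use V sub in auto)
  moreover have "openin (top_of_set S) V" by (rule open_subset[OF V(5,3)])
  ultimately show "\<exists>U. openin (top_of_set S) U \<and> a \<in> U \<and>
      (\<forall>x\<in>U. reach n d (e a, param_mat (T a) (\<rho> a) (b a)) (e x, param_mat (T x) (\<rho> x) (b x)))"
    using V(4) by blast
qed (use reach_sym rtranclp_trans in \<open>metis+\<close>)

lemma minus_mult_mat2: "(- A) ** B = - (A ** B)" for A B :: "complex^2^2"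
  by (cases A rule: mat2_cases; cases B rule: mat2_cases) simp

text \<open>Local solutions on discs are replaced by parametrized ones. These are known only up to
  sign, and the sign is absorbed by \<open>- mat 1\<close> in \<open>G\<close>.\<close>

lemma reductionI:
  assumes "d \<noteq> 0" "alg_group G" "\<And>x P. (x, P) \<in> Z \<Longrightarrow> poly d x \<noteq> 0 \<and> det P = 1"
    and fib: "\<And>x P P'. (x, P) \<in> Z \<Longrightarrow> det P' = 1 \<Longrightarrow> (x, P') \<in> Z \<longleftrightarrow> P' ** adj2 P \<in> G"
    and loc: "\<And>x. poly d x \<noteq> 0 \<Longrightarrow> \<exists>S e e' T \<rho> b s. parametrization (rat_eval n d) S e e' T \<rho> b \<and> s \<in> S \<and> e s = x \<and>
      (\<forall>s\<in>S. (e s, param_mat (T s) (\<rho> s) (b s)) \<in> Z)"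
    and clo: "\<exists>E\<subseteq>polyfun even_coords. \<forall>x P. poly d x \<noteq> 0 \<longrightarrow> det P = 1 \<longrightarrow> ((x, P) \<in> Z \<longleftrightarrow> (\<forall>f\<in>E. f (x, P) = 0))"
  shows "reduction n d G Z"
proof -
  have "\<exists>r>0. \<exists>P. ball x r \<subseteq> {x. poly d x \<noteq> 0} \<and> is_solution (rat_eval n d) (ball x r) P \<and>
        (\<forall>y\<in>ball x r. (y, P y) \<in> Z)" if x: "poly d x \<noteq> 0" for x
  proof -
    obtain S e e' T \<rho> b s where s: "parametrization (rat_eval n d) S e e' T \<rho> b" "s \<in> S" "e s = x"
      "\<And>s. s \<in> S \<Longrightarrow> (e s, param_mat (T s) (\<rho> s) (b s)) \<in> Z" using loc[OF x] by blast
    obtain r P V where V: "r > 0" "is_solution (rat_eval n d) (ball x r) P" "V \<subseteq> S" "e ` V = ball x r"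
      "\<And>s. s \<in> V \<Longrightarrow> P (e s) = param_mat (T s) (\<rho> s) (b s) \<or> P (e s) = - param_mat (T s) (\<rho> s) (b s)"
      using parametrization_local[OF s(1,2)] unfolding s(3) by blast
    have "(y, P y) \<in> Z" if y: "y \<in> ball x r" for y
    proof -
      from y have "y \<in> e ` V" unfolding V(4) .
      then obtain t where t: "t \<in> V" "y = e t" by blast
      have tZ: "(e t, param_mat (T t) (\<rho> t) (b t)) \<in> Z" using s(4) t(1) V(3) by blast
      have dt: "det (param_mat (T t) (\<rho> t) (b t)) = 1" using assms(3)[OF tZ] by blast
      have "- param_mat (T t) (\<rho> t) (b t) ** adj2 (param_mat (T t) (\<rho> t) (b t)) = - mat 1"
        by (simp add: minus_mult_mat2 mult_adj2 dt)
      moreover have "det (- param_mat (T t) (\<rho> t) (b t)) = 1"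
        using dt by (cases "param_mat (T t) (\<rho> t) (b t)" rule: mat2_cases) simp
      ultimately have "(e t, - param_mat (T t) (\<rho> t) (b t)) \<in> Z"
        using fib[OF tZ] alg_groupD(3)[OF assms(2)] by simp
      then show ?thesis using V(5)[OF t(1)] tZ t(2) by auto
    qed
    then show ?thesis using V(1,2) assms(3) by blast
  qed
  then show ?thesis using assms unfolding reduction_def by blast
qed

lemma reduction_step_minus:
  assumes R: "reduction n d G Z" and P: "(x, P) \<in> Z"
  shows "step n d (x, P) (x, - P)"
proof -
  obtain U P1 where "open U" "connected U" "U \<subseteq> {x. poly d x \<noteq> 0}" "is_solution (rat_eval n d) U P1"
     "x \<in> U" "P = P1 x \<or> P = - P1 x"
    using reduction_step_refl[OF assms] unfolding step_def by auto
  then show ?thesis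
    unfolding step_def by (intro exI[of _ U] exI[of _ P1]) auto
qed

text \<open>A matrix and its negative are one step apart, so the undetermined sign of
  \<open>P'\<close> does no harm.\<close>

lemma monodromyI:
  assumes R: "reduction n d G Z" and Z: "(x, m ** P) \<in> Z" and m: "det m = 1"
    and r: "reach n d (x, P) (x, P')" "P' = m ** P \<or> P' = - (m ** P)"
  shows "m \<in> monodromy n d (x, P)" "- m \<in> monodromy n d (x, P)"
proof -
  have mm: "- (m ** P) = (- m) ** P" by (simp add: minus_mult_mat2)
  note st = reduction_step_minus[OF R Z]
  have "reach n d (x, P) (x, m ** P) \<and> reach n d (x, P) (x, - (m ** P))"
    using r st step_sym[OF st] by (metis rtranclp.rtrancl_into_rtrancl)
  moreover have "det (- m) = 1" using m by (cases m rule: mat2_cases) simp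
  ultimately show "m \<in> monodromy n d (x, P)" "- m \<in> monodromy n d (x, P)"
    using m by (simp_all add: monodromy_def mm)
qed

lemma monodromy_mult:
  assumes "m \<in> monodromy n d a" "m' \<in> monodromy n d a" shows "m ** m' \<in> monodromy n d a"
proof -
  have "reach n d (fst a, m ** snd a) (fst a, m ** (m' ** snd a))"
    using reach_mult[of n d a "(fst a, m' ** snd a)" m] assms by (simp add: monodromy_def)
  then show ?thesis
    using assms by (auto simp: monodromy_def det_mul matrix_mul_assoc intro: rtranclp_trans)
qed

lemma monodromy_1: "mat 1 \<in> monodromy n d a"
  by (simp add: monodromy_def)

section \<open>Tori and their normalizers\<close>

lemma mult_mem_hull: "(\<And>Z. zariski_closed C Z \<Longrightarrow> S \<subseteq> Z \<Longrightarrow> x \<in> Z) \<Longrightarrow> x \<in> zariski_closed C hull S"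
  unfolding hull_def by blast

lemma exp_cis_shift: "exp (\<i> * (w + 2 * of_real pi * \<i> * of_nat k)) = exp (\<i> * w) * of_real (exp (- 2 * pi * k))"
proof -
  have "\<i> * (w + 2 * of_real pi * \<i> * of_nat k) = \<i> * w + of_real (- 2 * pi * k)"
    by (simp add: algebra_simps)
  then show ?thesis by (simp only: exp_add exp_of_real)
qed

lemma exp_shift: "exp (w + 2 * of_real pi * \<i> * of_nat k) = exp w"
proof -
  have "2 * of_real pi * \<i> * of_nat k = 2 * of_nat k * of_real pi * \<i>" by simp
  moreover have "exp (of_nat k * (2 * of_real pi * \<i>)) = (1::complex)"
    unfolding exp_of_nat_mult by simp
  ultimately show ?thesis by (simp add: exp_add mult_ac)
qed

lemma infinite_exp_pi: "infinite (range (\<lambda>k::nat. of_real (exp (- pi * k)) :: complex))"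
  by (intro range_inj_infinite injI) simp

text \<open>For \<open>a = u'\<close>, \<open>b = u\<close>, \<open>c = v'\<close>,
  \<open>d = v\<close>: the Wronskian 1 together with \<open>u v\<close> and its derivative
  determines \<open>u' v\<close> and \<open>u v'\<close>. Hence two such bases have the same
  logarithmic derivatives \<open>u' / u\<close> and \<open>v' / v\<close>.\<close>

lemma ratio_diag:
  fixes a b c d :: complex
  assumes "a * d - b * c = 1" "a' * d' - b' * c' = 1" "b * d = w" "b' * d' = w" "a * d + b * c = u" "a' * d' + b' * c' = u" "w \<noteq> 0"
  shows "a' * b = b' * a" "c' * d = d' * c"
proof -
  have nz: "b \<noteq> 0" "d \<noteq> 0" "b' \<noteq> 0" "d' \<noteq> 0" using assms by auto
  have ad: "2 * (a * d) = u + 1" "2 * (a' * d') = u + 1" and bc: "2 * (b * c) = u - 1" "2 * (b' * c') = u - 1"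
    using assms(1,2,5,6) by algebra+
  have "2 * d * d' * (a' * b) = (u + 1) * w" "2 * d * d' * (b' * a) = (u + 1) * w"
    using ad assms(3,4) by algebra+
  then have "2 * d * d' * (a' * b) = 2 * d * d' * (b' * a)" by simp
  then show "a' * b = b' * a" using nz by simp
  have "2 * b * b' * (c' * d) = (u - 1) * w" "2 * b * b' * (d' * c) = (u - 1) * w"
    using bc assms(3,4) by algebra+
  then have "2 * b * b' * (c' * d) = 2 * b * b' * (d' * c)" by simp
  then show "c' * d = d' * c" using nz by simp
qed

lemma polyfun_even_coords: "fst \<in> polyfun even_coords" "(\<lambda>a. snd a $ i $ j * snd a $ k $ l) \<in> polyfun even_coords"
  by (rule polyfun.coord, force simp: even_coords_def)+

text \<open>The Euler equation \<open>v'' = - v / (2 x^2)\<close> has exponents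
  \<open>(1 + i) / 2\<close> and \<open>(1 - i) / 2\<close>, so the quotient of solutions is
  \<open>x^i\<close>. The product \<open>u v = - i x\<close> is rational, which confines the group
  to the torus, while a turn around 0 multiplies \<open>T\<close> by \<open>exp (- 2 pi)\<close>,
  which is not a root of unity.\<close>

lemma torus_realization:
  assumes "alg_group torus2"
  shows "\<exists>n d Z x P. reduction n d torus2 Z \<and> (x, P) \<in> Z \<and> torus2 \<subseteq> zariski_closed mat_coords hull monodromy n d (x, P)"
proof -
  define n d :: "complex poly" where "n = [:-1:]" and "d = [:0, 0, 2:]"
  have q: "rat_eval n d x = - 1 / (2 * x^2)" for x by (simp add: rat_eval_def n_def d_def power2_eq_square)
  have d: "poly d x \<noteq> 0 \<longleftrightarrow> x \<noteq> 0" for x by (simp add: d_def)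
  define Z where "Z = {(x, P :: complex^2^2). x \<noteq> 0 \<and> det P = 1 \<and> P$1$2 * P$2$2 = - \<i> * x \<and> P$1$1 * P$2$2 + P$1$2 * P$2$1 = - \<i>}"
  define T \<rho> b where "T w = exp (\<i> * w)" and "\<rho> w = - \<i> * exp (w - \<i> * w)" and "b w = - (1 + \<i>) * exp (- \<i> * w)" for w
  have TR: "T w * \<rho> w = - \<i> * exp w" "T w * b w = - (1 + \<i>)" for w
    by (simp_all add: T_def \<rho>_def b_def flip: exp_add)
  have par: "parametrization (rat_eval n d) UNIV exp exp T \<rho> b"
    unfolding parametrization_def
  proof (intro conjI ballI)
    fix s
    have e: "exp (s - \<i> * s) = exp s * exp (- \<i> * s)" "exp (\<i> * s) = 1 / exp (- \<i> * s)"
      by (simp_all add: exp_diff exp_minus field_simps)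
    show "(T has_field_derivative exp s / \<rho> s) (at s)"
    proof -
      have "(T has_field_derivative exp (\<i> * s) * \<i>) (at s)"
        unfolding T_def by (auto intro!: derivative_eq_intros)
      moreover have "exp (\<i> * s) * \<i> = exp s / \<rho> s"
        unfolding \<rho>_def e by (simp add: field_simps)
      ultimately show ?thesis by simp
    qed
    show "(\<rho> has_field_derivative b s * exp s) (at s)"
      unfolding b_def \<rho>_def by (auto intro!: derivative_eq_intros simp: algebra_simps simp flip: exp_add)
    show "(b has_field_derivative exp s * (2 * \<rho> s * rat_eval n d (exp s) + (b s)^2 / (2 * \<rho> s))) (at s)"
      unfolding b_def \<rho>_def q e(1)
      by (auto intro!: derivative_eq_intros simp: field_simps power2_eq_square)
    show "\<rho> s \<noteq> 0" by (simp add: \<rho>_def)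
  qed (auto intro!: derivative_eq_intros)
  have RZ: "(exp w, param_mat (T w) (\<rho> w) (b w)) \<in> Z" for w
  proof -
    have "\<rho> w \<noteq> 0" by (simp add: \<rho>_def)
    from param_mat_prods(1,2)[OF this, of "T w" "b w"] det_param_mat[OF this, of "T w" "b w"] TR[of w]
    show ?thesis by (simp add: Z_def)
  qed
  have R: "reduction n d torus2 Z"
  proof (rule reductionI[OF _ assms])
    show "d \<noteq> 0" by (simp add: d_def)
    show "poly d x \<noteq> 0 \<and> det P = 1" if "(x, P) \<in> Z" for x P using that by (simp add: Z_def d)
    show "(x, P') \<in> Z \<longleftrightarrow> P' ** adj2 P \<in> torus2" if Z0: "(x, P) \<in> Z" and dP': "det P' = 1" for x P P'
    proof -
      obtain a b c d where P: "P = mat2 a b c d" by (rule mat2_cases)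
      obtain a' b' c' d' where P': "P' = mat2 a' b' c' d'" by (rule mat2_cases)
      have dP: "det P = 1" using Z0 by (simp add: Z_def)
      have det: "det (P' ** adj2 P) = 1" using dP' Z0 unfolding det_mul det_adj2 by (simp add: Z_def)
      have z: "x \<noteq> 0" "a * d - b * c = 1" "b * d = - \<i> * x" "a * d + b * c = - \<i>" "a' * d' - b' * c' = 1"
        using Z0 dP' by (auto simp: Z_def P P')
      show ?thesis
      proof
        assume "(x, P') \<in> Z"
        then have z': "b' * d' = - \<i> * x" "a' * d' + b' * c' = - \<i>" by (auto simp: Z_def P')
        have "a' * b = b' * a" "c' * d = d' * c"
          by (rule ratio_diag[OF z(2,5,3) z'(1) z(4) z'(2)]; use z(1) in simp)+
        then show "P' ** adj2 P \<in> torus2" using det by (simp add: torus2_def P P')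
      next
        assume t: "P' ** adj2 P \<in> torus2"
        obtain k l where kl: "P' ** adj2 P = mat2 k 0 0 l" "k * l = 1"
          using t by (cases "P' ** adj2 P" rule: mat2_cases) (auto simp: torus2_def)
        have "P' = mat2 k 0 0 l ** P" unfolding kl(1)[symmetric] by (rule mult_adj2_cancel(4)[OF dP, symmetric])
        then have e: "a' = k * a" "b' = k * b" "c' = l * c" "d' = l * d" by (simp_all add: P P')
        have "b' * d' = (k * l) * (b * d)" "a' * d' + b' * c' = (k * l) * (a * d + b * c)"
          by (simp_all add: e algebra_simps)
        then show "(x, P') \<in> Z" using z kl(2) by (simp add: Z_def P')
      qed
    qed
    show "\<exists>S e e' T \<rho> b s. parametrization (rat_eval n d) S e e' T \<rho> b \<and> s \<in> S \<and> e s = x \<and>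
      (\<forall>s\<in>S. (e s, param_mat (T s) (\<rho> s) (b s)) \<in> Z)" if "poly d x \<noteq> 0" for x
    proof -
      have "exp (Ln x) = x" using that by (simp add: d)
      then show ?thesis using par RZ by blast
    qed
    let ?E = "{\<lambda>a. snd a $1$2 * snd a $2$2 + \<i> * fst a, \<lambda>a. (snd a $1$1 * snd a $2$2 + snd a $1$2 * snd a $2$1) + \<i>} :: (complex \<times> (complex^2^2) \<Rightarrow> complex) set"
    have "?E \<subseteq> polyfun even_coords"
      by (intro insert_subsetI empty_subsetI polyfun_intros polyfun_even_coords)
    then show "\<exists>E\<subseteq>polyfun even_coords. \<forall>x P. poly d x \<noteq> 0 \<longrightarrow> det P = 1 \<longrightarrow> ((x, P) \<in> Z \<longleftrightarrow> (\<forall>f\<in>E. f (x, P) = 0))"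
      by (intro exI[of _ ?E]) (auto simp: Z_def d eq_neg_iff_add_eq_0)
  qed
  define P0 where "P0 = param_mat (T 0) (\<rho> 0) (b 0)"
  have Z0: "(1, P0) \<in> Z" using RZ[of 0] by (simp add: P0_def)
  \<comment> \<open>After \<open>k\<close> turns around 0 the map \<open>T\<close> is multiplied by
    the square of \<open>exp (- pi * k)\<close>.\<close>
  have mon: "mat2 (of_real (exp (- pi * k))) 0 0 (1 / of_real (exp (- pi * k))) \<in> monodromy n d (1, P0)" (is "?m \<in> _") for k :: nat
  proof (rule monodromyI(1)[OF R])
    define c :: complex where "c = of_real (exp (- pi * k))"
    have c: "c \<noteq> 0" by (simp add: c_def)
    define w1 :: complex where "w1 = 0 + 2 * of_real pi * \<i> * of_nat k"
    have cc: "of_real (exp (- 2 * pi * k)) = c^2"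
      unfolding c_def of_real_power[symmetric] by (simp flip: exp_of_nat_mult)
    have T': "T w1 = c^2 * T 0" unfolding T_def w1_def exp_cis_shift cc by simp
    have e1: "exp w1 = 1" using exp_shift[of 0 k] by (simp add: w1_def)
    have \<rho>': "\<rho> w1 = (1 / c^2) * \<rho> 0"
    proof -
      have T1: "T 0 = 1" by (simp add: T_def)
      have "c^2 * \<rho> w1 = - \<i>" "\<rho> 0 = - \<i>"
        using TR(1)[of w1] TR(1)[of 0] unfolding T' T1 e1 exp_zero by (simp_all only: mult_1_left mult_1_right)
      then have "c^2 * \<rho> w1 = \<rho> 0" by simp
      then show ?thesis using c by (simp add: field_simps)
    qed
    have b': "b w1 = (1 / c^2) * b 0"
    proof -
      have T1: "T 0 = 1" by (simp add: T_def)
      have "c^2 * b w1 = - (1 + \<i>)" "b 0 = - (1 + \<i>)"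
        using TR(2)[of w1] TR(2)[of 0] unfolding T' T1 by (simp_all only: mult_1_left mult_1_right)
      then have "c^2 * b w1 = b 0" by simp
      then show ?thesis using c by (simp add: field_simps)
    qed
    have "param_mat (T w1) (\<rho> w1) (b w1) = mat2 c 0 0 (1 / c) ** param_mat (T 0) (\<rho> 0) (b 0) \<or>
      param_mat (T w1) (\<rho> w1) (b w1) = - (mat2 c 0 0 (1 / c) ** param_mat (T 0) (\<rho> 0) (b 0))"
      by (rule param_mat_moebius) (use c in \<open>simp_all add: T' \<rho>' b' power2_eq_square, simp_all add: \<rho>_def\<close>)
    then show "param_mat (T w1) (\<rho> w1) (b w1) = ?m ** P0 \<or> param_mat (T w1) (\<rho> w1) (b w1) = - (?m ** P0)"
      by (simp add: P0_def c_def)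
    have "reach n d (exp 0, param_mat (T 0) (\<rho> 0) (b 0)) (exp w1, param_mat (T w1) (\<rho> w1) (b w1))"
      by (rule parametrization_reach[OF par]) (simp_all add: d)
    then show "reach n d (1, P0) (1, param_mat (T w1) (\<rho> w1) (b w1))" unfolding e1 by (simp add: P0_def)
    show "det ?m = 1" by simp
    have "?m \<in> torus2" by (simp add: torus2_def)
    then show "(1, ?m ** P0) \<in> Z" by (rule reduction_mult[OF R Z0])
  qed
  have "torus2 \<subseteq> zariski_closed mat_coords hull monodromy n d (1, P0)"
  proof
    fix A assume A: "A \<in> torus2"
    obtain t s where ts: "A = mat2 t 0 0 s" "t * s = 1"
      using A by (cases A rule: mat2_cases) (auto simp: torus2_def)
    then have t: "t \<noteq> 0" "s = 1 / t" by (auto simp: eq_divide_eq mult.commute)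
    show "A \<in> zariski_closed mat_coords hull monodromy n d (1, P0)"
    proof (rule mult_mem_hull)
      fix Y assume Y: "zariski_closed mat_coords Y" "monodromy n d (1, P0) \<subseteq> Y"
      have "range (\<lambda>k::nat. of_real (exp (- pi * k))) \<subseteq> {t. t \<noteq> 0 \<and> mat2 t 0 0 (1 / t) \<in> Y}"
        using mon Y(2) by auto
      then have "infinite {t. t \<noteq> 0 \<and> mat2 t 0 0 (1 / t) \<in> Y}" using infinite_exp_pi finite_subset by blast
      from infinite_torus[OF Y(1) this] show "A \<in> Y" using t ts by (simp add: contains_T_def)
    qed
  qed
  then show ?thesis using R Z0 by blast
qed

lemma connected_exp_domain: "open {w::complex. exp w \<noteq> 1 \<and> exp w \<noteq> -1}" "connected {w::complex. exp w \<noteq> 1 \<and> exp w \<noteq> -1}"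
proof -
  have 1: "open {w::complex. exp w \<noteq> 1}" "open {w::complex. exp w \<noteq> -1}"
    by (intro open_Collect_neq continuous_intros)+
  then show "open {w::complex. exp w \<noteq> 1 \<and> exp w \<noteq> (-1::complex)}" using open_Int[OF 1] by (simp add: Int_def)
  have "{w::complex. exp w = 1 \<or> exp w = -1} \<subseteq> range (\<lambda>k::int. of_int k * of_real pi * \<i>)"
  proof
    fix w :: complex assume "w \<in> {w. exp w = 1 \<or> exp w = -1}"
    then have "exp (2 * w) = 1" by (auto simp: exp_double)
    then obtain k :: int where "Re (2 * w) = 0" "Im (2 * w) = of_int (2 * k) * pi" by (auto simp: exp_eq_1)
    then have "w = of_int k * of_real pi * \<i>" by (simp add: complex_eq_iff)
    then show "w \<in> range (\<lambda>k::int. of_int k * of_real pi * \<i>)" by blast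
  qed
  then have "countable {w::complex. exp w = 1 \<or> exp w = -1}"
    by (rule countable_subset) (intro countable_image countableI_type)
  then have "connected (UNIV - {w::complex. exp w = 1 \<or> exp w = -1})"
    by (intro connected_open_diff_countable) auto
  moreover have "UNIV - {w::complex. exp w = 1 \<or> exp w = -1} = {w. exp w \<noteq> 1 \<and> exp w \<noteq> -1}" by blast
  ultimately show "connected {w::complex. exp w \<noteq> 1 \<and> exp w \<noteq> -1}" by simp
qed

text \<open>Counterpart of \<open>ratio_diag\<close> when \<open>u v\<close> and its derivative
  change sign: the two logarithmic derivatives are then exchanged.\<close>

lemma ratio_antidiag:
  fixes a b c d :: complex
  assumes "a * d - b * c = 1" "a' * d' - b' * c' = 1" "b * d = w" "b' * d' = - w" "a * d + b * c = u" "a' * d' + b' * c' = - u" "w \<noteq> 0"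
  shows "a' * d = b' * c" "d' * a = c' * b"
proof -
  have nz: "b \<noteq> 0" "d \<noteq> 0" "b' \<noteq> 0" "d' \<noteq> 0" using assms by auto
  have ad: "2 * (a * d) = u + 1" "2 * (a' * d') = 1 - u" and bc: "2 * (b * c) = u - 1" "2 * (b' * c') = - u - 1"
    using assms(1,2,5,6) by algebra+
  have "2 * b * d' * (a' * d) = (1 - u) * w" "2 * b * d' * (b' * c) = (1 - u) * w"
    using ad bc assms(3,4) by algebra+
  then have "2 * b * d' * (a' * d) = 2 * b * d' * (b' * c)" by simp
  then show "a' * d = b' * c" using nz by simp
  have "2 * d * b' * (d' * a) = (u + 1) * (- w)" "2 * d * b' * (c' * b) = (u + 1) * (- w)"
    using ad bc assms(3,4) by algebra+
  then have "2 * d * b' * (d' * a) = 2 * d * b' * (c' * b)" by simp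
  then show "d' * a = c' * b" using nz by simp
qed

text \<open>The equation for \<open>b\<close> in \<open>monomial_realization\<close>, split into the
  term with \<open>q\<close>, the term with \<open>b^2\<close>, and their sum with the derivative of
  \<open>b\<close>. Here \<open>v\<close> is a value of the function \<open>u\<close> and
  \<open>X\<close> one of \<open>exp (- i w)\<close>.\<close>

lemma monomial_aux:
  fixes v X :: complex
  assumes v: "v \<noteq> 0" "v^2 - 1 \<noteq> 0"
  shows "(v * (v^2 - 1)) * (2 * (- \<i> * (v * (v^2 - 1)) * X) * (- (3 * (v^2)^2 + 2 * v^2 + 3) / (16 * (v^2)^2 * (v^2 - 1)^2)))
      = \<i> * X * (3 * (v^2)^2 + 2 * v^2 + 3) / (8 * v^2)"
    and "X \<noteq> 0 \<Longrightarrow> (v * (v^2 - 1)) * ((- \<i> * ((3 * v^2 - 1) / (2 * v) - \<i>) * X)^2 / (2 * (- \<i> * (v * (v^2 - 1)) * X)))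
      = - \<i> * X * ((3 * v^2 - 1) / (2 * v) - \<i>)^2 / 2"
    and "- \<i> * ((6 * v * ((v^2 - 1) / 2) * (2 * v) - (3 * v^2 - 1) * (v^2 - 1)) / (2 * v)^2) * X + - \<i> * ((3 * v^2 - 1) / (2 * v) - \<i>) * (- \<i> * X)
      = \<i> * X * (3 * (v^2)^2 + 2 * v^2 + 3) / (8 * v^2) + - \<i> * X * ((3 * v^2 - 1) / (2 * v) - \<i>)^2 / 2"
proof -
  have "(v * K) * (2 * (- \<i> * (v * K) * X) * (- N / (16 * (v^2)^2 * K^2))) = \<i> * X * N / (8 * v^2)" if "K \<noteq> 0" for K N
    using v(1) that by (simp add: field_simps power2_eq_square)
  from this[OF v(2)] show "(v * (v^2 - 1)) * (2 * (- \<i> * (v * (v^2 - 1)) * X) * (- (3 * (v^2)^2 + 2 * v^2 + 3) / (16 * (v^2)^2 * (v^2 - 1)^2)))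
      = \<i> * X * (3 * (v^2)^2 + 2 * v^2 + 3) / (8 * v^2)" .
  have "(v * K) * ((- \<i> * c * X)^2 / (2 * (- \<i> * (v * K) * X))) = - \<i> * X * c^2 / 2" if "K \<noteq> 0" "X \<noteq> 0" for K c
    using v(1) that by (simp add: field_simps power2_eq_square)
  from this[OF v(2)] show "X \<noteq> 0 \<Longrightarrow> (v * (v^2 - 1)) * ((- \<i> * ((3 * v^2 - 1) / (2 * v) - \<i>) * X)^2 / (2 * (- \<i> * (v * (v^2 - 1)) * X)))
      = - \<i> * X * ((3 * v^2 - 1) / (2 * v) - \<i>)^2 / 2" .
  define m where "m = (3 * v^2 - 1) / (2 * v)"
  have m: "3 * v^2 - 1 = 2 * v * m" using v(1) by (simp add: m_def)
  have 1: "6 * v * ((v^2 - 1) / 2) * (2 * v) - (3 * v^2 - 1) * (v^2 - 1) = (v^2 - 1) * (3 * v^2 + 1)"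
    by (simp add: field_simps power2_eq_square)
  have 2: "m^2 = (3 * v^2 - 1)^2 / (4 * v^2)" by (simp add: m_def power_divide power_mult_distrib)
  have "- \<i> * ((v^2 - 1) * (3 * v^2 + 1) / (2 * v)^2) * X + - \<i> * (m - \<i>) * (- \<i> * X) - (- \<i> * X * (m - \<i>)^2 / 2)
    = \<i> * X * (m^2 / 2 + 1 / 2 - (v^2 - 1) * (3 * v^2 + 1) / (4 * v^2))"
    by (simp add: algebra_simps power2_eq_square add_divide_distrib diff_divide_distrib)
  also have "m^2 / 2 + 1 / 2 - (v^2 - 1) * (3 * v^2 + 1) / (4 * v^2) = (3 * (v^2)^2 + 2 * v^2 + 3) / (8 * v^2)"
  proof -
    have "(3 * w - 1)^2 / (4 * w) / 2 + 1 / 2 - (w - 1) * (3 * w + 1) / (4 * w) = (3 * w^2 + 2 * w + 3) / (8 * w)"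
      if "w \<noteq> 0" for w :: complex
      using that by (simp add: field_simps power2_eq_square)
    from this[of "v^2"] show ?thesis unfolding 2 using v(1) by simp
  qed
  finally show "- \<i> * ((6 * v * ((v^2 - 1) / 2) * (2 * v) - (3 * v^2 - 1) * (v^2 - 1)) / (2 * v)^2) * X + - \<i> * ((3 * v^2 - 1) / (2 * v) - \<i>) * (- \<i> * X)
      = \<i> * X * (3 * (v^2)^2 + 2 * v^2 + 3) / (8 * v^2) + - \<i> * X * ((3 * v^2 - 1) / (2 * v) - \<i>)^2 / 2"
    unfolding 1 m_def[symmetric] by (simp add: algebra_simps)
qed

text \<open>The developing map is \<open>exp (\<i> w)\<close> on the double cover \<open>x = s\<^sup>2\<close>, where
  \<open>s = (1 + exp w) / (1 - exp w)\<close>; the covering involution is \<open>w \<mapsto> - w\<close>.\<close>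

lemma monomial_realization:
  assumes "alg_group monomial2"
  shows "\<exists>n d Z x P. reduction n d monomial2 Z \<and> (x, P) \<in> Z \<and> monomial2 \<subseteq> zariski_closed mat_coords hull monodromy n d (x, P)"
proof -
  define n d :: "complex poly" where "n = [:-3, -2, -3:]" and "d = [:0, 0, 16:] * [:-1, 1:]^2"
  have q: "rat_eval n d x = - (3 * x^2 + 2 * x + 3) / (16 * x^2 * (x - 1)^2)" for x
    by (simp add: rat_eval_def n_def d_def power2_eq_square algebra_simps)
  have d: "poly d x \<noteq> 0 \<longleftrightarrow> x \<noteq> 0 \<and> x \<noteq> 1" for x by (auto simp: d_def)
  \<comment> \<open>The product of the two basis solutions is a square root of
    \<open>r x = - x (x - 1)^2\<close>. It changes sign under the covering involution, so only its
    square and its product with its derivative yield equations over \<open>x\<close>.\<close>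
  define r r' :: "complex \<Rightarrow> complex" where "r x = - x * (x - 1)^2" and "r' x = - (x - 1) * (3 * x - 1)" for x
  define Z where "Z = {(x, P :: complex^2^2). x \<noteq> 0 \<and> x \<noteq> 1 \<and> det P = 1 \<and> (P$1$2 * P$2$2)^2 = r x \<and>
     2 * (P$1$2 * P$2$2) * (P$1$1 * P$2$2 + P$1$2 * P$2$1) = r' x}"
  define S where "S = {w::complex. exp w \<noteq> 1 \<and> exp w \<noteq> -1}"
  define u where "u w = (1 + exp w) / (1 - exp w)" for w :: complex
  define e e' where "e w = (u w)^2" and "e' w = u w * ((u w)^2 - 1)" for w
  define Xf where "Xf w = exp (- \<i> * w)" for w :: complex
  define T \<rho> b where "T w = exp (\<i> * w)" and "\<rho> w = - \<i> * (u w * ((u w)^2 - 1)) * Xf w"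
    and "b w = - \<i> * ((3 * (u w)^2 - 1) / (2 * u w) - \<i>) * Xf w" for w
  have T1: "T w * Xf w = 1" for w by (simp add: T_def Xf_def flip: exp_add)
  have TR: "T w * \<rho> w = - \<i> * (u w * ((u w)^2 - 1))" "1 + T w * b w = - \<i> * ((3 * (u w)^2 - 1) / (2 * u w))" for w
  proof -
    have "T w * \<rho> w = - \<i> * (u w * ((u w)^2 - 1)) * (T w * Xf w)" by (simp only: \<rho>_def mult_ac)
    then show "T w * \<rho> w = - \<i> * (u w * ((u w)^2 - 1))" by (simp only: T1 mult_1_right)
    have "T w * b w = - \<i> * ((3 * (u w)^2 - 1) / (2 * u w) - \<i>) * (T w * Xf w)" by (simp only: b_def mult_ac)
    then show "1 + T w * b w = - \<i> * ((3 * (u w)^2 - 1) / (2 * u w))"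
      by (simp only: T1 mult_1_right) (simp add: algebra_simps)
  qed
  have u: "u w \<noteq> 0" "(u w)^2 \<noteq> 1" "(u has_field_derivative ((u w)^2 - 1) / 2) (at w)" if "w \<in> S" for w
  proof -
    have E: "1 - exp w \<noteq> 0" "1 + exp w \<noteq> 0" using that by (auto simp: S_def add_eq_0_iff)
    then show "u w \<noteq> 0" by (simp add: u_def)
    have u2: "(u w)^2 - 1 = 4 * exp w / (1 - exp w)^2"
    proof -
      have "(u w)^2 - 1 = ((1 + exp w)^2 - (1 - exp w)^2) / (1 - exp w)^2"
        using E(1) by (simp add: u_def power_divide diff_divide_distrib)
      also have "(1 + exp w)^2 - (1 - exp w)^2 = 4 * exp w" by (simp add: power2_eq_square algebra_simps)
      finally show ?thesis .
    qed
    then have "(u w)^2 - 1 \<noteq> 0" using E by simp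
    then show "(u w)^2 \<noteq> 1" by simp
    show "(u has_field_derivative ((u w)^2 - 1) / 2) (at w)"
    proof -
      have "(u has_field_derivative (exp w * (1 - exp w) - (1 + exp w) * (0 - exp w)) / ((1 - exp w) * (1 - exp w))) (at w)"
        unfolding u_def[abs_def] using E by (auto intro!: derivative_eq_intros)
      moreover have "exp w * (1 - exp w) - (1 + exp w) * (0 - exp w) = 2 * exp w" by (simp add: algebra_simps)
      ultimately show ?thesis unfolding u2 by (simp add: power2_eq_square)
    qed
  qed
  have par: "parametrization (rat_eval n d) S e e' T \<rho> b"
    unfolding parametrization_def
  proof (intro conjI ballI)
    show "open S" "connected S" unfolding S_def by (rule connected_exp_domain)+
    fix s assume s: "s \<in> S"
    define v where "v = u s"
    have v: "v \<noteq> 0" "v^2 \<noteq> 1" "(u has_field_derivative (v^2 - 1) / 2) (at s)" using u[OF s] by (simp_all add: v_def)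
    have v1: "v^2 - 1 \<noteq> 0" using v(2) by simp
    define X where "X = Xf s"
    have X: "X \<noteq> 0" by (simp add: X_def Xf_def)
    have DX: "(Xf has_field_derivative - \<i> * X) (at s)"
      unfolding X_def Xf_def[abs_def] by (auto intro!: derivative_eq_intros)
    show "e' s \<noteq> 0" "\<rho> s \<noteq> 0" using v X by (auto simp: e'_def \<rho>_def v_def[symmetric] X_def[symmetric])
    show "(e has_field_derivative e' s) (at s)"
      unfolding e_def[abs_def] e'_def v_def[symmetric]
      by (rule derivative_eq_intros v(3) refl)+ (simp add: v_def)
    have "T s = 1 / X" using T1[of s] X unfolding X_def[symmetric] by (simp add: field_simps)
    then have "(T has_field_derivative \<i> / X) (at s)"
      unfolding T_def by (auto intro!: derivative_eq_intros simp: X_def Xf_def exp_minus field_simps)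
    moreover have "e' s / \<rho> s = \<i> / X"
      using v(1) v1 X unfolding e'_def \<rho>_def v_def[symmetric] X_def[symmetric] by (simp add: field_simps)
    ultimately show "(T has_field_derivative e' s / \<rho> s) (at s)" by simp
    have "(\<rho> has_field_derivative (- \<i> * ((v^2 - 1) / 2 * (v^2 - 1) + v * (2 * v * ((v^2 - 1) / 2)))) * X + - \<i> * (v * (v^2 - 1)) * (- \<i> * X)) (at s)"
      unfolding \<rho>_def[abs_def]
      by (rule derivative_eq_intros v(3) DX refl)+ (simp add: v_def[symmetric] X_def[symmetric] algebra_simps)
    moreover have "(- \<i> * ((v^2 - 1) / 2 * (v^2 - 1) + v * (2 * v * ((v^2 - 1) / 2)))) * X + - \<i> * (v * (v^2 - 1)) * (- \<i> * X) = b s * e' s"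
      using v(1) unfolding b_def e'_def v_def[symmetric] X_def[symmetric] by (simp add: field_simps power2_eq_square)
    ultimately show "(\<rho> has_field_derivative b s * e' s) (at s)" by simp
    let ?D = "- \<i> * ((6 * v * ((v^2 - 1) / 2) * (2 * v) - (3 * v^2 - 1) * (v^2 - 1)) / (2 * v)^2) * X + - \<i> * ((3 * v^2 - 1) / (2 * v) - \<i>) * (- \<i> * X)"
    have DA: "((\<lambda>s. (3 * (u s)^2 - 1) / (2 * u s) - \<i>) has_field_derivative
        (6 * v * ((v^2 - 1) / 2) * (2 * v) - (3 * v^2 - 1) * (v^2 - 1)) / (2 * v)^2) (at s)"
      using v(1) by (auto intro!: derivative_eq_intros v(3) simp: v_def[symmetric] power2_eq_square field_simps)
    have "(b has_field_derivative ?D) (at s)"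
      unfolding b_def[abs_def]
      by (rule DERIV_cong[OF DERIV_mult[OF DERIV_cmult[OF DA, of "- \<i>"] DX]])
        (simp add: v_def[symmetric] X_def[symmetric] mult_ac)
    moreover have "?D = e' s * (2 * \<rho> s * rat_eval n d (e s) + (b s)^2 / (2 * \<rho> s))"
    proof -
      have 1: "e' s * (2 * \<rho> s * rat_eval n d (e s)) = \<i> * X * (3 * (v^2)^2 + 2 * v^2 + 3) / (8 * v^2)"
        unfolding q e'_def \<rho>_def e_def v_def[symmetric] X_def[symmetric] by (rule monomial_aux(1)[OF v(1) v1])
      have 2: "e' s * ((b s)^2 / (2 * \<rho> s)) = - \<i> * X * ((3 * v^2 - 1) / (2 * v) - \<i>)^2 / 2"
        unfolding b_def e'_def \<rho>_def v_def[symmetric] X_def[symmetric] by (rule monomial_aux(2)[OF v(1) v1 X])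
      show ?thesis
        unfolding distrib_left[of "e' s"] 1 2 by (rule monomial_aux(3)[OF v(1) v1])
    qed
    ultimately show "(b has_field_derivative e' s * (2 * \<rho> s * rat_eval n d (e s) + (b s)^2 / (2 * \<rho> s))) (at s)" by simp
  qed
  have eD: "e s \<noteq> 0 \<and> e s \<noteq> 1" if "s \<in> S" for s using u[OF that] by (simp add: e_def)
  have \<rho>0: "\<rho> s \<noteq> 0" if "s \<in> S" for s using par that by (simp add: parametrization_def)
  have RZ: "(e w, param_mat (T w) (\<rho> w) (b w)) \<in> Z" if "w \<in> S" for w
  proof -
    note v = u[OF that] and p = param_mat_prods(1,2)[OF \<rho>0[OF that], of "T w" "b w"]
    have "(T w * \<rho> w)^2 = r (e w)" unfolding TR r_def e_def by (simp add: power_mult_distrib)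
    moreover have "2 * (T w * \<rho> w) * (1 + T w * b w) = r' (e w)"
      unfolding TR r'_def e_def using v(1) by (simp add: field_simps power2_eq_square)
    ultimately show ?thesis using eD[OF that] det_param_mat[OF \<rho>0[OF that]] by (simp add: Z_def p)
  qed
  have R: "reduction n d monomial2 Z"
  proof (rule reductionI[OF _ assms])
    show "d \<noteq> 0" by (simp add: d_def)
    show "poly d x \<noteq> 0 \<and> det P = 1" if "(x, P) \<in> Z" for x P using that by (simp add: Z_def d)
    show "(x, P') \<in> Z \<longleftrightarrow> P' ** adj2 P \<in> monomial2" if Z0: "(x, P) \<in> Z" and dP': "det P' = 1" for x P P'
    proof -
      obtain a b c d where P: "P = mat2 a b c d" by (rule mat2_cases)
      obtain a' b' c' d' where P': "P' = mat2 a' b' c' d'" by (rule mat2_cases)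
      have z: "x \<noteq> 0" "x \<noteq> 1" "a * d - b * c = 1" "(b * d)^2 = r x" "2 * (b * d) * (a * d + b * c) = r' x" "a' * d' - b' * c' = 1"
        using Z0 dP' by (auto simp: Z_def P P')
      have "r x \<noteq> 0" using z(1,2) by (simp add: r_def)
      then have bd: "b * d \<noteq> 0" using z(4) by auto
      have dP: "det P = 1" using Z0 by (simp add: Z_def)
      have det: "det (P' ** adj2 P) = 1" using dP' Z0 unfolding det_mul det_adj2 by (simp add: Z_def)
      show ?thesis
      proof
        assume "(x, P') \<in> Z"
        then have z': "(b' * d')^2 = r x" "2 * (b' * d') * (a' * d' + b' * c') = r' x" by (auto simp: Z_def P')
        have "b' * d' = b * d \<or> b' * d' = - (b * d)" using z(4) z'(1) by (metis power2_eq_iff)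
        then show "P' ** adj2 P \<in> monomial2"
        proof
          assume w: "b' * d' = b * d"
          then have "(b * d) * (a' * d' + b' * c') = (b * d) * (a * d + b * c)" using z'(2) z(5) by algebra
          then have w2: "a' * d' + b' * c' = a * d + b * c" using bd by simp
          have "a' * b = b' * a" "c' * d = d' * c"
            by (rule ratio_diag[OF z(3,6) refl w refl w2 bd])+
          then show ?thesis using det by (simp add: monomial2_def torus2_def P P')
        next
          assume w: "b' * d' = - (b * d)"
          then have "(b * d) * (a' * d' + b' * c') = (b * d) * (- (a * d + b * c))" using z'(2) z(5) by algebra
          then have w2: "a' * d' + b' * c' = - (a * d + b * c)" using bd mult_left_cancel by blast
          have "a' * d = b' * c" "d' * a = c' * b"
            by (rule ratio_antidiag[OF z(3,6) refl w refl w2 bd])+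
          then show ?thesis using det by (simp add: monomial2_def P P')
        qed
      next
        assume t: "P' ** adj2 P \<in> monomial2"
        then consider k l where "P' ** adj2 P = mat2 k 0 0 l" "k * l = 1" | k l where "P' ** adj2 P = mat2 0 k l 0" "- k * l = 1"
          by (cases "P' ** adj2 P" rule: mat2_cases) (auto simp: monomial2_def torus2_def)
        then show "(x, P') \<in> Z"
        proof cases
          case 1
          have "P' = mat2 k 0 0 l ** P" unfolding 1(1)[symmetric] by (rule mult_adj2_cancel(4)[OF dP, symmetric])
          then have e: "a' = k * a" "b' = k * b" "c' = l * c" "d' = l * d" by (simp_all add: P P')
          have "b' * d' = (k * l) * (b * d)" "a' * d' + b' * c' = (k * l) * (a * d + b * c)"
            by (simp_all add: e algebra_simps)
          then show "(x, P') \<in> Z" using z 1(2) by (simp add: Z_def P')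
        next
          case 2
          have "P' = mat2 0 k l 0 ** P" unfolding 2(1)[symmetric] by (rule mult_adj2_cancel(4)[OF dP, symmetric])
          then have e: "a' = k * c" "b' = k * d" "c' = l * a" "d' = l * b" by (simp_all add: P P')
          have kl: "k * l = -1" using 2(2) by (simp add: minus_equation_iff)
          have "(b' * d')^2 = (k * l)^2 * (b * d)^2" "2 * (b' * d') * (a' * d' + b' * c') = (k * l)^2 * (2 * (b * d) * (a * d + b * c))"
            by (simp_all add: e algebra_simps power2_eq_square)
          then show "(x, P') \<in> Z" using z unfolding kl by (simp add: Z_def P')
        qed
      qed
    qed
    show "\<exists>S e e' T \<rho> b s. parametrization (rat_eval n d) S e e' T \<rho> b \<and> s \<in> S \<and> e s = x \<and>
      (\<forall>s\<in>S. (e s, param_mat (T s) (\<rho> s) (b s)) \<in> Z)" if "poly d x \<noteq> 0" for x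
    proof -
      define v where "v = csqrt x"
      have v2: "v^2 = x" by (simp add: v_def)
      have v: "v^2 = x" "v \<noteq> 0" "v \<noteq> 1" "v \<noteq> -1" using v2 that by (auto simp: d)
      \<comment> \<open>Solves \<open>(1 + E) / (1 - E) = v\<close> for
        \<open>E = exp w\<close>.\<close>
      define E where "E = (v - 1) / (v + 1)"
      have v1: "v + 1 \<noteq> 0" using v(4) by (metis add_eq_0_iff2)
      have E: "E \<noteq> 0" "E \<noteq> 1" "E \<noteq> -1" using v v1 by (auto simp: E_def divide_simps)
      then have x: "exp (Ln E) = E" by simp
      have "1 - E = 2 / (v + 1)" "1 + E = 2 * v / (v + 1)" using v1 by (simp_all add: E_def field_simps)
      then have "u (Ln E) = v" unfolding u_def x using v1 by simp
      then have "e (Ln E) = x" "Ln E \<in> S" using v(1) E x by (simp_all add: e_def S_def)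
      then show ?thesis using par RZ by blast
    qed
    let ?E = "{\<lambda>a. (snd a $1$2 * snd a $2$2)^2 - r (fst a),
      \<lambda>a. 2 * (snd a $1$2 * snd a $2$2) * (snd a $1$1 * snd a $2$2 + snd a $1$2 * snd a $2$1) - r' (fst a)} :: (complex \<times> (complex^2^2) \<Rightarrow> complex) set"
    have "?E \<subseteq> polyfun even_coords"
      unfolding r_def r'_def by (intro insert_subsetI empty_subsetI polyfun_intros polyfun_even_coords)
    then show "\<exists>E\<subseteq>polyfun even_coords. \<forall>x P. poly d x \<noteq> 0 \<longrightarrow> det P = 1 \<longrightarrow> ((x, P) \<in> Z \<longleftrightarrow> (\<forall>f\<in>E. f (x, P) = 0))"
      by (intro exI[of _ ?E]) (simp add: Z_def d)
  qed
  \<comment> \<open>The parameters \<open>w0\<close> and \<open>- w0\<close> lie over the same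
    \<open>x0\<close>, and \<open>exp w0 = \<i>\<close> keeps both away from the removed
    points.\<close>
  define w0 where "w0 = of_real (pi / 2) * \<i>"
  have ew0: "exp w0 = \<i>" by (simp add: w0_def exp_eq_polar mult.commute flip: cis_conv_exp)
  have w0: "w0 \<in> S" "- w0 \<in> S" by (auto simp: S_def exp_minus ew0 complex_eq_iff)
  define x0 P0 where "x0 = e w0" and "P0 = param_mat (T w0) (\<rho> w0) (b w0)"
  have Z0: "(x0, P0) \<in> Z" using RZ[OF w0(1)] by (simp add: x0_def P0_def)
  have us: "u (w + 2 * of_real pi * \<i> * of_nat k) = u w" for w k by (simp only: u_def exp_shift)
  have Ss: "w + 2 * of_real pi * \<i> * of_nat k \<in> S" if "w \<in> S" for w k using that unfolding S_def mem_Collect_eq exp_shift .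
  have um: "u (- w) = - u w" if "w \<in> S" for w
  proof -
    have "1 - exp w \<noteq> 0" "exp w - 1 \<noteq> 0" using that by (auto simp: S_def)
    then show ?thesis by (simp add: u_def exp_minus field_simps)
  qed
  \<comment> \<open>Going from \<open>w0\<close> to its shift by \<open>2 pi i k\<close> multiplies
    \<open>T\<close> by \<open>c^2\<close>, with \<open>c = exp (- pi * k)\<close>; going to the
    shift of \<open>- w0\<close> sends \<open>T\<close> to \<open>c^2 / T\<close>, which is the
    Moebius map of an antidiagonal matrix.\<close>
  have mon: "mat2 (of_real (exp (- pi * k))) 0 0 (1 / of_real (exp (- pi * k))) \<in> monodromy n d (x0, P0)" (is "?m1 \<in> _")
    "mat2 0 (\<i> * of_real (exp (- pi * k))) (\<i> / of_real (exp (- pi * k))) 0 \<in> monodromy n d (x0, P0)" (is "?m2 \<in> _") for k :: nat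
  proof -
    define c :: complex where "c = of_real (exp (- pi * k))"
    have c: "c \<noteq> 0" by (simp add: c_def)
    have cc: "of_real (exp (- 2 * pi * k)) = c^2"
      unfolding c_def of_real_power[symmetric] by (simp flip: exp_of_nat_mult)
    have Ts: "T (w + 2 * of_real pi * \<i> * of_nat k) = c^2 * T w" for w unfolding T_def exp_cis_shift cc by simp
    have T0: "T w \<noteq> 0" for w by (simp add: T_def)
    have E: "Xf w = 1 / T w" for w using T1[of w] T0[of w] by (simp add: field_simps)
    have \<rho>s: "\<rho> (w + 2 * of_real pi * \<i> * of_nat k) = (1 / c^2) * \<rho> w"
      "b (w + 2 * of_real pi * \<i> * of_nat k) = (1 / c^2) * b w" for w
      unfolding \<rho>_def b_def E Ts us by simp_all
    have Tm: "T (- w) = 1 / T w" for w by (simp add: T_def exp_minus field_simps)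
    have \<rho>m: "\<rho> (- w) = - ((T w)^2) * \<rho> w" "b (- w) = - ((T w)^2) * b w - 2 * T w" if "w \<in> S" for w
      using u(1)[OF that] T0[of w] unfolding \<rho>_def b_def E um[OF that] Tm by (simp_all add: field_simps power2_eq_square)
    note reach0 = parametrization_reach[OF par _ w0(1)]
    show "?m1 \<in> monodromy n d (x0, P0)"
    proof (rule monodromyI(1)[OF R])
      let ?w = "w0 + 2 * of_real pi * \<i> * of_nat k"
      have "param_mat (T ?w) (\<rho> ?w) (b ?w) = mat2 c 0 0 (1 / c) ** P0 \<or>
        param_mat (T ?w) (\<rho> ?w) (b ?w) = - (mat2 c 0 0 (1 / c) ** P0)"
        unfolding P0_def
        by (rule param_mat_moebius) (use c \<rho>0[OF w0(1)] in \<open>simp_all add: Ts \<rho>s power2_eq_square\<close>)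
      then show "param_mat (T ?w) (\<rho> ?w) (b ?w) = ?m1 ** P0 \<or> param_mat (T ?w) (\<rho> ?w) (b ?w) = - (?m1 ** P0)"
        by (simp add: c_def)
      have "e ?w = x0" by (simp add: e_def us x0_def)
      then show "reach n d (x0, P0) (x0, param_mat (T ?w) (\<rho> ?w) (b ?w))"
        using reach0[OF _ Ss[OF w0(1), of k]] eD d by (simp add: x0_def P0_def)
      show "det ?m1 = 1" by simp
      show "(x0, ?m1 ** P0) \<in> Z" by (rule reduction_mult[OF R Z0]) (simp add: monomial2_def torus2_def)
    qed
    show "?m2 \<in> monodromy n d (x0, P0)"
    proof (rule monodromyI(1)[OF R])
      define w2 where "w2 = - w0 + 2 * of_real pi * \<i> * of_nat k"
      have w2: "T w2 = c^2 * (1 / T w0)" "\<rho> w2 = (1 / c^2) * (- ((T w0)^2) * \<rho> w0)" "b w2 = (1 / c^2) * (- ((T w0)^2) * b w0 - 2 * T w0)" "u w2 = - u w0" "w2 \<in> S"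
        unfolding w2_def Ts \<rho>s us Tm \<rho>m[OF w0(1)] um[OF w0(1)] using Ss[OF w0(2)] by simp_all
      have "param_mat (T w2) (\<rho> w2) (b w2) = mat2 0 (\<i> * c) (\<i> / c) 0 ** P0 \<or>
        param_mat (T w2) (\<rho> w2) (b w2) = - (mat2 0 (\<i> * c) (\<i> / c) 0 ** P0)"
        unfolding P0_def
        by (rule param_mat_moebius)
          (use c \<rho>0[OF w0(1)] T0[of w0] in \<open>simp_all add: w2 field_simps power2_eq_square\<close>)
      then show "param_mat (T w2) (\<rho> w2) (b w2) = ?m2 ** P0 \<or> param_mat (T w2) (\<rho> w2) (b w2) = - (?m2 ** P0)"
        by (simp add: c_def)
      have "e w2 = x0" by (simp add: e_def w2 x0_def)
      then show "reach n d (x0, P0) (x0, param_mat (T w2) (\<rho> w2) (b w2))"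
        using reach0[OF _ w2(5)] eD d by (simp add: x0_def P0_def)
      show "det ?m2 = 1" by simp
      show "(x0, ?m2 ** P0) \<in> Z" by (rule reduction_mult[OF R Z0]) (simp add: monomial2_def)
    qed
  qed
  have "monomial2 \<subseteq> zariski_closed mat_coords hull monodromy n d (x0, P0)"
  proof
    fix A assume A: "A \<in> monomial2"
    show "A \<in> zariski_closed mat_coords hull monodromy n d (x0, P0)"
    proof (rule mult_mem_hull)
      fix Y assume Y: "zariski_closed mat_coords Y" "monodromy n d (x0, P0) \<subseteq> Y"
      have "range (\<lambda>k::nat. of_real (exp (- pi * k))) \<subseteq> {t. t \<noteq> 0 \<and> mat2 t 0 0 (1 / t) \<in> Y}"
        using mon(1) Y(2) by auto
      then have i1: "infinite {t. t \<noteq> 0 \<and> mat2 t 0 0 (1 / t) \<in> Y}" using infinite_exp_pi finite_subset by blast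
      have "range (\<lambda>k::nat. of_real (exp (- pi * k))) \<subseteq> {t. t \<noteq> 0 \<and> mat2 0 (\<i> * t) (\<i> * (1 / t)) 0 \<in> Y}"
        using mon(2) Y(2) by auto
      then have i2: "infinite {t. t \<noteq> 0 \<and> mat2 0 (\<i> * t) (\<i> * (1 / t)) 0 \<in> Y}" using infinite_exp_pi finite_subset by blast
      have anti: "mat2 0 (\<i> * t) (\<i> * (1 / t)) 0 \<in> Y" if "t \<noteq> 0" for t
        by (rule zariski_curve[OF Y(1) _ i2 that]) (intro laurent_mat2 laurent_intros)
      from A consider t s where "A = mat2 t 0 0 s" "t * s = 1" | t s where "A = mat2 0 t s 0" "- t * s = 1"
        by (cases A rule: mat2_cases) (auto simp: monomial2_def torus2_def)
      then show "A \<in> Y"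
      proof cases
        case 1
        then have "t \<noteq> 0" "s = 1 / t" by (auto simp: eq_divide_eq mult.commute)
        then show ?thesis using infinite_torus[OF Y(1) i1] 1(1) by (simp add: contains_T_def)
      next
        case 2
        then have t: "t \<noteq> 0" by auto
        have "s * t = - 1" using 2(2) by algebra
        then have "s = - 1 / t" using nonzero_eq_divide_eq[OF t, of s "- 1"] by simp
        then show ?thesis using anti[of "- \<i> * t"] t 2(1) by simp
      qed
    qed
  qed
  then show ?thesis using R Z0 by blast
qed

section \<open>Borel subgroups\<close>

text \<open>A residue in logarithmic coordinates. The increment of \<open>K\<close> over a period is
  constant; far to the left \<open>K\<close> differs from the linear function \<open>c * w\<close>
  by a function with small derivative, which identifies the increment.\<close>

lemma half_plane_period:
  fixes K g :: "complex \<Rightarrow> complex"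
  assumes K: "\<And>w. Re w < R \<Longrightarrow> (K has_field_derivative g w) (at w)"
    and per: "\<And>w. Re w < R \<Longrightarrow> g (w + 2 * of_real pi * \<i>) = g w"
    and lim: "\<And>\<epsilon>. \<epsilon> > 0 \<Longrightarrow> \<exists>M. \<forall>w. Re w < M \<longrightarrow> norm (g w - c) < \<epsilon>"
    and w: "Re w < R"
  shows "K (w + 2 * of_real pi * \<i>) = K w + 2 * of_real pi * \<i> * c"
proof -
  define p where "p = 2 * of_real pi * \<i>"
  have p: "Re p = 0" "norm p = 2 * pi" by (simp_all add: p_def norm_mult)
  define D where "D w = K (w + p) - K w" for w
  have "(D has_field_derivative 0) (at w within {w. Re w < R})" if "w \<in> {w. Re w < R}" for w
  proof -
    have "((\<lambda>w. K (w + p)) has_field_derivative g (w + p) * 1) (at w)"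
      by (rule DERIV_chain2[OF K]) (use that in \<open>auto simp: p intro!: derivative_eq_intros\<close>)
    then have "(D has_field_derivative g (w + p) * 1 - g w) (at w)"
      unfolding D_def[abs_def] using K[of w] that by (intro DERIV_diff) auto
    then have "(D has_field_derivative 0) (at w)" using per[of w] that by (simp add: p_def)
    then show ?thesis by (rule has_field_derivative_at_within)
  qed
  then have "\<exists>c. \<forall>w\<in>{w. Re w < R}. D w = c"
    by (intro has_field_derivative_zero_constant convex_halfspace_Re_lt)
  then obtain k where k: "\<And>w. Re w < R \<Longrightarrow> D w = k" by blast
  have "norm (k - p * c) \<le> \<epsilon>" if "\<epsilon> > 0" for \<epsilon>
  proof -
    have "\<epsilon> / (2 * pi) > 0" using that by simp
    then obtain M where M: "\<And>w. Re w < M \<Longrightarrow> norm (g w - c) < \<epsilon> / (2 * pi)"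
      using lim by blast
    define M' where "M' = min M R"
    define w where "w = complex_of_real (M' - 1)"
    have w: "Re w < M'" "Re (w + p) < M'" by (simp_all add: w_def p)
    have "norm ((K (w + p) - c * (w + p)) - (K w - c * w)) \<le> \<epsilon> / (2 * pi) * norm ((w + p) - w)"
    proof (rule field_differentiable_bound[where S = "{w. Re w < M'}" and f' = "\<lambda>w. g w - c"])
      show "convex {w. Re w < M'}" by (rule convex_halfspace_Re_lt)
      fix z assume z: "z \<in> {w. Re w < M'}"
      have "((\<lambda>w. K w - c * w) has_field_derivative g z - c * 1) (at z)"
        using z K[of z] by (intro derivative_intros) (auto simp: M'_def)
      then show "((\<lambda>w. K w - c * w) has_field_derivative g z - c) (at z within {w. Re w < M'})"
        by (simp add: has_field_derivative_at_within)
      show "norm (g z - c) \<le> \<epsilon> / (2 * pi)" using M[of z] z by (simp add: M'_def)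
    qed (use w in auto)
    moreover have "(K (w + p) - c * (w + p)) - (K w - c * w) = k - p * c"
      using k[of w] w by (simp add: D_def M'_def algebra_simps)
    ultimately show ?thesis by (simp add: p)
  qed
  then have "k = p * c" by (metis field_lbound_gt_zero leD norm_le_zero_iff not_le right_minus_eq)
  then show ?thesis using k[OF w] by (simp add: D_def p_def algebra_simps)
qed

lemma small_at_left:
  fixes f :: "complex \<Rightarrow> complex"
  assumes "(f \<longlongrightarrow> c) (at 0)" "\<epsilon> > 0"
  shows "\<exists>M. \<forall>w. Re w < M \<longrightarrow> norm (f (exp w) - c) < \<epsilon>"
proof -
  obtain r where r: "r > 0" "\<And>x. x \<noteq> 0 \<Longrightarrow> dist x 0 < r \<Longrightarrow> dist (f x) c < \<epsilon>"
    using tendstoD[OF assms] unfolding eventually_at by blast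
  have "norm (f (exp w) - c) < \<epsilon>" if "Re w < ln r" for w
  proof -
    have "norm (exp w) < r" using that r(1) by (metis exp_less_cancel_iff exp_ln norm_exp_eq_Re)
    then show ?thesis using r(2)[of "exp w"] by (simp add: dist_norm)
  qed
  then show ?thesis by blast
qed

lemma monodromy_conj:
  assumes "m \<in> monodromy n d (x, g ** P)" "det g = 1"
  shows "adj2 g ** m ** g \<in> monodromy n d (x, P)"
proof -
  have "reach n d (x, adj2 g ** (g ** P)) (x, adj2 g ** (m ** (g ** P)))"
    using reach_mult[of n d "(x, g ** P)" "(x, m ** (g ** P))" "adj2 g"] assms by (simp add: monodromy_def)
  moreover have "adj2 g ** (m ** (g ** P)) = (adj2 g ** m ** g) ** P" by (simp add: matrix_mul_assoc)
  ultimately show ?thesis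
    using assms by (simp add: monodromy_def det_mul mult_adj2_cancel(2)[OF assms(2)])
qed

text \<open>A power of the first matrix fixes the diagonal, and multiplying it by powers of the
  unipotent one puts infinitely many points of an affine line into \<open>Y\<close>.\<close>

lemma triangular_density:
  assumes Y: "zariski_closed mat_coords Y" "M \<subseteq> Y" and M: "\<And>A B. A \<in> M \<Longrightarrow> B \<in> M \<Longrightarrow> A ** B \<in> M" "mat 1 \<in> M"
    and m: "mat2 (1 / l) k 0 l \<in> M" "mat2 1 u 0 1 \<in> M" "u \<noteq> 0" "l \<noteq> 0"
  shows "mat2 (1 / l ^ j) t 0 (l ^ j) \<in> Y"
proof -
  have pw: "matpow A i \<in> M" if "A \<in> M" for A i using that M by (induction i) auto
  have "\<exists>b. matpow (mat2 (1 / l) k 0 l) j = mat2 (1 / l ^ j) b 0 (l ^ j)" for j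
    by (induction j) (auto simp: mat_1_mat2 field_simps)
  then obtain b where b: "mat2 (1 / l ^ j) b 0 (l ^ j) \<in> M" using pw[OF m(1)] by metis
  have mem: "mat2 (1 / l ^ j) (b + of_nat i * u * l ^ j) 0 (l ^ j) \<in> M" for i
    using M(1)[OF pw[OF m(2), of i] b] by (simp add: matpow_unipotent)
  \<comment> \<open>The shift by \<open>t - 1\<close> places the wanted matrix at parameter 1,
    because \<open>zariski_curve\<close> excludes the parameter 0.\<close>
  define f where "f i = b + of_nat i * u * l ^ j - t + 1" for i
  have "inj f" using m(3,4) by (intro injI) (simp add: f_def)
  then have "infinite (range f - {0})" by (intro infinite_remove range_inj_infinite)
  moreover have "range f - {0} \<subseteq> {s. s \<noteq> 0 \<and> mat2 (1 / l ^ j) (s + (t - 1)) 0 (l ^ j) \<in> Y}"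
    using mem Y(2) by (auto simp: f_def)
  ultimately have "infinite {s. s \<noteq> 0 \<and> mat2 (1 / l ^ j) (s + (t - 1)) 0 (l ^ j) \<in> Y}"
    using finite_subset by blast
  from zariski_curve[OF Y(1) laurent_mat2[OF laurent_const laurent_add[OF laurent_id laurent_const] laurent_const laurent_const] this, of 1]
  show ?thesis by simp
qed

text \<open>The exponent \<open>a\<close> in \<open>v^2 = x^(-a) (x - 1)\<close>. A turn around 0
  multiplies \<open>v^2\<close> by \<open>exp (- 2 pi i a)\<close>, which has order \<open>N\<close>
  for \<open>a = 1 / N\<close> and infinite order for \<open>a = i\<close>, the choice for the full
  Borel group.\<close>

definition borel_rate :: "nat \<Rightarrow> complex" where "borel_rate N = (if N = 0 then \<i> else 1 / of_nat N)"

text \<open>Logarithmic derivative \<open>h\<close> of \<open>v^2\<close>. Thus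
  \<open>v' / v = h / 2\<close> and \<open>q = h' / 2 + h^2 / 4\<close>, which
  \<open>borel_num\<close> and \<open>borel_den\<close> write as a fraction.\<close>

definition borel_log_deriv :: "nat \<Rightarrow> complex \<Rightarrow> complex" where
  "borel_log_deriv N x = 1 / (x - 1) - borel_rate N / x"

definition borel_num :: "nat \<Rightarrow> complex poly" where
  "borel_num N = (let a = borel_rate N in [:a^2 + 2 * a, - 2 * a^2 - 2 * a, a^2 - 1:])"
definition borel_den :: "complex poly" where "borel_den = [:0, 0, 4:] * [:-1, 1:]^2"

lemma borel_den: "poly borel_den x \<noteq> 0 \<longleftrightarrow> x \<noteq> 0 \<and> x \<noteq> 1"
  by (auto simp: borel_den_def)

lemma borel_rat_eval:
  assumes "x \<noteq> 0" "x \<noteq> 1"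
  shows "rat_eval (borel_num N) borel_den x = (borel_rate N / x^2 - 1 / (x - 1)^2) / 2 + (borel_log_deriv N x)^2 / 4"
proof -
  have y: "x - 1 \<noteq> 0" using assms by simp
  have key: "((a^2 + 2 * a) + x * ((- 2 * a^2 - 2 * a) + x * (a^2 - 1))) / (4 * x^2 * (x - 1)^2) =
    (a / x^2 - 1 / (x - 1)^2) / 2 + (1 / (x - 1) - a / x)^2 / 4" for a
  proof -
    define z where "z = x - 1"
    have z: "x = z + 1" "z \<noteq> 0" "z + 1 \<noteq> 0" using y assms by (auto simp: z_def)
    show ?thesis unfolding z_def[symmetric] unfolding z(1) using z(2,3)
      by (simp add: divide_simps) (simp add: algebra_simps power2_eq_square)
  qed
  have "poly borel_den x = 4 * x^2 * (x - 1)^2" by (simp add: borel_den_def power2_eq_square algebra_simps)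
  moreover have "poly (borel_num N) x = (borel_rate N^2 + 2 * borel_rate N) + x * ((- 2 * borel_rate N^2 - 2 * borel_rate N) + x * (borel_rate N^2 - 1))"
    by (simp add: borel_num_def Let_def)
  ultimately show ?thesis unfolding rat_eval_def borel_log_deriv_def using key[of "borel_rate N"] by simp
qed

text \<open>\<open>L\<close> is a branch of the logarithm of \<open>e\<close>, used to define the
  power of \<open>x\<close>. The second solution comes from reduction of order: \<open>T\<close> is
  a primitive, and convexity of \<open>S\<close> provides it.\<close>

lemma borel_parametrization:
  fixes N :: nat
  assumes S: "convex S" "open S" "e' holomorphic_on S"
    and e: "\<And>s. s \<in> S \<Longrightarrow> (e has_field_derivative e' s) (at s)" "\<And>s. s \<in> S \<Longrightarrow> e' s \<noteq> 0"
      "\<And>s. s \<in> S \<Longrightarrow> exp (L s) = e s" "\<And>s. s \<in> S \<Longrightarrow> (L has_field_derivative e' s / e s) (at s)" "\<And>s. s \<in> S \<Longrightarrow> e s \<noteq> 1"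
  defines "\<rho> \<equiv> \<lambda>s. exp (- borel_rate N * L s) * (e s - 1)"
  shows "\<exists>T. parametrization (rat_eval (borel_num N) borel_den) S e e' T \<rho> (\<lambda>s. borel_log_deriv N (e s) * \<rho> s)"
proof -
  let ?a = "borel_rate N"
  have ne: "e s \<noteq> 0" "e s - 1 \<noteq> 0" "\<rho> s \<noteq> 0" if "s \<in> S" for s
    using e(3)[OF that] e(5)[OF that] exp_not_eq_zero[of "L s"] by (auto simp: \<rho>_def)
  have D\<rho>: "(\<rho> has_field_derivative borel_log_deriv N (e s) * \<rho> s * e' s) (at s)" if "s \<in> S" for s
  proof -
    have "(\<rho> has_field_derivative exp (- ?a * L s) * (- ?a * (e' s / e s)) * (e s - 1) + exp (- ?a * L s) * e' s) (at s)"
      unfolding \<rho>_def by (rule derivative_eq_intros e(1)[OF that] e(4)[OF that] refl)+ (simp add: algebra_simps)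
    moreover have "exp (- ?a * L s) * (- ?a * (e' s / e s)) * (e s - 1) + exp (- ?a * L s) * e' s = borel_log_deriv N (e s) * \<rho> s * e' s"
      using ne[OF that] unfolding \<rho>_def borel_log_deriv_def by (simp add: field_simps)
    ultimately show ?thesis by simp
  qed
  have "\<rho> holomorphic_on S" using D\<rho> S(2) holomorphic_on_open by blast
  then have "(\<lambda>s. e' s / \<rho> s) holomorphic_on S" using S(3) ne(3) by (intro holomorphic_intros) auto
  then obtain T where T: "\<And>s. s \<in> S \<Longrightarrow> (T has_field_derivative e' s / \<rho> s) (at s within S)"
    using holomorphic_convex_primitive'[OF S(1,2)] by blast
  have "((\<lambda>s. borel_log_deriv N (e s) * \<rho> s) has_field_derivative
      e' s * (2 * \<rho> s * rat_eval (borel_num N) borel_den (e s) + (borel_log_deriv N (e s) * \<rho> s)^2 / (2 * \<rho> s))) (at s)" if s: "s \<in> S" for s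
  proof -
    have "((\<lambda>s. borel_log_deriv N (e s)) has_field_derivative (?a / (e s)^2 - 1 / (e s - 1)^2) * e' s) (at s)"
      unfolding borel_log_deriv_def using ne[OF s] e(1)[OF s]
      by (auto intro!: derivative_eq_intros simp: power2_eq_square field_simps)
    from DERIV_mult[OF this D\<rho>[OF s]] show ?thesis
    proof (rule DERIV_cong)
      have "h * e' s * \<rho> s + l * \<rho> s * e' s * l = e' s * (2 * \<rho> s * (h / 2 + l^2 / 4) + (l * \<rho> s)^2 / (2 * \<rho> s))" for h l
        using ne(3)[OF s] by (simp add: field_simps power2_eq_square)
      then show "(?a / (e s)^2 - 1 / (e s - 1)^2) * e' s * \<rho> s + borel_log_deriv N (e s) * \<rho> s * e' s * borel_log_deriv N (e s) =
        e' s * (2 * \<rho> s * rat_eval (borel_num N) borel_den (e s) + (borel_log_deriv N (e s) * \<rho> s)^2 / (2 * \<rho> s))"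
        using borel_rat_eval[of "e s" N] ne[OF s] by simp
    qed
  qed
  then have "parametrization (rat_eval (borel_num N) borel_den) S e e' T \<rho> (\<lambda>s. borel_log_deriv N (e s) * \<rho> s)"
    unfolding parametrization_def
    using S(2) convex_connected[OF S(1)] e(1,2) ne D\<rho> T at_within_open[OF _ S(2)] by simp
  then show ?thesis by blast
qed

text \<open>\<open>T\<close> is a primitive of \<open>x^a / (x - 1)\<close>: a turn around 1 adds
  \<open>2 pi i\<close> and gives a unipotent matrix, a turn around 0 gives the diagonal part. The
  group is bounded by the rationality of \<open>v' / v\<close> and, for \<open>N\<close> at least 1,
  of \<open>v^(2 N)\<close>.\<close>

lemma borel_realization:
  assumes "alg_group (borel2_root N)"
  shows "\<exists>n d Z x P. reduction n d (borel2_root N) Z \<and> (x, P) \<in> Z \<and> borel2_root N \<subseteq> zariski_closed mat_coords hull monodromy n d (x, P)"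
proof -
  let ?n = "borel_num N" and ?d = borel_den and ?a = "borel_rate N" and ?H = "borel_log_deriv N"
  \<comment> \<open>For \<open>N\<close> at least 1 one has \<open>a N = 1\<close>, so
    \<open>v^(2 N)\<close> equals \<open>(x - 1)^N / x\<close>. For \<open>N = 0\<close> the
    relation degenerates to \<open>1 = 1\<close>.\<close>
  define \<epsilon> where "\<epsilon> = (if N = 0 then 0 else 1 :: nat)"
  define Z where "Z = {(x, P :: complex^2^2). x \<noteq> 0 \<and> x \<noteq> 1 \<and> det P = 1 \<and> P$2$1 = ?H x / 2 * P$2$2 \<and> (P$2$2 * P$2$2) ^ N * x ^ \<epsilon> = (x - 1) ^ N}"
  define \<rho> where "\<rho> e L s = exp (- ?a * L s) * (e s - 1)" for e L :: "complex \<Rightarrow> complex" and s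
  have aN: "exp (- ?a * l) ^ N * exp l ^ \<epsilon> = 1" for l
  proof (cases "N = 0")
    case False
    have "exp (- ?a * l) ^ N = exp (of_nat N * (- ?a * l))" by (rule exp_of_nat_mult[symmetric])
    also have "of_nat N * (- ?a * l) = - l" using False by (simp add: borel_rate_def)
    finally show ?thesis using False by (simp add: \<epsilon>_def exp_minus)
  qed (simp add: \<epsilon>_def)
  have inZ: "(e s, param_mat (T s) (\<rho> e L s) (?H (e s) * \<rho> e L s)) \<in> Z"
    if "exp (L s) = e s" "e s \<noteq> 1" for T e L s
  proof -
    have \<rho>: "\<rho> e L s \<noteq> 0" "e s \<noteq> 0" using that exp_not_eq_zero[of "L s"] by (auto simp: \<rho>_def)
    let ?P = "param_mat (T s) (\<rho> e L s) (?H (e s) * \<rho> e L s)"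
    note p = param_mat_prods(3-5)[OF \<rho>(1), of "T s" "?H (e s) * \<rho> e L s"]
    have "?P$2$1 * ?P$2$2 = (?H (e s) / 2 * ?P$2$2) * ?P$2$2" using p(1,2) by (simp add: mult.assoc)
    then have "?P$2$1 = ?H (e s) / 2 * ?P$2$2" using p(3) by simp
    moreover have "(\<rho> e L s) ^ N * e s ^ \<epsilon> = (e s - 1) ^ N"
      using aN[of "L s"] that(1) by (simp add: \<rho>_def power_mult_distrib mult_ac)
    ultimately show ?thesis using \<rho> that p(1) det_param_mat[OF \<rho>(1)] by (simp add: Z_def)
  qed
  have ex: "\<exists>T. parametrization (rat_eval ?n ?d) S e e' T (\<rho> e L) (\<lambda>s. ?H (e s) * \<rho> e L s)"
    if "convex S" "open S" "e' holomorphic_on S" "\<And>s. s \<in> S \<Longrightarrow> (e has_field_derivative e' s) (at s)" "\<And>s. s \<in> S \<Longrightarrow> e' s \<noteq> 0"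
      "\<And>s. s \<in> S \<Longrightarrow> exp (L s) = e s" "\<And>s. s \<in> S \<Longrightarrow> (L has_field_derivative e' s / e s) (at s)" "\<And>s. s \<in> S \<Longrightarrow> e s \<noteq> 1"
    for S e e' L
    unfolding \<rho>_def[abs_def] by (rule borel_parametrization[OF that])
  have R: "reduction ?n ?d (borel2_root N) Z"
  proof (rule reductionI[OF _ assms])
    show "?d \<noteq> 0" by (simp add: borel_den_def)
    show "poly ?d x \<noteq> 0 \<and> det P = 1" if "(x, P) \<in> Z" for x P using that borel_den by (simp add: Z_def)
    show "(x, P') \<in> Z \<longleftrightarrow> P' ** adj2 P \<in> borel2_root N" if Z0: "(x, P) \<in> Z" and dP': "det P' = 1" for x P P'
    proof -
      have dP: "det P = 1" using Z0 by (simp add: Z_def)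
      have det: "det (P' ** adj2 P) = 1" unfolding det_mul det_adj2 using dP dP' by simp
      obtain a b c d where P: "P = mat2 a b c d" by (rule mat2_cases)
      obtain a' b' c' d' where P': "P' = mat2 a' b' c' d'" by (rule mat2_cases)
      define h where "h = ?H x / 2"
      have z: "x \<noteq> 0" "x \<noteq> 1" "c = h * d" "(d * d) ^ N * x ^ \<epsilon> = (x - 1) ^ N"
        using Z0 by (auto simp: Z_def P h_def)
      have ad: "d * (a - h * b) = 1" using dP by (simp add: P z(3) algebra_simps)
      then have d: "d \<noteq> 0" by auto
      have e: "(P' ** adj2 P) $ 2 $ 1 = c' * d - d' * c" "(P' ** adj2 P) $ 2 $ 2 = d' * a - c' * b" by (simp_all add: P P')
      have c': "(P' ** adj2 P) $ 2 $ 1 = 0 \<longleftrightarrow> c' = h * d'" unfolding e z(3) using d by (auto simp: algebra_simps)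
      have "(P' ** adj2 P) $ 2 $ 2 ^ (2 * N) = 1 \<longleftrightarrow> (d' * d') ^ N * x ^ \<epsilon> = (x - 1) ^ N" if "c' = h * d'"
      proof -
        have "d * (P' ** adj2 P) $ 2 $ 2 = d' * (d * (a - h * b))" unfolding e that by (simp add: algebra_simps)
        then have "d * (P' ** adj2 P) $ 2 $ 2 = d'" unfolding ad by simp
        then have "(P' ** adj2 P) $ 2 $ 2 = d' / d" using d by (metis nonzero_mult_div_cancel_left)
        then have "(P' ** adj2 P) $ 2 $ 2 ^ (2 * N) = 1 \<longleftrightarrow> (d' * d') ^ N = (d * d) ^ N"
          using d by (simp add: power_mult power2_eq_square power_divide)
        also have "\<dots> \<longleftrightarrow> (d' * d') ^ N * x ^ \<epsilon> = (x - 1) ^ N" unfolding z(4)[symmetric] using z(1) by simp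
        finally show ?thesis .
      qed
      then show ?thesis using c' det dP' z unfolding borel2_root_def Z_def h_def by (auto simp: P')
    qed
    show "\<exists>S e e' T \<rho> b s. parametrization (rat_eval ?n ?d) S e e' T \<rho> b \<and> s \<in> S \<and> e s = x \<and>
      (\<forall>s\<in>S. (e s, param_mat (T s) (\<rho> s) (b s)) \<in> Z)" if x: "poly ?d x \<noteq> 0" for x
    proof -
      have x01: "x \<noteq> 0" "x \<noteq> 1" using x borel_den by auto
      have "open {w::complex. exp w \<noteq> 1}" by (intro open_Collect_neq continuous_intros)
      moreover have "Ln x \<in> {w. exp w \<noteq> 1}" using x01 by simp
      ultimately obtain r where r: "r > 0" "ball (Ln x) r \<subseteq> {w. exp w \<noteq> 1}" using open_contains_ball by blast
      have "\<exists>T. parametrization (rat_eval ?n ?d) (ball (Ln x) r) exp exp T (\<rho> exp (\<lambda>w. w)) (\<lambda>s. ?H (exp s) * \<rho> exp (\<lambda>w. w) s)"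
        by (rule ex) (use r(2) in \<open>auto intro!: derivative_eq_intros holomorphic_intros\<close>)
      then obtain T where T: "parametrization (rat_eval ?n ?d) (ball (Ln x) r) exp exp T (\<rho> exp (\<lambda>w. w)) (\<lambda>s. ?H (exp s) * \<rho> exp (\<lambda>w. w) s)" ..
      moreover have "(exp s, param_mat (T s) (\<rho> exp (\<lambda>w. w) s) (?H (exp s) * \<rho> exp (\<lambda>w. w) s)) \<in> Z" if "s \<in> ball (Ln x) r" for s
        using inZ[where e = exp and L = "\<lambda>w. w" and s = s and T = T] r(2) that by auto
      moreover have "Ln x \<in> ball (Ln x) r" "exp (Ln x) = x" using r(1) x01 by auto
      ultimately show ?thesis by blast
    qed
    \<comment> \<open>The relation between \<open>P $ 2 $ 1\<close> and \<open>P $ 2 $ 2\<close> is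
      odd in \<open>P\<close>. Multiplied once by each of these entries, which do not vanish
      together, it becomes an equivalent pair of even ones.\<close>
    let ?E = "{\<lambda>a. snd a $2$1 * snd a $2$2 * (2 * fst a * (fst a - 1)) - (fst a - ?a * (fst a - 1)) * (snd a $2$2 * snd a $2$2),
      \<lambda>a. snd a $2$1 * snd a $2$1 * (2 * fst a * (fst a - 1)) - (fst a - ?a * (fst a - 1)) * (snd a $2$1 * snd a $2$2),
      \<lambda>a. (snd a $2$2 * snd a $2$2) ^ N * fst a ^ \<epsilon> - (fst a - 1) ^ N} :: (complex \<times> (complex^2^2) \<Rightarrow> complex) set"
    have E: "?E \<subseteq> polyfun even_coords"
      by (intro insert_subsetI empty_subsetI polyfun_intros polyfun_even_coords)
    have "(x, P) \<in> Z \<longleftrightarrow> (\<forall>f\<in>?E. f (x, P) = 0)" if x: "poly ?d x \<noteq> 0" and P: "det P = 1" for x P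
    proof -
      have x01: "x \<noteq> 0" "x - 1 \<noteq> 0" using x borel_den by auto
      define y where "y = 2 * x * (x - 1)"
      have y: "y \<noteq> 0" using x01 by (simp add: y_def)
      have H: "?H x / 2 = (x - ?a * (x - 1)) / y" using x01 by (simp add: borel_log_deriv_def y_def field_simps)
      define g where "g = x - ?a * (x - 1)"
      have "P$2$1 = ?H x / 2 * P$2$2 \<longleftrightarrow> P$2$1 * y - g * P$2$2 = 0"
        unfolding H g_def[symmetric] using y by (auto simp: field_simps)
      also have "\<dots> \<longleftrightarrow> P$2$1 * P$2$2 * y - g * (P$2$2 * P$2$2) = 0 \<and> P$2$1 * P$2$1 * y - g * (P$2$1 * P$2$2) = 0"
      proof -
        have "P$2$1 \<noteq> 0 \<or> P$2$2 \<noteq> 0" using P by (auto simp: det_2)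
        moreover have "P$2$1 * P$2$2 * y - g * (P$2$2 * P$2$2) = P$2$2 * (P$2$1 * y - g * P$2$2)"
          "P$2$1 * P$2$1 * y - g * (P$2$1 * P$2$2) = P$2$1 * (P$2$1 * y - g * P$2$2)" by (simp_all add: algebra_simps)
        ultimately show ?thesis by auto
      qed
      finally have 1: "P$2$1 = ?H x / 2 * P$2$2 \<longleftrightarrow> P$2$1 * P$2$2 * y - g * (P$2$2 * P$2$2) = 0 \<and> P$2$1 * P$2$1 * y - g * (P$2$1 * P$2$2) = 0" .
      show ?thesis
        unfolding Z_def using x01 P 1 unfolding y_def g_def by simp
    qed
    then show "\<exists>E\<subseteq>polyfun even_coords. \<forall>x P. poly ?d x \<noteq> 0 \<longrightarrow> det P = 1 \<longrightarrow> ((x, P) \<in> Z \<longleftrightarrow> (\<forall>f\<in>E. f (x, P) = 0))"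
      using E by (intro exI[of _ ?E]) blast
  qed
  define p where "p = 2 * of_real pi * \<i>"
  have ep: "exp (w + p) = exp w" for w using exp_shift[of w 1] by (simp add: p_def)
  have Rp: "Re p = 0" by (simp add: p_def)
  let ?S = "{w::complex. Re w < 0}"
  have S: "convex ?S" "open ?S" by (rule convex_halfspace_Re_lt open_halfspace_Re_lt)+
  have e1: "norm (exp w) < 1" if "w \<in> ?S" for w :: complex using that by (simp add: norm_exp_eq_Re)
  have expne: "exp w \<noteq> 1" if "w \<in> ?S" for w :: complex using e1[OF that] by (metis norm_one less_irrefl)
  have "\<exists>T. parametrization (rat_eval ?n ?d) ?S exp exp T (\<rho> exp (\<lambda>w. w)) (\<lambda>s. ?H (exp s) * \<rho> exp (\<lambda>w. w) s)"
    by (rule ex[OF S]) (use expne in \<open>auto intro!: derivative_eq_intros holomorphic_intros\<close>)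
  then obtain T where T: "parametrization (rat_eval ?n ?d) ?S exp exp T (\<rho> exp (\<lambda>w. w)) (\<lambda>s. ?H (exp s) * \<rho> exp (\<lambda>w. w) s)" ..
  define R0 where "R0 w = param_mat (T w) (\<rho> exp (\<lambda>w. w) w) (?H (exp w) * \<rho> exp (\<lambda>w. w) w)" for w
  define w0 where "w0 = complex_of_real (ln (1 / 2))"
  have w0: "exp w0 = 1 / 2" "w0 \<in> ?S" "w0 + p \<in> ?S"
    by (simp_all add: w0_def exp_of_real Rp)
  define x0 :: complex where "x0 = 1 / 2"
  define P0 where "P0 = R0 w0"
  have Z0: "(x0, P0) \<in> Z"
    unfolding P0_def R0_def x0_def w0(1)[symmetric] by (rule inZ) (use expne[OF w0(2)] in auto)
  \<comment> \<open>The factor of \<open>v\<close>, up to sign, along the loop around 0; its square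
    is the factor of \<open>v^2\<close>.\<close>
  define l where "l = exp (- (of_real pi * \<i> * ?a))"
  have l: "l \<noteq> 0" by (simp add: l_def)
  have \<rho>p: "\<rho> exp (\<lambda>w. w) (w + p) = l^2 * \<rho> exp (\<lambda>w. w) w" for w
  proof -
    have "exp (- ?a * (w + p)) = exp (- ?a * w) * l^2"
      unfolding l_def by (simp add: p_def algebra_simps flip: exp_add exp_double)
    then show ?thesis unfolding \<rho>_def ep by simp
  qed
  \<comment> \<open>The derivative of \<open>T\<close> is divided by \<open>l^2\<close> under the
    shift, so \<open>T\<close> itself transforms by an affine map, whose constant term stays
    unspecified.\<close>
  have "\<exists>k. \<forall>w\<in>?S. T (w + p) - 1 / l^2 * T w = k"
  proof (intro has_field_derivative_zero_constant S)
    fix w :: complex assume w: "w \<in> ?S"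
    have D: "(T has_field_derivative exp z / \<rho> exp (\<lambda>w. w) z) (at z)" if "z \<in> ?S" for z
      using T that unfolding parametrization_def by blast
    have "((\<lambda>w. T (w + p)) has_field_derivative exp (w + p) / \<rho> exp (\<lambda>w. w) (w + p) * 1) (at w)"
      by (rule DERIV_chain2[OF D]) (use w in \<open>auto simp: Rp intro!: derivative_eq_intros\<close>)
    from DERIV_diff[OF this DERIV_cmult[OF D[OF w], of "1 / l^2"]]
    show "((\<lambda>w. T (w + p) - 1 / l^2 * T w) has_field_derivative 0) (at w within ?S)"
      unfolding ep \<rho>p by (simp add: has_field_derivative_at_within)
  qed
  then obtain k where k: "T (w0 + p) - 1 / l^2 * T w0 = k" using w0(2) by blast
  have m0: "mat2 (1 / l) (k * l) 0 l \<in> monodromy ?n ?d (x0, P0)" (is "?m0 \<in> _")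
  proof (rule monodromyI(1)[OF R])
    show "det ?m0 = 1" using l by simp
    have lN: "(l^2) ^ N = 1"
    proof -
      have "(l^2) ^ N = exp (- ?a * p) ^ N" unfolding l_def p_def by (simp add: algebra_simps flip: exp_double)
      also have "\<dots> = 1" using aN[of p] ep[of 0] by simp
      finally show ?thesis .
    qed
    have "?m0 \<in> borel2_root N" using l lN by (simp add: borel2_root_def power_mult)
    then show "(x0, ?m0 ** P0) \<in> Z" by (rule reduction_mult[OF R Z0])
    have \<rho>0: "\<rho> exp (\<lambda>w. w) w0 \<noteq> 0" using expne[OF w0(2)] by (simp add: \<rho>_def)
    show "R0 (w0 + p) = ?m0 ** P0 \<or> R0 (w0 + p) = - (?m0 ** P0)"
      unfolding P0_def R0_def ep \<rho>p
    proof (rule param_mat_moebius)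
      show "T (w0 + p) = (1 / l * T w0 + k * l) / (0 * T w0 + l)"
        using k l by (simp add: field_simps power2_eq_square)
    qed (use l \<rho>0 in \<open>simp_all add: algebra_simps\<close>)
    have "reach ?n ?d (exp w0, R0 w0) (exp (w0 + p), R0 (w0 + p))"
      unfolding R0_def by (rule parametrization_reach[OF T _ w0(2,3)]) (use expne borel_den in auto)
    then show "reach ?n ?d (x0, P0) (x0, R0 (w0 + p))" unfolding ep w0(1) P0_def x0_def .
  qed
  \<comment> \<open>Second chart: the punctured disc around the other singular point,
    \<open>x = 1 + exp w\<close>.\<close>
  let ?e = "\<lambda>w. 1 + exp w" and ?L = "\<lambda>w. Ln (1 + exp w)"
  have Re1: "1 + exp w \<notin> \<real>\<^sub>\<le>\<^sub>0" if "w \<in> ?S" for w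
  proof -
    have "\<bar>Re (exp w)\<bar> < 1" using e1[OF that] abs_Re_le_cmod[of "exp w"] by linarith
    then show ?thesis by (auto simp: complex_nonpos_Reals_iff)
  qed
  have ne1: "1 + exp w \<noteq> 0" if "w \<in> ?S" for w using Re1[OF that] by auto
  have "\<exists>T1. parametrization (rat_eval ?n ?d) ?S ?e exp T1 (\<rho> ?e ?L) (\<lambda>s. ?H (?e s) * \<rho> ?e ?L s)"
  proof (rule ex[OF S])
    show "(?L has_field_derivative exp s / ?e s) (at s)" if "s \<in> ?S" for s
      using Re1[OF that] ne1[OF that] by (auto intro!: derivative_eq_intros simp: field_simps)
  qed (use ne1 in \<open>auto intro!: derivative_eq_intros holomorphic_intros\<close>)
  then obtain T1 where T1: "parametrization (rat_eval ?n ?d) ?S ?e exp T1 (\<rho> ?e ?L) (\<lambda>s. ?H (?e s) * \<rho> ?e ?L s)" ..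
  define R1 where "R1 w = param_mat (T1 w) (\<rho> ?e ?L w) (?H (?e w) * \<rho> ?e ?L w)" for w
  have per: "T1 (w + p) = T1 w + p" if "w \<in> ?S" for w
  proof -
    have \<rho>1: "exp z / \<rho> ?e ?L z = exp (?a * ?L z)" if "z \<in> ?S" for z
      using ne1[OF that] by (simp add: \<rho>_def exp_minus field_simps)
    have "T1 (w + 2 * of_real pi * \<i>) = T1 w + 2 * of_real pi * \<i> * 1"
    proof (rule half_plane_period[where R = 0 and g = "\<lambda>w. exp (?a * ?L w)"])
      show "(T1 has_field_derivative exp (?a * ?L z)) (at z)" if "Re z < 0" for z
        using T1 that \<rho>1[of z] unfolding parametrization_def by auto
      show "exp (?a * ?L (z + 2 * of_real pi * \<i>)) = exp (?a * ?L z)" for z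
        using ep[of z] by (simp add: p_def)
      show "\<exists>M. \<forall>w. Re w < M \<longrightarrow> norm (exp (?a * ?L w) - 1) < r" if "r > 0" for r
      proof (rule small_at_left[where f = "\<lambda>z. exp (?a * Ln (1 + z))", OF _ that])
        have "isCont (\<lambda>z. exp (?a * Ln (1 + z))) 0" by (intro continuous_intros) auto
        then show "((\<lambda>z. exp (?a * Ln (1 + z))) \<longlongrightarrow> 1) (at 0)" by (simp add: isCont_def)
      qed
    qed (use that in auto)
    then show ?thesis by (simp add: p_def)
  qed
  \<comment> \<open>Chosen so that \<open>1 + exp u0 = 1 / 2\<close>, the base point of the first
    chart. The two solution matrices there differ by a constant \<open>g\<close>, which transports
    the loop.\<close>
  define u0 where "u0 = complex_of_real (ln (1 / 2)) + of_real pi * \<i>"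
  have u0: "exp u0 = - 1 / 2" "u0 \<in> ?S" "u0 + p \<in> ?S"
    by (simp_all add: u0_def exp_add exp_of_real Rp)
  have eu: "?e u0 = x0" by (simp add: u0(1) x0_def)
  have ZR1: "(x0, R1 u0) \<in> Z"
    unfolding R1_def eu[symmetric] by (rule inZ) (use ne1[OF u0(2)] in auto)
  have m1: "mat2 1 p 0 1 \<in> monodromy ?n ?d (x0, R1 u0)" (is "?m1 \<in> _")
  proof (rule monodromyI(1)[OF R])
    show "det ?m1 = 1" by simp
    have "?m1 \<in> borel2_root N" by (simp add: borel2_root_def)
    then show "(x0, ?m1 ** R1 u0) \<in> Z" by (rule reduction_mult[OF R ZR1])
    have \<rho>s: "\<rho> ?e ?L (u0 + p) = \<rho> ?e ?L u0" by (simp add: \<rho>_def ep)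
    have \<rho>0: "\<rho> ?e ?L u0 \<noteq> 0" by (simp add: \<rho>_def)
    show "R1 (u0 + p) = ?m1 ** R1 u0 \<or> R1 (u0 + p) = - (?m1 ** R1 u0)"
      unfolding R1_def ep \<rho>s by (rule param_mat_moebius) (use \<rho>0 per[OF u0(2)] in simp_all)
    have "reach ?n ?d (?e u0, R1 u0) (?e (u0 + p), R1 (u0 + p))"
      unfolding R1_def by (rule parametrization_reach[OF T1 _ u0(2,3)]) (use ne1 borel_den in auto)
    then show "reach ?n ?d (x0, R1 u0) (x0, R1 (u0 + p))" by (simp add: eu ep)
  qed
  obtain g where g: "g \<in> borel2_root N" "R1 u0 = g ** P0" using reduction_factor[OF R Z0 ZR1] by blast
  then obtain a b d where gm: "g = mat2 a b 0 d" "a * d = 1"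
    by (cases g rule: mat2_cases) (auto simp: borel2_root_def)
  have d0: "d \<noteq> 0" using gm(2) by auto
  have "adj2 g ** ?m1 ** g \<in> monodromy ?n ?d (x0, P0)"
    using monodromy_conj[of ?m1 ?n ?d x0 g P0] m1 gm by (simp add: g(2))
  also have "adj2 g ** ?m1 ** g = mat2 1 (p * d^2) 0 1"
    using gm(2) by (simp add: gm(1) algebra_simps power2_eq_square)
  finally have m1': "mat2 1 (p * d^2) 0 1 \<in> monodromy ?n ?d (x0, P0)" .
  have pd: "p * d^2 \<noteq> 0" using d0 by (simp add: p_def)
  have "borel2_root N \<subseteq> zariski_closed mat_coords hull monodromy ?n ?d (x0, P0)"
  proof
    fix A assume A: "A \<in> borel2_root N"
    show "A \<in> zariski_closed mat_coords hull monodromy ?n ?d (x0, P0)"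
    proof (rule mult_mem_hull)
      fix Y assume Y: "zariski_closed mat_coords Y" "monodromy ?n ?d (x0, P0) \<subseteq> Y"
      have tri: "mat2 (1 / l ^ j) t 0 (l ^ j) \<in> Y" for j t
        by (rule triangular_density[OF Y monodromy_mult monodromy_1 m0 m1' pd l])
      obtain r t s where A': "A = mat2 r t 0 s" "r * s = 1" "s ^ (2 * N) = 1"
        using A by (cases A rule: mat2_cases) (auto simp: borel2_root_def)
      then have s: "s \<noteq> 0" "r = 1 / s" by (auto simp: eq_divide_eq)
      show "A \<in> Y"
      proof (cases "N = 0")
        case True
        have "l = of_real (exp pi)" using True by (simp add: l_def borel_rate_def exp_of_real[symmetric] mult_ac)
        then have "l ^ j \<noteq> 1" if "j \<ge> 1" for j
          using that by (metis exp_gt_one not_one_le_zero of_real_eq_1_iff of_real_power one_less_power pi_gt_zero less_irrefl less_le_trans zero_less_one)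
        then have "infinite (range (\<lambda>j::nat. l ^ j))" by (rule infinite_powers[OF l])
        moreover have "range (\<lambda>j::nat. l ^ j) \<subseteq> {z. z \<noteq> 0 \<and> mat2 (1 / z) t 0 z \<in> Y}" using tri l by auto
        ultimately have "infinite {z. z \<noteq> 0 \<and> mat2 (1 / z) t 0 z \<in> Y}" using finite_subset by blast
        from zariski_curve[OF Y(1) laurent_mat2[OF laurent_inverse laurent_const laurent_const laurent_id] this s(1)]
        show ?thesis by (simp add: A' s)
      next
        case False
        have "s \<in> {exp (2 * of_real pi * \<i> * of_nat j / of_nat (2 * N)) |j. j < 2 * N}"
          using A'(3) False complex_roots_unity[of "2 * N"] by auto
        then obtain j where j: "s = exp (2 * of_real pi * \<i> * of_nat j / of_nat (2 * N))" "j < 2 * N" by blast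
        \<comment> \<open>Since \<open>l = exp (- pi i / N)\<close> is the inverse of the root of
          unity that parametrizes \<open>s\<close>, the exponent is \<open>- j\<close>, shifted by
          \<open>2 * N\<close> to be a natural number.\<close>
        have "s = l ^ (2 * N - j)"
        proof -
          have "l ^ (2 * N - j) = exp (of_nat (2 * N - j) * - (of_real pi * \<i> * ?a))"
            unfolding l_def by (rule exp_of_nat_mult[symmetric])
          also have "of_nat (2 * N - j) * - (of_real pi * \<i> * ?a) = 2 * of_real pi * \<i> * of_nat j / of_nat (2 * N) - p"
            using False j(2) by (simp add: borel_rate_def p_def of_nat_diff field_simps)
          also have "exp \<dots> = s" unfolding j(1) using ep[of "2 * of_real pi * \<i> * of_nat j / of_nat (2 * N) - p"] by simp
          finally show ?thesis ..
        qed
        then show ?thesis using tri[of "2 * N - j" t] by (simp add: A' s)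
      qed
    qed
  qed
  then show ?thesis using R Z0 by blast
qed

section \<open>The full group\<close>

lemma line_density:
  assumes Y: "zariski_closed mat_coords Y" and L: "\<And>c i j. laurent (\<lambda>s. M (s + c) $ i $ j)"
    and mem: "\<And>i::nat. M (of_nat i * u) \<in> Y" and u: "u \<noteq> 0"
  shows "M t \<in> Y"
proof -
  define f where "f i = of_nat i * u - (t - 1)" for i
  have "inj f" using u by (intro injI) (simp add: f_def)
  then have "infinite (range f - {0})" by (intro infinite_remove range_inj_infinite)
  moreover have "range f - {0} \<subseteq> {s. s \<noteq> 0 \<and> M (s + (t - 1)) \<in> Y}"
    using mem by (auto simp: f_def)
  ultimately have "infinite {s. s \<noteq> 0 \<and> M (s + (t - 1)) \<in> Y}" using finite_subset by blast
  from zariski_curve[OF Y L this, of 1] show ?thesis by simp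
qed

text \<open>Every matrix of determinant 1 is a product of at most four elementary ones. Their
  parameters are freed from multiples of \<open>u\<close> and \<open>l\<close> one factor at a time,
  from the left, the remaining factors still being taken in \<open>M\<close>.\<close>

lemma SL2_density:
  assumes Y: "zariski_closed mat_coords Y" "M \<subseteq> Y" and M: "\<And>A B. A \<in> M \<Longrightarrow> B \<in> M \<Longrightarrow> A ** B \<in> M" "mat 1 \<in> M"
    and m: "mat2 1 u 0 1 \<in> M" "mat2 1 0 l 1 \<in> M" "u \<noteq> 0" "l \<noteq> 0" and A: "det A = 1"
  shows "A \<in> Y"
proof -
  define E F where "E t = mat2 1 t 0 1" and "F t = mat2 1 0 t 1" for t
  have Ei: "E (of_nat i * u) \<in> M" for i
    by (induction i) (use M m in \<open>auto simp: E_def mat_1_mat2 algebra_simps dest: M(1)[OF m(1)]\<close>)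
  have Fi: "F (of_nat i * l) \<in> M" for i
    by (induction i) (use M m in \<open>auto simp: F_def mat_1_mat2 algebra_simps dest: M(1)[OF m(2)]\<close>)
  have EL: "laurent (\<lambda>s. E (s + c) $ i $ j)" "laurent (\<lambda>s. F (s + c) $ i $ j)" for c i j
    unfolding E_def F_def by (intro laurent_mat2 laurent_intros)+
  have 1: "E t ** B \<in> Y" if "B \<in> M" for t B
    by (rule line_density[OF Y(1) _ _ m(3), where M = "\<lambda>t. E t ** B"])
      (use Y(2) M(1)[OF Ei that] in \<open>auto intro!: laurent_mat_mult EL laurent_const\<close>)
  have 2: "E t ** (F s ** B) \<in> Y" if "B \<in> M" for t s B
    by (rule line_density[OF Y(1) _ _ m(4), where M = "\<lambda>s. E t ** (F s ** B)"])
      (use 1[OF M(1)[OF Fi that]] in \<open>auto intro!: laurent_mat_mult EL laurent_const\<close>)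
  have 3: "E t ** (F s ** (E r ** B)) \<in> Y" if "B \<in> M" for t s r B
    by (rule line_density[OF Y(1) _ _ m(3), where M = "\<lambda>r. E t ** (F s ** (E r ** B))"])
      (use 2[OF M(1)[OF Ei that]] in \<open>auto intro!: laurent_mat_mult EL laurent_const\<close>)
  have 4: "E t ** (F s ** (E r ** (F q ** B))) \<in> Y" if "B \<in> M" for t s r q B
    by (rule line_density[OF Y(1) _ _ m(4), where M = "\<lambda>q. E t ** (F s ** (E r ** (F q ** B)))"])
      (use 3[OF M(1)[OF Fi that]] in \<open>auto intro!: laurent_mat_mult EL laurent_const\<close>)
  obtain a b c d where A': "A = mat2 a b c d" by (rule mat2_cases)
  have ad: "a * d - b * c = 1" using A by (simp add: A')
  show ?thesis
  proof (cases "c = 0")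
    case False
    have "E ((a - 1) / c) ** (F c ** (E ((d - 1) / c) ** mat 1)) = A"
      using False ad by (simp add: A' E_def F_def mat_1_mat2 field_simps)
    then show ?thesis using 3[OF M(2), of "(a - 1) / c" c "(d - 1) / c"] by simp
  next
    case True
    then have d: "d \<noteq> 0" "a * d = 1" using ad by auto
    \<comment> \<open>Multiplying \<open>A\<close> on the right by \<open>F 1\<close> makes the
      lower left entry equal to \<open>d\<close>, which is nonzero, and leads back to the previous
      decomposition.\<close>
    have "E ((a + b - 1) / d) ** (F d ** (E ((d - 1) / d) ** (F (- 1) ** mat 1))) = A"
      using d True by (simp add: A' E_def F_def mat_1_mat2 field_simps)
    then show ?thesis using 4[OF M(2), of "(a + b - 1) / d" d "(d - 1) / d" "-1"] by simp
  qed
qed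

lemma monodromy_reach:
  assumes "reach n d (x, P) (y, P')" "m \<in> monodromy n d (y, P')"
  shows "m \<in> monodromy n d (x, P)"
proof -
  have "det m = 1" "reach n d (y, P') (y, m ** P')" using assms(2) by (auto simp: monodromy_def)
  moreover have "reach n d (y, m ** P') (x, m ** P)"
    using reach_mult[OF reach_sym[OF assms(1)] \<open>det m = 1\<close>] by simp
  ultimately show ?thesis using assms(1) by (auto simp: monodromy_def intro: rtranclp_trans)
qed

text \<open>A power series solution of \<open>(A + B z - z\<^sup>2) v'' = v\<close>; this is \<open>v'' = v / (x (1 - x))\<close>
  expanded in \<open>z = x - x\<^sub>0\<close>.\<close>

lemma power_series_solution:
  fixes c :: "nat \<Rightarrow> complex"
  assumes C: "C > 0" "\<And>n. norm (c n) \<le> C ^ n"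
    and rec: "\<And>n. A * (of_nat (n + 2) * of_nat (n + 1) * c (n + 2)) + B * (of_nat (n + 1) * of_nat n * c (n + 1))
      - (of_nat n * of_nat n - of_nat n) * c n = c n"
  defines "v \<equiv> \<lambda>z. \<Sum>n. c n * z ^ n" and "v1 \<equiv> \<lambda>z. \<Sum>n. diffs c n * z ^ n"
  assumes z: "norm z < 1 / C"
  shows "(v has_field_derivative v1 z) (at z)"
    "\<exists>v2. (v1 has_field_derivative v2) (at z) \<and> (A + B * z - z^2) * v2 = v z"
proof -
  have sm: "summable (\<lambda>n. c n * x ^ n)" if "norm x < 1 / C" for x
  proof (rule summable_comparison_test'[of "\<lambda>n. (C * norm x) ^ n" 0])
    show "summable (\<lambda>n. (C * norm x) ^ n)" using that C(1) by (intro summable_geometric) (auto simp: field_simps)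
    show "norm (c n * x ^ n) \<le> (C * norm x) ^ n" for n
      using mult_right_mono[OF C(2)[of n], of "norm x ^ n"] by (simp add: norm_mult norm_power power_mult_distrib)
  qed
  have sm1: "summable (\<lambda>n. diffs c n * x ^ n)" if "norm x < 1 / C" for x
    by (rule termdiff_converges[OF that sm])
  have sm2: "summable (\<lambda>n. diffs (diffs c) n * x ^ n)" if "norm x < 1 / C" for x
    by (rule termdiff_converges[OF that sm1])
  obtain r where r: "norm z < r" "r < 1 / C" using dense z by blast
  have "r \<ge> 0" using r(1) norm_ge_zero[of z] by linarith
  then have nr: "norm (of_real r :: complex) = r" by simp
  show "(v has_field_derivative v1 z) (at z)"
    unfolding v_def v1_def by (rule termdiffs_strong[of c "of_real r"]) (use r nr sm in auto)
  define v2 where "v2 = (\<Sum>n. diffs (diffs c) n * z ^ n)"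
  have D2: "(v1 has_field_derivative v2) (at z)"
    unfolding v1_def v2_def by (rule termdiffs_strong[of "diffs c" "of_real r"]) (use r nr sm1 in auto)
  define d where "d n = of_nat (n + 2) * of_nat (n + 1) * c (n + 2)" for n
  have dd: "diffs (diffs c) n = d n" for n by (simp add: diffs_def d_def)
  have s0: "(\<lambda>n. d n * z ^ n) sums v2" using summable_sums[OF sm2[OF z]] by (simp add: v2_def dd)
  \<comment> \<open>Coefficients of \<open>z v''\<close>; \<open>e2\<close> below are those of
    \<open>z^2 v''\<close>.\<close>
  define e where "e n = (case n of 0 \<Rightarrow> 0 | Suc n \<Rightarrow> d n)" for n
  have s1: "(\<lambda>n. e n * z ^ n) sums (z * v2)"
  proof -
    have "(\<lambda>n. e (Suc n) * z ^ Suc n) sums (z * v2)"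
      using sums_mult[OF s0, of z] by (simp add: e_def mult_ac)
    from sums_Suc[OF this] show ?thesis by (simp add: e_def)
  qed
  define e2 where "e2 n = (case n of 0 \<Rightarrow> 0 | Suc n \<Rightarrow> e n)" for n
  have s2: "(\<lambda>n. e2 n * z ^ n) sums (z * (z * v2))"
  proof -
    have "(\<lambda>n. e2 (Suc n) * z ^ Suc n) sums (z * (z * v2))"
      using sums_mult[OF s1, of z] by (simp add: e2_def mult_ac)
    from sums_Suc[OF this] show ?thesis by (simp add: e2_def)
  qed
  have coef: "A * d n + B * e n - e2 n = c n" for n
  proof -
    have "e n = of_nat (n + 1) * of_nat n * c (n + 1)" by (cases n) (simp_all add: e_def d_def)
    moreover have "e2 n = (of_nat n * of_nat n - of_nat n) * c n"
      by (cases n; cases "n - 1") (simp_all add: e2_def e_def d_def algebra_simps)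
    ultimately show ?thesis using rec[of n] by (simp add: d_def)
  qed
  have "(\<lambda>n. A * (d n * z ^ n) + B * (e n * z ^ n) - e2 n * z ^ n) sums (A * v2 + B * (z * v2) - z * (z * v2))"
    by (intro sums_add sums_diff sums_mult s0 s1 s2)
  moreover have "A * (d n * z ^ n) + B * (e n * z ^ n) - e2 n * z ^ n = c n * z ^ n" for n
    unfolding coef[of n, symmetric] by (simp add: algebra_simps)
  ultimately have "(\<lambda>n. c n * z ^ n) sums (A * v2 + B * (z * v2) - z * (z * v2))" by simp
  then have "v z = A * v2 + B * (z * v2) - z * (z * v2)" unfolding v_def by (rule sums_unique[symmetric])
  then have "(A + B * z - z^2) * v2 = v z" by (simp add: algebra_simps power2_eq_square)
  then show "\<exists>v2. (v1 has_field_derivative v2) (at z) \<and> (A + B * z - z^2) * v2 = v z" using D2 by blast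
qed

fun regular_coeff :: "complex \<Rightarrow> complex \<Rightarrow> nat \<Rightarrow> complex" where
  "regular_coeff A B 0 = 1"
| "regular_coeff A B (Suc 0) = 0"
| "regular_coeff A B (Suc (Suc n)) = ((of_nat n * of_nat n - of_nat n + 1) * regular_coeff A B n
     - B * of_nat (n + 1) * of_nat n * regular_coeff A B (n + 1)) / (A * of_nat (n + 2) * of_nat (n + 1))"

text \<open>Geometric majorant. The polynomial factors in the recursion are at most
  \<open>(n + 2) (n + 1)\<close>, and the choice of \<open>C\<close> gives
  \<open>1 + norm B \<le> C * norm A\<close>, which closes the induction.\<close>

lemma regular_coeff_bound:
  fixes A B :: complex
  assumes "A \<noteq> 0"
  defines "C \<equiv> 1 + (1 + norm B) / norm A"
  shows "norm (regular_coeff A B n) \<le> C ^ n"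
proof (induction n rule: induct_nat_012)
  case (ge2 n)
  have C1: "C \<ge> 1" by (simp add: C_def)
  let ?N = "of_nat (n + 2) * of_nat (n + 1) :: real"
  have N: "?N > 0" by simp
  have 1: "norm (of_nat n * of_nat n - of_nat n + 1 :: complex) \<le> ?N"
  proof -
    have "of_nat n * of_nat n - of_nat n + 1 = (of_real (real n * real n - real n + 1) :: complex)" by simp
    also have "norm \<dots> = \<bar>real n * real n - real n + 1\<bar>" by (rule norm_of_real)
    also have "\<dots> \<le> ?N"
    proof -
      have "0 \<le> real n * real n - real n + 1"
        using zero_le_square[of "real n - 1"] by (simp add: algebra_simps)
      then show ?thesis by (simp add: algebra_simps)
    qed
    finally show ?thesis .
  qed
  have 2: "real (n + 1) * real n \<le> ?N" by (simp add: algebra_simps)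
  have "norm (regular_coeff A B (Suc (Suc n))) * (norm A * ?N) =
      norm ((of_nat n * of_nat n - of_nat n + 1) * regular_coeff A B n - B * of_nat (n + 1) * of_nat n * regular_coeff A B (n + 1))"
    using assms(1) N by (simp add: norm_divide norm_mult mult_ac del: of_nat_add of_nat_Suc)
  also have "\<dots> \<le> norm (of_nat n * of_nat n - of_nat n + 1 :: complex) * norm (regular_coeff A B n) +
      norm B * (real (n + 1) * real n) * norm (regular_coeff A B (n + 1))"
    by (rule order_trans[OF norm_triangle_ineq4]) (simp add: norm_mult mult_ac del: of_nat_add of_nat_Suc)
  also have "\<dots> \<le> ?N * C ^ (n + 1) + norm B * ?N * C ^ (n + 1)"
  proof (intro add_mono mult_mono 1 2 order_refl)
    show "norm (regular_coeff A B n) \<le> C ^ (n + 1)"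
      using ge2(1) C1 power_increasing[of n "n + 1" C] by linarith
    show "norm (regular_coeff A B (n + 1)) \<le> C ^ (n + 1)" using ge2(2) by simp
  qed (use C1 in auto)
  also have "\<dots> = (1 + norm B) * C ^ (n + 1) * ?N" by (simp add: algebra_simps)
  also have "\<dots> \<le> (C * norm A) * C ^ (n + 1) * ?N"
  proof (intro mult_right_mono)
    show "1 + norm B \<le> C * norm A" using assms(1) by (simp add: C_def field_simps)
  qed (use C1 in auto)
  also have "\<dots> = C ^ (Suc (Suc n)) * (norm A * ?N)" by simp
  finally show ?case using assms(1) N by (simp add: mult_le_cancel_right del: of_nat_add of_nat_Suc)
qed (simp_all add: C_def)

text \<open>Reduction of order: one nonvanishing solution \<open>v\<close> gives the other as
  \<open>T v\<close>, with \<open>T\<close> a primitive of \<open>1 / v^2\<close>.\<close>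

lemma solution_parametrization:
  assumes S: "convex S" "open S" "e' holomorphic_on S"
    and e: "\<And>s. s \<in> S \<Longrightarrow> (e has_field_derivative e' s) (at s)" "\<And>s. s \<in> S \<Longrightarrow> e' s \<noteq> 0"
    and v: "\<And>s. s \<in> S \<Longrightarrow> v s \<noteq> 0" "\<And>s. s \<in> S \<Longrightarrow> (v has_field_derivative v1 s * e' s) (at s)"
      "\<And>s. s \<in> S \<Longrightarrow> (v1 has_field_derivative q (e s) * v s * e' s) (at s)"
  shows "\<exists>T. parametrization q S e e' T (\<lambda>s. v s * v s) (\<lambda>s. 2 * v s * v1 s)"
proof -
  have "v holomorphic_on S" using v(2) S(2) holomorphic_on_open by blast
  then have "(\<lambda>s. e' s / (v s * v s)) holomorphic_on S" using S(3) v(1) by (intro holomorphic_intros) auto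
  then obtain T where T: "\<And>s. s \<in> S \<Longrightarrow> (T has_field_derivative e' s / (v s * v s)) (at s within S)"
    using holomorphic_convex_primitive'[OF S(1,2)] by blast
  have "((\<lambda>s. v s * v s) has_field_derivative 2 * v s * v1 s * e' s) (at s)" if "s \<in> S" for s
    by (rule DERIV_cong[OF DERIV_mult[OF v(2)[OF that] v(2)[OF that]]]) simp
  moreover have "((\<lambda>s. 2 * v s * v1 s) has_field_derivative
      e' s * (2 * (v s * v s) * q (e s) + (2 * v s * v1 s)^2 / (2 * (v s * v s)))) (at s)" if "s \<in> S" for s
    by (rule DERIV_cong[OF DERIV_mult[OF DERIV_cmult[OF v(2)[OF that], of 2] v(3)[OF that]]])
      (use v(1)[OF that] in \<open>simp add: field_simps power2_eq_square\<close>)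
  ultimately have "parametrization q S e e' T (\<lambda>s. v s * v s) (\<lambda>s. 2 * v s * v1 s)"
    unfolding parametrization_def
    using S(2) convex_connected[OF S(1)] e v(1) T at_within_open[OF _ S(2)] by simp
  then show ?thesis by blast
qed

text \<open>The equation \<open>v'' = v / (x (1 - x))\<close> is symmetric under
  \<open>x \<mapsto> 1 - x\<close> and has exponents 0 and 1 at both finite singular points, with
  logarithms. Its two local monodromies are unipotent and nontrivial.\<close>

definition "full_den = [:0, 1, -1::complex:]"

lemma full_den: "poly full_den x = x * (1 - x)" "rat_eval 1 full_den x = 1 / (x * (1 - x))"
  by (simp_all add: full_den_def rat_eval_def algebra_simps)

text \<open>The identity parameter on a small disc. The normalization \<open>c 0 = 1\<close> of the
  power series keeps the solution away from 0 there.\<close>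

lemma regular_parametrization:
  assumes x0: "x0 \<noteq> 0" "x0 \<noteq> 1"
  shows "\<exists>S e e' T \<rho> b. parametrization (rat_eval 1 full_den) S e e' T \<rho> b \<and> x0 \<in> S \<and> e x0 = x0 \<and> (\<forall>s\<in>S. e s \<noteq> 0 \<and> e s \<noteq> 1)"
proof -
  define A B where "A = x0 * (1 - x0)" and "B = 1 - 2 * x0"
  have A: "A \<noteq> 0" using x0 by (simp add: A_def)
  define C where "C = 1 + (1 + norm B) / norm A"
  have C: "C > 0" using A by (simp add: C_def add_pos_nonneg)
  define c where "c = regular_coeff A B"
  have cb: "norm (c n) \<le> C ^ n" for n unfolding c_def C_def by (rule regular_coeff_bound[OF A])
  have rec: "A * (of_nat (n + 2) * of_nat (n + 1) * c (n + 2)) + B * (of_nat (n + 1) * of_nat n * c (n + 1))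
      - (of_nat n * of_nat n - of_nat n) * c n = c n" for n
  proof -
    have "(of_nat (n + 2) :: complex) \<noteq> 0" "(of_nat (n + 1) :: complex) \<noteq> 0" by (simp_all only: of_nat_eq_0_iff)
    then have "A * (of_nat (n + 2) * of_nat (n + 1) * c (n + 2)) = (of_nat n * of_nat n - of_nat n + 1) * c n - B * of_nat (n + 1) * of_nat n * c (n + 1)"
      using A by (simp add: c_def del: of_nat_add of_nat_Suc)
    then show ?thesis by (simp add: algebra_simps)
  qed
  define v v1 where "v z = (\<Sum>n. c n * z ^ n)" and "v1 z = (\<Sum>n. diffs c n * z ^ n)" for z
  note ps = power_series_solution[OF C cb rec, folded v_def v1_def]
  have v0: "v 0 = 1" using powser_zero[of c] by (simp add: v_def c_def)
  have "isCont v 0" using ps(1)[of 0] C DERIV_isCont by force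
  then have "\<forall>\<^sub>F z in at 0. v z \<noteq> 0"
    unfolding isCont_def by (rule tendsto_imp_eventually_ne) (simp add: v0)
  then obtain r1 where r1: "r1 > 0" "\<And>z. z \<noteq> 0 \<Longrightarrow> dist z 0 < r1 \<Longrightarrow> v z \<noteq> 0" unfolding eventually_at by blast
  define r where "r = Min {r1, 1 / C, norm x0, norm (1 - x0)}"
  have r: "r > 0" "r \<le> r1" "r \<le> 1 / C" "r \<le> norm x0" "r \<le> norm (1 - x0)" using r1 C x0 by (auto simp: r_def)
  have nb: "norm (x - x0) < r" if "x \<in> ball x0 r" for x using that by (simp add: dist_norm norm_minus_commute)
  have ne: "x \<noteq> 0" "x \<noteq> 1" if "x \<in> ball x0 r" for x using nb[OF that] r by auto
  have q: "((\<lambda>x. v1 (x - x0)) has_field_derivative rat_eval 1 full_den x * v (x - x0) * 1) (at x)" if x: "x \<in> ball x0 r" for x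
  proof -
    obtain v2 where v2: "(v1 has_field_derivative v2) (at (x - x0))" "(A + B * (x - x0) - (x - x0)^2) * v2 = v (x - x0)"
      using ps(2)[of "x - x0"] nb[OF x] r by auto
    have "A + B * (x - x0) - (x - x0)^2 = x * (1 - x)" by (simp add: A_def B_def power2_eq_square algebra_simps)
    from v2(2)[unfolded this] have eq: "v2 * (x * (1 - x)) = v (x - x0)" by (simp only: mult.commute)
    have nz: "x * (1 - x) \<noteq> 0" using ne[OF x] by simp
    from eq have "v2 = v (x - x0) / (x * (1 - x))" unfolding nonzero_eq_divide_eq[OF nz] .
    then have "v2 = rat_eval 1 full_den x * v (x - x0)" by (simp add: full_den)
    moreover have "((\<lambda>x. v1 (x - x0)) has_field_derivative v2 * 1) (at x)"
      by (rule DERIV_chain2[where g = "\<lambda>x. x - x0" and x = x, OF v2(1)]) (auto intro!: derivative_eq_intros)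
    ultimately show ?thesis by simp
  qed
  have "\<exists>T. parametrization (rat_eval 1 full_den) (ball x0 r) (\<lambda>x. x) (\<lambda>_. 1) T (\<lambda>x. v (x - x0) * v (x - x0)) (\<lambda>x. 2 * v (x - x0) * v1 (x - x0))"
  proof (rule solution_parametrization)
    fix x assume x: "x \<in> ball x0 r"
    show "v (x - x0) \<noteq> 0" using nb[OF x] r r1(2)[of "x - x0"] v0 by (cases "x = x0") auto
    show "((\<lambda>x. v (x - x0)) has_field_derivative v1 (x - x0) * 1) (at x)"
      by (rule DERIV_chain2[where g = "\<lambda>x. x - x0" and x = x, OF ps(1)]) (use nb[OF x] r in \<open>auto intro!: derivative_eq_intros\<close>)
  qed (use q in auto)
  then obtain T where T: "parametrization (rat_eval 1 full_den) (ball x0 r) (\<lambda>x. x) (\<lambda>_. 1) T (\<lambda>x. v (x - x0) * v (x - x0)) (\<lambda>x. 2 * v (x - x0) * v1 (x - x0))" ..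
  show ?thesis by (intro exI conjI, rule T) (use r(1) ne in auto)
qed

text \<open>Taylor coefficients of the solution \<open>z + z^2 / 2 + ...\<close> vanishing at a
  singular point. Being at most 1 they converge in the unit disc, and being positive they exclude a
  zero at 1/2.\<close>

primrec singular_coeff :: "nat \<Rightarrow> real" where
  "singular_coeff 0 = 0"
| "singular_coeff (Suc n) = (if n = 0 then 1 else (real n * real n - real n + 1) / (real n * real (n + 1)) * singular_coeff n)"

lemma singular_coeff_pos: "n > 0 \<Longrightarrow> singular_coeff n > 0"
proof (induction n)
  case (Suc n)
  have "real n * real n - real n + 1 = (real n - 1 / 2)^2 + 3 / 4" by (simp add: power2_eq_square field_simps)
  moreover have "(real n - 1 / 2)^2 \<ge> 0" by simp
  ultimately have "real n * real n - real n + 1 > 0" by linarith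
  then show ?case using Suc by (cases "n = 0") auto
qed simp

lemma singular_coeff_le: "singular_coeff n \<le> 1"
proof (induction n)
  case (Suc n)
  show ?case
  proof (cases "n = 0")
    case False
    then have n: "real n \<ge> 1" "real n * real (n + 1) > 0" by simp_all
    have "(real n * real n - real n + 1) / (real n * real (n + 1)) \<le> 1"
      unfolding divide_le_eq_1_pos[OF n(2)] using n(1) by (simp add: algebra_simps)
    moreover have "0 \<le> singular_coeff n" using singular_coeff_pos[of n] False by simp
    ultimately have "(real n * real n - real n + 1) / (real n * real (n + 1)) * singular_coeff n \<le> 1 * 1"
      using Suc by (intro mult_mono) auto
    then show ?thesis using False by simp
  qed simp
qed simp

definition sing_sol :: "complex \<Rightarrow> complex" where "sing_sol z = (\<Sum>n. of_real (singular_coeff n) * z ^ n)"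
definition sing_sol' :: "complex \<Rightarrow> complex" where "sing_sol' z = (\<Sum>n. diffs (\<lambda>n. of_real (singular_coeff n)) n * z ^ n)"

lemma sing_sol_deriv:
  assumes "norm z < 1"
  shows "(sing_sol has_field_derivative sing_sol' z) (at z)"
    "z \<noteq> 0 \<Longrightarrow> (sing_sol' has_field_derivative 1 / (z * (1 - z)) * sing_sol z) (at z)"
proof -
  let ?c = "\<lambda>n. of_real (singular_coeff n) :: complex"
  have cb: "norm (?c n) \<le> 1 ^ n" for n
    using singular_coeff_pos[of n] singular_coeff_le[of n] by (cases "n = 0") auto
  have rec: "0 * (of_nat (n + 2) * of_nat (n + 1) * ?c (n + 2)) + 1 * (of_nat (n + 1) * of_nat n * ?c (n + 1))
      - (of_nat n * of_nat n - of_nat n) * ?c n = ?c n" for n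
  proof (cases "n = 0")
    case False
    then have nz: "real n \<noteq> 0" "real (n + 1) \<noteq> 0" by auto
    have "singular_coeff (n + 1) = (real n * real n - real n + 1) / (real n * real (n + 1)) * singular_coeff n"
      using False by simp
    moreover have "b * a * (X / (a * b) * c) = X * c" if "a \<noteq> 0" "b \<noteq> 0" for a b c X :: real using that by simp
    ultimately have "real (n + 1) * real n * singular_coeff (n + 1) = (real n * real n - real n + 1) * singular_coeff n"
      using nz by (simp only:)
    then have "complex_of_real (real (n + 1) * real n * singular_coeff (n + 1)) = of_real ((real n * real n - real n + 1) * singular_coeff n)"
      by (simp only:)
    then have "of_nat (n + 1) * of_nat n * ?c (n + 1) = (of_nat n * of_nat n - of_nat n + 1) * ?c n"
      by (simp only: of_real_mult of_real_add of_real_diff of_real_of_nat_eq of_real_1)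
    then show ?thesis by (simp only: algebra_simps) simp
  qed simp
  have z: "norm z < 1 / 1" using assms by simp
  note ps = power_series_solution[OF zero_less_one cb rec z, folded sing_sol_def sing_sol'_def]
  show "(sing_sol has_field_derivative sing_sol' z) (at z)"
    using ps(1) unfolding sing_sol_def[abs_def] sing_sol'_def .
  obtain v2 where v2: "(sing_sol' has_field_derivative v2) (at z)" "(0 + 1 * z - z^2) * v2 = sing_sol z"
    using ps(2) unfolding sing_sol_def sing_sol'_def[abs_def] by blast
  show "(sing_sol' has_field_derivative 1 / (z * (1 - z)) * sing_sol z) (at z)" if "z \<noteq> 0"
  proof -
    have "z \<noteq> 1" using assms by auto
    then have "v2 = 1 / (z * (1 - z)) * sing_sol z"
      using v2(2) that by (simp add: field_simps power2_eq_square)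
    then show ?thesis using v2(1) by simp
  qed
qed

lemma sing_sol_half: "sing_sol (1 / 2) \<noteq> 0" "sing_sol' (1 / 2) \<noteq> 0"
proof -
  have pos: "complex_of_real (\<Sum>n. a n * (1 / 2) ^ n) \<noteq> 0 \<and> (\<Sum>n. of_real (a n) * (1 / 2 :: complex) ^ n) = of_real (\<Sum>n. a n * (1 / 2) ^ n)"
    if a: "\<And>n. a n \<ge> 0" "a i > 0" and s: "summable (\<lambda>n. of_real (a n) * (1 / 2 :: complex) ^ n)" for a :: "nat \<Rightarrow> real" and i
  proof -
    have eq: "of_real (a n) * (1 / 2 :: complex) ^ n = of_real (a n * (1 / 2) ^ n)" for n by simp
    have "summable (\<lambda>n. complex_of_real (a n * (1 / 2) ^ n))" using s unfolding eq .
    then have s': "summable (\<lambda>n. a n * (1 / 2) ^ n)" by (simp only: summable_of_real_iff)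
    then have "(\<Sum>n. a n * (1 / 2) ^ n) > 0" using a by (intro suminf_pos2[of _ i]) auto
    moreover have "(\<Sum>n. of_real (a n) * (1 / 2 :: complex) ^ n) = of_real (\<Sum>n. a n * (1 / 2) ^ n)"
      unfolding eq by (rule suminf_of_real[OF s', symmetric])
    ultimately show ?thesis by simp
  qed
  have nn: "singular_coeff n \<ge> 0" for n using singular_coeff_pos[of n] by (cases "n = 0") auto
  have sm: "summable (\<lambda>n. of_real (singular_coeff n) * (x::complex) ^ n)" if "norm x < 1" for x
  proof (rule summable_comparison_test'[of "\<lambda>n. norm x ^ n" 0])
    show "summable (\<lambda>n. norm x ^ n)" using that by (intro summable_geometric) auto
    show "norm (of_real (singular_coeff n) * x ^ n) \<le> norm x ^ n" for n
      using mult_right_mono[OF singular_coeff_le[of n], of "norm x ^ n"] nn[of n] by (simp add: norm_mult norm_power)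
  qed
  show "sing_sol (1 / 2) \<noteq> 0"
    using pos[of singular_coeff 1] nn sm[of "1 / 2"] by (simp add: sing_sol_def norm_divide)
  have d: "diffs (\<lambda>n. complex_of_real (singular_coeff n)) = (\<lambda>n. of_real (diffs singular_coeff n))"
    by (simp add: diffs_def fun_eq_iff)
  have "summable (\<lambda>n. diffs (\<lambda>n. complex_of_real (singular_coeff n)) n * (1 / 2) ^ n)"
    by (rule termdiff_converges[OF _ sm]) (simp_all add: norm_divide)
  then show "sing_sol' (1 / 2) \<noteq> 0"
    using pos[of "diffs singular_coeff" 0] nn unfolding sing_sol'_def d by (simp add: diffs_def)
qed

lemma sing_sol_expand: "\<exists>m. isCont m 0 \<and> m 0 = 1 / 2 \<and> (\<forall>z. norm z < 1 \<longrightarrow> sing_sol z = z * (1 + z * m z))"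
proof -
  have nn: "singular_coeff n \<ge> 0" for n using singular_coeff_pos[of n] by (cases "n = 0") auto
  have sm: "summable (\<lambda>n. of_real (singular_coeff (n + k)) * (z::complex) ^ n)" if "norm z < 1" for z k
  proof (rule summable_comparison_test'[of "\<lambda>n. norm z ^ n" 0])
    show "summable (\<lambda>n. norm z ^ n)" using that by (intro summable_geometric) auto
    show "norm (of_real (singular_coeff (n + k)) * z ^ n) \<le> norm z ^ n" for n
      using mult_right_mono[OF singular_coeff_le[of "n + k"], of "norm z ^ n"] nn[of "n + k"] by (simp add: norm_mult norm_power)
  qed
  define m where "m z = (\<Sum>n. of_real (singular_coeff (n + 2)) * (z::complex) ^ n)" for z
  have "isCont m 0"
    unfolding m_def[abs_def] by (rule isCont_powser[where K = "1 / 2", OF sm]) (simp_all add: norm_divide)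
  moreover have "m 0 = 1 / 2"
    using powser_zero[of "\<lambda>n. complex_of_real (singular_coeff (n + 2))"] by (simp add: m_def numeral_2_eq_2)
  moreover have "sing_sol z = z * (1 + z * m z)" if z: "norm z < 1" for z
  proof -
    have s0: "summable (\<lambda>n. of_real (singular_coeff n) * z ^ n)" using sm[OF z, of 0] by simp
    have "sing_sol z = (\<Sum>n. of_real (singular_coeff (n + 2)) * z ^ (n + 2)) + (\<Sum>i<2. of_real (singular_coeff i) * z ^ i)"
      unfolding sing_sol_def by (rule suminf_split_initial_segment[OF s0])
    also have "(\<Sum>n. of_real (singular_coeff (n + 2)) * z ^ (n + 2)) = z^2 * m z"
      unfolding m_def suminf_mult[OF sm[OF z], symmetric]
      by (rule arg_cong[of _ _ suminf]) (simp add: fun_eq_iff power_add mult_ac power2_eq_square)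
    also have "(\<Sum>i<2. of_real (singular_coeff i) * z ^ i) = z" by (simp add: numeral_2_eq_2)
    finally show ?thesis by (simp add: algebra_simps power2_eq_square)
  qed
  ultimately show ?thesis by blast
qed

text \<open>The expansion \<open>1 / v^2 = 1 / z^2 - 1 / z + ...\<close> has residue -1, the source
  of the logarithm. It is stated after multiplication by \<open>z\<close>, as
  \<open>dz = z dw\<close> in the coordinate \<open>z = exp w\<close>.\<close>

lemma sing_sol_near_0:
  "((\<lambda>z. z / (sing_sol z * sing_sol z) - 1 / z) \<longlongrightarrow> - 1) (at 0)"
  "\<exists>\<delta>>0. \<delta> \<le> 1 \<and> (\<forall>z. z \<noteq> 0 \<longrightarrow> norm z < \<delta> \<longrightarrow> sing_sol z \<noteq> 0)"
proof -
  obtain m where m: "isCont m 0" "m 0 = 1 / 2" "\<And>z. norm z < 1 \<Longrightarrow> sing_sol z = z * (1 + z * m z)"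
    using sing_sol_expand by blast
  have m0: "(m \<longlongrightarrow> 1 / 2) (at 0)" using m(1,2) by (simp add: isCont_def)
  have k: "((\<lambda>z. 1 + z * m z) \<longlongrightarrow> 1 + 0 * (1 / 2)) (at 0)" by (intro tendsto_intros m0)
  then have "\<forall>\<^sub>F z in at 0. 1 + z * m z \<noteq> 0" by (rule tendsto_imp_eventually_ne) simp
  then obtain r where r: "r > 0" "\<And>z. z \<noteq> 0 \<Longrightarrow> dist z 0 < r \<Longrightarrow> 1 + z * m z \<noteq> 0" unfolding eventually_at by blast
  have ne: "1 + z * m z \<noteq> 0 \<and> sing_sol z = z * (1 + z * m z)" if "z \<noteq> 0" "norm z < min r 1" for z
    using r(2)[of z] m(3)[of z] that by simp
  show "\<exists>\<delta>>0. \<delta> \<le> 1 \<and> (\<forall>z. z \<noteq> 0 \<longrightarrow> norm z < \<delta> \<longrightarrow> sing_sol z \<noteq> 0)"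
    by (rule exI[of _ "min r 1"]) (use ne r(1) in simp)
  have "((\<lambda>z. - (2 * m z + z * (m z * m z)) / ((1 + z * m z) * (1 + z * m z))) \<longlongrightarrow>
      - (2 * (1 / 2) + 0 * (1 / 2 * (1 / 2))) / ((1 + 0 * (1 / 2)) * (1 + 0 * (1 / 2)))) (at 0)"
    by (intro tendsto_intros m0) simp
  then have lim: "((\<lambda>z. - (2 * m z + z * (m z * m z)) / ((1 + z * m z) * (1 + z * m z))) \<longlongrightarrow> - 1) (at 0)" by simp
  have eq: "z / (sing_sol z * sing_sol z) - 1 / z = - (2 * m z + z * (m z * m z)) / ((1 + z * m z) * (1 + z * m z))"
    if z: "z \<noteq> 0" "norm z < min r 1" for z
  proof -
    define j where "j = 1 + z * m z"
    have j: "j \<noteq> 0" "sing_sol z = z * j" using ne[OF z] by (auto simp: j_def)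
    have mz: "m z = (j - 1) / z" using z(1) by (simp add: j_def)
    show ?thesis unfolding j(2) j_def[symmetric] using z(1) j(1)
      by (simp add: mz divide_simps) (simp add: algebra_simps)
  qed
  show "((\<lambda>z. z / (sing_sol z * sing_sol z) - 1 / z) \<longlongrightarrow> - 1) (at 0)"
  proof (rule Lim_transform_eventually[OF lim])
    show "\<forall>\<^sub>F z in at 0. - (2 * m z + z * (m z * m z)) / ((1 + z * m z) * (1 + z * m z)) = z / (sing_sol z * sing_sol z) - 1 / z"
      unfolding eventually_at using eq r(1) by (intro exI[of _ "min r 1"]) auto
  qed
qed

text \<open>The parametrization \<open>x = exp w\<close> resp. \<open>x = 1 - exp w\<close> of the punctured neighbourhood of a
  singular point. The developing map \<open>T\<close> has the form \<open>-\<epsilon> / z - \<epsilon> log z + \<dots>\<close> with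
  \<open>z = exp w\<close>, whence the parabolic monodromy.\<close>

lemma singular_parametrization:
  assumes \<epsilon>: "\<epsilon> = 1 \<or> \<epsilon> = (- 1 :: complex)"
  shows "\<exists>\<delta> T. 0 < \<delta> \<and> \<delta> \<le> 1 \<and> (\<forall>w. Re w < ln \<delta> \<longrightarrow> sing_sol (exp w) \<noteq> 0 \<and> T (w + 2 * of_real pi * \<i>) = T w - 2 * of_real pi * \<i> * \<epsilon>) \<and>
    parametrization (rat_eval 1 full_den) {w. Re w < ln \<delta>} (\<lambda>w. (1 - \<epsilon>) / 2 + \<epsilon> * exp w) (\<lambda>w. \<epsilon> * exp w) T
      (\<lambda>w. sing_sol (exp w) * sing_sol (exp w)) (\<lambda>w. 2 * sing_sol (exp w) * (\<epsilon> * sing_sol' (exp w)))"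
proof -
  obtain \<delta> where \<delta>: "\<delta> > 0" "\<delta> \<le> 1" "\<And>z. z \<noteq> 0 \<Longrightarrow> norm z < \<delta> \<Longrightarrow> sing_sol z \<noteq> 0"
    using sing_sol_near_0(2) by blast
  have nz: "norm (exp w) < \<delta>" "norm (exp w) < 1" "sing_sol (exp w) \<noteq> 0" if "Re w < ln \<delta>" for w
  proof -
    have "exp (Re w) < \<delta>" using that \<delta>(1) by (metis exp_less_cancel_iff exp_ln)
    then show 1: "norm (exp w) < \<delta>" by simp
    then show "norm (exp w) < 1" using \<delta>(2) by linarith
    show "sing_sol (exp w) \<noteq> 0" by (rule \<delta>(3)[OF _ 1]) simp
  qed
  let ?e = "\<lambda>w. (1 - \<epsilon>) / 2 + \<epsilon> * exp w"
  have q: "rat_eval 1 full_den (?e w) = 1 / (exp w * (1 - exp w))" for w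
    using \<epsilon> by (auto simp: full_den mult.commute)
  have e2: "\<epsilon> * \<epsilon> = 1" "\<epsilon> \<noteq> 0" using \<epsilon> by auto
  have "\<exists>T. parametrization (rat_eval 1 full_den) {w. Re w < ln \<delta>} ?e (\<lambda>w. \<epsilon> * exp w) T
      (\<lambda>w. sing_sol (exp w) * sing_sol (exp w)) (\<lambda>w. 2 * sing_sol (exp w) * (\<epsilon> * sing_sol' (exp w)))"
  proof (rule solution_parametrization)
    show "convex {w. Re w < ln \<delta>}" "open {w. Re w < ln \<delta>}" by (rule convex_halfspace_Re_lt open_halfspace_Re_lt)+
    fix w assume "w \<in> {w. Re w < ln \<delta>}"
    then have w: "Re w < ln \<delta>" by simp
    show "sing_sol (exp w) \<noteq> 0" by (rule nz(3)[OF w])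
    have "((\<lambda>w. sing_sol (exp w)) has_field_derivative sing_sol' (exp w) * exp w) (at w)"
      by (rule DERIV_chain2[where g = exp and x = w, OF sing_sol_deriv(1)[OF nz(2)[OF w]] DERIV_exp])
    moreover have "sing_sol' (exp w) * exp w = \<epsilon> * sing_sol' (exp w) * (\<epsilon> * exp w)" using e2(1) by algebra
    ultimately show "((\<lambda>w. sing_sol (exp w)) has_field_derivative \<epsilon> * sing_sol' (exp w) * (\<epsilon> * exp w)) (at w)" by simp
    have "((\<lambda>w. sing_sol' (exp w)) has_field_derivative 1 / (exp w * (1 - exp w)) * sing_sol (exp w) * exp w) (at w)"
      by (rule DERIV_chain2[where g = exp and x = w, OF sing_sol_deriv(2)[OF nz(2)[OF w] exp_not_eq_zero] DERIV_exp])
    from DERIV_cmult[OF this, of \<epsilon>]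
    show "((\<lambda>w. \<epsilon> * sing_sol' (exp w)) has_field_derivative rat_eval 1 full_den (?e w) * sing_sol (exp w) * (\<epsilon> * exp w)) (at w)"
      unfolding q by (rule DERIV_cong) (simp only: mult_ac)
  qed (use e2 in \<open>auto intro!: derivative_eq_intros holomorphic_intros\<close>)
  then obtain T where T: "parametrization (rat_eval 1 full_den) {w. Re w < ln \<delta>} ?e (\<lambda>w. \<epsilon> * exp w) T
      (\<lambda>w. sing_sol (exp w) * sing_sol (exp w)) (\<lambda>w. 2 * sing_sol (exp w) * (\<epsilon> * sing_sol' (exp w)))" ..
  have per: "exp (w + 2 * of_real pi * \<i>) = exp w" for w using exp_shift[of w 1] by simp
  have shift: "T (w + 2 * of_real pi * \<i>) = T w - 2 * of_real pi * \<i> * \<epsilon>" if w: "Re w < ln \<delta>" for w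
  proof -
    let ?F = "\<lambda>z. z / (sing_sol z * sing_sol z) - 1 / z"
    have "T (w + 2 * of_real pi * \<i>) + \<epsilon> / exp (w + 2 * of_real pi * \<i>) = (T w + \<epsilon> / exp w) + 2 * of_real pi * \<i> * (\<epsilon> * - 1)"
    proof (rule half_plane_period[where K = "\<lambda>w. T w + \<epsilon> / exp w" and g = "\<lambda>w. \<epsilon> * ?F (exp w)", OF _ _ _ w])
      fix z :: complex assume z: "Re z < ln \<delta>"
      have "(T has_field_derivative \<epsilon> * exp z / (sing_sol (exp z) * sing_sol (exp z))) (at z)"
        using T z unfolding parametrization_def by blast
      moreover have "((\<lambda>w. \<epsilon> / exp w) has_field_derivative - \<epsilon> / exp z) (at z)"
        by (auto intro!: derivative_eq_intros)
      ultimately show "((\<lambda>w. T w + \<epsilon> / exp w) has_field_derivative \<epsilon> * ?F (exp z)) (at z)"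
        by (rule DERIV_cong[OF DERIV_add]) (simp add: algebra_simps)
      show "\<epsilon> * ?F (exp (z + 2 * of_real pi * \<i>)) = \<epsilon> * ?F (exp z)" by (simp only: per)
    next
      show "\<exists>M. \<forall>w. Re w < M \<longrightarrow> norm (\<epsilon> * ?F (exp w) - \<epsilon> * - 1) < r" if "r > 0" for r
        by (rule small_at_left[where f = "\<lambda>z. \<epsilon> * ?F z", OF _ that]) (intro tendsto_mult tendsto_const sing_sol_near_0(1))
    qed
    then show ?thesis unfolding per by simp
  qed
  show ?thesis by (intro exI[of _ \<delta>] exI[of _ T] conjI allI impI) (use \<delta> T shift nz in auto)
qed

text \<open>The matrix from the singular chart and \<open>P\<close> have the same second row up to
  sign, hence differ by an upper triangular matrix with equal diagonal entries. This commutes with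
  the local monodromy, so the same matrix occurs for \<open>P\<close>.\<close>

lemma singular_monodromy:
  assumes \<epsilon>: "\<epsilon> = 1 \<or> \<epsilon> = (- 1 :: complex)"
    and R: "reduction 1 full_den {A::complex^2^2. det A = 1} Z" and Z: "\<And>x P. (x, P) \<in> Z \<longleftrightarrow> x \<noteq> 0 \<and> x \<noteq> 1 \<and> det P = 1"
    and sol: "is_solution (rat_eval 1 full_den) (ball 0 1 \<inter> ball 1 1) P"
    and row: "\<And>y. P y $ 2 $ 1 = \<epsilon> * sing_sol' ((1 - \<epsilon>) / 2 + \<epsilon> * y)" "\<And>y. P y $ 2 $ 2 = sing_sol ((1 - \<epsilon>) / 2 + \<epsilon> * y)"
  shows "\<exists>u. u \<noteq> 0 \<and> mat2 1 u 0 1 \<in> monodromy 1 full_den (1 / 2, P (1 / 2))"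
proof -
  obtain \<delta> T where \<delta>: "0 < \<delta>" "\<delta> \<le> 1" and sT: "\<And>w. Re w < ln \<delta> \<Longrightarrow> sing_sol (exp w) \<noteq> 0"
      "\<And>w. Re w < ln \<delta> \<Longrightarrow> T (w + 2 * of_real pi * \<i>) = T w - 2 * of_real pi * \<i> * \<epsilon>"
    and T: "parametrization (rat_eval 1 full_den) {w. Re w < ln \<delta>} (\<lambda>w. (1 - \<epsilon>) / 2 + \<epsilon> * exp w) (\<lambda>w. \<epsilon> * exp w) T
      (\<lambda>w. sing_sol (exp w) * sing_sol (exp w)) (\<lambda>w. 2 * sing_sol (exp w) * (\<epsilon> * sing_sol' (exp w)))"
    using singular_parametrization[OF \<epsilon>] by blast
  define p where "p = 2 * of_real pi * \<i>"
  have per: "exp (w + p) = exp w" for w using exp_shift[of w 1] by (simp add: p_def)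
  \<comment> \<open>A real point of the punctured disc; it makes \<open>y\<close> real between 0 and
    1, inside the lens on which \<open>P\<close> is defined.\<close>
  define w0 where "w0 = complex_of_real (ln (\<delta> / 2))"
  have w0: "exp w0 = of_real (\<delta> / 2)" using \<delta>(1) by (simp add: w0_def exp_of_real)
  have "ln (\<delta> / 2) < ln \<delta>" using \<delta>(1) by simp
  then have w0S: "Re w0 < ln \<delta>" "Re (w0 + p) < ln \<delta>" by (simp_all add: w0_def p_def)
  define s s' where "s = sing_sol (exp w0)" and "s' = sing_sol' (exp w0)"
  have s0: "s \<noteq> 0" using sT(1)[OF w0S(1)] by (simp add: s_def)
  define y where "y = (1 - \<epsilon>) / 2 + \<epsilon> * exp w0"
  have yr: "y = of_real (\<delta> / 2) \<or> y = of_real (1 - \<delta> / 2)" using \<epsilon> by (auto simp: y_def w0)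
  then have "\<exists>t. y = of_real t \<and> 0 < t \<and> t < 1"
  proof
    assume "y = of_real (\<delta> / 2)"
    then show ?thesis using \<delta> by (intro exI[of _ "\<delta> / 2"]) auto
  next
    assume "y = of_real (1 - \<delta> / 2)"
    then show ?thesis using \<delta> by (intro exI[of _ "1 - \<delta> / 2"]) auto
  qed
  then obtain t where t: "y = of_real t" "0 < t" "t < 1" by blast
  have lens: "of_real r \<in> ball 0 1 \<inter> (ball 1 1 :: complex set)" if "0 < r" "r < 1" for r
  proof -
    have "1 - complex_of_real r = of_real (1 - r)" by simp
    then have "norm (1 - complex_of_real r) = \<bar>1 - r\<bar>" by (metis norm_of_real)
    then show ?thesis using that by (simp add: dist_norm)
  qed
  have yL: "y \<in> ball 0 1 \<inter> ball 1 1" unfolding t(1) by (rule lens[OF t(2,3)])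
  have hL: "1 / 2 \<in> ball 0 1 \<inter> (ball 1 1 :: complex set)" using lens[of "1 / 2"] by simp
  have yy: "(1 - \<epsilon>) / 2 + \<epsilon> * y = exp w0" using \<epsilon> by (auto simp: y_def)
  have dP: "det (P y) = 1" by (rule is_solutionD(1)[OF sol yL])
  have Py: "P y $ 2 $ 1 = \<epsilon> * s'" "P y $ 2 $ 2 = s" unfolding row yy by (simp_all add: s_def s'_def)
  define R0 where "R0 = param_mat (T w0) (s * s) (2 * s * (\<epsilon> * s'))"
  define R1 where "R1 = param_mat (T (w0 + p)) (s * s) (2 * s * (\<epsilon> * s'))"
  have ss: "s * s \<noteq> 0" using s0 by simp
  have dR0: "det R0 = 1" unfolding R0_def by (rule det_param_mat[OF ss])
  note pp = param_mat_prods(3,4)[OF ss, of "T w0" "2 * s * (\<epsilon> * s')", folded R0_def]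
  have "R0 $ 2 $ 2 = s \<or> R0 $ 2 $ 2 = - s" using pp(1) by (metis square_eq_iff)
  then have "\<exists>\<sigma>. R0 $ 2 $ 2 = \<sigma> * s \<and> \<sigma> * \<sigma> = 1"
  proof
    assume "R0 $ 2 $ 2 = s"
    then show ?thesis by (intro exI[of _ 1]) simp
  next
    assume "R0 $ 2 $ 2 = - s"
    then show ?thesis by (intro exI[of _ "- 1"]) simp
  qed
  then obtain \<sigma> where \<sigma>: "R0 $ 2 $ 2 = \<sigma> * s" "\<sigma> * \<sigma> = 1" by blast
  have "R0 $ 2 $ 1 * (\<sigma> * s) = s * (\<epsilon> * s')" using pp(2) unfolding \<sigma>(1) by simp
  then have "s * R0 $ 2 $ 1 = s * (\<sigma> * (\<epsilon> * s'))" using \<sigma>(2) by algebra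
  then have \<sigma>': "R0 $ 2 $ 1 = \<sigma> * (\<epsilon> * s')" using s0 by simp
  define g where "g = R0 ** adj2 (P y)"
  have dg: "det g = 1" unfolding g_def det_mul det_adj2 using dR0 dP by simp
  have gP: "g ** P y = R0" unfolding g_def by (rule mult_adj2_cancel(4)[OF dP])
  obtain b where g: "g = mat2 \<sigma> b 0 \<sigma>"
  proof -
    obtain a b c d where P: "P y = mat2 a b c d" by (rule mat2_cases)
    obtain a' b' c' d' where R0': "R0 = mat2 a' b' c' d'" by (rule mat2_cases)
    have cd: "c' = \<sigma> * c" "d' = \<sigma> * d" using \<sigma>(1) \<sigma>' Py by (simp_all add: P R0')
    have 1: "a * d - b * c = 1" using dP by (simp add: P)
    have "\<sigma> * d * a - \<sigma> * c * b = \<sigma>" using 1 by algebra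
    then have "g $ 2 $ 1 = 0" "g $ 2 $ 2 = \<sigma>" unfolding g_def P R0' cd by simp_all
    moreover obtain g1 g2 g3 g4 where "g = mat2 g1 g2 g3 g4" by (rule mat2_cases)
    ultimately have g': "g = mat2 g1 g2 0 \<sigma>" by simp
    then have "g1 * \<sigma> = 1" using dg by simp
    then have "g1 = \<sigma>" using \<sigma>(2) by algebra
    then show ?thesis using g' that by simp
  qed
  define u where "u = - (p * \<epsilon>)"
  have u0: "u \<noteq> 0" using \<epsilon> by (auto simp: u_def p_def)
  have y01: "y \<noteq> 0" "y \<noteq> 1" using t by auto
  have "mat2 1 u 0 1 \<in> monodromy 1 full_den (y, R0)"
  proof (rule monodromyI(1)[OF R])
    show "det (mat2 1 u 0 1) = 1" by simp
    show "(y, mat2 1 u 0 1 ** R0) \<in> Z" unfolding Z det_mul using y01 dR0 by simp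
    show "R1 = mat2 1 u 0 1 ** R0 \<or> R1 = - (mat2 1 u 0 1 ** R0)"
      unfolding R0_def R1_def using ss sT(2)[OF w0S(1)]
      by (intro param_mat_moebius) (simp_all add: u_def p_def)
    have "reach 1 full_den ((1 - \<epsilon>) / 2 + \<epsilon> * exp w0, R0) ((1 - \<epsilon>) / 2 + \<epsilon> * exp (w0 + p), param_mat (T (w0 + p))
       (sing_sol (exp (w0 + p)) * sing_sol (exp (w0 + p))) (2 * sing_sol (exp (w0 + p)) * (\<epsilon> * sing_sol' (exp (w0 + p)))))"
      unfolding R0_def s_def s'_def
    proof (rule parametrization_reach[OF T])
      fix w assume "w \<in> {w. Re w < ln \<delta>}"
      then have "exp (Re w) < \<delta>" using \<delta>(1) by (metis exp_less_cancel_iff exp_ln mem_Collect_eq)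
      then have "exp w \<noteq> 1" using \<delta>(2) by (metis norm_exp_eq_Re norm_one not_le)
      then show "poly full_den ((1 - \<epsilon>) / 2 + \<epsilon> * exp w) \<noteq> 0" using \<epsilon> by (auto simp: full_den)
    qed (use w0S in auto)
    then show "reach 1 full_den (y, R0) (y, R1)" unfolding per R1_def s_def[symmetric] s'_def[symmetric] y_def[symmetric] .
  qed
  then have "adj2 g ** mat2 1 u 0 1 ** g \<in> monodromy 1 full_den (y, P y)"
    unfolding gP[symmetric] using dg by (rule monodromy_conj)
  also have "adj2 g ** mat2 1 u 0 1 ** g = mat2 1 u 0 1"
  proof -
    have "\<sigma> * b + \<sigma> * (\<sigma> * u - b) = u" using \<sigma>(2) by algebra
    then show ?thesis unfolding g using \<sigma>(2) by (simp add: mult_ac)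
  qed
  finally have my: "mat2 1 u 0 1 \<in> monodromy 1 full_den (y, P y)" .
  have "step 1 full_den (1 / 2, P (1 / 2)) (y, P y)"
    unfolding step_def
  proof (intro exI[of _ "ball 0 1 \<inter> ball 1 1"] exI[of _ P] conjI)
    show "connected (ball 0 1 \<inter> (ball 1 1 :: complex set))" by (intro convex_connected convex_Int convex_ball)
    show "ball 0 1 \<inter> ball 1 1 \<subseteq> {x. poly full_den x \<noteq> 0}" by (auto simp: full_den)
  qed (use sol yL hL in auto)
  then show ?thesis using monodromy_reach[OF r_into_rtranclp my] u0 by blast
qed

text \<open>In the basis \<open>sing_sol (1 - x)\<close>, \<open>sing_sol x\<close>, suitably
  normalized, the loop around 0 fixes the second solution and the loop around 1 the first. They give
  an upper and a lower unipotent matrix, to which \<open>SL2_density\<close> applies.\<close>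

lemma SL2_realization:
  assumes "alg_group {A::complex^2^2. det A = 1}"
  shows "\<exists>n d Z x P. reduction n d {A::complex^2^2. det A = 1} Z \<and> (x, P) \<in> Z \<and> {A::complex^2^2. det A = 1} \<subseteq> zariski_closed mat_coords hull monodromy n d (x, P)"
proof -
  define Z where "Z = {(x :: complex, P :: complex^2^2). x \<noteq> 0 \<and> x \<noteq> 1 \<and> det P = 1}"
  have Zm: "(x, P) \<in> Z \<longleftrightarrow> x \<noteq> 0 \<and> x \<noteq> 1 \<and> det P = 1" for x P by (simp add: Z_def)
  have R: "reduction 1 full_den {A::complex^2^2. det A = 1} Z"
  proof (rule reductionI[OF _ assms])
    show "full_den \<noteq> 0" by (simp add: full_den_def)
    show "poly full_den x \<noteq> 0 \<and> det P = 1" if "(x, P) \<in> Z" for x P using that by (simp add: Zm full_den)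
    show "(x, P') \<in> Z \<longleftrightarrow> P' ** adj2 P \<in> {A::complex^2^2. det A = 1}" if "(x, P) \<in> Z" "det P' = 1" for x P P'
      using that by (simp add: Zm det_mul det_adj2)
    show "\<exists>S e e' T \<rho> b s. parametrization (rat_eval 1 full_den) S e e' T \<rho> b \<and> s \<in> S \<and> e s = x \<and>
      (\<forall>s\<in>S. (e s, param_mat (T s) (\<rho> s) (b s)) \<in> Z)" if x: "poly full_den x \<noteq> 0" for x
    proof -
      obtain S e e' T \<rho> b where p: "parametrization (rat_eval 1 full_den) S e e' T \<rho> b" "x \<in> S" "e x = x" "\<forall>s\<in>S. e s \<noteq> 0 \<and> e s \<noteq> 1"
        using regular_parametrization[of x] x by (auto simp: full_den)
      have "(e s, param_mat (T s) (\<rho> s) (b s)) \<in> Z" if "s \<in> S" for s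
      proof -
        have "\<rho> s \<noteq> 0" using p(1) that unfolding parametrization_def by blast
        from det_param_mat[OF this] show ?thesis using p(4) that by (simp add: Zm)
      qed
      then show ?thesis using p(1-3) by blast
    qed
    show "\<exists>E\<subseteq>polyfun even_coords. \<forall>x P. poly full_den x \<noteq> 0 \<longrightarrow> det P = 1 \<longrightarrow> ((x, P) \<in> Z \<longleftrightarrow> (\<forall>f\<in>E. f (x, P) = 0))"
      by (intro exI[of _ "{}"]) (simp add: Zm full_den)
  qed
  \<comment> \<open>The Wronskian of the two solutions, evaluated at 1/2, where its two terms
    coincide.\<close>
  define \<kappa> where "\<kappa> = 2 * sing_sol (1 / 2) * sing_sol' (1 / 2)"
  have \<kappa>: "\<kappa> \<noteq> 0" using sing_sol_half by (simp add: \<kappa>_def)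
  define A where "A x = mat2 (sing_sol' (1 - x) / \<kappa>) (- sing_sol (1 - x) / \<kappa>) (sing_sol' x) (sing_sol x)" for x
  let ?L = "ball 0 1 \<inter> (ball 1 1 :: complex set)"
  have A1: "is_solution (rat_eval 1 full_den) ?L A"
  proof -
    have D: "(sing_sol has_field_derivative sing_sol' x) (at x)"
      "(sing_sol' has_field_derivative rat_eval 1 full_den x * sing_sol x) (at x)"
      "((\<lambda>x. sing_sol (1 - x)) has_field_derivative - sing_sol' (1 - x)) (at x)"
      "((\<lambda>x. sing_sol' (1 - x)) has_field_derivative - (rat_eval 1 full_den x * sing_sol (1 - x))) (at x)" if x: "x \<in> ?L" for x
    proof -
      have n: "norm x < 1" "norm (1 - x) < 1" "x \<noteq> 0" "1 - x \<noteq> 0" using x by (auto simp: dist_norm)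
      show "(sing_sol has_field_derivative sing_sol' x) (at x)" by (rule sing_sol_deriv(1)[OF n(1)])
      show "(sing_sol' has_field_derivative rat_eval 1 full_den x * sing_sol x) (at x)"
        unfolding full_den by (rule sing_sol_deriv(2)[OF n(1,3)])
      have d: "((\<lambda>x. 1 - x) has_field_derivative - 1) (at x)" by (auto intro!: derivative_eq_intros)
      show "((\<lambda>x. sing_sol (1 - x)) has_field_derivative - sing_sol' (1 - x)) (at x)"
        using DERIV_chain2[where g = "\<lambda>x. 1 - x" and x = x, OF sing_sol_deriv(1)[OF n(2)] d] by simp
      have "1 / ((1 - x) * (1 - (1 - x))) * sing_sol (1 - x) * - 1 = - (rat_eval 1 full_den x * sing_sol (1 - x))"
        by (simp add: full_den mult.commute)
      then show "((\<lambda>x. sing_sol' (1 - x)) has_field_derivative - (rat_eval 1 full_den x * sing_sol (1 - x))) (at x)"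
        using DERIV_chain2[where g = "\<lambda>x. 1 - x" and x = x, OF sing_sol_deriv(2)[OF n(2,4)] d] by simp
    qed
    have "\<exists>c. \<forall>x\<in>?L. sing_sol' (1 - x) * sing_sol x + sing_sol (1 - x) * sing_sol' x = c"
    proof (intro has_field_derivative_zero_constant convex_Int convex_ball)
      fix x assume x: "x \<in> ?L"
      have "((\<lambda>x. sing_sol' (1 - x) * sing_sol x + sing_sol (1 - x) * sing_sol' x) has_field_derivative 0) (at x)"
        by (rule DERIV_cong[OF DERIV_add[OF DERIV_mult[OF D(4,1)] DERIV_mult[OF D(3,2)]]]) (use x in \<open>simp_all add: algebra_simps\<close>)
      then show "((\<lambda>x. sing_sol' (1 - x) * sing_sol x + sing_sol (1 - x) * sing_sol' x) has_field_derivative 0) (at x within ?L)"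
        by (rule has_field_derivative_at_within)
    qed
    then obtain c where c: "\<And>x. x \<in> ?L \<Longrightarrow> sing_sol' (1 - x) * sing_sol x + sing_sol (1 - x) * sing_sol' x = c" by blast
    have "(1 / 2 :: complex) \<in> ?L" by (simp add: dist_norm norm_divide)
    from c[OF this] have "c = \<kappa>" by (simp add: \<kappa>_def mult_ac)
    then have det: "det (A x) = 1" if "x \<in> ?L" for x
    proof -
      have "det (A x) = (sing_sol' (1 - x) * sing_sol x + sing_sol (1 - x) * sing_sol' x) / \<kappa>"
        by (simp add: A_def add_divide_distrib)
      then show ?thesis using c[OF that] \<open>c = \<kappa>\<close> \<kappa> by simp
    qed
    have D3: "((\<lambda>x. - sing_sol (1 - x) / \<kappa>) has_field_derivative sing_sol' (1 - x) / \<kappa>) (at x)" if "x \<in> ?L" for x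
      using DERIV_cdivide[OF DERIV_minus[OF D(3)[OF that]], of \<kappa>] by simp
    have D4: "((\<lambda>x. sing_sol' (1 - x) / \<kappa>) has_field_derivative rat_eval 1 full_den x * (- sing_sol (1 - x) / \<kappa>)) (at x)" if "x \<in> ?L" for x
      using DERIV_cdivide[OF D(4)[OF that], of \<kappa>] by simp
    show ?thesis
      unfolding is_solution_def
    proof (intro ballI conjI allI)
      fix x and i :: 2 assume x: "x \<in> ?L"
      show "det (A x) = 1" by (rule det[OF x])
      show "((\<lambda>x. A x $ i $ 2) has_field_derivative A x $ i $ 1) (at x)"
        "((\<lambda>x. A x $ i $ 1) has_field_derivative rat_eval 1 full_den x * A x $ i $ 2) (at x)"
        using exhaust_2[of i] D(1,2)[OF x] D3[OF x] D4[OF x] by (auto simp: A_def)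
    qed
  qed
  \<comment> \<open>Exchanges the rows with determinant 1 and scales them so that the second
    solution becomes \<open>sing_sol (1 - x)\<close>, as the lemma for the other singular point
    requires.\<close>
  define h where "h = mat2 0 (1 / \<kappa>) (- \<kappa>) 0"
  have h: "det h = 1" using \<kappa> by (simp add: h_def)
  obtain u where u: "u \<noteq> 0" "mat2 1 u 0 1 \<in> monodromy 1 full_den (1 / 2, A (1 / 2))"
    using singular_monodromy[of 1, OF _ R Zm A1] by (auto simp: A_def)
  have hA: "h ** A x = mat2 (sing_sol' x / \<kappa>) (sing_sol x / \<kappa>) (- sing_sol' (1 - x)) (sing_sol (1 - x))" for x
    using \<kappa> by (simp add: h_def A_def)
  obtain u' where u': "u' \<noteq> 0" "mat2 1 u' 0 1 \<in> monodromy 1 full_den (1 / 2, h ** A (1 / 2))"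
    using singular_monodromy[of "- 1", OF _ R Zm is_solution_mult[OF A1 h]] by (auto simp: hA)
  have "adj2 h ** mat2 1 u' 0 1 ** h \<in> monodromy 1 full_den (1 / 2, A (1 / 2))"
    by (rule monodromy_conj[OF u'(2) h])
  also have "adj2 h ** mat2 1 u' 0 1 ** h = mat2 1 0 (- (\<kappa> * \<kappa> * u')) 1"
    using \<kappa> by (simp add: h_def)
  finally have l: "mat2 1 0 (- (\<kappa> * \<kappa> * u')) 1 \<in> monodromy 1 full_den (1 / 2, A (1 / 2))" .
  have l0: "- (\<kappa> * \<kappa> * u') \<noteq> 0" using \<kappa> u'(1) by simp
  have "{A::complex^2^2. det A = 1} \<subseteq> zariski_closed mat_coords hull monodromy 1 full_den (1 / 2, A (1 / 2))"
  proof
    fix B :: "complex^2^2" assume "B \<in> {A::complex^2^2. det A = 1}"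
    then have B: "det B = 1" by simp
    show "B \<in> zariski_closed mat_coords hull monodromy 1 full_den (1 / 2, A (1 / 2))"
      by (rule mult_mem_hull) (rule SL2_density[OF _ _ monodromy_mult monodromy_1 u(2) l u(1) l0 B])
  qed
  moreover have "(1 / 2, A (1 / 2)) \<in> Z"
    using is_solutionD(1)[OF A1, of "1 / 2"] by (simp add: Zm dist_norm norm_divide)
  ultimately show ?thesis using R by blast
qed

section \<open>Finite groups\<close>

text \<open>Gaussian elimination for \<open>k\<close> equations in \<open>k + 1\<close> unknowns, by
  induction on \<open>k\<close>: a pivot row removes the last unknown.\<close>

lemma underdetermined_system:
  fixes a :: "nat \<Rightarrow> nat \<Rightarrow> complex"
  shows "\<exists>u. (\<exists>j\<le>k. u j \<noteq> 0) \<and> (\<forall>i<k. (\<Sum>j\<le>k. a i j * u j) = 0)"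
proof (induction k arbitrary: a)
  case 0
  show ?case by (intro exI[of _ "\<lambda>_. 1"]) auto
next
  case (Suc k)
  show ?case
  proof (cases "\<forall>i<Suc k. a i (Suc k) = 0")
    case True
    show ?thesis
    proof (intro exI[of _ "\<lambda>j. if j = Suc k then 1 else 0"] conjI allI impI)
      show "\<exists>j\<le>Suc k. (if j = Suc k then 1 else 0) \<noteq> (0::complex)" by (intro exI[of _ "Suc k"]) simp
      fix i assume i: "i < Suc k"
      have "(\<Sum>j\<le>Suc k. a i j * (if j = Suc k then 1 else 0)) = (\<Sum>j\<le>Suc k. 0)"
        by (rule sum.cong) (use True i in auto)
      then show "(\<Sum>j\<le>Suc k. a i j * (if j = Suc k then 1 else 0)) = 0" by (simp only: sum.neutral_const)
    qed
  next
    case False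
    then obtain r where r: "r < Suc k" "a r (Suc k) \<noteq> 0" by blast
    define c where "c = a r (Suc k)"
    \<comment> \<open>The pivot row \<open>r\<close> is taken out, and the last row moves to its
      place, so that the remaining \<open>k\<close> rows are indexed below \<open>k\<close>.\<close>
    define row where "row i = (if i = r then a k else a i)" for i
    obtain u where u: "\<exists>j\<le>k. u j \<noteq> 0" "\<And>i. i < k \<Longrightarrow> (\<Sum>j\<le>k. (row i j - row i (Suc k) / c * a r j) * u j) = 0"
      using Suc.IH[of "\<lambda>i j. row i j - row i (Suc k) / c * a r j"] by blast
    define s where "s = (\<Sum>j\<le>k. a r j * u j)"
    define u' where "u' j = (if j = Suc k then - s / c else u j)" for j
    have sum: "(\<Sum>j\<le>Suc k. w j * u' j) = (\<Sum>j\<le>k. w j * u j) - w (Suc k) / c * s" for w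
    proof -
      have "(\<Sum>j\<le>k. w j * u' j) = (\<Sum>j\<le>k. w j * u j)" by (rule sum.cong) (auto simp: u'_def)
      then show ?thesis by (simp add: u'_def)
    qed
    have row0: "(\<Sum>j\<le>Suc k. row i j * u' j) = 0" if "i < k" for i
    proof -
      have "(\<Sum>j\<le>k. (row i j - row i (Suc k) / c * a r j) * u j) = (\<Sum>j\<le>k. row i j * u j) - row i (Suc k) / c * s"
        by (simp add: s_def sum_distrib_left sum_subtractf left_diff_distrib mult.assoc)
      then show ?thesis unfolding sum using u(2)[OF that] by simp
    qed
    have "(\<Sum>j\<le>Suc k. a i j * u' j) = 0" if i: "i < Suc k" for i
    proof (cases "i = r")
      case True
      then show ?thesis unfolding sum using r(2) by (simp add: s_def c_def)
    next
      case nr: False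
      show ?thesis
      proof (cases "i < k")
        case True
        have "row i = a i" using nr by (simp add: row_def)
        then show ?thesis using row0[OF True] by simp
      next
        case False
        then have "r < k" "row r = a i" using i nr r(1) by (auto simp: row_def less_Suc_eq)
        then show ?thesis using row0[of r] by simp
      qed
    qed
    moreover have "\<exists>j\<le>Suc k. u' j \<noteq> 0"
    proof -
      obtain j where "j \<le> k" "u j \<noteq> 0" using u(1) by blast
      then show ?thesis by (intro exI[of _ j]) (simp add: u'_def)
    qed
    ultimately show ?thesis by blast
  qed
qed

text \<open>The \<open>2 M + 2\<close> coefficients of \<open>p\<close> and \<open>q\<close> face
  \<open>2 M + 1\<close> linear conditions.\<close>

lemma rational_interpolation:
  fixes x y :: "nat \<Rightarrow> complex"
  shows "\<exists>p q. degree p \<le> M \<and> degree q \<le> M \<and> (p \<noteq> 0 \<or> q \<noteq> 0) \<and> (\<forall>i<2 * M + 1. poly p (x i) = y i * poly q (x i))"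
proof -
  let ?k = "2 * M + 1"
  define a where "a i j = (if j \<le> M then x i ^ j else - (y i * x i ^ (j - M - 1)))" for i j
  obtain u where u: "\<exists>j\<le>?k. u j \<noteq> 0" "\<And>i. i < ?k \<Longrightarrow> (\<Sum>j\<le>?k. a i j * u j) = 0"
    using underdetermined_system[of ?k a] by blast
  define p where "p = (\<Sum>j\<le>?k. if j \<le> M then monom (u j) j else 0)"
  define q where "q = (\<Sum>j\<le>?k. if j \<le> M then 0 else monom (u j) (j - M - 1))"
  have "poly p (x i) = y i * poly q (x i)" if "i < ?k" for i
  proof -
    have "poly p (x i) - y i * poly q (x i) = (\<Sum>j\<le>?k. a i j * u j)"
      unfolding p_def q_def poly_sum sum_distrib_left sum_subtractf[symmetric]
      by (rule sum.cong) (auto simp: a_def poly_monom)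
    then show ?thesis using u(2)[OF that] by simp
  qed
  moreover have "degree p \<le> M" "degree q \<le> M"
    unfolding p_def q_def by (rule degree_sum_le; auto intro: order_trans[OF degree_monom_le])+
  moreover have "p \<noteq> 0 \<or> q \<noteq> 0"
  proof -
    obtain j where j: "j \<le> ?k" "u j \<noteq> 0" using u(1) by blast
    show ?thesis
    proof (cases "j \<le> M")
      case True
      have "coeff p j = (\<Sum>i\<le>?k. if i = j then u j else 0)"
        unfolding p_def coeff_sum by (rule sum.cong) (use True in auto)
      then have "coeff p j \<noteq> 0" using j by (simp add: sum.delta del: sum.atMost_Suc)
      then show ?thesis by auto
    next
      case False
      have "coeff q (j - M - 1) = (\<Sum>i\<le>?k. if i = j then u j else 0)"
        unfolding q_def coeff_sum by (rule sum.cong) (use False in auto)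
      then have "coeff q (j - M - 1) \<noteq> 0" using j by (simp add: sum.delta del: sum.atMost_Suc)
      then show ?thesis by auto
    qed
  qed
  ultimately show ?thesis by blast
qed

text \<open>\<open>V^m p(U / V)\<close>, meaningful also for \<open>V = 0\<close>.\<close>

definition homog :: "complex poly \<Rightarrow> nat \<Rightarrow> complex \<Rightarrow> complex \<Rightarrow> complex" where
  "homog p m U V = (\<Sum>k\<le>m. coeff p k * U ^ k * V ^ (m - k))"

lemma homog_eq:
  assumes "degree p \<le> m" "V \<noteq> 0"
  shows "homog p m U V = V ^ m * poly p (U / V)"
proof -
  have "poly p (U / V) = (\<Sum>k\<le>m. coeff p k * (U / V) ^ k)"
    by (subst (1) poly_as_sum_of_monoms'[OF assms(1), symmetric]) (simp add: poly_sum poly_monom)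
  then have "V ^ m * poly p (U / V) = (\<Sum>k\<le>m. V ^ m * (coeff p k * (U / V) ^ k))" by (simp add: sum_distrib_left)
  also have "\<dots> = homog p m U V"
    unfolding homog_def
  proof (rule sum.cong)
    fix k assume "k \<in> {..m}"
    then have "V ^ m = V ^ k * V ^ (m - k)" by (simp flip: power_add)
    then show "V ^ m * (coeff p k * (U / V) ^ k) = coeff p k * U ^ k * V ^ (m - k)"
      using assms(2) by (simp add: power_divide)
  qed simp
  finally show ?thesis by simp
qed

lemma homog_at_0: "homog p m U 0 = coeff p m * U ^ m"
proof -
  have "homog p m U 0 = (\<Sum>k\<le>m. if k = m then coeff p m * U ^ m else 0)"
    unfolding homog_def by (rule sum.cong) auto
  then show ?thesis by simp
qed

definition homog_poly :: "complex poly \<Rightarrow> nat \<Rightarrow> complex poly \<Rightarrow> complex poly \<Rightarrow> complex poly" where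
  "homog_poly p m N D = (\<Sum>k\<le>m. smult (coeff p k) (N ^ k * D ^ (m - k)))"

lemma poly_homog_poly: "poly (homog_poly p m N D) t = homog p m (poly N t) (poly D t)"
  by (simp add: homog_poly_def homog_def poly_sum mult.assoc)

lemma degree_homog_poly:
  assumes "degree N \<le> n" "degree D \<le> n"
  shows "degree (homog_poly p m N D) \<le> n * m"
  unfolding homog_poly_def
proof (rule degree_sum_le)
  fix k assume k: "k \<in> {..m}"
  have "degree (N ^ k) \<le> n * k" "degree (D ^ (m - k)) \<le> n * (m - k)"
    by (rule order_trans[OF degree_power_le], use assms in simp)+
  then have "degree (N ^ k * D ^ (m - k)) \<le> n * k + n * (m - k)"
    by (intro order_trans[OF degree_mult_le] add_mono)
  also have "\<dots> = n * m" using k by (simp flip: distrib_left)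
  finally show "degree (smult (coeff p k) (N ^ k * D ^ (m - k))) \<le> n * m"
    using degree_smult_le order_trans by blast
qed simp

section \<open>Moebius maps and the quotient of the projective line by a finite group\<close>

definition mob :: "complex^2^2 \<Rightarrow> complex \<Rightarrow> complex" where
  "mob g t = (g$1$1 * t + g$1$2) / (g$2$1 * t + g$2$2)"

definition jac :: "complex^2^2 \<Rightarrow> complex \<Rightarrow> complex" where
  "jac g t = g$2$1 * t + g$2$2"

lemma jac_mult:
  assumes "jac B t \<noteq> 0" shows "jac (A ** B) t = jac A (mob B t) * jac B t"
proof -
  obtain a b c d where A: "A = mat2 a b c d" by (rule mat2_cases)
  obtain a' b' c' d' where B: "B = mat2 a' b' c' d'" by (rule mat2_cases)
  show ?thesis using assms by (simp add: A B jac_def mob_def field_simps)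
qed

lemma mob_mult:
  assumes "jac B t \<noteq> 0" shows "mob (A ** B) t = mob A (mob B t)"
proof -
  obtain a b c d where A: "A = mat2 a b c d" by (rule mat2_cases)
  obtain a' b' c' d' where B: "B = mat2 a' b' c' d'" by (rule mat2_cases)
  define j where "j = c' * t + d'"
  have j: "j \<noteq> 0" using assms by (simp add: B jac_def j_def)
  have "mob (A ** B) t = ((a * a' + b * c') * t + (a * b' + b * d')) / ((c * a' + d * c') * t + (c * b' + d * d'))"
    by (simp add: A B mob_def)
  also have "(a * a' + b * c') * t + (a * b' + b * d') = (a * ((a' * t + b') / j) + b) * j"
    using j by (simp add: distrib_right) (simp add: j_def algebra_simps)
  also have "(c * a' + d * c') * t + (c * b' + d * d') = (c * ((a' * t + b') / j) + d) * j"
    using j by (simp add: distrib_right) (simp add: j_def algebra_simps)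
  also have "(a * ((a' * t + b') / j) + b) * j / ((c * ((a' * t + b') / j) + d) * j) = mob A (mob B t)"
    using j by (simp add: A B mob_def j_def)
  finally show ?thesis .
qed

lemma mob_jac_1 [simp]: "mob (mat 1) t = t" "jac (mat 1) t = 1" "mob (- A) t = mob A t" "jac (- A) t = - jac A t"
proof -
  show "mob (mat 1) t = t" "jac (mat 1) t = 1" by (simp_all add: mat_1_mat2 mob_def jac_def)
  have m: "- A$2$1 * t + - A$2$2 = - (A$2$1 * t + A$2$2)" "- A$1$1 * t + - A$1$2 = - (A$1$1 * t + A$1$2)" by simp_all
  show "jac (- A) t = - jac A t" by (simp add: jac_def)
  show "mob (- A) t = mob A t" unfolding mob_def vector_uminus_component m by (rule minus_divide_divide)
qed

lemma mob_adj2: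
  assumes "det A = 1" "jac A t \<noteq> 0"
  shows "mob (adj2 A) (mob A t) = t" "jac (adj2 A) (mob A t) = 1 / jac A t"
  using mob_mult[OF assms(2), of "adj2 A"] jac_mult[OF assms(2), of "adj2 A"] assms(2)
  by (simp_all add: mult_adj2(2)[OF assms(1)] field_simps)

lemma mob_deriv:
  assumes "det A = 1" "jac A t \<noteq> 0"
  shows "(mob A has_field_derivative 1 / (jac A t)^2) (at t)"
proof -
  obtain a b c d where A: "A = mat2 a b c d" by (rule mat2_cases)
  have j: "c * t + d \<noteq> 0" using assms(2) by (simp add: A jac_def)
  have e: "a * (c * t + d) - (a * t + b) * c = 1" using assms(1) by (simp add: A algebra_simps)
  have "((\<lambda>t. (a * t + b) / (c * t + d)) has_field_derivative (a * (c * t + d) - (a * t + b) * c) / ((c * t + d) * (c * t + d))) (at t)"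
    by (rule derivative_eq_intros refl j)+ simp
  then show ?thesis unfolding e by (simp add: A mob_def[abs_def] jac_def power2_eq_square)
qed

text \<open>The orbit of such a point avoids infinity, and its stabilizer in \<open>PSL2\<close> is
  trivial.\<close>

definition regular :: "(complex^2^2) set \<Rightarrow> complex \<Rightarrow> bool" where
  "regular G t \<longleftrightarrow> (\<forall>g\<in>G. jac g t \<noteq> 0 \<and> (mob g t = t \<longrightarrow> g = mat 1 \<or> g = - mat 1))"

lemma finite_nonregular:
  assumes "alg_group G" "finite G"
  shows "finite {t. \<not> regular G t}"
proof -
  have "finite {t. \<not> (jac g t \<noteq> 0 \<and> (mob g t = t \<longrightarrow> g = mat 1 \<or> g = - mat 1))}" if g: "g \<in> G" for g
  proof -
    obtain a b c d where m: "g = mat2 a b c d" by (rule mat2_cases)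
    have det: "a * d - b * c = 1" using alg_groupD(1)[OF assms(1) g] by (simp add: m)
    have "[:d, c:] \<noteq> 0" using det by auto
    then have 1: "finite {t. poly [:d, c:] t = 0}" by (rule poly_roots_finite)
    have 2: "finite {t. jac g t \<noteq> 0 \<and> mob g t = t}" if "g \<noteq> mat 1" "g \<noteq> - mat 1"
    proof -
      have "[:- b, d - a, c:] \<noteq> 0"
      proof
        assume "[:- b, d - a, c:] = 0"
        then have z: "b = 0" "d = a" "c = 0" by simp_all
        then have "a * a = 1" using det by simp
        then have "a = 1 \<or> a = - 1" by (simp add: square_eq_1_iff)
        moreover have "- mat 1 = mat2 (- 1) 0 0 (- 1)" by (rule mat2_eqI) (simp_all add: mat_def)
        ultimately show False using \<open>g \<noteq> mat 1\<close> \<open>g \<noteq> - mat 1\<close> z by (auto simp: m mat_1_mat2)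
      qed
      then have "finite {t. poly [:- b, d - a, c:] t = 0}" by (rule poly_roots_finite)
      moreover have "{t. jac g t \<noteq> 0 \<and> mob g t = t} \<subseteq> {t. poly [:- b, d - a, c:] t = 0}"
        by (auto simp: m jac_def mob_def divide_eq_eq algebra_simps)
      ultimately show ?thesis by (rule rev_finite_subset)
    qed
    have "finite ({t. poly [:d, c:] t = 0} \<union> (if g = mat 1 \<or> g = - mat 1 then {} else {t. jac g t \<noteq> 0 \<and> mob g t = t}))"
      using 1 2 by simp
    then show ?thesis by (rule rev_finite_subset) (auto simp: m jac_def algebra_simps)
  qed
  then have "finite (\<Union>g\<in>G. {t. \<not> (jac g t \<noteq> 0 \<and> (mob g t = t \<longrightarrow> g = mat 1 \<or> g = - mat 1))})"
    using assms(2) by blast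
  then show ?thesis by (rule rev_finite_subset) (auto simp: regular_def)
qed

lemma mob_eqD:
  assumes G: "alg_group G" and t: "regular G t" and g: "g \<in> G" "h \<in> G" "mob g t = mob h t"
  shows "g = h \<or> g = - h"
proof -
  let ?e = "adj2 h ** g"
  have e: "?e \<in> G" using G g alg_groupD(4,5) by blast
  have j: "jac g t \<noteq> 0" "jac h t \<noteq> 0" using t g by (auto simp: regular_def)
  have "mob ?e t = t"
    unfolding mob_mult[OF j(1)] g(3) by (rule mob_adj2(1)[OF alg_groupD(1)[OF G g(2)] j(2)])
  then have "?e = mat 1 \<or> ?e = - mat 1" using t e by (auto simp: regular_def)
  moreover have "h ** ?e = g" by (rule mult_adj2_cancel(1)[OF alg_groupD(1)[OF G g(2)]])
  moreover have "h ** - mat 1 = - h" by (simp add: mult_minus_mat2)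
  ultimately show ?thesis by (metis matrix_mul_rid)
qed

text \<open>The quotient map by \<open>G\<close> is the rational function \<open>\<Sum>\<^sub>g 1 / (g\<^sup>-\<^sup>1 t - a)\<close>, written over the
  common denominator \<open>\<Prod>\<^sub>b (t - b)\<close> with \<open>b\<close> in the orbit of \<open>a\<close>.\<close>

definition orb :: "(complex^2^2) set \<Rightarrow> complex \<Rightarrow> complex set" where
  "orb G t = (\<lambda>g. mob g t) ` G"

definition quot_den :: "(complex^2^2) set \<Rightarrow> complex \<Rightarrow> complex poly" where
  "quot_den G a = (\<Prod>b\<in>orb G a. [:- b, 1:])"

definition quot_num :: "(complex^2^2) set \<Rightarrow> complex \<Rightarrow> complex poly" where
  "quot_num G a = (\<Sum>g\<in>G. smult (1 / (jac g a)^2) (\<Prod>b\<in>orb G a - {mob g a}. [:- b, 1:]) - smult (g$2$1 / jac g a) (quot_den G a))"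

definition quot_map :: "(complex^2^2) set \<Rightarrow> complex \<Rightarrow> complex \<Rightarrow> complex" where
  "quot_map G a t = poly (quot_num G a) t / poly (quot_den G a) t"

locale finite_alg_group =
  fixes G :: "(complex^2^2) set" and a :: complex
  assumes G: "alg_group G" and fin: "finite G" and a: "regular G a"
begin

abbreviation "N \<equiv> quot_num G a"
abbreviation "D \<equiv> quot_den G a"
abbreviation "f \<equiv> quot_map G a"
abbreviation "n \<equiv> card (orb G a)"

lemma fin_orb: "finite (orb G t)" using fin by (simp add: orb_def)

lemma mob_in_orb: "g \<in> G \<Longrightarrow> mob g t \<in> orb G t" by (simp add: orb_def)

lemma n_pos: "n \<ge> 1"
proof -
  have "mob (mat 1) a \<in> orb G a" by (rule mob_in_orb) (rule alg_groupD(2)[OF G])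
  then show ?thesis using fin_orb[of a] by (metis One_nat_def Suc_leI card_gt_0_iff empty_iff)
qed

lemma D_eq_0: "poly D t = 0 \<longleftrightarrow> t \<in> orb G a"
  using fin_orb by (auto simp: quot_den_def poly_prod)

lemma D_degree: "degree D = n" "coeff D n = 1"
proof -
  show d: "degree D = n" unfolding quot_den_def by (subst degree_prod_sum_eq) simp_all
  have "lead_coeff D = 1" unfolding quot_den_def lead_coeff_prod by simp
  then show "coeff D n = 1" by (simp add: d)
qed

lemma N_degree: "degree N \<le> n"
  unfolding quot_num_def
proof (rule degree_sum_le[OF fin])
  fix g assume "g \<in> G"
  have "degree (\<Prod>b\<in>orb G a - {mob g a}. [:- b, 1:]) \<le> n"
    by (subst degree_prod_sum_eq) (auto intro!: card_mono fin_orb)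
  then show "degree (smult (1 / (jac g a)^2) (\<Prod>b\<in>orb G a - {mob g a}. [:- b, 1:]) - smult (g$2$1 / jac g a) D) \<le> n"
    using D_degree(1) by (intro degree_diff_le) (auto intro: order_trans[OF degree_smult_le])
qed

text \<open>At a point \<open>b\<close> of the orbit only the summands with
  \<open>mob g a = b\<close> survive. These \<open>g\<close> agree up to sign and contribute the
  same nonzero value, so nothing cancels.\<close>

lemma N_ne_0: assumes b: "b \<in> orb G a" shows "poly N b \<noteq> 0"
proof -
  obtain h where h: "h \<in> G" "b = mob h a" using b by (auto simp: orb_def)
  let ?p = "\<Prod>x\<in>orb G a - {b}. b - x"
  have "poly N b = (\<Sum>g\<in>G. if mob g a = b then 1 / (jac h a)^2 * ?p else 0)"
    unfolding quot_num_def poly_sum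
  proof (rule sum.cong)
    fix g assume g: "g \<in> G"
    have Db: "poly D b = 0" using b D_eq_0 by blast
    show "poly (smult (1 / (jac g a)^2) (\<Prod>b\<in>orb G a - {mob g a}. [:- b, 1:]) - smult (g$2$1 / jac g a) D) b = (if mob g a = b then 1 / (jac h a)^2 * ?p else 0)"
    proof (cases "mob g a = b")
      case True
      then have "g = h \<or> g = - h" using mob_eqD[OF G a g h(1)] h(2) by simp
      then have "(jac g a)^2 = (jac h a)^2" by auto
      then show ?thesis using True Db by (simp add: poly_prod)
    next
      case False
      then have "(\<Prod>x\<in>orb G a - {mob g a}. b - x) = 0" using b fin_orb by (intro prod_zero) auto
      then show ?thesis using False Db by (simp add: poly_prod)
    qed
  qed simp
  also have "\<dots> = of_nat (card {g \<in> G. mob g a = b}) * (1 / (jac h a)^2 * ?p)"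
    using fin by (simp add: sum.If_cases Int_def)
  finally have e: "poly N b = of_nat (card {g \<in> G. mob g a = b}) * (1 / (jac h a)^2 * ?p)" .
  have "{g \<in> G. mob g a = b} \<noteq> {}" using h by auto
  then have "card {g \<in> G. mob g a = b} \<noteq> 0" using fin by simp
  moreover have "jac h a \<noteq> 0" using a h(1) by (auto simp: regular_def)
  moreover have "?p \<noteq> 0" using fin_orb by auto
  ultimately show ?thesis unfolding e by simp
qed

definition dom where "dom = {t. t \<notin> orb G a \<and> (\<forall>g\<in>G. jac g t \<noteq> 0)}"

lemma quot_map_sum:
  assumes "t \<in> dom" shows "f t = (\<Sum>g\<in>G. 1 / (mob (adj2 g) t - a))"
proof -
  have t: "t \<notin> orb G a" "poly D t \<noteq> 0" using assms D_eq_0 by (auto simp: dom_def)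
  have "f t = (\<Sum>g\<in>G. poly (smult (1 / (jac g a)^2) (\<Prod>b\<in>orb G a - {mob g a}. [:- b, 1:]) - smult (g$2$1 / jac g a) D) t / poly D t)"
    unfolding quot_map_def quot_num_def poly_sum sum_divide_distrib ..
  also have "\<dots> = (\<Sum>g\<in>G. 1 / (mob (adj2 g) t - a))"
  proof (rule sum.cong)
    fix g assume g: "g \<in> G"
    let ?p = "\<Prod>b\<in>orb G a - {mob g a}. t - b"
    have D: "poly D t = (t - mob g a) * ?p"
      unfolding quot_den_def poly_prod using prod.remove[OF fin_orb mob_in_orb[OF g], of "\<lambda>b. t - b"] by simp
    obtain \<alpha> \<beta> c d where m: "g = mat2 \<alpha> \<beta> c d" by (rule mat2_cases)
    have det: "\<alpha> * d = 1 + \<beta> * c" using alg_groupD(1)[OF G g] by (simp add: m algebra_simps)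
    define j where "j = c * a + d"
    have "jac g a \<noteq> 0" using a g by (auto simp: regular_def)
    then have j: "j \<noteq> 0" by (simp add: m jac_def j_def)
    have k: "\<alpha> - c * t \<noteq> 0" using assms alg_groupD(5)[OF G g] by (auto simp: dom_def m jac_def)
    define b where "b = (\<alpha> * a + \<beta>) / j"
    have b: "mob g a = b" "b * j = \<alpha> * a + \<beta>" using j by (simp_all add: m mob_def b_def j_def)
    have tb: "t - b \<noteq> 0" "(\<Prod>x\<in>orb G a - {b}. t - x) \<noteq> 0" using t(2) unfolding D b(1) by auto
    have "mob (adj2 g) t - a = j * (t - b) / (\<alpha> - c * t)"
    proof -
      have "j * (t - b) = d * t - \<beta> - a * (\<alpha> - c * t)" using b(2) by (simp add: j_def algebra_simps)
      then show ?thesis using k by (simp add: m mob_def field_simps)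
    qed
    then have r: "1 / (mob (adj2 g) t - a) = (\<alpha> - c * t) / (j * (t - b))" by simp
    have "(\<alpha> - c * t) * j = 1 - c * j * (t - b)"
    proof -
      have "c * j * (t - b) = c * j * t - c * (b * j)" by (simp add: algebra_simps)
      then show ?thesis unfolding b(2) using det by (simp add: j_def algebra_simps)
    qed
    then have k': "\<alpha> - c * t = (1 - c * j * (t - b)) / j" using j by (simp add: eq_divide_eq)
    have "poly (smult (1 / (jac g a)^2) (\<Prod>b\<in>orb G a - {mob g a}. [:- b, 1:]) - smult (g$2$1 / jac g a) D) t / poly D t
      = (1 / j^2 * ?p - c / j * poly D t) / poly D t"
      by (simp add: m poly_prod jac_def j_def)
    \<comment> \<open>Partial fraction of the summand: its pole is at \<open>b = mob g a\<close>,
      and \<open>- c / j\<close> is its value at infinity.\<close>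
    also have "\<dots> = 1 / (j^2 * (t - b)) - c / j"
    proof -
      have "(1 / j^2 * P - c / j * ((t - b) * P)) / ((t - b) * P) = 1 / (j^2 * (t - b)) - c / j" if "P \<noteq> 0" for P
        using that tb(1) j by (simp add: divide_simps) (simp add: algebra_simps power2_eq_square)
      then show ?thesis unfolding D b(1) using tb(2) by blast
    qed
    also have "\<dots> = (\<alpha> - c * t) / (j * (t - b))" unfolding k' using tb(1) j by (simp add: divide_simps power2_eq_square)
    finally show "poly (smult (1 / (jac g a)^2) (\<Prod>b\<in>orb G a - {mob g a}. [:- b, 1:]) - smult (g$2$1 / jac g a) D) t / poly D t
      = 1 / (mob (adj2 g) t - a)" unfolding r .
  qed simp
  finally show ?thesis .
qed

lemma mob_dom:
  assumes t: "t \<in> dom" and g: "g \<in> G"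
  shows "mob g t \<in> dom"
proof -
  have j: "jac g t \<noteq> 0" using t g by (auto simp: dom_def)
  have "jac h (mob g t) \<noteq> 0" if "h \<in> G" for h
    using jac_mult[OF j, of h] t alg_groupD(4)[OF G that g] by (auto simp: dom_def)
  moreover have "mob g t \<notin> orb G a"
  proof
    assume "mob g t \<in> orb G a"
    then obtain h where h: "h \<in> G" "mob g t = mob h a" by (auto simp: orb_def)
    have ja: "jac h a \<noteq> 0" using a h(1) by (auto simp: regular_def)
    have "t = mob (adj2 g ** h) a"
      unfolding mob_mult[OF ja] h(2)[symmetric] by (rule mob_adj2(1)[OF alg_groupD(1)[OF G g] j, symmetric])
    then have "t \<in> orb G a" using mob_in_orb[OF alg_groupD(4)[OF G alg_groupD(5)[OF G g] h(1)]] by metis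
    then show False using t by (simp add: dom_def)
  qed
  ultimately show ?thesis by (simp add: dom_def)
qed

lemma quot_map_invariant:
  assumes t: "t \<in> dom" and g: "g \<in> G"
  shows "f (mob g t) = f t"
proof -
  have j: "jac g t \<noteq> 0" using t g by (auto simp: dom_def)
  note dg = alg_groupD(1)[OF G g]
  have "f (mob g t) = (\<Sum>h\<in>G. 1 / (mob (adj2 h ** g) t - a))"
    unfolding quot_map_sum[OF mob_dom[OF assms]] mob_mult[OF j] ..
  also have "\<dots> = (\<Sum>h\<in>G. 1 / (mob (adj2 h) t - a))"
  proof (rule sum.reindex_bij_witness[of _ "\<lambda>h. g ** h" "\<lambda>h. adj2 g ** h"])
    show "adj2 g ** h \<in> G" "g ** h \<in> G" if "h \<in> G" for h using that g alg_groupD(4,5)[OF G] by blast+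
    show "g ** (adj2 g ** h) = h" for h :: "complex^2^2" by (rule mult_adj2_cancel(1)[OF dg])
    show "adj2 g ** (g ** h) = h" for h :: "complex^2^2" by (rule mult_adj2_cancel(2)[OF dg])
    show "1 / (mob (adj2 (adj2 g ** h)) t - a) = 1 / (mob (adj2 h ** g) t - a)" for h
      by (simp add: adj2_mult adj2_adj2)
  qed
  also have "\<dots> = f t" using quot_map_sum[OF t] by simp
  finally show ?thesis .
qed

text \<open>Choosing for each \<open>b\<close> in the orbit of \<open>a\<close> an element
  \<open>s b\<close> that sends \<open>a\<close> to \<open>b\<close> embeds this orbit into that of
  \<open>t\<close>: elements with the same value at the regular point \<open>t\<close> agree up to
  sign.\<close>

lemma card_orb: assumes "regular G t" shows "n \<le> card (orb G t)"
proof -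
  define s where "s b = (SOME g. g \<in> G \<and> mob g a = b)" for b
  have s: "s b \<in> G \<and> mob (s b) a = b" if "b \<in> orb G a" for b
    unfolding s_def by (rule someI_ex) (use that in \<open>auto simp: orb_def\<close>)
  have "inj_on (\<lambda>b. mob (s b) t) (orb G a)"
  proof (rule inj_onI)
    fix b c assume bc: "b \<in> orb G a" "c \<in> orb G a" "mob (s b) t = mob (s c) t"
    then have "s b = s c \<or> s b = - s c" using s by (intro mob_eqD[OF G assms]) auto
    then have "mob (s b) a = mob (s c) a" by auto
    then show "b = c" using s bc by metis
  qed
  then show ?thesis by (rule card_inj_on_le[OF _ _ fin_orb]) (use s mob_in_orb in auto)
qed

lemma pencil: "N - smult x D \<noteq> 0" "degree (N - smult x D) \<le> n"
  "poly D t \<noteq> 0 \<Longrightarrow> poly (N - smult x D) t = 0 \<longleftrightarrow> f t = x"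
proof -
  have "mob (mat 1) a \<in> orb G a" by (rule mob_in_orb) (rule alg_groupD(2)[OF G])
  then have "poly (N - smult x D) a \<noteq> 0" using N_ne_0[of a] D_eq_0[of a] by simp
  then show "N - smult x D \<noteq> 0" by auto
  show "degree (N - smult x D) \<le> n"
    using N_degree D_degree(1) by (intro degree_diff_le) (auto intro: order_trans[OF degree_smult_le])
  show "poly D t \<noteq> 0 \<Longrightarrow> poly (N - smult x D) t = 0 \<longleftrightarrow> f t = x"
    by (auto simp: quot_map_def field_simps)
qed

lemma regular_dom: "regular G t \<Longrightarrow> t \<notin> orb G a \<Longrightarrow> t \<in> dom"
  by (auto simp: regular_def dom_def)

text \<open>The polynomial \<open>N - smult (f t) D\<close> has degree at most \<open>n\<close> and
  already vanishes on the orbit of \<open>t\<close>, which has at least \<open>n\<close> points;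
  there is no room for another root.\<close>

lemma fibre:
  assumes t: "regular G t" "t \<notin> orb G a" and s: "s \<notin> orb G a" "f s = f t"
  shows "s \<in> orb G t"
proof -
  let ?p = "N - smult (f t) D"
  let ?R = "{x. poly ?p x = 0}"
  have "orb G t \<subseteq> ?R"
  proof
    fix x assume "x \<in> orb G t"
    then obtain g where g: "g \<in> G" "x = mob g t" by (auto simp: orb_def)
    have "x \<in> dom" "f x = f t" unfolding g(2) using mob_dom quot_map_invariant regular_dom[OF t] g(1) by auto
    then show "x \<in> ?R" using pencil(3)[of x "f t"] D_eq_0[of x] by (auto simp: dom_def)
  qed
  moreover have "card ?R \<le> card (orb G t)"
    using card_poly_roots_bound[OF pencil(1)[of "f t"]] pencil(2)[of "f t"] card_orb[OF t(1)] by linarith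
  ultimately have "orb G t = ?R" by (intro card_seteq poly_roots_finite[OF pencil(1)])
  moreover have "s \<in> ?R" using pencil(3)[of s "f t"] D_eq_0[of s] s by auto
  ultimately show ?thesis by simp
qed

text \<open>The excluded value is the one taken at infinity. For any other \<open>x\<close> the
  pencil member keeps degree \<open>n\<close> and has a root, which is no pole of \<open>f\<close>
  by \<open>N_ne_0\<close>.\<close>

lemma root_exists:
  assumes "x \<noteq> coeff N n"
  shows "\<exists>t. t \<notin> orb G a \<and> f t = x"
proof -
  let ?p = "N - smult x D"
  have "coeff ?p n \<noteq> 0" using assms D_degree(2) by simp
  then have "degree ?p \<noteq> 0" using n_pos le_degree[of ?p n] by linarith
  then have "\<not> constant (poly ?p)" unfolding constant_degree .
  from fundamental_theorem_of_algebra[OF this] obtain t where t: "poly ?p t = 0" ..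
  have "t \<notin> orb G a"
  proof
    assume "t \<in> orb G a"
    then show False using t N_ne_0[of t] D_eq_0[of t] by simp
  qed
  then show ?thesis using pencil(3)[of t x] t D_eq_0[of t] by auto
qed

end

section \<open>Derivatives of the quotient map and its Schwarzian\<close>

context finite_alg_group
begin

text \<open>Numerator, over \<open>D^(k + 1)\<close>, of the derivative of
  \<open>X / D^k\<close>.\<close>

definition "der X k = pderiv X * D - smult (of_nat k) (X * pderiv D)"

abbreviation "W \<equiv> der N 1"
abbreviation "W2 \<equiv> der W 2"
abbreviation "W3 \<equiv> der W2 3"

definition "f1 t = poly W t / poly D t ^ 2"
definition "f2 t = poly W2 t / poly D t ^ 3"
definition "f3 t = poly W3 t / poly D t ^ 4"

lemma der_deriv:
  assumes "poly D t \<noteq> 0"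
  shows "((\<lambda>t. poly X t / poly D t ^ Suc k) has_field_derivative poly (der X (Suc k)) t / poly D t ^ Suc (Suc k)) (at t)"
proof -
  let ?d = "poly D t" and ?y = "poly (pderiv D) t" and ?x = "poly X t" and ?x' = "poly (pderiv X) t"
  have "((\<lambda>t. poly X t / poly D t ^ Suc k) has_field_derivative
      (?x' * ?d ^ Suc k - ?x * (of_nat (Suc k) * (?y * ?d ^ k))) / (?d ^ Suc k * ?d ^ Suc k)) (at t)"
    using DERIV_divide[OF poly_DERIV DERIV_power[OF poly_DERIV], of D t "Suc k" X] assms by (simp add: mult_ac)
  moreover have "(?x' * ?d ^ Suc k - ?x * (of_nat (Suc k) * (?y * ?d ^ k))) / (?d ^ Suc k * ?d ^ Suc k) =
      poly (der X (Suc k)) t / ?d ^ Suc (Suc k)"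
  proof -
    have "?x' * ?d ^ Suc k - ?x * (of_nat (Suc k) * (?y * ?d ^ k)) = ?d ^ k * poly (der X (Suc k)) t"
      by (simp add: der_def algebra_simps)
    moreover have "?d ^ Suc k * ?d ^ Suc k = ?d ^ k * ?d ^ Suc (Suc k)" by simp
    ultimately show ?thesis using assms by (simp only: mult_divide_mult_cancel_left power_not_zero not_False_eq_True simp_thms)
  qed
  ultimately show ?thesis by simp
qed

lemma f_derivs:
  assumes "t \<notin> orb G a"
  shows "(f has_field_derivative f1 t) (at t)" "(f1 has_field_derivative f2 t) (at t)" "(f2 has_field_derivative f3 t) (at t)"
proof -
  have D: "poly D t \<noteq> 0" using assms D_eq_0 by blast
  show "(f has_field_derivative f1 t) (at t)"
    using der_deriv[OF D, of N 0] by (simp add: quot_map_def[abs_def] f1_def numeral_2_eq_2)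
  show "(f1 has_field_derivative f2 t) (at t)"
    using der_deriv[OF D, of W 1] by (simp add: f1_def[abs_def] f2_def eval_nat_numeral)
  show "(f2 has_field_derivative f3 t) (at t)"
    using der_deriv[OF D, of W2 2] by (simp add: f2_def[abs_def] f3_def eval_nat_numeral)
qed

lemma open_dom: "open dom"
proof -
  have "dom = - orb G a \<inter> (\<Inter>g\<in>G. {t. g$2$1 * t + g$2$2 \<noteq> 0})" by (auto simp: dom_def jac_def)
  moreover have "open (\<Inter>g\<in>G. {t. g$2$1 * t + g$2$2 \<noteq> 0})"
    by (intro open_INT fin ballI open_Collect_neq continuous_intros)
  ultimately show ?thesis using finite_imp_closed[OF fin_orb[of a]] by (simp add: open_Int open_Compl)
qed

lemma transfer_deriv:
  assumes t: "t \<in> dom" "g \<in> G" and F: "(F has_field_derivative F') (at (mob g t))"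
    and H: "(H has_field_derivative H') (at t)" and eq: "\<And>s. s \<in> dom \<Longrightarrow> F (mob g s) = H s"
  shows "F' = (jac g t)^2 * H'"
proof -
  have j: "jac g t \<noteq> 0" using t by (auto simp: dom_def)
  have 1: "((\<lambda>s. F (mob g s)) has_field_derivative F' * (1 / (jac g t)^2)) (at t)"
    by (rule DERIV_chain2[where g = "mob g" and x = t, OF F mob_deriv[OF alg_groupD(1)[OF G t(2)] j]])
  have 2: "((\<lambda>s. F (mob g s)) has_field_derivative H') (at t)"
    by (rule has_field_derivative_transform_within_open[OF H open_dom t(1)]) (simp add: eq)
  from DERIV_unique[OF 1 2] show ?thesis using j by (auto simp: field_simps)
qed

lemma derivs_mob:
  assumes t: "t \<in> dom" "g \<in> G"
  defines "j \<equiv> jac g t" and "c \<equiv> g$2$1"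
  shows "f1 (mob g t) = j^2 * f1 t" "f2 (mob g t) = j^2 * (2 * j * c * f1 t + j^2 * f2 t)"
    "f3 (mob g t) = j^2 * (6 * j^2 * c^2 * f1 t + 6 * j^3 * c * f2 t + j^4 * f3 t)"
proof -
  have no: "s \<notin> orb G a" if "s \<in> dom" for s using that by (simp add: dom_def)
  note d = f_derivs[OF no[OF t(1)]]
  note e = f_derivs[OF no[OF mob_dom[OF t]]]
  have dj: "(jac g has_field_derivative c) (at t)"
    unfolding jac_def[abs_def] c_def by (auto intro!: derivative_eq_intros)
  have 1: "f1 (mob g s) = (jac g s)^2 * f1 s" if "s \<in> dom" for s
    by (rule transfer_deriv[OF that t(2) f_derivs(1)[OF no[OF mob_dom[OF that t(2)]]] f_derivs(1)[OF no[OF that]]])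
      (rule quot_map_invariant[OF _ t(2)])
  show "f1 (mob g t) = j^2 * f1 t" using 1[OF t(1)] by (simp add: j_def)
  have dH: "((\<lambda>s. (jac g s)^2 * f1 s) has_field_derivative 2 * jac g s * c * f1 s + (jac g s)^2 * f2 s) (at s)" if "s \<in> dom" for s
  proof -
    have djs: "(jac g has_field_derivative c) (at s)"
      unfolding jac_def[abs_def] c_def by (auto intro!: derivative_eq_intros)
    show ?thesis
      by (rule derivative_eq_intros djs f_derivs(2)[OF no[OF that]] refl)+ (simp add: power2_eq_square algebra_simps)
  qed
  have 2: "f2 (mob g s) = (jac g s)^2 * (2 * jac g s * c * f1 s + (jac g s)^2 * f2 s)" if "s \<in> dom" for s
    by (rule transfer_deriv[OF that t(2) f_derivs(2)[OF no[OF mob_dom[OF that t(2)]]] dH[OF that] 1])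
  show "f2 (mob g t) = j^2 * (2 * j * c * f1 t + j^2 * f2 t)" using 2[OF t(1)] by (simp add: j_def)
  have "((\<lambda>s. (jac g s)^2 * (2 * jac g s * c * f1 s + (jac g s)^2 * f2 s)) has_field_derivative
      6 * j^2 * c^2 * f1 t + 6 * j^3 * c * f2 t + j^4 * f3 t) (at t)"
    by (rule derivative_eq_intros dj d refl)+
      (simp add: j_def power2_eq_square power3_eq_cube power4_eq_xxxx algebra_simps)
  from transfer_deriv[OF t e(3) this 2]
  show "f3 (mob g t) = j^2 * (6 * j^2 * c^2 * f1 t + 6 * j^3 * c * f2 t + j^4 * f3 t)" by (simp add: j_def)
qed

text \<open>The Schwarzian of \<open>f\<close> divided by \<open>2 f'^2\<close>. It is the value of
  \<open>q\<close> at \<open>f t\<close> forced by the developing map \<open>T = t\<close>, for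
  which \<open>v^2 = f'\<close>.\<close>

definition "schw t = (2 * f1 t * f3 t - 3 * (f2 t)^2) / (4 * (f1 t)^4)"

lemma schw_mob:
  assumes t: "t \<in> dom" "g \<in> G"
  shows "schw (mob g t) = schw t"
proof -
  define j where "j = jac g t"
  have j: "j \<noteq> 0" using t by (auto simp: dom_def j_def)
  have "2 * f1 (mob g t) * f3 (mob g t) - 3 * (f2 (mob g t))^2 = j^8 * (2 * f1 t * f3 t - 3 * (f2 t)^2)"
    unfolding derivs_mob[OF t] j_def[symmetric] by algebra
  moreover have "4 * (f1 (mob g t))^4 = j^8 * (4 * (f1 t)^4)"
    unfolding derivs_mob[OF t] j_def[symmetric] by algebra
  ultimately show ?thesis using j by (simp add: schw_def)
qed

abbreviation "A \<equiv> D^2 * (2 * W * W3 - 3 * W2^2)"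
abbreviation "B \<equiv> 4 * W^4"

lemma schw_eq:
  assumes "poly D t \<noteq> 0" "f1 t \<noteq> 0"
  shows "poly A t = schw t * poly B t" "poly B t \<noteq> 0"
proof -
  define d w w2 w3 where "d = poly D t" and "w = poly W t" and "w2 = poly W2 t" and "w3 = poly W3 t"
  have d: "d \<noteq> 0" "w \<noteq> 0" using assms by (auto simp: d_def w_def f1_def)
  have "(2 * (w / d^2) * (w3 / d^4) - 3 * (w2 / d^3)^2) / (4 * (w / d^2)^4) = d^2 * (2 * w * w3 - 3 * w2^2) / (4 * w^4)"
    using d by (simp add: divide_simps)
  then have "schw t = d^2 * (2 * w * w3 - 3 * w2^2) / (4 * w^4)"
    by (simp add: schw_def f1_def f2_def f3_def d_def w_def w2_def w3_def)
  then show "poly A t = schw t * poly B t" using d by (simp add: d_def w_def w2_def w3_def)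
  show "poly B t \<noteq> 0" using d by (simp add: w_def)
qed

definition "generic = {t. regular G t \<and> t \<notin> orb G a \<and> f1 t \<noteq> 0}"

lemma finite_nongeneric: "finite (- generic)"
proof -
  have aa: "a \<in> orb G a" using mob_in_orb[OF alg_groupD(2)[OF G], of a] by simp
  \<comment> \<open>The point \<open>a\<close> is a simple pole of \<open>f\<close>, so the
    numerator of \<open>f'\<close> is nonzero at \<open>a\<close> and has only finitely many
    roots.\<close>
  have "poly (pderiv D) a \<noteq> 0"
  proof -
    have D: "D = [:- a, 1:] * (\<Prod>b\<in>orb G a - {a}. [:- b, 1:])"
      unfolding quot_den_def by (rule prod.remove[OF fin_orb aa])
    have "poly (pderiv D) a = (\<Prod>b\<in>orb G a - {a}. a - b)"
      unfolding D pderiv_mult by (simp add: pderiv_pCons poly_prod)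
    then show ?thesis using fin_orb by auto
  qed
  then have "poly W a \<noteq> 0" using N_ne_0[OF aa] D_eq_0[of a] aa by (simp add: der_def)
  then have "W \<noteq> 0" by auto
  then have "finite ({t. \<not> regular G t} \<union> orb G a \<union> {t. poly W t = 0})"
    using finite_nonregular[OF G fin] fin_orb poly_roots_finite by blast
  then show ?thesis by (rule rev_finite_subset) (auto simp: generic_def f1_def D_eq_0)
qed

lemma generic_dom: "t \<in> generic \<Longrightarrow> t \<in> dom"
  by (auto simp: generic_def intro: regular_dom)

lemma finite_fibre: "finite {s \<in> generic. f s = x}"
proof (cases "{s \<in> generic. f s = x} = {}")
  case False
  then obtain t where t: "t \<in> generic" "f t = x" by blast
  have "{s \<in> generic. f s = x} \<subseteq> orb G t" using fibre[of t] t by (auto simp: generic_def)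
  then show ?thesis using fin_orb finite_subset by blast
next
  case True
  show ?thesis unfolding True by simp
qed

lemma infinite_image: "infinite (f ` generic)"
proof
  assume "finite (f ` generic)"
  moreover have "infinite generic"
  proof
    assume "finite generic"
    then have "finite (generic \<union> - generic)" using finite_nongeneric by (rule finite_UnI)
    then show False using infinite_UNIV_char_0[where 'a = complex] by simp
  qed
  ultimately obtain y where "infinite {s \<in> generic. f s = f y}" using pigeonhole_infinite[of generic f] by blast
  then show False using finite_fibre by blast
qed

text \<open>Interpolation at \<open>2 M + 1\<close> values gives a candidate \<open>P / Q\<close>.
  By invariance the cleared difference \<open>\<Psi>\<close> vanishes on \<open>2 M + 1\<close>
  disjoint orbits of at least \<open>n\<close> points each, while its degree is at most
  \<open>n * M + M\<close>; so it is zero. The counting takes the place of a field-theoretic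
  description of the invariant functions.\<close>

lemma schw_rational: "\<exists>P Q. Q \<noteq> 0 \<and> (\<forall>t\<in>generic. poly P (f t) = schw t * poly Q (f t))"
proof -
  define M where "M = max (degree A) (degree B)"
  obtain x :: "nat \<Rightarrow> complex" where x: "inj x" "range x \<subseteq> f ` generic"
    using infinite_countable_subset[OF infinite_image] by blast
  have "\<forall>i. \<exists>t. t \<in> generic \<and> f t = x i" using x(2) by (metis imageE range_subsetD)
  then obtain \<tau> where \<tau>: "\<And>i. \<tau> i \<in> generic" "\<And>i. f (\<tau> i) = x i" by metis
  have reg: "regular G (\<tau> i)" for i using \<tau>(1)[of i] by (simp add: generic_def)
  obtain P Q where PQ: "degree P \<le> M" "degree Q \<le> M" "P \<noteq> 0 \<or> Q \<noteq> 0"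
    "\<And>i. i < 2 * M + 1 \<Longrightarrow> poly P (x i) = schw (\<tau> i) * poly Q (x i)"
    using rational_interpolation[of M x "\<lambda>i. schw (\<tau> i)"] by blast
  define \<Psi> where "\<Psi> = homog_poly P M N D * B - A * homog_poly Q M N D"
  have val: "poly \<Psi> t = poly D t ^ M * poly B t * (poly P (f t) - schw t * poly Q (f t))"
    if "t \<notin> orb G a" "f1 t \<noteq> 0" for t
  proof -
    have D: "poly D t \<noteq> 0" using that D_eq_0 by blast
    have "poly \<Psi> t = poly D t ^ M * poly P (f t) * poly B t - poly A t * (poly D t ^ M * poly Q (f t))"
      unfolding \<Psi>_def poly_diff poly_mult[of _ B] poly_mult[of A] poly_homog_poly homog_eq[OF PQ(1) D] homog_eq[OF PQ(2) D] quot_map_def ..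
    then show ?thesis unfolding schw_eq(1)[OF D that(2)] by (simp only: algebra_simps)
  qed
  let ?U = "\<Union>i\<in>{..<2 * M + 1}. orb G (\<tau> i)"
  have "?U \<subseteq> {t. poly \<Psi> t = 0}"
  proof
    fix s assume "s \<in> ?U"
    then obtain i g where i: "i < 2 * M + 1" "g \<in> G" "s = mob g (\<tau> i)" by (auto simp: orb_def)
    note ti = generic_dom[OF \<tau>(1)[of i]]
    have "s \<notin> orb G a" using mob_dom[OF ti i(2)] i(3) by (simp add: dom_def)
    moreover have "f1 s \<noteq> 0"
      unfolding i(3) derivs_mob(1)[OF ti i(2)] using ti i(2) \<tau>(1)[of i] by (auto simp: dom_def generic_def)
    moreover have "f s = x i" "schw s = schw (\<tau> i)"
      unfolding i(3) using quot_map_invariant[OF ti i(2)] schw_mob[OF ti i(2)] \<tau>(2) by auto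
    ultimately show "s \<in> {t. poly \<Psi> t = 0}" using val[of s] PQ(4)[OF i(1)] by simp
  qed
  have disj: "orb G (\<tau> i) \<inter> orb G (\<tau> k) = {}" if "i \<noteq> k" for i k
  proof -
    have "f s = x i" if "s \<in> orb G (\<tau> i)" for s i
      using that quot_map_invariant[OF generic_dom[OF \<tau>(1)]] \<tau>(2) by (auto simp: orb_def)
    then have "x i = x k" if "s \<in> orb G (\<tau> i) \<inter> orb G (\<tau> k)" for s using that by (metis IntD1 IntD2)
    then show ?thesis using injD[OF x(1), of i k] that by blast
  qed
  have "(\<Sum>i<2 * M + 1. n) \<le> (\<Sum>i<2 * M + 1. card (orb G (\<tau> i)))"
    by (intro sum_mono card_orb reg)
  also have "\<dots> = card ?U"
    by (rule card_UN_disjoint[symmetric]) (use fin_orb disj in auto)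
  finally have cU: "(2 * M + 1) * n \<le> card ?U" by simp
  have "\<Psi> = 0"
  proof (rule ccontr)
    assume nz: "\<Psi> \<noteq> 0"
    have "card ?U \<le> card {t. poly \<Psi> t = 0}"
      by (rule card_mono[OF poly_roots_finite[OF nz] \<open>?U \<subseteq> _\<close>])
    also have "\<dots> \<le> degree \<Psi>" by (rule card_poly_roots_bound[OF nz])
    also have "\<dots> \<le> n * M + M"
      unfolding \<Psi>_def
    proof (intro degree_diff_le order_trans[OF degree_mult_le])
      have "degree A \<le> M" "degree B \<le> M" by (simp_all add: M_def)
      then show "degree (homog_poly P M N D) + degree B \<le> n * M + M" "degree A + degree (homog_poly Q M N D) \<le> n * M + M"
        using degree_homog_poly[OF N_degree, of D P M] degree_homog_poly[OF N_degree, of D Q M] D_degree(1) by simp_all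
    qed
    also have "\<dots> < (2 * M + 1) * n"
    proof -
      have "M \<le> M * n" using n_pos by simp
      moreover have "(2 * M + 1) * n = n * M + M * n + n" by (simp add: algebra_simps)
      ultimately show ?thesis using n_pos by linarith
    qed
    finally show False using cU by simp
  qed
  have eq: "poly P (f t) = schw t * poly Q (f t)" if "t \<in> generic" for t
  proof -
    have t: "t \<notin> orb G a" "f1 t \<noteq> 0" "poly D t \<noteq> 0" using that D_eq_0 by (auto simp: generic_def)
    show ?thesis using val[OF t(1,2)] schw_eq(2)[OF t(3,2)] t(3) \<open>\<Psi> = 0\<close> by simp
  qed
  moreover have "Q \<noteq> 0"
  proof
    assume Q: "Q = 0"
    then have "P \<noteq> 0" using PQ(3) by simp
    moreover have "f ` generic \<subseteq> {x. poly P x = 0}" using eq Q by auto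
    ultimately show False using infinite_image poly_roots_finite finite_subset by blast
  qed
  ultimately show ?thesis by blast
qed

end

lemma polyfun_sum: "finite I \<Longrightarrow> (\<And>i. i \<in> I \<Longrightarrow> F i \<in> polyfun C) \<Longrightarrow> (\<lambda>x. \<Sum>i\<in>I. F i x) \<in> polyfun C"
  by (induction rule: finite_induct) (auto intro: polyfun.const polyfun.add)

lemma polyfun_homog: "f \<in> polyfun C \<Longrightarrow> g \<in> polyfun C \<Longrightarrow> (\<lambda>x. homog p m (f x) (g x)) \<in> polyfun C"
  unfolding homog_def by (intro polyfun_sum polyfun_intros finite_atMost)

lemma polyfun_even_monomial:
  assumes "even (i + j)"
  shows "(\<lambda>a. snd a $ 1 $ 2 ^ i * snd a $ 2 $ 2 ^ j) \<in> polyfun even_coords"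
proof -
  have eq: "u ^ i * v ^ j = (u * u) ^ (i div 2) * (v * v) ^ (j div 2) * (if even i then 1 else u * v)" for u v :: complex
  proof (cases "even i")
    case True
    then have "even j" using assms by simp
    with True show ?thesis by (simp flip: power2_eq_square power_mult)
  next
    case False
    then have "odd j" using assms by simp
    then obtain k where k: "j = 2 * k + 1" by (elim oddE)
    obtain l where l: "i = 2 * l + 1" using False by (elim oddE)
    show ?thesis by (simp add: k l power_mult power2_eq_square power_mult_distrib mult_ac)
  qed
  have "(\<lambda>a. (snd a $ 1 $ 2 * snd a $ 1 $ 2) ^ (i div 2) * (snd a $ 2 $ 2 * snd a $ 2 $ 2) ^ (j div 2) *
     (if even i then 1 else snd a $ 1 $ 2 * snd a $ 2 $ 2)) \<in> polyfun even_coords"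
    by (cases "even i") (simp_all, (intro polyfun_intros polyfun_even_coords)+)
  then show ?thesis unfolding eq .
qed

section \<open>Realization of a finite group\<close>

context finite_alg_group
begin

definition "sol t = param_mat t (f1 t) (f2 t / f1 t)"

lemma sol_mob:
  assumes t: "t \<in> generic" "g \<in> G"
  shows "sol (mob g t) = g ** sol t \<or> sol (mob g t) = - (g ** sol t)"
proof -
  note td = generic_dom[OF t(1)]
  have j: "jac g t \<noteq> 0" using td t(2) by (auto simp: dom_def)
  have f1: "f1 t \<noteq> 0" using t(1) by (simp add: generic_def)
  obtain \<alpha> \<beta> c d where m: "g = mat2 \<alpha> \<beta> c d" by (rule mat2_cases)
  have jm: "jac g t = c * t + d" "g$2$1 = c" by (simp_all add: m jac_def)
  note dm = derivs_mob[OF td t(2), unfolded jm]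
  have jn: "c * t + d \<noteq> 0" using j unfolding jm .
  have "param_mat (mob g t) (f1 (mob g t)) (f2 (mob g t) / f1 (mob g t)) = mat2 \<alpha> \<beta> c d ** param_mat t (f1 t) (f2 t / f1 t) \<or>
    param_mat (mob g t) (f1 (mob g t)) (f2 (mob g t) / f1 (mob g t)) = - (mat2 \<alpha> \<beta> c d ** param_mat t (f1 t) (f2 t / f1 t))"
  proof (rule param_mat_moebius)
    show "\<alpha> * d - \<beta> * c = 1" using alg_groupD(1)[OF G t(2)] by (simp add: m)
    show "mob g t = (\<alpha> * t + \<beta>) / (c * t + d)" by (simp add: m mob_def)
    show "f1 (mob g t) = (c * t + d)^2 * f1 t" by (rule dm(1))
    show "f2 (mob g t) / f1 (mob g t) = (c * t + d)^2 * (f2 t / f1 t) + 2 * c * (c * t + d)"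
      unfolding dm(1,2) using jn f1 by (simp add: divide_simps)
  qed (use jn f1 in auto)
  then show ?thesis by (simp only: sol_def m)
qed

text \<open>The parameter \<open>t\<close> runs over the plane minus a finite set, which is
  connected, and \<open>f\<close> is invariant. A path from \<open>t\<close> to
  \<open>mob g t\<close> therefore lies over a loop with monodromy \<open>g\<close> up to sign, so
  that the monodromy itself contains \<open>G\<close>.\<close>

lemma realization_exists: "\<exists>n d Z x P. reduction n d G Z \<and> (x, P) \<in> Z \<and> G \<subseteq> monodromy n d (x, P)"
proof -
  obtain P0 Q where Q: "Q \<noteq> 0" "\<And>t. t \<in> generic \<Longrightarrow> poly P0 (f t) = schw t * poly Q (f t)"
    using schw_rational by blast
  \<comment> \<open>Values of \<open>x\<close> to be avoided: those over nongeneric points, and the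
    value at infinity. The factor \<open>C\<close> in numerator and denominator leaves the quotient
    unchanged and declares these values singular.\<close>
  define X where "X = f ` (- generic) \<union> {coeff N n}"
  have finX: "finite X" using finite_nongeneric by (simp add: X_def)
  define C where "C = (\<Prod>x\<in>X. [:- x, 1:])"
  have C: "poly C x = 0 \<longleftrightarrow> x \<in> X" for x using finX by (auto simp: C_def poly_prod)
  have "C \<noteq> 0" using finX by (auto simp: C_def)
  define d' n' where "d' = Q * C" and "n' = P0 * C"
  have d0: "d' \<noteq> 0" using Q(1) \<open>C \<noteq> 0\<close> by (simp add: d'_def)
  define S where "S = {t. t \<notin> orb G a \<and> poly d' (f t) \<noteq> 0}"
  have Sg: "t \<in> generic" if "t \<in> S" for t
  proof (rule ccontr)
    assume "t \<notin> generic"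
    then have "f t \<in> X" by (auto simp: X_def)
    then show False using that C by (simp add: S_def d'_def)
  qed
  have S1: "t \<notin> orb G a" "poly D t \<noteq> 0" "f1 t \<noteq> 0" "poly d' (f t) \<noteq> 0" "t \<in> dom" if "t \<in> S" for t
    using Sg[OF that] generic_dom[OF Sg[OF that]] that D_eq_0[of t] by (auto simp: S_def generic_def)
  have q: "rat_eval n' d' (f t) = schw t" if "t \<in> S" for t
  proof -
    have "poly Q (f t) \<noteq> 0" "poly C (f t) \<noteq> 0" using S1(4)[OF that] by (auto simp: d'_def)
    then show ?thesis using Q(2)[OF Sg[OF that]] by (simp add: rat_eval_def d'_def n'_def)
  qed
  have mobS: "mob g t \<in> S" "f (mob g t) = f t" if "t \<in> S" "g \<in> G" for t g
    using mob_dom[OF S1(5)[OF that(1)] that(2)] quot_map_invariant[OF S1(5)[OF that(1)] that(2)] S1(4)[OF that(1)]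
    by (auto simp: S_def dom_def)
  have finS: "finite (- S)"
  proof -
    have "finite (\<Union>x\<in>{x. poly d' x = 0}. {s \<in> generic. f s = x})"
      using poly_roots_finite[OF d0] finite_fibre by blast
    then have "finite (orb G a \<union> - generic \<union> (\<Union>x\<in>{x. poly d' x = 0}. {s \<in> generic. f s = x}))"
      using fin_orb finite_nongeneric by blast
    then show ?thesis by (rule rev_finite_subset) (auto simp: S_def)
  qed
  have "connected (UNIV - - S)"
    by (rule connected_open_delete_finite[OF open_UNIV connected_UNIV _ finS]) simp
  then have So: "open S" "connected S"
    using finite_imp_closed[OF finS] by (simp_all add: closed_def Compl_eq_Diff_UNIV[symmetric])
  have par: "parametrization (rat_eval n' d') S f f1 (\<lambda>t. t) f1 (\<lambda>t. f2 t / f1 t)"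
    unfolding parametrization_def
  proof (intro conjI ballI So)
    fix s assume s: "s \<in> S"
    note fd = f_derivs[OF S1(1)[OF s]]
    show f1: "f1 s \<noteq> 0" "f1 s \<noteq> 0" by (rule S1(3)[OF s])+
    show "(f has_field_derivative f1 s) (at s)" by (rule fd)
    show "((\<lambda>t. t) has_field_derivative f1 s / f1 s) (at s)" using f1 by simp
    show "(f1 has_field_derivative f2 s / f1 s * f1 s) (at s)" using fd(2) f1 by simp
    have e: "f1 s * (2 * f1 s * schw s + (f2 s / f1 s)^2 / (2 * f1 s)) = (f3 s * f1 s - f2 s * f2 s) / (f1 s * f1 s)"
      using f1 by (simp add: schw_def divide_simps) (simp add: eval_nat_numeral algebra_simps)
    show "((\<lambda>t. f2 t / f1 t) has_field_derivative f1 s * (2 * f1 s * rat_eval n' d' (f s) + (f2 s / f1 s)^2 / (2 * f1 s))) (at s)"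
      unfolding q[OF s] e by (rule DERIV_divide[OF fd(3,2) f1(1)])
  qed
  define Z where "Z = {(x, P :: complex^2^2). poly d' x \<noteq> 0 \<and> det P = 1 \<and> (\<exists>t\<in>S. f t = x \<and> (P = sol t \<or> P = - sol t))}"
  have det: "det (sol t) = 1" if "t \<in> S" for t
    unfolding sol_def by (rule det_param_mat[OF S1(3)[OF that]])
  have inZ: "(f t, sol t) \<in> Z" if "t \<in> S" for t
    using that S1(4) det by (auto simp: Z_def)
  have preimage: "\<exists>t\<in>S. f t = x" if "poly d' x \<noteq> 0" for x
  proof -
    have "x \<noteq> coeff N n" using that C[of x] by (auto simp: d'_def X_def)
    then obtain t where "t \<notin> orb G a" "f t = x" using root_exists by blast
    then show ?thesis using that by (intro bexI[of _ t]) (auto simp: S_def)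
  qed
  have R: "reduction n' d' G Z"
  proof (rule reductionI[OF d0 G])
    show "poly d' x \<noteq> 0 \<and> det P = 1" if "(x, P) \<in> Z" for x P using that by (simp add: Z_def)
    show "(x, P') \<in> Z \<longleftrightarrow> P' ** adj2 P \<in> G" if z: "(x, P) \<in> Z" and dP': "det P' = 1" for x P P'
    proof -
      obtain t where t: "t \<in> S" "f t = x" "P = sol t \<or> P = - sol t" and dx: "poly d' x \<noteq> 0" and dP: "det P = 1"
        using z by (auto simp: Z_def)
      have mP: "g ** P = sol (mob g t) \<or> g ** P = - sol (mob g t)" if "g \<in> G" for g
        using sol_mob[OF Sg[OF t(1)] that] t(3) by (auto simp: mult_minus_mat2)
      show ?thesis
      proof
        assume "(x, P') \<in> Z"
        then obtain s where s: "s \<in> S" "f s = x" "P' = sol s \<or> P' = - sol s" by (auto simp: Z_def)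
        have "s \<in> orb G t"
          using fibre[of t s] Sg[OF t(1)] S1(1)[OF s(1)] s(2) t(2) by (auto simp: generic_def)
        then obtain g where g: "g \<in> G" "s = mob g t" by (auto simp: orb_def)
        have "P' = g ** P \<or> P' = - (g ** P)" using mP[OF g(1)] s(3) g(2) by auto
        then have "P' ** adj2 P = g \<or> P' ** adj2 P = - g"
          by (auto simp: minus_mult_mat2 mult_adj2_cancel(3)[OF dP])
        moreover have "- g \<in> G"
          using alg_groupD(4)[OF G g(1) alg_groupD(3)[OF G]] by (simp add: mult_minus_mat2)
        ultimately show "P' ** adj2 P \<in> G" using g(1) by auto
      next
        assume g: "P' ** adj2 P \<in> G"
        have "P' = (P' ** adj2 P) ** P" by (rule mult_adj2_cancel(4)[OF dP, symmetric])
        then have "P' = sol (mob (P' ** adj2 P) t) \<or> P' = - sol (mob (P' ** adj2 P) t)" using mP[OF g] by simp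
        then show "(x, P') \<in> Z" using mobS[OF t(1) g] t(2) dx dP' by (auto simp: Z_def)
      qed
    qed
    show "\<exists>S e e' T \<rho> b s. parametrization (rat_eval n' d') S e e' T \<rho> b \<and> s \<in> S \<and> e s = x \<and>
      (\<forall>s\<in>S. (e s, param_mat (T s) (\<rho> s) (b s)) \<in> Z)" if x: "poly d' x \<noteq> 0" for x
    proof -
      obtain t where t: "t \<in> S" "f t = x" using preimage[OF x] by blast
      show ?thesis
        by (intro exI conjI, rule par, rule t(1), rule t(2)) (use inZ in \<open>simp add: sol_def\<close>)
    qed
    \<comment> \<open>With \<open>(u, v)\<close> the second column, \<open>F1\<close> and
      \<open>F2\<close> are the homogenized equation \<open>N(u/v) = x D(u/v)\<close>, multiplied by
      \<open>u^n\<close> and \<open>v^n\<close> to have even degree; \<open>F1\<close> also excludes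
      \<open>v = 0\<close>. Then \<open>F3\<close> says \<open>v^2 = f'\<close>, and
      \<open>F4\<close> says \<open>2 v v' = f'' / f'\<close>.\<close>
    define F1 where "F1 b = (\<Sum>k\<le>n. (coeff N k - fst b * coeff D k) * (snd b $ 1 $ 2 ^ (n + k) * snd b $ 2 $ 2 ^ (n - k)))" for b :: "complex \<times> (complex^2^2)"
    define F2 where "F2 b = (\<Sum>k\<le>n. (coeff N k - fst b * coeff D k) * (snd b $ 1 $ 2 ^ k * snd b $ 2 $ 2 ^ (n + (n - k))))" for b :: "complex \<times> (complex^2^2)"
    define F3 where "F3 b = (snd b $ 2 $ 2 * snd b $ 2 $ 2) * (homog D n (snd b $ 1 $ 2 * snd b $ 2 $ 2) (snd b $ 2 $ 2 * snd b $ 2 $ 2))^2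
      - homog W (2 * n) (snd b $ 1 $ 2 * snd b $ 2 $ 2) (snd b $ 2 $ 2 * snd b $ 2 $ 2)" for b :: "complex \<times> (complex^2^2)"
    define F4 where "F4 b = 2 * (snd b $ 2 $ 1 * snd b $ 2 $ 2) * homog (D * W) (3 * n) (snd b $ 1 $ 2 * snd b $ 2 $ 2) (snd b $ 2 $ 2 * snd b $ 2 $ 2)
      - homog W2 (3 * n) (snd b $ 1 $ 2 * snd b $ 2 $ 2) (snd b $ 2 $ 2 * snd b $ 2 $ 2)" for b :: "complex \<times> (complex^2^2)"
    have poly: "{F1, F2, F3, F4} \<subseteq> polyfun even_coords"
    proof (intro insert_subsetI empty_subsetI)
      show "F1 \<in> polyfun even_coords" "F2 \<in> polyfun even_coords"
        unfolding F1_def[abs_def] F2_def[abs_def]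
        by (rule polyfun_sum, simp, intro polyfun.mult polyfun_diff polyfun.const polyfun_even_coords polyfun_even_monomial, simp)+
      show "F3 \<in> polyfun even_coords" "F4 \<in> polyfun even_coords"
        unfolding F3_def[abs_def] F4_def[abs_def]
        by (intro polyfun_diff polyfun.mult polyfun.const polyfun_power polyfun_homog polyfun_even_coords)+
    qed
    have dW: "degree W \<le> 2 * n" "degree W2 \<le> 3 * n" "degree (D * W) \<le> 3 * n"
    proof -
      have der: "degree (der Y k) \<le> m + n" if "degree Y \<le> m" for Y k m
        unfolding der_def using that D_degree(1) degree_pderiv[of Y] degree_pderiv[of D]
        by (intro degree_diff_le order_trans[OF degree_smult_le] order_trans[OF degree_mult_le]) auto
      show 1: "degree W \<le> 2 * n" using der[OF N_degree, of 1] by (simp add: mult_2)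
      show "degree W2 \<le> 3 * n" using der[OF 1, of 2] by simp
      show "degree (D * W) \<le> 3 * n" using degree_mult_le[of D W] 1 D_degree(1) by linarith
    qed
    have sums: "F1 (x, P) = P$1$2 ^ n * (homog N n (P$1$2) (P$2$2) - x * homog D n (P$1$2) (P$2$2))"
      "F2 (x, P) = P$2$2 ^ n * (homog N n (P$1$2) (P$2$2) - x * homog D n (P$1$2) (P$2$2))" for x P
      unfolding F1_def F2_def homog_def power_add sum_distrib_left sum_subtractf[symmetric]
      by (rule sum.cong; simp add: algebra_simps)+
    have hom: "homog p m (t * v) v = v ^ m * poly p t" if "degree p \<le> m" "v \<noteq> 0" for p m t v
      using homog_eq[OF that, of "t * v"] that(2) by simp
    have eqs: "(F1 (x, P) = 0 \<and> F2 (x, P) = 0 \<and> F3 (x, P) = 0 \<and> F4 (x, P) = 0) \<longleftrightarrow>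
        poly N t = x * poly D t \<and> P$2$2 * P$2$2 * poly D t ^ 2 = poly W t \<and> 2 * (P$2$1 * P$2$2) * (poly D t * poly W t) = poly W2 t"
      if v: "P$2$2 \<noteq> 0" and t: "P$1$2 = t * P$2$2" for x P t
    proof -
      define v where "v = P$2$2"
      have v0: "v \<noteq> 0" "v * v \<noteq> 0" using v by (simp_all add: v_def)
      have u: "P$1$2 * v = t * (v * v)" by (simp add: t v_def)
      have dD: "degree D \<le> n" using D_degree(1) by simp
      have h12: "homog N n (P$1$2) v - x * homog D n (P$1$2) v = v ^ n * (poly N t - x * poly D t)"
        unfolding t v_def[symmetric] hom[OF N_degree v0(1)] hom[OF dD v0(1)] by (simp add: algebra_simps)
      have e12: "F1 (x, P) = P$1$2 ^ n * (v ^ n * (poly N t - x * poly D t))" "F2 (x, P) = v ^ n * (v ^ n * (poly N t - x * poly D t))"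
        unfolding sums v_def[symmetric] h12 by simp_all
      have sq: "(y ^ n * z)^2 = y ^ (2 * n) * z^2" for y z :: complex
        by (simp only: power_mult_distrib mult.commute[of 2 n] power_mult)
      have e3: "F3 (x, P) = (v * v) ^ (2 * n) * (v * v * poly D t ^ 2 - poly W t)"
        unfolding F3_def snd_conv v_def[symmetric] u hom[OF dW(1) v0(2)] hom[OF dD v0(2)]
        unfolding sq by (simp only: right_diff_distrib mult_ac)
      have e4: "F4 (x, P) = (v * v) ^ (3 * n) * (2 * (P$2$1 * v) * (poly D t * poly W t) - poly W2 t)"
        unfolding F4_def snd_conv v_def[symmetric] u hom[OF dW(3) v0(2)] hom[OF dW(2) v0(2)]
        by (simp add: algebra_simps)
      show ?thesis unfolding e12 e3 e4 v_def[symmetric] using v0 by auto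
    qed
    have Zeq: "(x, P) \<in> Z \<longleftrightarrow> F1 (x, P) = 0 \<and> F2 (x, P) = 0 \<and> F3 (x, P) = 0 \<and> F4 (x, P) = 0"
      if x: "poly d' x \<noteq> 0" and dP: "det P = 1" for x P
    proof
      assume "(x, P) \<in> Z"
      then obtain t where t: "t \<in> S" "f t = x" "P = sol t \<or> P = - sol t" by (auto simp: Z_def)
      note D = S1(2)[OF t(1)]
      note pp = param_mat_prods[OF S1(3)[OF t(1)], of t "f2 t / f1 t", folded sol_def]
      have p: "P$1$2 * P$2$2 = t * f1 t" "P$2$2 * P$2$2 = f1 t" "P$2$1 * P$2$2 = f2 t / f1 t / 2" "P$2$2 \<noteq> 0"
        using pp(1,3,4,5) t(3) by auto
      have "P$1$2 * P$2$2 = (t * P$2$2) * P$2$2" using p(1,2) by (simp add: mult.assoc)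
      then have u: "P$1$2 = t * P$2$2" using p(4) by simp
      have W: "poly W t \<noteq> 0" using S1(3)[OF t(1)] by (auto simp: f1_def)
      show "F1 (x, P) = 0 \<and> F2 (x, P) = 0 \<and> F3 (x, P) = 0 \<and> F4 (x, P) = 0"
        unfolding eqs[OF p(4) u] p(2,3)
      proof (intro conjI)
        show "poly N t = x * poly D t" using t(2) D by (auto simp: quot_map_def)
        show "f1 t * poly D t ^ 2 = poly W t" using D by (simp add: f1_def)
        show "2 * (f2 t / f1 t / 2) * (poly D t * poly W t) = poly W2 t"
          using D W by (simp add: f1_def f2_def eval_nat_numeral)
      qed
    next
      assume F: "F1 (x, P) = 0 \<and> F2 (x, P) = 0 \<and> F3 (x, P) = 0 \<and> F4 (x, P) = 0"
      obtain p u c v where m: "P = mat2 p u c v" by (rule mat2_cases)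
      have dm: "p * v - u * c = 1" using dP by (simp add: m)
      have "x \<noteq> coeff N n" using x C[of x] by (auto simp: d'_def X_def)
      have v: "v \<noteq> 0"
      proof
        assume v: "v = 0"
        then have u: "u \<noteq> 0" using dm by auto
        have "u ^ n * (coeff N n * u ^ n - x * (coeff D n * u ^ n)) = 0"
          using F sums(1)[of x P] by (simp add: m v homog_at_0)
        then have "coeff N n * u ^ n = x * u ^ n" using u D_degree(2) by simp
        then show False using u \<open>x \<noteq> coeff N n\<close> by simp
      qed
      define t where "t = u / v"
      have u: "u = t * v" using v by (simp add: t_def)
      from F have e: "poly N t = x * poly D t" "v * v * poly D t ^ 2 = poly W t" "2 * (c * v) * (poly D t * poly W t) = poly W2 t"
        using eqs[of P t x] v u by (auto simp: m)
      have D: "poly D t \<noteq> 0"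
      proof
        assume "poly D t = 0"
        then show False using e(1) D_eq_0[of t] N_ne_0[of t] by simp
      qed
      have ft: "f t = x" using e(1) D by (simp add: quot_map_def)
      then have tS: "t \<in> S" using x D D_eq_0[of t] by (auto simp: S_def)
      have r: "v^2 = f1 t" using e(2) D by (simp add: f1_def eq_divide_eq power2_eq_square)
      have W: "poly W t \<noteq> 0" using S1(3)[OF tS] by (auto simp: f1_def)
      have "f2 t / f1 t = poly W2 t / (poly D t * poly W t)" using D W by (simp add: f1_def f2_def eval_nat_numeral)
      also have "\<dots> = 2 * (c * v)" unfolding e(3)[symmetric] using D W by simp
      finally have b: "f2 t / f1 t = 2 * (c * v)" .
      have "mat2 (1 / v + t * (f2 t / f1 t) / (2 * v)) (t * v) ((f2 t / f1 t) / (2 * v)) v = P"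
      proof -
        have "p = (1 + u * c) / v" using dm v by (simp add: eq_divide_eq algebra_simps)
        also have "\<dots> = 1 / v + t * c" using v by (simp add: u add_divide_distrib)
        finally show ?thesis unfolding b m using v u by simp
      qed
      then have "P = sol t \<or> P = - sol t"
        using param_mat_sqrt[OF r S1(3)[OF tS], of t "f2 t / f1 t"] by (simp only: sol_def)
      then show "(x, P) \<in> Z" using tS ft x dP by (auto simp: Z_def)
    qed
    show "\<exists>E\<subseteq>polyfun even_coords. \<forall>x P. poly d' x \<noteq> 0 \<longrightarrow> det P = 1 \<longrightarrow> ((x, P) \<in> Z \<longleftrightarrow> (\<forall>f\<in>E. f (x, P) = 0))"
      using poly Zeq by (intro exI[of _ "{F1, F2, F3, F4}"]) simp
  qed
  have "infinite S"
  proof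
    assume "finite S"
    then have "finite (S \<union> - S)" using finS by (rule finite_UnI)
    then show False using infinite_UNIV_char_0[where 'a = complex] by simp
  qed
  then obtain t where t: "t \<in> S" by (metis equals0I finite.emptyI)
  have "g \<in> monodromy n' d' (f t, sol t)" if g: "g \<in> G" for g
  proof (rule monodromyI(1)[OF R])
    show "det g = 1" by (rule alg_groupD(1)[OF G g])
    show "(f t, g ** sol t) \<in> Z" by (rule reduction_mult[OF R inZ[OF t] g])
    show "sol (mob g t) = g ** sol t \<or> sol (mob g t) = - (g ** sol t)" by (rule sol_mob[OF Sg[OF t] g])
    show "reach n' d' (f t, sol t) (f t, sol (mob g t))"
      using parametrization_reach[OF par S1(4) t mobS(1)[OF t g]] mobS(2)[OF t g] by (simp add: sol_def)
  qed
  then show ?thesis using R inZ[OF t] by blast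
qed

end

lemma finite_realization:
  assumes "alg_group G" "finite G"
  shows "\<exists>n d Z x P. reduction n d G Z \<and> (x, P) \<in> Z \<and> G \<subseteq> zariski_closed mat_coords hull monodromy n d (x, P)"
proof -
  have "{t. \<not> regular G t} \<noteq> UNIV"
    using finite_nonregular[OF assms] infinite_UNIV_char_0[where 'a = complex] by metis
  then obtain a where "regular G a" by blast
  then interpret finite_alg_group G a using assms by unfold_locales
  obtain n d Z x P where *: "reduction n d G Z" "(x, P) \<in> Z" "G \<subseteq> monodromy n d (x, P)"
    using realization_exists by blast
  moreover have "G \<subseteq> zariski_closed mat_coords hull monodromy n d (x, P)"
    using *(3) hull_subset[of "monodromy n d (x, P)" "zariski_closed mat_coords"] by (rule order_trans)
  ultimately show ?thesis by blast
qed

theorem theorem3p16: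
  fixes \<Gamma> :: "(complex^2^2) set set"
  assumes "algebraic_subgroup_PSL2 \<Gamma>"
  shows "\<exists>\<rho> nabla G. rational_parallelism \<rho> \<and> associated_connection \<rho> nabla \<and>
           galois_group_in_aut (reciprocal nabla) G \<and>
           (\<exists>\<gamma>\<in>aut_sl2. G = conjugate_aut \<gamma> ` (PSL2_aut ` \<Gamma>))"
proof -
  note U = alg_group_Union(1)[OF assms]
  have real: ?thesis
    if h: "det h = 1" and ex: "\<exists>n d Z x P. reduction n d (conj2 h ` \<Union>\<Gamma>) Z \<and> (x, P) \<in> Z \<and>
      conj2 h ` \<Union>\<Gamma> \<subseteq> zariski_closed mat_coords hull monodromy n d (x, P)" for h
    using ex by (elim exE conjE) (rule realization[OF assms h])
  show ?thesis
  proof (cases "finite (\<Union>\<Gamma>)")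
    case True
    have "adj2 (mat 1) = mat 1" by (simp add: mat_1_mat2)
    then have "conj2 (mat 1) ` \<Union>\<Gamma> = \<Union>\<Gamma>" by (simp add: conj2_def)
    then show ?thesis using real[of "mat 1"] finite_realization[OF U True] by simp
  next
    case False
    obtain h where h: "det h = 1" "conj2 h ` \<Union>\<Gamma> \<in> {{A. det A = 1}, borel2, torus2, monomial2} \<or>
        (\<exists>n\<ge>1. conj2 h ` \<Union>\<Gamma> = borel2_root n)"
      using alg_group_classification[OF U False] by (elim exE conjE) (rule that)
    define H where "H = conj2 h ` \<Union>\<Gamma>"
    have C: "alg_group H" unfolding H_def by (rule alg_group_conj[OF U h(1)])
    have "borel2 = borel2_root 0" by (simp add: borel2_def borel2_root_def)
    with h(2)[folded H_def] consider "H = {A. det A = 1}" | "H = torus2" | "H = monomial2" | k where "H = borel2_root k"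
      by blast
    then have "\<exists>n d Z x P. reduction n d H Z \<and> (x, P) \<in> Z \<and> H \<subseteq> zariski_closed mat_coords hull monodromy n d (x, P)"
    proof cases
      case 1
      show ?thesis using SL2_realization[OF C[unfolded 1]] unfolding 1 .
    next
      case 2
      show ?thesis using torus_realization[OF C[unfolded 2]] unfolding 2 .
    next
      case 3
      show ?thesis using monomial_realization[OF C[unfolded 3]] unfolding 3 .
    next
      case 4
      show ?thesis using borel_realization[OF C[unfolded 4]] unfolding 4 .
    qed
    then show ?thesis unfolding H_def by (rule real[OF h(1)])
  qed
qed

end
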